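(* At least two of the numbers $\zeta(5),\zeta(7),\zeta(9),\ldots,\zeta(35)$ (the values of the Riemann zeta function at the odd integers from $5$ to $35$) are irrational.
   Context: $\zeta(s)=\sum_{n\geq 1} n^{-s}$ denotes the Riemann zeta function. *)

theory Defs
  imports Complex_Main
begin

text \<open>
  The Riemann zeta function on the half-line \<open>s > 1\<close>, where the Dirichlet series converges;
  for \<open>s \<le> 1\<close> the value is junk (no analytic continuation). The summation
  index is shifted so that the series starts at \<open>n = 1\<close>.
\<close>

definition zeta :: "real \<Rightarrow> real" where
  "zeta s = (\<Sum>n. real (Suc n) powr (- s))"

end

(*
  For N >= 1 let R_N(t) be the product of all 2t - u with |u| <= 242 N and of all 3t - u with
  |u| <= 363 N, divided by the products of t - j over |j| <= L N for L = 121, 53 and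
  L = 19, ..., 53, normalised by factorials.  R_N is odd, its poles are the integers of absolute
  value <= 53 N and have order at most 35, and it vanishes at all other fractions u/d with
  d = 1, 2, 3 and |u/d| <= 121 N.  Summing its partial fraction expansion over the points u/d gives,
  for d = 1, 2, 3, linear forms in 1 and zeta(3), zeta(5), ..., zeta(35) in which the coefficient of
  zeta(i) depends on d only through the factor d^i.  A suitable combination of the three
  forms therefore eliminates zeta(3) and one further value zeta(i0).

  If all remaining values were rational, this combination would be a rational number with
  denominator q D_N, where D_N is a product of prime powers.  The exponent of a prime p in D_N is
  controlled by the size of p/N, and the prime number theorem (proved following Newman) gives
  D_N <= exp(3750 N).  On the other hand R_N is positive and unimodal to the right of 121 N, with a flat
  peak near 122 N.  So the three sums are asymptotically in the ratio 1 : 2 : 3, which makes the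
  combination positive, and by Stirling's formula at 122 N they are at most exp(-3761 N).  Hence
  q D_N times the combination would be a positive integer tending to 0.
*)
theory Submission
  imports Defs "HOL-Complex_Analysis.Complex_Analysis" "HOL-Number_Theory.Number_Theory"
    "HOL-Computational_Algebra.Computational_Algebra" "HOL-Real_Asymp.Real_Asymp" "HOL-Library.Log_Nat"
begin

section \<open>The prime number theorem\<close>

text \<open>Both sides of the contest are exp (const * N) with nearly equal constants: 27 - 3789 =
  -3762 for the sums against 29998 / 8 < 3750 for the denominator. A loss of one percent in the
  density of primes would exceed the gap, so the prime number theorem itself is required, and the
  exponents of the primes are bounded separately on many short ranges of p/N.

  The zeros of R_N at the points u/d do two jobs. They leave only positive terms in the three sums,
  and they serve the arithmetic: the vanishing of R_N at u/d expresses the polar part at one pole by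
  those at the other poles, which keeps powers of p out of the denominators.

  The ratio 1 : 2 : 3 rests on the peak moving away from 121 N by more than any fixed distance:
  zeros that accumulate below 121 N push it with a harmonic sum, of order N ln N, against a linear
  force of the poles. There R_N changes by a bounded factor over K consecutive integers, so the sums
  dwarf the maximum, whereas the sum with step 1/d differs from d times the sum with step 1 by at
  most 2 d maxima.\<close>

definition chebyshev_psi :: "nat \<Rightarrow> real" where
  "chebyshev_psi n = (\<Sum>d=1..n. mangoldt d)"

lemma chebyshev_psi_Suc: "chebyshev_psi (Suc n) = chebyshev_psi n + mangoldt (Suc n)"
  by (simp add: chebyshev_psi_def)

lemma chebyshev_psi_mono: "m \<le> n \<Longrightarrow> chebyshev_psi m \<le> chebyshev_psi n"
  unfolding chebyshev_psi_def by (intro sum_mono2) (auto simp: mangoldt_nonneg)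

lemma chebyshev_psi_nonneg: "chebyshev_psi n \<ge> 0"
  unfolding chebyshev_psi_def by (intro sum_nonneg) (auto simp: mangoldt_nonneg)

text \<open>Passing from \<open>n\<close> to \<open>n + 1\<close> raises \<open>n div d\<close> by
  one exactly for the divisors \<open>d\<close> of \<open>n + 1\<close>, and the values of
  \<open>mangoldt\<close> at these divisors add up to \<open>ln (n + 1)\<close>.\<close>

lemma ln_fact_eq_sum_mangoldt:
  "ln (fact n) = (\<Sum>d=1..n. mangoldt d * real (n div d))"
proof (induction n)
  case (Suc n)
  have "(\<Sum>d=1..Suc n. mangoldt d * real (Suc n div d)) =
        (\<Sum>d=1..Suc n. mangoldt d * real (n div d) + (if d dvd Suc n then mangoldt d else 0))"
    by (intro sum.cong) (auto simp: div_Suc mod_eq_0_iff_dvd algebra_simps)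
  also have "\<dots> = (\<Sum>d=1..Suc n. mangoldt d * real (n div d)) + (\<Sum>d | d dvd Suc n. mangoldt d)"
    unfolding sum.distrib
    using dvd_imp_le[of _ "Suc n"] dvd_pos_nat[of "Suc n"]
    by (intro arg_cong2[where f = "(+)"] refl sum.mono_neutral_cong_right) (auto simp: Suc_le_eq)
  also have "(\<Sum>d | d dvd Suc n. mangoldt d :: real) = ln (real (Suc n))"
    using mangoldt_sum[of "Suc n", where 'a = real] by simp
  also have "(\<Sum>d=1..Suc n. mangoldt d * real (n div d)) = ln (fact n)"
    by (simp add: Suc.IH)
  finally show ?case by (simp add: ln_mult add.commute)
qed auto

text \<open>Chebyshev's argument with the central binomial coefficient:
  \<open>2 * n div d - 2 * (n div d)\<close> is never negative and equals 1 for
  \<open>n < d \<le> 2 * n\<close>, and its \<open>mangoldt\<close>-weighted sum is the logarithm of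
  a number that is at most 4^n.\<close>

lemma chebyshev_psi_double: "chebyshev_psi (2 * n) - chebyshev_psi n \<le> 2 * real n * ln 2"
proof -
  have "chebyshev_psi (2 * n) - chebyshev_psi n = (\<Sum>d\<in>{n<..2*n}. mangoldt d)"
    unfolding chebyshev_psi_def
    by (subst sum_diff [symmetric]) (auto intro!: sum.cong)
  also have "\<dots> = (\<Sum>d=1..2*n. mangoldt d * (if n < d then 1 else 0))"
    by (intro sum.mono_neutral_cong_left) auto
  also have "\<dots> \<le> (\<Sum>d=1..2*n. mangoldt d * (real (2 * n div d) - 2 * real (n div d)))"
  proof (intro sum_mono mult_left_mono mangoldt_nonneg)
    fix d assume d: "d \<in> {1..2*n}"
    have "2 * (n div d) \<le> 2 * n div d"
      using d div_times_less_eq_dividend[of n d] by (subst less_eq_div_iff_mult_less_eq) auto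
    moreover have "n < d \<Longrightarrow> n div d = 0 \<and> 2 * n div d = 1"
      using d by (auto intro: div_nat_eqI)
    ultimately show "(if n < d then 1 else 0) \<le> real (2 * n div d) - 2 * real (n div d)"
      by (auto simp flip: of_nat_mult)
  qed
  also have "\<dots> = (\<Sum>d=1..2*n. mangoldt d * real (2 * n div d)) - 2 * (\<Sum>d=1..2*n. mangoldt d * real (n div d))"
    by (simp add: sum_subtractf sum_distrib_left algebra_simps)
  also have "(\<Sum>d=1..2*n. mangoldt d * real (n div d)) = (\<Sum>d=1..n. mangoldt d * real (n div d))"
    by (intro sum.mono_neutral_right) auto
  also have "(\<Sum>d=1..2*n. mangoldt d * real (2 * n div d)) - 2 * \<dots> = ln (fact (2 * n) / (fact n * fact n))"
    unfolding ln_fact_eq_sum_mangoldt[symmetric] by (simp add: ln_div ln_mult)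
  also have "fact (2 * n) / (fact n * fact n) = real ((2 * n) choose n)"
    by (subst binomial_fact) auto
  also have "ln (real ((2 * n) choose n)) \<le> ln (2 ^ (2 * n))"
  proof (subst ln_le_cancel_iff)
    have "(2 * n) choose n \<le> 2 ^ (2 * n)" by (rule binomial_le_pow2)
    thus "real ((2 * n) choose n) \<le> 2 ^ (2 * n)" by (metis of_nat_le_iff of_nat_numeral of_nat_power)
  qed auto
  also have "\<dots> = 2 * real n * ln 2" by (simp add: ln_realpow)
  finally show ?thesis .
qed

lemma chebyshev_psi_le: "chebyshev_psi n \<le> 4 * real n"
proof (induction n rule: less_induct)
  case (less n)
  have ln2: "ln 2 \<le> (1 :: real)" using ln_2_less_1 by simp
  show ?case
  proof (cases "n \<le> 1")
    case True
    thus ?thesis by (cases "n = 0") (auto simp: chebyshev_psi_def le_Suc_eq)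
  next
    case False
    define m where "m = n div 2"
    have m: "m < n" "m \<ge> 1" using False by (auto simp: m_def)
    \<comment> \<open>\<open>4 * m\<close> by induction plus \<open>2 * m\<close> for the doubling;
      the slack up to \<open>8 * m\<close> absorbs the extra term \<open>mangoldt n\<close> of an
      odd \<open>n\<close>.\<close>
    have *: "chebyshev_psi (2 * m) \<le> 6 * real m"
    proof -
      have "2 * real m * ln 2 \<le> 2 * real m * 1" by (intro mult_left_mono ln2) auto
      thus ?thesis using less[of m] m chebyshev_psi_double[of m] by linarith
    qed
    show ?thesis
    proof (cases "even n")
      case True
      hence "n = 2 * m" by (simp add: m_def)
      thus ?thesis using * by simp
    next
      case False
      hence n: "n = Suc (2 * m)" by (simp add: m_def)
      have "mangoldt n \<le> ln (real n)" using m by (intro mangoldt_le) auto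
      also have "\<dots> \<le> real n - 1" using m by (intro ln_le_minus_one) auto
      also have "\<dots> = 2 * real m" by (simp add: n)
      finally show ?thesis using * unfolding n chebyshev_psi_Suc by simp
    qed
  qed
qed

section \<open>Continuation of the zeta function to Re s > 0\<close>

lemma norm_nat_powr [simp]: "norm ((of_nat n :: complex) powr s) = real n powr Re s"
  by (subst norm_powr_real_powr) auto

text \<open>The local majorants give uniform convergence on small closed balls by the M-test;
  Weierstrass' theorem on locally uniform limits then gives holomorphy and termwise
  differentiation.\<close>

lemma holomorphic_suminf:
  fixes f :: "nat \<Rightarrow> complex \<Rightarrow> complex"
  assumes "open S" "\<And>n. f n holomorphic_on S"
    and "\<And>x. x \<in> S \<Longrightarrow> \<exists>d>0. \<exists>M. cball x d \<subseteq> S \<and> summable M \<and> (\<forall>n. \<forall>y\<in>cball x d. norm (f n y) \<le> M n)"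
  shows "(\<lambda>x. \<Sum>n. f n x) holomorphic_on S"
    and "\<And>x. x \<in> S \<Longrightarrow> (\<lambda>n. deriv (f n) x) sums deriv (\<lambda>x. \<Sum>n. f n x) x"
proof -
  have ul: "\<exists>d. 0 < d \<and> cball x d \<subseteq> S \<and> uniform_limit (cball x d) (\<lambda>n x. \<Sum>i<n. f i x) (\<lambda>x. \<Sum>n. f n x) sequentially"
    if "x \<in> S" for x
    using assms(3)[OF that] Weierstrass_m_test[of _ f] by (meson)
  show "(\<lambda>x. \<Sum>n. f n x) holomorphic_on S"
    by (rule holomorphic_uniform_sequence[OF assms(1) _ ul]) (auto intro!: holomorphic_intros assms)
  have "((\<lambda>x. \<Sum>i<n. f i x) has_field_derivative (\<Sum>i<n. deriv (f i) x)) (at x)" if "x \<in> S" for n x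
    using that assms by (auto intro!: derivative_eq_intros holomorphic_derivI)
  from has_complex_derivative_uniform_sequence[OF assms(1) this ul]
  obtain g' where g': "\<And>x. x \<in> S \<Longrightarrow> ((\<lambda>x. \<Sum>n. f n x) has_field_derivative g' x) (at x) \<and>
      (\<lambda>n. \<Sum>i<n. deriv (f i) x) \<longlonglongrightarrow> g' x" by metis
  show "(\<lambda>n. deriv (f n) x) sums deriv (\<lambda>x. \<Sum>n. f n x) x" if "x \<in> S" for x
    using g'[OF that] DERIV_imp_deriv[of "\<lambda>x. \<Sum>n. f n x" "g' x" x] by (simp add: sums_def)
qed

text \<open>This is \<open>s - 1\<close> times the difference between n^(-s) and the integral of
  x^(-s) over [n, n+1]. Replacing the plain terms of the zeta series by these gains one power of
  \<open>n\<close>.\<close>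

definition zterm :: "nat \<Rightarrow> complex \<Rightarrow> complex" where
  "zterm n s = (s - 1) * of_nat n powr (- s) + of_nat (Suc n) powr (1 - s) - of_nat n powr (1 - s)"

text \<open>\<open>zterm n s\<close> is the remainder of the first-order Taylor expansion of x^(1-s)
  around \<open>n\<close>, taken at \<open>n + 1\<close>. The second derivative bounds it, and for
  \<open>Re s \<ge> - 1\<close> that is largest at the left end.\<close>

lemma zterm_bound:
  assumes "n > 0" "Re s \<ge> - 1"
  shows "norm (zterm n s) \<le> norm s * norm (1 - s) * real n powr (- Re s - 1)"
proof -
  define f where "f = (\<lambda>i::nat. \<lambda>z. if i = 0 then z powr (1 - s) else if i = 1 then (1 - s) * z powr (- s)
      else (1 - s) * (- s) * z powr (- s - 1))"
  let ?S = "closed_segment (complex_of_nat n) (of_nat (Suc n))"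
  have S: "z \<in> \<real> \<and> real n \<le> Re z \<and> z \<notin> \<real>\<^sub>\<le>\<^sub>0" if "z \<in> ?S" for z
  proof -
    have "z \<in> complex_of_real ` closed_segment (real n) (real (Suc n))"
      using that closed_segment_of_real[of "real n" "real (Suc n)"] by (metis of_real_of_nat_eq)
    thus ?thesis using assms(1) by (auto simp: closed_segment_eq_real_ivl complex_nonpos_Reals_iff)
  qed
  have "cmod (f 0 (of_nat (Suc n)) - (\<Sum>i\<le>1. f i (of_nat n) * (of_nat (Suc n) - of_nat n) ^ i / fact i))
        \<le> (norm s * norm (1 - s) * real n powr (- Re s - 1)) * cmod (of_nat (Suc n) - of_nat n) ^ Suc 1 / fact 1"
  proof (rule complex_Taylor[of ?S])
    fix i :: nat and x assume x: "x \<in> ?S" "i \<le> 1"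
    have "i = 0 \<or> i = 1" using x by auto
    thus "(f i has_field_derivative f (Suc i) x) (at x within ?S)"
    proof
      assume "i = 0"
      moreover have "((\<lambda>z. z powr (1 - s)) has_field_derivative (1 - s) * x powr (- s)) (at x within ?S)"
        using S[OF x(1)] by (auto intro!: derivative_eq_intros)
      ultimately show ?thesis by (simp add: f_def)
    next
      assume "i = 1"
      moreover have "((\<lambda>z. (1 - s) * z powr (- s)) has_field_derivative (1 - s) * (- s) * x powr (- s - 1)) (at x within ?S)"
        using S[OF x(1)] by (auto intro!: derivative_eq_intros)
      ultimately show ?thesis by (simp add: f_def)
    qed
  next
    fix x assume x: "x \<in> ?S"
    have "norm (x powr (- s - 1)) = Re x powr (- Re s - 1)"
      using S[OF x] assms(1) by (subst norm_powr_real_powr) auto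
    also have "\<dots> \<le> real n powr (- Re s - 1)" using S[OF x] assms by (intro powr_mono2') auto
    finally show "cmod (f (Suc 1) x) \<le> norm s * norm (1 - s) * real n powr (- Re s - 1)"
      by (auto simp: f_def norm_mult mult_ac intro!: mult_left_mono)
  qed auto
  also have "f 0 (of_nat (Suc n)) - (\<Sum>i\<le>1. f i (of_nat n) * (of_nat (Suc n) - of_nat n) ^ i / fact i) = zterm n s"
    by (simp add: f_def zterm_def algebra_simps)
  finally show ?thesis by simp
qed

lemma holomorphic_zterm: "n > 0 \<Longrightarrow> zterm n holomorphic_on S"
  unfolding zterm_def by (auto intro!: holomorphic_intros)

text \<open>Supplies the local majorants that \<open>holomorphic_suminf\<close> asks for: on the
  ball whose radius is half the distance to the boundary line, \<open>P\<close> is bounded and the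
  exponent is at most \<open>- 1 - d\<close>.\<close>

lemma halfplane_series_bound:
  fixes f :: "nat \<Rightarrow> complex \<Rightarrow> complex" and P :: "complex \<Rightarrow> real"
  assumes f: "\<And>n s. Re s > c \<Longrightarrow> norm (f n s) \<le> P s * real (Suc n) powr (- Re s - 1 + c)"
    and P: "continuous_on UNIV P" and "Re x > c"
  shows "\<exists>d>0. \<exists>M. cball x d \<subseteq> {s. Re s > c} \<and> summable M \<and> (\<forall>n. \<forall>y\<in>cball x d. norm (f n y) \<le> M n)"
proof -
  define d where "d = (Re x - c) / 2"
  have d: "d > 0" using assms by (simp add: d_def)
  have "compact (P ` cball x d)" 
    by (intro compact_continuous_image continuous_on_subset[OF P]) auto
  then obtain B where B: "\<And>y. y \<in> cball x d \<Longrightarrow> P y \<le> B" "B \<ge> 0"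
    using compact_imp_bounded[of "P ` cball x d"] unfolding bounded_iff
    by (metis abs_ge_self abs_ge_zero cball_eq_empty ex_in_conv imageI linorder_not_less order_less_le_trans order_trans real_norm_def d)
  have Re: "Re y \<ge> c + d" if "y \<in> cball x d" for y
  proof -
    have "\<bar>Re (x - y)\<bar> \<le> d" using abs_Re_le_cmod[of "x - y"] that by (simp add: dist_norm)
    moreover have "Re x = c + d + d" by (simp add: d_def field_simps)
    ultimately show ?thesis by simp
  qed
  have "norm (f n y) \<le> B * real (Suc n) powr (- 1 - d)" if "y \<in> cball x d" for n y
  proof -
    have "norm (f n y) \<le> P y * real (Suc n) powr (- Re y - 1 + c)" using Re[OF that] d by (intro f) auto
    also have "\<dots> \<le> B * real (Suc n) powr (- 1 - d)"
      using B that Re[OF that] by (intro mult_mono powr_mono) auto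
    finally show ?thesis .
  qed
  moreover have "summable (\<lambda>n. B * real (Suc n) powr (- 1 - d))"
    using d by (intro summable_mult) (subst summable_Suc_iff[of "\<lambda>n. real n powr (-1 - d)"], simp add: summable_real_powr_iff)
  moreover have "cball x d \<subseteq> {s. Re s > c}" using Re d by force
  ultimately show ?thesis using d by blast
qed

text \<open>The function (s-1) zeta(s), continued to Re s > 0. The factor \<open>s - 1\<close>
  removes the pole, and the summand 1 makes up for the telescoping powers in \<open>zterm\<close>,
  whose sum is -1 for Re s > 1.\<close>

definition zeta_aux :: "complex \<Rightarrow> complex" where
  "zeta_aux s = 1 + (\<Sum>n. zterm (Suc n) s)"

lemma zeta_aux_holomorphic: "zeta_aux holomorphic_on {s. Re s > 0}"
proof -
  have "norm (zterm (Suc n) s) \<le> (norm s * norm (1 - s)) * real (Suc n) powr (- Re s - 1 + 0)" if "Re s > 0" for n s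
    using zterm_bound[of "Suc n" s] that by simp
  hence "(\<lambda>s. \<Sum>n. zterm (Suc n) s) holomorphic_on {s. Re s > 0}"
    by (intro holomorphic_suminf(1) halfplane_series_bound[where P = "\<lambda>s. norm s * norm (1 - s)"] holomorphic_zterm
         continuous_intros) (auto simp: open_halfspace_Re_gt)
  thus ?thesis unfolding zeta_aux_def by (intro holomorphic_intros)
qed

lemma zeta_aux_1 [simp]: "zeta_aux 1 = 1"
proof -
  have "zterm (Suc n) 1 = 0" for n by (simp add: zterm_def del: of_nat_Suc)
  thus ?thesis by (simp add: zeta_aux_def)
qed

lemma summable_zeta: "Re s > 1 \<Longrightarrow> summable (\<lambda>n. norm (of_nat (Suc n) powr (- s) :: complex))"
  unfolding norm_nat_powr
  by (subst summable_Suc_iff[of "\<lambda>n. real n powr (Re (-s))"]) (simp add: summable_real_powr_iff)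

lemma zeta_aux_sums:
  assumes "Re s > 1"
  shows "(\<lambda>n. (s - 1) * of_nat (Suc n) powr (- s)) sums zeta_aux s"
proof -
  have lim: "(\<lambda>n. of_nat (Suc n) powr (1 - s) :: complex) \<longlonglongrightarrow> 0"
  proof (rule Lim_null_comparison)
    show "(\<lambda>n. real (Suc n) powr (Re (1 - s))) \<longlonglongrightarrow> 0"
      using assms by (intro tendsto_neg_powr filterlim_compose[OF filterlim_real_sequentially filterlim_Suc]) auto
  qed (auto simp del: of_nat_Suc)
  from telescope_sums[OF this]
  have t: "(\<lambda>n. of_nat (Suc (Suc n)) powr (1 - s) - of_nat (Suc n) powr (1 - s)) sums (-1 :: complex)"
    by simp
  have "summable (\<lambda>n. (s - 1) * of_nat (Suc n) powr (- s))"
    using summable_zeta[OF assms] by (intro summable_mult) (rule summable_norm_cancel)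
  then obtain Y where Y: "(\<lambda>n. (s - 1) * of_nat (Suc n) powr (- s)) sums Y"
    unfolding summable_def by blast
  from sums_add[OF this t] have "(\<lambda>n. zterm (Suc n) s) sums (Y - 1)"
    by (simp add: zterm_def algebra_simps)
  hence "zeta_aux s = Y" by (simp add: zeta_aux_def sums_iff)
  with Y show ?thesis by simp
qed

section \<open>Logarithmic derivative of zeta and nonvanishing on Re s = 1\<close>

definition mangoldt_series :: "complex \<Rightarrow> complex" where
  "mangoldt_series s = (\<Sum>n. mangoldt (Suc n) * of_nat (Suc n) powr (- s))"

lemma summable_ln_series:
  assumes "Re s > 1"
  shows "summable (\<lambda>n. ln (real (Suc n)) * norm (of_nat (Suc n) powr (- s) :: complex))"
proof -
  define e where "e = (Re s - 1) / 2"
  have e: "e > 0" using assms by (simp add: e_def)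
  show ?thesis
  proof (rule summable_comparison_test')
    show "summable (\<lambda>n. 1 / e * real (Suc n) powr (- 1 - e))"
      using e by (intro summable_mult) (subst summable_Suc_iff[of "\<lambda>n. real n powr (-1 - e)"], simp add: summable_real_powr_iff)
    show "norm (ln (real (Suc n)) * norm (of_nat (Suc n) powr (- s) :: complex)) \<le> 1 / e * real (Suc n) powr (- 1 - e)"
      if "n \<ge> 0" for n
    proof -
      have "ln (real (Suc n)) \<le> real (Suc n) powr e / e"
        using e ln_powr_bound[of "real (Suc n)" e] by simp
      hence "ln (real (Suc n)) * real (Suc n) powr (- Re s) \<le> real (Suc n) powr e / e * real (Suc n) powr (- Re s)"
        by (intro mult_right_mono) auto
      also have "\<dots> = 1 / e * real (Suc n) powr (- 1 - e)"
        using e by (simp add: powr_add [symmetric] e_def field_simps del: of_nat_Suc)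
      finally show ?thesis by (simp add: abs_mult del: of_nat_Suc)
    qed
  qed
qed

lemma summable_mangoldt_series:
  assumes "Re s > 1"
  shows "summable (\<lambda>n. norm (mangoldt (Suc n) * of_nat (Suc n) powr (- s) :: complex))"
proof (rule summable_comparison_test'[OF summable_ln_series[OF assms]])
  show "norm (norm (mangoldt (Suc n) * of_nat (Suc n) powr (- s) :: complex)) \<le> 
     ln (real (Suc n)) * norm (of_nat (Suc n) powr (- s) :: complex)" if "n \<ge> 0" for n
    by (simp add: norm_mult abs_mult mangoldt_le mult_right_mono del: of_nat_Suc)
qed

lemma mangoldt_series_sums:
  "Re s > 1 \<Longrightarrow> (\<lambda>n. mangoldt (Suc n) * of_nat (Suc n) powr (- s)) sums mangoldt_series s"
  unfolding mangoldt_series_def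
  by (rule summable_sums, rule summable_norm_cancel, rule summable_mangoldt_series)

lemma bij_betw_Suc_pos: "bij_betw Suc UNIV {0<..}"
  by (rule bij_betwI[where g = "\<lambda>n. n - 1"]) auto

lemma has_sum_pos_nat:
  fixes f :: "nat \<Rightarrow> complex"
  assumes "summable (\<lambda>n. norm (f (Suc n)))" "(\<lambda>n. f (Suc n)) sums S"
  shows "(f has_sum S) {0<..}" "(\<lambda>n. norm (f n)) summable_on {0<..}"
proof -
  show "(f has_sum S) {0<..}"
    using norm_summable_imp_has_sum[OF assms] has_sum_reindex_bij_betw[OF bij_betw_Suc_pos, of f S] by simp
  have "(\<lambda>n. norm (f (Suc n))) summable_on UNIV"
    using assms(1) by (simp add: norm_summable_imp_summable_on)
  thus "(\<lambda>n. norm (f n)) summable_on {0<..}"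
    using summable_on_reindex_bij_betw[OF bij_betw_Suc_pos, of "\<lambda>n. norm (f n)"] by simp
qed

text \<open>The absolutely convergent double series over pairs \<open>(d, m)\<close> is regrouped by
  the product \<open>n = d * m\<close>; each group is a divisor sum of \<open>mangoldt\<close>,
  hence a logarithm.\<close>

lemma mangoldt_series_times_zeta:
  assumes s: "Re s > 1"
  shows "(\<lambda>n. of_real (ln (real (Suc n))) * of_nat (Suc n) powr (- s)) sums (mangoldt_series s * (zeta_aux s / (s - 1)))"
proof -
  define A :: "nat set" where "A = {0<..}"
  define F :: "nat \<Rightarrow> complex" where "F = (\<lambda>d. mangoldt d * of_nat d powr (- s))"
  define G :: "nat \<Rightarrow> complex" where "G = (\<lambda>d. of_nat d powr (- s))"
  have s1: "s \<noteq> 1" using s by auto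
  have "(\<lambda>n. G (Suc n)) sums (zeta_aux s / (s - 1))"
    using sums_divide[OF zeta_aux_sums[OF s], of "s - 1"] s1 by (simp add: G_def)
  hence G: "(G has_sum (zeta_aux s / (s - 1))) A" "(\<lambda>n. norm (G n)) summable_on A"
    using has_sum_pos_nat[of G] summable_zeta[OF s] unfolding A_def G_def by blast+
  have F: "(F has_sum mangoldt_series s) A" "(\<lambda>n. norm (F n)) summable_on A"
    using has_sum_pos_nat[of F] summable_mangoldt_series[OF s] mangoldt_series_sums[OF s] unfolding A_def F_def by blast+
  let ?f = "\<lambda>(d, m). F d * G m"
  have "(\<lambda>x. norm (?f x)) summable_on A \<times> A"
    unfolding Infinite_Sum.abs_summable_on_Sigma_iff
    using F(2) G(2) by (auto simp: norm_mult abs_mult infsum_nonneg infsum_cmult_right' summable_on_cmult_right intro!: summable_on_cmult_left)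
  hence summ: "?f summable_on A \<times> A" by (rule abs_summable_summable)
  have "(?f has_sum (mangoldt_series s * (zeta_aux s / (s - 1)))) (A \<times> A)"
    by (rule has_sum_SigmaI[OF _ _ summ, where g = "\<lambda>d. F d * (zeta_aux s / (s - 1))"])
       (auto intro!: has_sum_cmult_right has_sum_cmult_left F G simp del: times_divide_eq_right)
  moreover have "bij_betw (\<lambda>(n, d). (d, n div d)) (SIGMA n:A. {d. d dvd n}) (A \<times> A)"
    by (rule bij_betwI[where g = "\<lambda>(d, m). (d * m, d)"]) (auto simp: A_def intro: Nat.gr0I)
  ultimately have "((\<lambda>x. ?f ((\<lambda>(n, d). (d, n div d)) x)) has_sum (mangoldt_series s * (zeta_aux s / (s - 1))))
      (SIGMA n:A. {d. d dvd n})"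
    by (subst has_sum_reindex_bij_betw) auto
  hence "((\<lambda>n. \<Sum>d | d dvd n. F d * G (n div d)) has_sum (mangoldt_series s * (zeta_aux s / (s - 1)))) A"
    by (rule has_sum_SigmaD) (auto simp: A_def intro!: has_sum_finite)
  also have "?this \<longleftrightarrow> ((\<lambda>n. of_real (ln (real n)) * of_nat n powr (- s)) has_sum (mangoldt_series s * (zeta_aux s / (s - 1)))) A"
  proof (rule has_sum_cong)
    fix n assume n: "n \<in> A"
    have "(\<Sum>d | d dvd n. F d * G (n div d)) = (\<Sum>d | d dvd n. mangoldt d * of_nat n powr (- s))"
    proof (intro sum.cong refl)
      fix d assume "d \<in> {d. d dvd n}"
      then obtain m where m: "n = d * m" by auto
      have "d > 0" using n m by (auto simp: A_def intro: Nat.gr0I)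
      thus "F d * G (n div d) = mangoldt d * of_nat n powr (- s)"
        using powr_times_real[of "of_nat d" "of_nat m" "- s"] by (simp add: F_def G_def m)
    qed
    also have "\<dots> = of_real (ln (real n)) * of_nat n powr (- s)"
      using mangoldt_sum[of n, where 'a = complex] n by (simp add: A_def flip: sum_distrib_right)
    finally show "(\<Sum>d | d dvd n. F d * G (n div d)) = of_real (ln (real n)) * of_nat n powr (- s)" .
  qed
  finally have "((\<lambda>n. of_real (ln (real n)) * of_nat n powr (- s)) has_sum (mangoldt_series s * (zeta_aux s / (s - 1)))) {0<..}"
    by (simp add: A_def)
  hence "((\<lambda>n. of_real (ln (real (Suc n))) * of_nat (Suc n) powr (- s)) has_sum (mangoldt_series s * (zeta_aux s / (s - 1)))) UNIV"
    using has_sum_reindex_bij_betw[OF bij_betw_Suc_pos, of "\<lambda>n. of_real (ln (real n)) * of_nat n powr (- s)"] by simp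
  thus ?thesis by (rule has_sum_imp_sums)
qed

text \<open>Termwise differentiation identifies the series with logarithmic coefficients as minus
  the derivative of zeta. The identity is stated without dividing by \<open>zeta_aux\<close>, whose
  nonvanishing is deduced from it afterwards.\<close>

lemma mangoldt_series_eq:
  assumes s: "Re s > 1"
  shows "mangoldt_series s * zeta_aux s = zeta_aux s / (s - 1) - deriv zeta_aux s"
proof -
  define f :: "nat \<Rightarrow> complex \<Rightarrow> complex" where "f = (\<lambda>n s. of_nat (Suc n) powr (- s))"
  have s1: "s \<noteq> 1" using s by auto
  have op: "open {s. Re s > 1}" by (rule open_halfspace_Re_gt)
  have f_eq: "(\<Sum>n. f n z) = zeta_aux z / (z - 1)" if "Re z > 1" for z
  proof -
    have "z \<noteq> 1" using that by auto
    thus ?thesis using sums_divide[OF zeta_aux_sums[OF that], of "z - 1"] by (simp add: f_def sums_iff)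
  qed
  have "(\<lambda>n. deriv (f n) s) sums deriv (\<lambda>z. \<Sum>n. f n z) s"
  proof (rule holomorphic_suminf(2)[OF op])
    show "f n holomorphic_on {s. Re s > 1}" for n unfolding f_def by (auto intro!: holomorphic_intros simp del: of_nat_Suc)
    show "\<exists>d>0. \<exists>M. cball x d \<subseteq> {s. Re s > 1} \<and> summable M \<and> (\<forall>n. \<forall>y\<in>cball x d. norm (f n y) \<le> M n)" 
      if "x \<in> {s. Re s > 1}" for x
      using that by (intro halfplane_series_bound[where P = "\<lambda>_. 1"]) (auto simp: f_def simp del: of_nat_Suc)
  qed (use s in auto)
  moreover have "deriv (f n) s = - (of_real (ln (real (Suc n))) * of_nat (Suc n) powr (- s))" for n
  proof (rule DERIV_imp_deriv)
    have deriv_powr: "((\<lambda>s. w powr (- s)) has_field_derivative (- (Ln w * w powr (- s)))) (at s)" if "w \<noteq> 0" for w :: complex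
      using DERIV_chain2[OF has_field_derivative_powr_right[OF that] DERIV_minus[OF DERIV_ident], of s] by simp
    have "((\<lambda>s. of_nat (Suc n) powr (- s)) has_field_derivative (- (Ln (of_nat (Suc n)) * of_nat (Suc n) powr (- s)))) (at s)"
      by (rule deriv_powr) (simp del: of_nat_Suc)
    from this[unfolded Ln_of_nat[OF zero_less_Suc]] show "(f n has_field_derivative - (of_real (ln (real (Suc n))) * of_nat (Suc n) powr (- s))) (at s)"
      by (simp only: f_def)
  qed
  ultimately have "(\<lambda>n. of_real (ln (real (Suc n))) * of_nat (Suc n) powr (- s)) sums (- deriv (\<lambda>z. \<Sum>n. f n z) s)"
    using sums_minus by fastforce
  hence 1: "mangoldt_series s * (zeta_aux s / (s - 1)) = - deriv (\<lambda>z. \<Sum>n. f n z) s"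
    using mangoldt_series_times_zeta[OF s] sums_unique2 by blast
  have "deriv (\<lambda>z. \<Sum>n. f n z) s = deriv (\<lambda>z. zeta_aux z / (z - 1)) s"
    using f_eq s by (intro deriv_cong_ev eventually_mono[OF eventually_nhds_in_open[OF op, of s]]) auto
  also have "\<dots> = (deriv zeta_aux s * (s - 1) - zeta_aux s) / (s - 1)\<^sup>2"
  proof (rule DERIV_imp_deriv)
    have "(zeta_aux has_field_derivative deriv zeta_aux s) (at s)"
      using s by (intro holomorphic_derivI[OF zeta_aux_holomorphic]) (auto simp: open_halfspace_Re_gt)
    thus "((\<lambda>z. zeta_aux z / (z - 1)) has_field_derivative (deriv zeta_aux s * (s - 1) - zeta_aux s) / (s - 1)\<^sup>2) (at s)"
      using s1 by (auto intro!: derivative_eq_intros simp: power2_eq_square)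
  qed
  finally have 2: "deriv (\<lambda>z. \<Sum>n. f n z) s = (deriv zeta_aux s * (s - 1) - zeta_aux s) / (s - 1)\<^sup>2" .
  define u where "u = s - 1"
  have u0: "u \<noteq> 0" using s1 by (simp add: u_def)
  have "mangoldt_series s * zeta_aux s = (mangoldt_series s * (zeta_aux s / u)) * u"
    using s1 by (simp add: u_def)
  also have "\<dots> = - ((deriv zeta_aux s * u - zeta_aux s) / u\<^sup>2) * u"
    by (simp only: u_def 1 2)
  also have "\<dots> = zeta_aux s / u - deriv zeta_aux s"
    using u0 by (simp add: power2_eq_square field_simps)
  finally show ?thesis by (simp add: u_def)
qed

text \<open>\<open>m\<close> is the order of the zero at \<open>z0\<close> (0 if there is none). It
  is the residue of the logarithmic derivative, read off from the factorisation
  \<open>g w * (w - z0) ^ m\<close> with \<open>g\<close> free of zeros.\<close>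

lemma zeta_aux_order:
  assumes "Re z0 > 0"
  obtains m :: nat where "zeta_aux z0 = 0 \<longleftrightarrow> m > 0" "eventually (\<lambda>w. zeta_aux w \<noteq> 0) (at z0)"
    "((\<lambda>w. (w - z0) * deriv zeta_aux w / zeta_aux w) \<longlongrightarrow> of_nat m) (at z0)"
proof -
  define g where "g = zor_poly zeta_aux z0"
  define m where "m = nat (zorder zeta_aux z0)"
  have "connected {s. Re s > 0}" by (intro convex_connected convex_halfspace_Re_gt)
  moreover have "\<exists>w\<in>{s. Re s > 0}. zeta_aux w \<noteq> 0" by (intro bexI[of _ 1]) auto
  ultimately have *: "(if zeta_aux z0 = 0 then zorder zeta_aux z0 > 0 else zorder zeta_aux z0 = 0) \<and>
     (\<exists>r. r>0 \<and> cball z0 r \<subseteq> {s. Re s > 0} \<and> g holomorphic_on cball z0 r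
       \<and> (\<forall>w\<in>cball z0 r. zeta_aux w = g w * (w-z0) ^ m \<and> g w \<noteq> 0))"
    unfolding g_def m_def using assms
    by (intro zorder_exist_zero zeta_aux_holomorphic) (auto simp: open_halfspace_Re_gt)
  then obtain r where r: "r > 0" "g holomorphic_on cball z0 r" "\<And>w. w \<in> cball z0 r \<Longrightarrow> zeta_aux w = g w * (w-z0) ^ m \<and> g w \<noteq> 0"
    by blast
  have ghol: "g holomorphic_on ball z0 r" using r(2) by (rule holomorphic_on_subset) auto
  have ev: "eventually (\<lambda>w. w \<in> ball z0 r - {z0}) (at z0)"
    using r(1) by (intro eventually_at_in_open) auto
  have eq: "(w - z0) * deriv zeta_aux w / zeta_aux w = of_nat m + (w - z0) * deriv g w / g w" if w: "w \<in> ball z0 r - {z0}" for w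
  proof -
    have "deriv zeta_aux w = deriv (\<lambda>w. g w * (w - z0) ^ m) w"
      using w r(3) by (intro deriv_cong_ev eventually_mono[OF eventually_nhds_in_open[of "ball z0 r" w]]) auto
    also have "\<dots> = deriv g w * (w - z0) ^ m + g w * (of_nat m * (w - z0) ^ (m - 1))"
    proof (rule DERIV_imp_deriv)
      have "(g has_field_derivative deriv g w) (at w)" using w by (intro holomorphic_derivI[OF ghol]) auto
      thus "((\<lambda>w. g w * (w - z0) ^ m) has_field_derivative
          deriv g w * (w - z0) ^ m + g w * (of_nat m * (w - z0) ^ (m - 1))) (at w)"
        by (auto intro!: derivative_eq_intros)
    qed
    finally have d: "deriv zeta_aux w = deriv g w * (w - z0) ^ m + g w * (of_nat m * (w - z0) ^ (m - 1))" .
    have "(w - z0) * (of_nat m * (w - z0) ^ (m - 1)) = of_nat m * (w - z0) ^ m"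
      by (cases m) auto
    moreover have "(w - z0) * deriv zeta_aux w = (w - z0) * deriv g w * (w - z0) ^ m +
        g w * ((w - z0) * (of_nat m * (w - z0) ^ (m - 1)))" unfolding d by (simp only: algebra_simps)
    ultimately have "(w - z0) * deriv zeta_aux w = (w - z0) * deriv g w * (w - z0) ^ m + g w * (of_nat m * (w - z0) ^ m)"
      by simp
    hence "(w - z0) * deriv zeta_aux w = ((w - z0) * deriv g w + of_nat m * g w) * (w - z0) ^ m"
      by (simp add: algebra_simps)
    moreover have "zeta_aux w = g w * (w - z0) ^ m" "g w \<noteq> 0" "(w - z0) ^ m \<noteq> 0" using r(3)[of w] w by auto
    ultimately show ?thesis by (simp add: add_divide_distrib)
  qed
  have "continuous_on (ball z0 r) (\<lambda>w. of_nat m + (w - z0) * deriv g w / g w)"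
    using r(3) by (intro continuous_intros holomorphic_on_imp_continuous_on[OF holomorphic_deriv[OF ghol]]
        holomorphic_on_imp_continuous_on[OF ghol]) auto
  hence "isCont (\<lambda>w. of_nat m + (w - z0) * deriv g w / g w) z0"
    using r(1) by (simp add: continuous_on_eq_continuous_at)
  hence "((\<lambda>w. of_nat m + (w - z0) * deriv g w / g w) \<longlongrightarrow> of_nat m) (at z0)"
    by (simp add: isCont_def)
  hence "((\<lambda>w. (w - z0) * deriv zeta_aux w / zeta_aux w) \<longlongrightarrow> of_nat m) (at z0)"
    by (rule Lim_transform_eventually) (use ev eq in \<open>auto elim!: eventually_mono\<close>)
  moreover have "eventually (\<lambda>w. zeta_aux w \<noteq> 0) (at z0)"
    using ev by eventually_elim (use r(3) in auto)
  moreover have "zeta_aux z0 = 0 \<longleftrightarrow> m > 0" using * by (auto simp: m_def split: if_splits)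
  ultimately show ?thesis using that by blast
qed

text \<open>By \<open>mangoldt_series_eq\<close> the logarithmic derivative of
  \<open>zeta_aux\<close> extends holomorphically to \<open>s\<close>, so its residue there, the
  order of the zero, is 0.\<close>

lemma zeta_aux_nz_gt1:
  assumes s: "Re s > 1"
  shows "zeta_aux s \<noteq> 0"
proof -
  obtain m where m: "zeta_aux s = 0 \<longleftrightarrow> m > 0" "eventually (\<lambda>w. zeta_aux w \<noteq> 0) (at s)"
    "((\<lambda>w. (w - s) * deriv zeta_aux w / zeta_aux w) \<longlongrightarrow> of_nat m) (at s)"
    using zeta_aux_order[of s] s by auto
  have op: "open {s. Re s > 1}" by (rule open_halfspace_Re_gt)
  have hol: "mangoldt_series holomorphic_on {s. Re s > 1}"
    unfolding mangoldt_series_def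
  proof (rule holomorphic_suminf(1)[OF op])
    show "(\<lambda>s. mangoldt (Suc n) * of_nat (Suc n) powr (- s)) holomorphic_on {s. Re s > 1}" for n
      by (auto intro!: holomorphic_intros simp del: of_nat_Suc)
    show "\<exists>d>0. \<exists>M. cball x d \<subseteq> {s. Re s > 1} \<and> summable M \<and>
       (\<forall>n. \<forall>y\<in>cball x d. norm (mangoldt (Suc n) * of_nat (Suc n) powr (- y) :: complex) \<le> M n)" 
      if x: "x \<in> {s. Re s > 1}" for x
    proof -
      define d where "d = (Re x - 1) / 2"
      have d: "d > 0" using x by (simp add: d_def)
      have Re: "Re y \<ge> 1 + d" if "y \<in> cball x d" for y
      proof -
        have "\<bar>Re (x - y)\<bar> \<le> d" using abs_Re_le_cmod[of "x - y"] that by (simp add: dist_norm)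
        moreover have "Re x = 1 + d + d" by (simp add: d_def field_simps)
        ultimately show ?thesis by simp
      qed
      have "norm (mangoldt (Suc n) * of_nat (Suc n) powr (- y) :: complex) \<le> 
              norm (mangoldt (Suc n) * of_nat (Suc n) powr (- of_real (1 + d)) :: complex)" if "y \<in> cball x d" for y n
        unfolding norm_mult norm_nat_powr using Re[OF that]
        by (intro mult_left_mono powr_mono) (auto simp: mangoldt_nonneg)
      moreover have "summable (\<lambda>n. norm (mangoldt (Suc n) * of_nat (Suc n) powr (- of_real (1 + d)) :: complex))"
        using d by (intro summable_mangoldt_series) auto
      moreover have "cball x d \<subseteq> {s. Re s > 1}" using Re d by force
      ultimately show ?thesis using d by blast
    qed
  qed
  have "isCont (\<lambda>w. (w - s) * (1 / (w - 1) - mangoldt_series w)) s"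
    using s holomorphic_on_imp_continuous_on[OF hol] op
    by (intro continuous_intros) (auto simp: continuous_on_eq_continuous_at)
  hence "((\<lambda>w. (w - s) * (1 / (w - 1) - mangoldt_series w)) \<longlongrightarrow> 0) (at s)" by (simp add: isCont_def)
  moreover have "eventually (\<lambda>w. (w - s) * (1 / (w - 1) - mangoldt_series w) = (w - s) * deriv zeta_aux w / zeta_aux w) (at s)"
    using m(2) eventually_at_in_open'[OF op, of s, simplified, OF s]
  proof eventually_elim
    case (elim w)
    hence "deriv zeta_aux w = (1 / (w - 1) - mangoldt_series w) * zeta_aux w"
      using mangoldt_series_eq[of w] by (simp add: algebra_simps)
    thus ?case using elim by simp
  qed
  ultimately have "((\<lambda>w. (w - s) * deriv zeta_aux w / zeta_aux w) \<longlongrightarrow> 0) (at s)"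
    by (rule Lim_transform_eventually)
  hence "of_nat m = (0 :: complex)" using m(3) by (intro LIM_unique)
  thus ?thesis using m(1) by simp
qed

lemma mangoldt_series_eq':
  assumes "Re s > 1"
  shows "mangoldt_series s = 1 / (s - 1) - deriv zeta_aux s / zeta_aux s"
  using mangoldt_series_eq[OF assms] zeta_aux_nz_gt1[OF assms] by (simp add: field_simps)

lemma Re_mangoldt_series:
  assumes "\<sigma> > 1"
  shows "(\<lambda>n. mangoldt (Suc n) * real (Suc n) powr (- \<sigma>) * cos (t * ln (real (Suc n)))) sums Re (mangoldt_series (Complex \<sigma> t))"
proof -
  have "(\<lambda>n. Re (mangoldt (Suc n) * of_nat (Suc n) powr (- Complex \<sigma> t))) sums Re (mangoldt_series (Complex \<sigma> t))"
    by (intro sums_Re mangoldt_series_sums) (use assms in auto)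
  also have "(\<lambda>n. Re (mangoldt (Suc n) * of_nat (Suc n) powr (- Complex \<sigma> t))) =
      (\<lambda>n. mangoldt (Suc n) * real (Suc n) powr (- \<sigma>) * cos (t * ln (real (Suc n))))"
  proof
    fix n
    have "of_nat (Suc n) powr (- Complex \<sigma> t) = exp (- Complex \<sigma> t * of_real (ln (real (Suc n))))"
      using Ln_of_nat[of "Suc n"] by (simp add: powr_def del: of_nat_Suc)
    hence "Re (of_nat (Suc n) powr (- Complex \<sigma> t)) = real (Suc n) powr (- \<sigma>) * cos (t * ln (real (Suc n)))"
      by (simp add: Re_exp powr_def del: of_nat_Suc)
    moreover have "Re (mangoldt (Suc n) * z) = mangoldt (Suc n) * Re z" for z
      by (metis of_real_mangoldt Re_complex_of_real mult.commute Re_mangoldt complex_Re_of_nat Im_mangoldt complex.sel times_complex.sel(1) diff_zero mult_zero_left)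
    ultimately show "Re (mangoldt (Suc n) * of_nat (Suc n) powr (- Complex \<sigma> t)) =
       mangoldt (Suc n) * real (Suc n) powr (- \<sigma>) * cos (t * ln (real (Suc n)))" by simp
  qed
  finally show ?thesis .
qed

text \<open>Each term is a nonnegative multiple of 3 + 4 cos x + cos 2x = 2 (1 + cos x)^2.\<close>

lemma mangoldt_series_341:
  assumes "\<sigma> > 1"
  shows "3 * Re (mangoldt_series (Complex \<sigma> 0)) + 4 * Re (mangoldt_series (Complex \<sigma> t)) + Re (mangoldt_series (Complex \<sigma> (2 * t))) \<ge> 0"
proof (rule sums_le[OF _ sums_zero sums_add[OF sums_add[OF sums_mult sums_mult]]])
  note R = Re_mangoldt_series[OF assms]
  show "0 \<le> 3 * (mangoldt (Suc n) * real (Suc n) powr (- \<sigma>) * cos (0 * ln (real (Suc n)))) +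
     4 * (mangoldt (Suc n) * real (Suc n) powr (- \<sigma>) * cos (t * ln (real (Suc n)))) +
     mangoldt (Suc n) * real (Suc n) powr (- \<sigma>) * cos ((2 * t) * ln (real (Suc n)))" for n
  proof -
    define x where "x = t * ln (real (Suc n))"
    have "3 + 4 * cos x + cos (2 * x) = 2 * (1 + cos x)\<^sup>2"
      using cos_double_cos[of x] by (simp add: power2_eq_square algebra_simps)
    hence "0 \<le> (mangoldt (Suc n) * real (Suc n) powr (- \<sigma>)) * (3 + 4 * cos x + cos (2 * x))"
      by (intro mult_nonneg_nonneg mangoldt_nonneg) auto
    thus ?thesis by (simp add: x_def algebra_simps)
  qed
qed (rule Re_mangoldt_series[OF assms])+

text \<open>The residue of \<open>mangoldt_series\<close> at \<open>Complex 1 t\<close>, approached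
  from the right: 1/(s-1) contributes 1 when \<open>t = 0\<close>, and a zero of order
  \<open>m\<close> contributes \<open>- m\<close>.\<close>

lemma mangoldt_series_limit:
  obtains m :: nat where "zeta_aux (Complex 1 t) = 0 \<longleftrightarrow> m > 0"
    "((\<lambda>\<sigma>. (\<sigma> - 1) * Re (mangoldt_series (Complex \<sigma> t))) \<longlongrightarrow> (if t = 0 then 1 else 0) - real m) (at_right 1)"
proof -
  define z0 where "z0 = Complex 1 t"
  obtain m where m: "zeta_aux z0 = 0 \<longleftrightarrow> m > 0" 
    "((\<lambda>w. (w - z0) * deriv zeta_aux w / zeta_aux w) \<longlongrightarrow> of_nat m) (at z0)"
    using zeta_aux_order[of z0] by (auto simp: z0_def)
  have fl: "filterlim (\<lambda>\<sigma>. Complex \<sigma> t) (at z0) (at_right 1)"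
    unfolding filterlim_at
  proof
    have "((\<lambda>\<sigma>. of_real \<sigma> + of_real t * \<i>) \<longlongrightarrow> of_real 1 + of_real t * \<i>) (at_right 1)"
      by (intro tendsto_intros)
    thus "((\<lambda>\<sigma>. Complex \<sigma> t) \<longlongrightarrow> z0) (at_right 1)" by (simp add: z0_def complex_eq_iff Complex_eq mult.commute)
    show "\<forall>\<^sub>F x in at_right 1. Complex x t \<in> UNIV \<and> Complex x t \<noteq> z0"
      using eventually_at_right_less[of 1] by eventually_elim (auto simp: z0_def)
  qed
  have A: "((\<lambda>\<sigma>. Re ((Complex \<sigma> t - z0) * deriv zeta_aux (Complex \<sigma> t) / zeta_aux (Complex \<sigma> t))) \<longlongrightarrow> Re (of_nat m)) (at_right 1)"
    by (intro tendsto_Re filterlim_compose[OF m(2) fl])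
  have B: "((\<lambda>\<sigma>. Re ((Complex \<sigma> t - z0) / (Complex \<sigma> t - 1))) \<longlongrightarrow> (if t = 0 then 1 else 0)) (at_right 1)"
  proof (cases "t = 0")
    case True
    have "eventually (\<lambda>\<sigma>. 1 = Re ((Complex \<sigma> t - z0) / (Complex \<sigma> t - 1))) (at_right 1)"
      using eventually_at_right_less[of 1]
    proof eventually_elim
      case (elim \<sigma>)
      have "Complex \<sigma> t - z0 = Complex \<sigma> t - 1" "Complex \<sigma> t - 1 \<noteq> 0" using True elim by (auto simp: z0_def complex_eq_iff)
      thus ?case by simp
    qed
    from Lim_transform_eventually[OF tendsto_const this] show ?thesis using True by simp
  next
    case False
    have "z0 - 1 \<noteq> 0" using False by (auto simp: z0_def complex_eq_iff)
    hence "((\<lambda>w. (w - z0) / (w - 1)) \<longlongrightarrow> (z0 - z0) / (z0 - 1)) (at z0)" by (intro tendsto_intros) auto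
    from tendsto_Re[OF filterlim_compose[OF this fl]] show ?thesis using False by simp
  qed
  have "eventually (\<lambda>\<sigma>. Re ((Complex \<sigma> t - z0) / (Complex \<sigma> t - 1)) - Re ((Complex \<sigma> t - z0) * deriv zeta_aux (Complex \<sigma> t) / zeta_aux (Complex \<sigma> t))
      = (\<sigma> - 1) * Re (mangoldt_series (Complex \<sigma> t))) (at_right 1)"
    using eventually_at_right_less[of 1]
  proof eventually_elim
    case (elim \<sigma>)
    have eps: "Complex \<sigma> t - z0 = of_real (\<sigma> - 1)" by (simp add: z0_def complex_eq_iff)
    have "(Complex \<sigma> t - z0) / (Complex \<sigma> t - 1) - (Complex \<sigma> t - z0) * deriv zeta_aux (Complex \<sigma> t) / zeta_aux (Complex \<sigma> t)
      = of_real (\<sigma> - 1) * mangoldt_series (Complex \<sigma> t)"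
      unfolding eps using elim by (subst mangoldt_series_eq') (simp_all add: right_diff_distrib)
    hence "Re ((Complex \<sigma> t - z0) / (Complex \<sigma> t - 1)) - Re ((Complex \<sigma> t - z0) * deriv zeta_aux (Complex \<sigma> t) / zeta_aux (Complex \<sigma> t))
      = Re (of_real (\<sigma> - 1) * mangoldt_series (Complex \<sigma> t))" by (metis minus_complex.sel(1))
    thus ?case by simp
  qed
  from Lim_transform_eventually[OF tendsto_diff[OF B A] this] show ?thesis
    using m(1) that[of m] by (simp add: z0_def)
qed

text \<open>Multiplying \<open>mangoldt_series_341\<close> by \<open>\<sigma> - 1\<close> and
  passing to the limit gives 3 - 4 m1 - m2 >= 0 for the orders m1, m2 of the zeros at 1 + it and 1 +
  2it, so m1 = 0.\<close>

lemma zeta_aux_nz_line: "zeta_aux (Complex 1 t) \<noteq> 0"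
proof (cases "t = 0")
  case True
  have "Complex 1 0 = 1" by (simp add: complex_eq_iff)
  thus ?thesis using True by simp
next
  case False
  obtain m0 where m0: "zeta_aux (Complex 1 0) = 0 \<longleftrightarrow> m0 > 0"
    "((\<lambda>\<sigma>. (\<sigma> - 1) * Re (mangoldt_series (Complex \<sigma> 0))) \<longlongrightarrow> (if (0::real) = 0 then 1 else 0) - real m0) (at_right 1)"
    using mangoldt_series_limit by blast
  obtain m1 where m1: "zeta_aux (Complex 1 t) = 0 \<longleftrightarrow> m1 > 0"
    "((\<lambda>\<sigma>. (\<sigma> - 1) * Re (mangoldt_series (Complex \<sigma> t))) \<longlongrightarrow> (if t = 0 then 1 else 0) - real m1) (at_right 1)"
    using mangoldt_series_limit by blast
  obtain m2 where m2: 
    "((\<lambda>\<sigma>. (\<sigma> - 1) * Re (mangoldt_series (Complex \<sigma> (2 * t)))) \<longlongrightarrow> (if 2 * t = 0 then 1 else 0) - real m2) (at_right 1)"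
    using mangoldt_series_limit by blast
  have "Complex 1 0 = 1" by (simp add: complex_eq_iff)
  hence "m0 = 0" using m0(1) by simp
  have "((\<lambda>\<sigma>. 3 * ((\<sigma> - 1) * Re (mangoldt_series (Complex \<sigma> 0))) + 4 * ((\<sigma> - 1) * Re (mangoldt_series (Complex \<sigma> t)))
      + (\<sigma> - 1) * Re (mangoldt_series (Complex \<sigma> (2 * t)))) \<longlongrightarrow> 3 * (1 - 0) + 4 * (0 - real m1) + (0 - real m2)) (at_right 1)"
    using m0(2) m1(2) m2 False \<open>m0 = 0\<close> by (intro tendsto_intros) auto
  moreover have "eventually (\<lambda>\<sigma>. 0 \<le> 3 * ((\<sigma> - 1) * Re (mangoldt_series (Complex \<sigma> 0))) + 4 * ((\<sigma> - 1) * Re (mangoldt_series (Complex \<sigma> t)))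
      + (\<sigma> - 1) * Re (mangoldt_series (Complex \<sigma> (2 * t)))) (at_right 1)"
    using eventually_at_right_less[of 1]
  proof eventually_elim
    case (elim \<sigma>)
    have "0 \<le> (\<sigma> - 1) * (3 * Re (mangoldt_series (Complex \<sigma> 0)) + 4 * Re (mangoldt_series (Complex \<sigma> t)) + Re (mangoldt_series (Complex \<sigma> (2 * t))))"
      using elim mangoldt_series_341[of \<sigma> t] by (intro mult_nonneg_nonneg) auto
    thus ?case by (simp add: algebra_simps)
  qed
  ultimately have "0 \<le> 3 * (1 - 0) + 4 * (0 - real m1) + (0 - real m2)"
    by (intro tendsto_lowerbound[where F = "at_right (1::real)"]) auto
  moreover have "real m2 \<ge> 0" by simp
  ultimately have "4 * real m1 \<le> 3" by (simp add: algebra_simps)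
  hence "real m1 < 1" by simp
  hence "m1 = 0" by simp
  thus ?thesis using m1(1) by simp
qed

lemma zeta_aux_nz: "Re s \<ge> 1 \<Longrightarrow> zeta_aux s \<noteq> 0"
proof (cases "Re s = 1")
  case True
  hence "s = Complex 1 (Im s)" by (simp add: complex_eq_iff)
  thus ?thesis using zeta_aux_nz_line[of "Im s"] by simp
next
  case False
  assume "Re s \<ge> 1"
  thus ?thesis using False zeta_aux_nz_gt1[of s] by simp
qed

section \<open>Newman's Tauberian theorem\<close>

lemma powr_mvt:
  fixes x a :: real
  assumes "x > 0" "a \<noteq> 0"
  obtains \<xi> where "x < \<xi>" "\<xi> < x + 1" "((x + 1) powr a - x powr a) / a = \<xi> powr (a - 1)"
proof -
  have "\<exists>z>x. z < x + 1 \<and> (x + 1) powr a - x powr a = (x + 1 - x) * (a * z powr (a - 1))"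
    using assms by (intro MVT2[of x "x + 1" "\<lambda>z. z powr a" "\<lambda>z. a * z powr (a - 1)"]) (auto intro!: derivative_eq_intros)
  then obtain z where z: "z > x" "z < x + 1" "(x + 1) powr a - x powr a = a * z powr (a - 1)" by auto
  thus ?thesis using that[of z] assms by simp
qed

text \<open>Comparison with the integral of x^(a-1), term by term through the mean value theorem.
  For \<open>a > 1\<close> the summands increase, so the comparison is shifted by one index and the
  last summand becomes the extra term.\<close>

lemma sum_powr_bound:
  assumes "a > 0"
  shows "(\<Sum>n<N. real (Suc n) powr (a - 1)) \<le> real N powr (a - 1) + real N powr a / a"
proof (cases "a \<le> 1")
  case True
  have "(\<Sum>n<N. real (Suc n) powr (a - 1)) \<le> real N powr a / a"
  proof (induction N)
    case (Suc N)
    have "real (Suc N) powr (a - 1) \<le> (real (Suc N) powr a - real N powr a) / a"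
    proof (cases "N = 0")
      case False
      then obtain \<xi> where \<xi>: "real N < \<xi>" "\<xi> < real N + 1" "((real N + 1) powr a - real N powr a) / a = \<xi> powr (a - 1)"
        using powr_mvt[of "real N" a] assms by auto
      have "real (Suc N) powr (a - 1) \<le> \<xi> powr (a - 1)" using \<xi> True by (intro powr_mono2') auto
      thus ?thesis using \<xi> by (simp add: add.commute)
    qed (use assms True in \<open>simp add: field_simps\<close>)
    thus ?case using Suc by (simp add: diff_divide_distrib)
  qed auto
  thus ?thesis by (smt (verit) powr_ge_zero)
next
  case False
  have "(\<Sum>n<N. real n powr (a - 1)) \<le> real N powr a / a"
  proof (induction N)
    case (Suc N)
    have "real N powr (a - 1) \<le> (real (Suc N) powr a - real N powr a) / a"
    proof (cases "N = 0")
      case False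
      then obtain \<xi> where \<xi>: "real N < \<xi>" "\<xi> < real N + 1" "((real N + 1) powr a - real N powr a) / a = \<xi> powr (a - 1)"
        using powr_mvt[of "real N" a] assms by auto
      have "real N powr (a - 1) \<le> \<xi> powr (a - 1)" using \<xi> \<open>\<not> a \<le> 1\<close> by (intro powr_mono2) auto
      thus ?thesis using \<xi> by (simp add: add.commute)
    qed (use assms in simp)
    thus ?case using Suc by (simp add: diff_divide_distrib)
  qed auto
  moreover have "(\<Sum>n<N. real (Suc n) powr (a - 1)) = (\<Sum>n<N. real n powr (a - 1)) + real N powr (a - 1)"
    by (induction N) auto
  ultimately show ?thesis by simp
qed

lemma tail_powr_bound:
  assumes "x > 0" "N > 0"
  shows "(\<Sum>n<M. real (n + N + 1) powr (- 1 - x)) \<le> real N powr (- x) / x"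
proof -
  have "(\<Sum>n<M. real (n + N + 1) powr (- 1 - x)) \<le> (real N powr (- x) - real (N + M) powr (- x)) / x"
  proof (induction M)
    case (Suc M)
    obtain \<xi> where \<xi>: "real (N + M) < \<xi>" "\<xi> < real (N + M) + 1" 
       "((real (N + M) + 1) powr (-x) - real (N + M) powr (-x)) / (-x) = \<xi> powr (-x - 1)"
      using powr_mvt[of "real (N + M)" "-x"] assms by auto
    have "real (M + N + 1) powr (- 1 - x) \<le> \<xi> powr (- 1 - x)" using \<xi> assms by (intro powr_mono2') auto
    also have "\<xi> powr (- 1 - x) = \<xi> powr (- x - 1)" by (rule arg_cong[where f = "\<lambda>e. \<xi> powr e"]) simp
    also have "\<dots> = ((real (N + M) + 1) powr (-x) - real (N + M) powr (-x)) / (-x)" by (simp only: \<xi>(3))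
    also have "\<dots> = (real (N + M) powr (-x) - real (N + Suc M) powr (-x)) / x"
      using assms by (simp add: field_simps)
    finally show ?case using Suc by (simp add: diff_divide_distrib)
  qed auto
  also have "\<dots> \<le> real N powr (- x) / x" using assms by (intro divide_right_mono) auto
  finally show ?thesis .
qed

text \<open>The segment meets the imaginary axis in at most one endpoint, so the integrand tends to
  0 at every interior point and stays bounded: dominated convergence applies.\<close>

lemma linepath_decay:
  assumes h: "continuous_on (closed_segment a b) h" and "Re a \<le> 0" "Re b \<le> 0" "Re a < 0 \<or> Re b < 0"
  shows "(\<lambda>N. contour_integral (linepath a b) (\<lambda>z. h z * of_nat (Suc N) powr z)) \<longlonglongrightarrow> 0"
proof -
  define f where "f = (\<lambda>N x. h (linepath a b x) * of_nat (Suc N) powr (linepath a b x) * (b - a))"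
  have cont: "continuous_on {0..1} (f N)" for N
    unfolding f_def
    by (intro continuous_intros continuous_on_compose2[OF h] continuous_on_linepath) 
       (auto simp: linepath_in_path simp del: of_nat_Suc)
  have int: "f N integrable_on {0..1}" for N by (intro integrable_continuous_real cont)
  have eq: "contour_integral (linepath a b) (\<lambda>z. h z * of_nat (Suc N) powr z) = integral {0<..<1} (f N)" for N
  proof -
    have "((\<lambda>z. h z * of_nat (Suc N) powr z) has_contour_integral integral {0..1} (f N)) (linepath a b)"
      unfolding has_contour_integral_linepath using integrable_integral[OF int, of N] by (simp add: f_def)
    thus ?thesis by (simp add: contour_integral_unique integral_open_interval_real)
  qed
  obtain B where B: "\<And>z. z \<in> closed_segment a b \<Longrightarrow> norm (h z) \<le> B"
    using compact_imp_bounded[OF compact_continuous_image[OF h compact_segment]] unfolding bounded_iff by auto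
  have "(\<lambda>N. integral {0<..<1} (f N)) \<longlonglongrightarrow> integral {0<..<1::real} (\<lambda>x. 0)"
  proof (rule dominated_convergence(2)[where h = "\<lambda>_. B * norm (b - a)"])
    show "f N integrable_on {0<..<1}" for N
      using int[of N] integrable_on_open_interval_real[of "f N" 0 1] by simp
    show "(\<lambda>_. B * norm (b - a)) integrable_on {0<..<1::real}" 
      using integrable_on_open_interval_real[of "\<lambda>_. B * norm (b - a)" 0 1] by auto
    have Re: "Re (linepath a b x) < 0" if x: "x \<in> {0<..<1}" for x
    proof -
      have "Re (linepath a b x) = (1 - x) * Re a + x * Re b" by (simp add: linepath_def)
      moreover have "(1 - x) * Re a \<le> 0" "x * Re b \<le> 0" using x assms by (auto intro: mult_nonneg_nonpos)
      moreover have "(1 - x) * Re a < 0 \<or> x * Re b < 0" using x assms by (auto intro: mult_pos_neg)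
      ultimately show ?thesis by linarith
    qed
    have seg: "linepath a b x \<in> closed_segment a b" if "x \<in> {0<..<1}" for x
      using that by (intro linepath_in_path) auto
    show "norm (f N x) \<le> B * norm (b - a)" if x: "x \<in> {0<..<1}" for N x
    proof -
      have "real (Suc N) powr Re (linepath a b x) \<le> real (Suc N) powr 0"
        using Re[OF x] by (intro powr_mono) auto
      hence "norm (h (linepath a b x)) * real (Suc N) powr Re (linepath a b x) \<le> B * 1"
        using B[OF seg[OF x]] by (intro mult_mono) (auto intro: order_trans[OF norm_ge_zero])
      thus ?thesis unfolding f_def norm_mult norm_nat_powr by (intro mult_right_mono) auto
    qed
    show "(\<lambda>N. f N x) \<longlonglongrightarrow> 0" if x: "x \<in> {0<..<1}" for x
    proof -
      have "(\<lambda>N. real (Suc N) powr Re (linepath a b x)) \<longlonglongrightarrow> 0"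
        using Re[OF x] by (intro tendsto_neg_powr filterlim_compose[OF filterlim_real_sequentially filterlim_Suc])
      hence "(\<lambda>N. (of_nat (Suc N) :: complex) powr (linepath a b x)) \<longlonglongrightarrow> 0"
        by (subst tendsto_norm_zero_iff [symmetric]) (simp del: of_nat_Suc)
      hence "(\<lambda>N. h (linepath a b x) * of_nat (Suc N) powr (linepath a b x) * (b - a)) \<longlonglongrightarrow> h (linepath a b x) * 0 * (b - a)"
        by (intro tendsto_intros)
      thus ?thesis by (simp add: f_def)
    qed
  qed
  thus ?thesis by (simp add: eq del: of_nat_Suc)
qed

text \<open>Cauchy's formula at 0 without winding numbers. The difference quotient of
  \<open>\<Phi>\<close> is holomorphic and integrates to 0. For the remaining 1/z, the half circle
  has the primitive \<open>Ln z\<close> and \<open>P\<close>, which avoids the nonnegative reals,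
  has the primitive \<open>Ln (- z)\<close>; each contributes pi i.\<close>

lemma half_circle_Cauchy:
  assumes \<Phi>: "\<Phi> holomorphic_on Q" and Q: "open Q" "convex Q" "0 \<in> Q" and R: "R > 0"
    and A: "path_image (part_circlepath 0 R (-pi/2) (pi/2)) \<subseteq> Q"
    and P: "valid_path P" "pathstart P = \<i> * R" "pathfinish P = - (\<i> * R)" "path_image P \<subseteq> Q"
      "\<And>z. z \<in> path_image P \<Longrightarrow> - z \<notin> \<real>\<^sub>\<le>\<^sub>0"
  shows "(\<lambda>z. \<Phi> z / z) contour_integrable_on part_circlepath 0 R (-pi/2) (pi/2)"
    and "(\<lambda>z. \<Phi> z / z) contour_integrable_on P"
    and "contour_integral (part_circlepath 0 R (-pi/2) (pi/2)) (\<lambda>z. \<Phi> z / z) + contour_integral P (\<lambda>z. \<Phi> z / z) = 2 * pi * \<i> * \<Phi> 0"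
proof -
  let ?A = "part_circlepath 0 R (-pi/2) (pi/2)"
  define h where "h = (\<lambda>z. if z = 0 then deriv \<Phi> 0 else (\<Phi> z - \<Phi> 0) / (z - 0))"
  have h: "h holomorphic_on Q" unfolding h_def
    using Q by (intro pole_lemma \<Phi>) (auto simp: interior_open)
  have e1: "exp (\<i> * of_real (pi / 2)) = \<i>" "exp (\<i> * of_real (- pi / 2)) = - \<i>"
    using cis_conv_exp[of "pi / 2"] cis_conv_exp[of "- pi / 2"] by (simp_all add: cis_minus_pi_half)
  have A_ends: "pathstart ?A = - (\<i> * R)" "pathfinish ?A = \<i> * R"
    using e1 by (simp_all add: exp_minus mult.commute)
  have A_nz: "z \<notin> \<real>\<^sub>\<le>\<^sub>0" if z: "z \<in> path_image ?A" for z
  proof -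
    obtain x where x: "z = 0 + R * exp (\<i> * of_real x)" "- pi / 2 \<le> x" "x \<le> pi / 2"
      using z by (subst (asm) path_image_part_circlepath) auto
    have "cos x \<ge> 0" using x by (intro cos_ge_zero) auto
    moreover have "Re z = R * cos x" "norm z = R" using x R by (auto simp: Re_exp norm_mult)
    ultimately have "Re z \<ge> 0" "z \<noteq> 0" using R by auto
    thus ?thesis by (auto simp: complex_nonpos_Reals_iff complex_eq_iff)
  qed
  have nz: "z \<noteq> 0" if "z \<in> path_image ?A \<or> z \<in> path_image P" for z
    using that A_nz[of z] P(5)[of z] by auto
  have hA: "h contour_integrable_on ?A" and hP: "h contour_integrable_on P"
    using A P by (auto intro!: contour_integrable_holomorphic_simple[OF h Q(1)])
  have "(h has_contour_integral 0) (?A +++ P)"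
    using A P A_ends Q by (intro Cauchy_theorem_convex_simple[OF h Q(2)] valid_path_join) 
      (auto simp: path_image_join)
  moreover have "contour_integral (?A +++ P) h = contour_integral ?A h + contour_integral P h"
    using hA hP P(1) by (intro contour_integral_join) auto
  ultimately have sum0: "contour_integral ?A h + contour_integral P h = 0"
    using contour_integral_unique by metis
  have iA: "((\<lambda>z. 1 / z) has_contour_integral (Ln (pathfinish ?A) - Ln (pathstart ?A))) ?A"
    by (rule contour_integral_primitive[where S = "path_image ?A"])
       (use A_nz in \<open>auto intro!: derivative_eq_intros simp: field_simps\<close>)
  have "Ln (pathfinish ?A) - Ln (pathstart ?A) = pi * \<i>"
  proof -
    have "Ln (\<i> * R) = Ln (of_real R) + \<i> * pi / 2" "Ln (- (\<i> * R)) = Ln (of_real R) - \<i> * pi / 2"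
      using Ln_times_of_real[of R "\<i>"] Ln_times_of_real[of R "-\<i>"] R by (simp_all add: mult.commute)
    thus ?thesis unfolding A_ends by simp
  qed
  note iA = iA[unfolded this]
  have iP: "((\<lambda>z. 1 / z) has_contour_integral (Ln (- pathfinish P) - Ln (- pathstart P))) P"
    by (rule contour_integral_primitive[where S = "path_image P" and f = "\<lambda>z. Ln (- z)"])
       (use P in \<open>auto intro!: derivative_eq_intros simp: field_simps\<close>)
  have "Ln (- pathfinish P) - Ln (- pathstart P) = pi * \<i>"
  proof -
    have "Ln (\<i> * R) = Ln (of_real R) + \<i> * pi / 2" "Ln (- (\<i> * R)) = Ln (of_real R) - \<i> * pi / 2"
      using Ln_times_of_real[of R "\<i>"] Ln_times_of_real[of R "-\<i>"] R by (simp_all add: mult.commute)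
    thus ?thesis unfolding P by simp
  qed
  note iP = iP[unfolded this]
  have fA: "((\<lambda>z. \<Phi> z / z) has_contour_integral (contour_integral ?A h + \<Phi> 0 * (pi * \<i>))) ?A"
    by (rule has_contour_integral_eq[OF has_contour_integral_add[OF has_contour_integral_integral[OF hA] has_contour_integral_lmul[OF iA, of "\<Phi> 0"]]])
       (use nz in \<open>auto simp: h_def field_simps\<close>)
  have fP: "((\<lambda>z. \<Phi> z / z) has_contour_integral (contour_integral P h + \<Phi> 0 * (pi * \<i>))) P"
    by (rule has_contour_integral_eq[OF has_contour_integral_add[OF has_contour_integral_integral[OF hP] has_contour_integral_lmul[OF iP, of "\<Phi> 0"]]])
       (use nz in \<open>auto simp: h_def field_simps\<close>)
  show "(\<lambda>z. \<Phi> z / z) contour_integrable_on ?A" "(\<lambda>z. \<Phi> z / z) contour_integrable_on P"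
    using fA fP by (auto simp: contour_integrable_on_def)
  have "contour_integral ?A (\<lambda>z. \<Phi> z / z) + contour_integral P (\<lambda>z. \<Phi> z / z) =
     (contour_integral ?A h + contour_integral P h) + 2 * pi * \<i> * \<Phi> 0"
    using contour_integral_unique[OF fA] contour_integral_unique[OF fP] by (simp add: algebra_simps)
  thus "contour_integral ?A (\<lambda>z. \<Phi> z / z) + contour_integral P (\<lambda>z. \<Phi> z / z) = 2 * pi * \<i> * \<Phi> 0"
    unfolding sum0 by simp
qed

text \<open>On the circle R^2 = z * cnj z, which turns Newman's kernel into 2 Re z / R^2. Its zeros
  on the imaginary axis cancel the factor 1 / Re z in the estimates of tails and partial
  sums.\<close>

lemma circle_kernel_norm:
  assumes "norm z = R" "R > 0"
  shows "norm ((1 + z\<^sup>2 / of_real (R\<^sup>2)) / z) = 2 * \<bar>Re z\<bar> / R\<^sup>2"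
proof -
  have "of_real (R\<^sup>2) = z * cnj z" using assms complex_norm_square[of z] by simp
  moreover have "z \<noteq> 0" using assms by auto
  ultimately have "(1 + z\<^sup>2 / of_real (R\<^sup>2)) / z = (cnj z + z) / of_real (R\<^sup>2)"
    by (simp add: power2_eq_square field_simps)
  also have "cnj z + z = of_real (2 * Re z)" by (simp add: complex_eq_iff)
  finally show ?thesis by (simp add: norm_divide norm_power)
qed

lemma vertical_strip_nbhd:
  assumes S: "open S" "{z. Re z \<ge> 0} \<subseteq> S" and "R > 0"
  obtains \<delta> where "\<delta> > 0" "{z. - \<delta> < Re z \<and> \<bar>Im z\<bar> < R} \<subseteq> S"
proof -
  let ?K = "cbox (Complex 0 (-R)) (Complex 0 R)"
  have "?K \<subseteq> S" using S(2) by (auto simp: in_cbox_complex_iff)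
  then obtain e where e: "e > 0" "(\<Union>x\<in>?K. ball x e) \<subseteq> S"
    using compact_subset_open_imp_ball_epsilon_subset[OF compact_cbox S(1)] by metis
  have "{z. - e < Re z \<and> \<bar>Im z\<bar> < R} \<subseteq> S"
  proof
    fix z assume z: "z \<in> {z. - e < Re z \<and> \<bar>Im z\<bar> < R}"
    show "z \<in> S"
    proof (cases "Re z \<ge> 0")
      case False
      have "Complex 0 (Im z) \<in> ?K" using z by (auto simp: in_cbox_complex_iff)
      moreover have "z \<in> ball (Complex 0 (Im z)) e"
      proof -
        have "Complex 0 (Im z) - z = of_real (- Re z)" by (simp add: complex_eq_iff)
        thus ?thesis using False z by (simp add: dist_norm)
      qed
      ultimately show ?thesis using e(2) by blast
    qed (use S in auto)
  qed
  thus ?thesis using that e(1) by blast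
qed

text \<open>The partial sums \<open>FN\<close> are entire and are integrated over the whole circle;
  the continuation \<open>F\<close> is integrated over the right half circle and a path slightly to
  the left of the imaginary axis. On the half circles the kernel reduces the contribution to O(C /
  R), up to a term C / N, and on the left path of \<open>F\<close> the factor
  \<open>N powr z\<close> decays.\<close>

theorem newman_tauberian:
  fixes c :: "nat \<Rightarrow> complex"
  assumes c: "\<And>n. norm (c n) \<le> C" and F: "F holomorphic_on S" and S: "open S" "{z. Re z \<ge> 0} \<subseteq> S"
    and sums: "\<And>z. Re z > 0 \<Longrightarrow> (\<lambda>n. c n * of_nat (Suc n) powr (- 1 - z)) sums F z"
  shows "(\<lambda>n. c n / of_nat (Suc n)) sums F 0"
proof -
  have C: "C \<ge> 0" using c[of 0] norm_ge_zero order_trans by blast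
  define FN where "FN = (\<lambda>N z. \<Sum>n<N. c n * of_nat (Suc n) powr (- 1 - z))"
  have FN0: "FN N 0 = (\<Sum>n<N. c n / of_nat (Suc n))" for N
    by (simp add: FN_def powr_minus field_simps del: of_nat_Suc)
  have FN_hol: "FN N holomorphic_on X" for N X
    unfolding FN_def by (auto intro!: holomorphic_intros simp del: of_nat_Suc)
  have tail: "norm (F z - FN N z) \<le> C * (real N powr (- Re z) / Re z)" if z: "Re z > 0" "N > 0" for z N
  proof (rule tendsto_upperbound)
    have "(\<lambda>M. FN (M + N) z - FN N z) \<longlonglongrightarrow> F z - FN N z"
      using sums[OF z(1)] unfolding sums_def FN_def by (intro tendsto_diff tendsto_const) (rule LIMSEQ_ignore_initial_segment)
    thus "(\<lambda>M. norm (FN (M + N) z - FN N z)) \<longlonglongrightarrow> norm (F z - FN N z)" by (rule tendsto_norm)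
    show "\<forall>\<^sub>F M in sequentially. norm (FN (M + N) z - FN N z) \<le> C * (real N powr (- Re z) / Re z)"
    proof (rule always_eventually, rule allI)
      fix M
      have "FN (M + N) z - FN N z = (\<Sum>n<M. c (n + N) * of_nat (Suc (n + N)) powr (- 1 - z))"
        unfolding FN_def by (induction M) auto
      also have "norm \<dots> \<le> (\<Sum>n<M. C * real (Suc (n + N)) powr (- 1 - Re z))"
        by (rule sum_norm_le, simp only: norm_mult norm_nat_powr) (auto intro!: mult_right_mono c)
      also have "\<dots> = C * (\<Sum>n<M. real (n + N + 1) powr (- 1 - Re z))" by (simp add: sum_distrib_left)
      also have "\<dots> \<le> C * (real N powr (- Re z) / Re z)"
        using z C by (intro mult_left_mono tail_powr_bound) auto
      finally show "norm (FN (M + N) z - FN N z) \<le> C * (real N powr (- Re z) / Re z)" .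
    qed
  qed auto
  have head: "norm (FN N z) \<le> C * (real N powr (- Re z - 1) + real N powr (- Re z) / (- Re z))" if z: "Re z < 0" for z N
  proof -
    have "norm (FN N z) \<le> (\<Sum>n<N. C * real (Suc n) powr (- 1 - Re z))"
      unfolding FN_def by (rule sum_norm_le, simp only: norm_mult norm_nat_powr) (auto intro!: mult_right_mono c)
    also have "- 1 - Re z = - Re z - 1" by simp
    also have "(\<Sum>n<N. C * real (Suc n) powr (- Re z - 1)) = C * (\<Sum>n<N. real (Suc n) powr (- Re z - 1))"
      by (simp add: sum_distrib_left)
    also have "\<dots> \<le> C * (real N powr (- Re z - 1) + real N powr (- Re z) / (- Re z))"
      using z C by (intro mult_left_mono sum_powr_bound) auto
    finally show ?thesis .
  qed
  have "(\<lambda>N. FN N 0) \<longlonglongrightarrow> F 0"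
  proof (rule LIMSEQ_I)
    fix e :: real assume e: "e > 0"
    \<comment> \<open>Chosen so that the two half circles together contribute at most
      \<open>2 * C / R \<le> e / 2\<close>.\<close>
    define R where "R = 4 * (C + 1) / e"
    have R: "R > 0" using C e by (simp add: R_def)
    have CR: "C / R \<le> e / 4" using C e by (simp add: R_def field_simps)
    obtain \<delta>0 where \<delta>0: "\<delta>0 > 0" "{z. - \<delta>0 < Re z \<and> \<bar>Im z\<bar> < R + 1} \<subseteq> S"
      using vertical_strip_nbhd[OF S, of "R + 1"] R by auto
    define \<delta> where "\<delta> = \<delta>0 / 2"
    have \<delta>: "\<delta> > 0" "\<delta> < \<delta>0" using \<delta>0 by (simp_all add: \<delta>_def)
    define Q where "Q = {z. - \<delta>0 < Re z} \<inter> {z. Im z < R + 1} \<inter> {z. - (R + 1) < Im z}"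
    have Q: "open Q" "convex Q" "0 \<in> Q" "Q \<subseteq> S"
      using \<delta>0 R unfolding Q_def
      by (auto intro!: open_Int convex_Int open_halfspace_Re_gt open_halfspace_Im_lt open_halfspace_Im_gt
            convex_halfspace_Re_gt convex_halfspace_Im_lt convex_halfspace_Im_gt simp: abs_less_iff)
    define K where "K = (\<lambda>z::complex. 1 + z\<^sup>2 / of_real (R\<^sup>2))"
    let ?A = "part_circlepath 0 R (-pi/2) (pi/2)"
    let ?C = "part_circlepath 0 R (pi/2) (3*pi/2)"
    let ?z1 = "Complex (-\<delta>) R" and ?z2 = "Complex (-\<delta>) (-R)"
    let ?B1 = "linepath (\<i> * R) ?z1" and ?B2 = "linepath ?z1 ?z2" and ?B3 = "linepath ?z2 (- (\<i> * R))"
    let ?B = "?B1 +++ ?B2 +++ ?B3"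
    define \<Phi> where "\<Phi> = (\<lambda>N z. F z * of_nat N powr z * K z)"
    define \<Psi> where "\<Psi> = (\<lambda>N z. FN N z * of_nat N powr z * K z)"
    have A_img: "norm z = R \<and> Re z \<ge> 0" if zA: "z \<in> path_image ?A" for z
    proof -
      obtain x where x: "z = 0 + R * exp (\<i> * of_real x)" "- pi / 2 \<le> x" "x \<le> pi / 2"
        using zA by (subst (asm) path_image_part_circlepath) auto
      have "cos x \<ge> 0" using x by (intro cos_ge_zero) auto
      moreover have "Re z = R * cos x" "norm z = R" using x R by (auto simp: Re_exp norm_mult)
      ultimately show ?thesis using R by auto
    qed
    have C_img: "norm z = R \<and> Re z \<le> 0" if zC: "z \<in> path_image ?C" for z
    proof -
      obtain x where x: "z = 0 + R * exp (\<i> * of_real x)" "pi / 2 \<le> x" "x \<le> 3 * pi / 2"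
        using zC by (subst (asm) path_image_part_circlepath) auto
      have "cos (x - pi) \<ge> 0" using x by (intro cos_ge_zero) auto
      moreover have "cos (x - pi) = - cos x" by (simp add: cos_diff)
      moreover have "Re z = R * cos x" "norm z = R" using x R by (auto simp: Re_exp norm_mult)
      ultimately show ?thesis using R by (auto simp: mult_nonneg_nonpos)
    qed
    have A_Q: "path_image ?A \<subseteq> Q"
    proof
      fix z assume "z \<in> path_image ?A"
      from A_img[OF this] have "\<bar>Im z\<bar> \<le> R" "Re z \<ge> 0" using abs_Im_le_cmod[of z] by auto
      thus "z \<in> Q" using \<delta>0 by (auto simp: Q_def)
    qed
    have seg: "z \<in> Q \<and> - z \<notin> \<real>\<^sub>\<le>\<^sub>0"
      if z: "z \<in> closed_segment (\<i> * R) ?z1 \<or> z \<in> closed_segment ?z1 ?z2 \<or> z \<in> closed_segment ?z2 (- (\<i> * R))" for z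
    proof -
      have "z \<in> {w. - \<delta> \<le> Re w \<and> Re w \<le> 0 \<and> \<bar>Im w\<bar> \<le> R} \<and> (Im z \<noteq> 0 \<or> Re z < 0)"
        using z
      proof (elim disjE)
        assume "z \<in> closed_segment (\<i> * R) ?z1"
        then obtain u where u: "0 \<le> u" "u \<le> 1" "z = (1 - u) *\<^sub>R (\<i> * R) + u *\<^sub>R ?z1" by (auto simp: closed_segment_def)
        have "Re z = - (u * \<delta>)" "Im z = R" unfolding u(3) by (simp_all add: algebra_simps)
        thus ?thesis using u \<delta> R mult_left_le_one_le[of \<delta> u] by auto
      next
        assume "z \<in> closed_segment ?z2 (- (\<i> * R))"
        then obtain u where u: "0 \<le> u" "u \<le> 1" "z = (1 - u) *\<^sub>R ?z2 + u *\<^sub>R (- (\<i> * R))" by (auto simp: closed_segment_def)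
        have "Re z = - ((1 - u) * \<delta>)" "Im z = - R" unfolding u(3) by (simp_all add: algebra_simps)
        thus ?thesis using u \<delta> R mult_left_le_one_le[of \<delta> "1 - u"] by auto
      next
        assume "z \<in> closed_segment ?z1 ?z2"
        then obtain u where u: "0 \<le> u" "u \<le> 1" "z = (1 - u) *\<^sub>R ?z1 + u *\<^sub>R ?z2" by (auto simp: closed_segment_def)
        have "Re z = - \<delta>" "Im z = (1 - u) * R + u * (- R)" unfolding u(3) by (simp_all add: algebra_simps)
        moreover have "\<bar>(1 - u) * R + u * (- R)\<bar> \<le> R"
        proof -
          have "(1 - u) * R + u * (- R) = R - 2 * (u * R)" by (simp add: algebra_simps)
          moreover have "0 \<le> u * R" "u * R \<le> R" using u R mult_left_le_one_le[of R u] by auto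
          ultimately show ?thesis by linarith
        qed
        ultimately show ?thesis using \<delta> by auto
      qed
      thus ?thesis using \<delta> by (auto simp: Q_def complex_nonpos_Reals_iff)
    qed
    have B_path: "valid_path ?B" "pathstart ?B = \<i> * R" "pathfinish ?B = - (\<i> * R)"
      by (auto intro!: valid_path_join)
    have B_img: "path_image ?B \<subseteq> closed_segment (\<i> * R) ?z1 \<union> closed_segment ?z1 ?z2 \<union> closed_segment ?z2 (- (\<i> * R))"
      by (auto simp: path_image_join)
    have B_Q: "path_image ?B \<subseteq> Q" "\<And>z. z \<in> path_image ?B \<Longrightarrow> - z \<notin> \<real>\<^sub>\<le>\<^sub>0"
      using seg B_img by blast+
    have C_ends: "pathstart ?C = \<i> * R" "pathfinish ?C = - (\<i> * R)"
    proof -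
      have "cis (3 * pi / 2) = - \<i>"
        using cis_mult[of pi "pi / 2"] by (simp add: algebra_simps) 
      hence "exp (\<i> * of_real (3 * pi / 2)) = - \<i>" "exp (\<i> * of_real (pi / 2)) = \<i>"
        using cis_conv_exp[of "3 * pi / 2"] cis_conv_exp[of "pi / 2"] by simp_all
      thus "pathstart ?C = \<i> * R" "pathfinish ?C = - (\<i> * R)" by (simp_all add: mult.commute)
    qed
    have C_neg: "- z \<notin> \<real>\<^sub>\<le>\<^sub>0" if "z \<in> path_image ?C" for z
      using C_img[OF that] R by (auto simp: complex_nonpos_Reals_iff cmod_def)
    have K_hol: "K holomorphic_on X" for X unfolding K_def using R by (auto intro!: holomorphic_intros)
    have \<Phi>_hol: "\<Phi> N holomorphic_on Q" if "N > 0" for N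
      unfolding \<Phi>_def using that Q(4) by (auto intro!: holomorphic_intros K_hol holomorphic_on_subset[OF F])
    have \<Psi>_hol: "\<Psi> N holomorphic_on UNIV" if "N > 0" for N
      unfolding \<Psi>_def using that by (auto intro!: holomorphic_intros K_hol FN_hol)
    note half1 = half_circle_Cauchy[OF \<Phi>_hol Q(1-3) R A_Q B_path B_Q]
    note half2 = half_circle_Cauchy[OF \<Psi>_hol open_UNIV convex_UNIV UNIV_I R subset_UNIV valid_path_part_circlepath C_ends subset_UNIV C_neg]
    have zero: "\<Phi> N 0 = F 0" "\<Psi> N 0 = FN N 0" if "N > 0" for N
      using that by (simp_all add: \<Phi>_def \<Psi>_def K_def)
    have key: "norm (F 0 - FN N 0) \<le> 2 * C / R + C / real N + norm (contour_integral ?B (\<lambda>z. \<Phi> N z / z)) / (2 * pi)"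
      if N: "N > 0" for N
    proof -
      let ?f = "\<lambda>z. \<Phi> N z / z" and ?g = "\<lambda>z. \<Psi> N z / z"
      have split: "2 * pi * \<i> * (F 0 - FN N 0) = (contour_integral ?A ?f + contour_integral ?B ?f) - (contour_integral ?A ?g + contour_integral ?C ?g)"
        using half1(3)[OF N] half2(3)[OF N] zero[OF N] by (simp add: algebra_simps)
      have split': "2 * pi * \<i> * (F 0 - FN N 0) = contour_integral ?A (\<lambda>z. ?f z - ?g z) - contour_integral ?C ?g + contour_integral ?B ?f"
        unfolding split using half1(1)[OF N] half2(1)[OF N] by (simp add: contour_integral_diff)
      have tri: "norm (2 * pi * \<i> * (F 0 - FN N 0)) \<le> norm (contour_integral ?A (\<lambda>z. ?f z - ?g z)) + norm (contour_integral ?C ?g) + norm (contour_integral ?B ?f)"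
        unfolding split' by (intro order_trans[OF norm_triangle_ineq] add_right_mono norm_triangle_ineq4)
      have "norm (contour_integral ?A (\<lambda>z. ?f z - ?g z)) \<le> (2 * C / R\<^sup>2) * R * (pi/2 - (-pi/2))"
      proof (rule has_contour_integral_bound_part_circlepath_strong[where k = "{\<i> * R, - (\<i> * R)}"])
        show "((\<lambda>z. ?f z - ?g z) has_contour_integral contour_integral ?A (\<lambda>z. ?f z - ?g z)) ?A"
          using half1(1)[OF N] half2(1)[OF N] by (intro has_contour_integral_integral contour_integrable_diff)
        fix z assume z: "z \<in> path_image ?A - {\<i> * R, - (\<i> * R)}"
        have nz: "norm z = R" "Re z \<ge> 0" using A_img z by auto
        have "Re z \<noteq> 0"
        proof
          assume "Re z = 0"
          hence "\<bar>Im z\<bar> = R" using nz by (simp add: cmod_def)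
          hence "z = \<i> * R \<or> z = - (\<i> * R)" using \<open>Re z = 0\<close> by (auto simp: complex_eq_iff)
          thus False using z by auto
        qed
        hence rz: "Re z > 0" using nz by simp
        have "?f z - ?g z = (F z - FN N z) * of_nat N powr z * (K z / z)" by (simp add: \<Phi>_def \<Psi>_def algebra_simps diff_divide_distrib)
        moreover have "norm (K z / z) = 2 * Re z / R\<^sup>2"
          using circle_kernel_norm[OF nz(1) R] rz unfolding K_def by simp
        ultimately have "norm (?f z - ?g z) = norm (F z - FN N z) * real N powr Re z * (2 * Re z / R\<^sup>2)"
          by (simp only: norm_mult norm_nat_powr)
        also have "\<dots> \<le> C * (real N powr (- Re z) / Re z) * real N powr Re z * (2 * Re z / R\<^sup>2)"
          using rz N by (intro mult_right_mono tail) auto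
        also have "\<dots> = 2 * C / R\<^sup>2" using rz N by (simp add: powr_minus field_simps)
        finally show "norm (?f z - ?g z) \<le> 2 * C / R\<^sup>2" .
      qed (use C R in auto)
      also have "(2 * C / R\<^sup>2) * R * (pi/2 - (-pi/2)) = 2 * pi * (C / R)" using R by (simp add: power2_eq_square field_simps)
      finally have boundA: "norm (contour_integral ?A (\<lambda>z. ?f z - ?g z)) \<le> 2 * pi * (C / R)" .
      have "norm (contour_integral ?C ?g) \<le> (2 * C / R\<^sup>2 * (1 + R / real N)) * R * (3*pi/2 - pi/2)"
      proof (rule has_contour_integral_bound_part_circlepath_strong[where k = "{\<i> * R, - (\<i> * R)}"])
        show "(?g has_contour_integral contour_integral ?C ?g) ?C"
          using half2(2)[OF N] by (intro has_contour_integral_integral)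
        fix z assume z: "z \<in> path_image ?C - {\<i> * R, - (\<i> * R)}"
        have nz: "norm z = R" "Re z \<le> 0" using C_img z by auto
        have "Re z \<noteq> 0"
        proof
          assume "Re z = 0"
          hence "\<bar>Im z\<bar> = R" using nz by (simp add: cmod_def)
          hence "z = \<i> * R \<or> z = - (\<i> * R)" using \<open>Re z = 0\<close> by (auto simp: complex_eq_iff)
          thus False using z by auto
        qed
        hence rz: "Re z < 0" using nz by simp
        have "?g z = FN N z * of_nat N powr z * (K z / z)" by (simp add: \<Psi>_def)
        moreover have "norm (K z / z) = 2 * (- Re z) / R\<^sup>2"
          using circle_kernel_norm[OF nz(1) R] rz unfolding K_def by simp
        ultimately have "norm (?g z) = norm (FN N z) * real N powr Re z * (2 * (- Re z) / R\<^sup>2)"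
          by (simp only: norm_mult norm_nat_powr)
        also have "\<dots> \<le> C * (real N powr (- Re z - 1) + real N powr (- Re z) / (- Re z)) * real N powr Re z * (2 * (- Re z) / R\<^sup>2)"
          using rz N by (intro mult_right_mono head) (auto intro!: divide_nonpos_nonneg)
        also have "\<dots> = 2 * C / R\<^sup>2 * ((- Re z) * (real N powr (- Re z - 1) * real N powr Re z) + (real N powr (- Re z) * real N powr Re z))"
        proof -
          have gen: "C * (a + b / y) * c * (2 * y / R\<^sup>2) = 2 * C / R\<^sup>2 * (y * (a * c) + b * c)" if "y \<noteq> 0" for a b c y :: real
          proof -
            have "C * (a + b / y) * c * (2 * y / R\<^sup>2) = 2 * C / R\<^sup>2 * (((a + b / y) * y) * c)" by (simp add: mult_ac)
            also have "(a + b / y) * y = a * y + b" using that by (simp add: distrib_right)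
            finally show ?thesis by (simp add: algebra_simps)
          qed
          show ?thesis by (rule gen) (use rz in simp)
        qed
        also have "real N powr (- Re z - 1) * real N powr Re z = 1 / real N"
          using N by (simp add: powr_add [symmetric] powr_minus field_simps)
        also have "real N powr (- Re z) * real N powr Re z = 1" using N by (simp add: powr_add [symmetric])
        also have "2 * C / R\<^sup>2 * ((- Re z) * (1 / real N) + 1) \<le> 2 * C / R\<^sup>2 * (1 + R / real N)"
        proof (intro mult_left_mono)
          have "- Re z \<le> R" using abs_Re_le_cmod[of z] nz by linarith
          hence "(- Re z) / real N \<le> R / real N" by (intro divide_right_mono) auto
          thus "(- Re z) * (1 / real N) + 1 \<le> 1 + R / real N" by simp
        qed (use C in auto)
        finally show "norm (?g z) \<le> 2 * C / R\<^sup>2 * (1 + R / real N)" .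
      qed (use C R in auto)
      also have "(2 * C / R\<^sup>2 * (1 + R / real N)) * R * (3*pi/2 - pi/2) = 2 * pi * (C / R + C / real N)"
        using R N by (simp add: power2_eq_square field_simps)
      finally have boundC: "norm (contour_integral ?C ?g) \<le> 2 * pi * (C / R + C / real N)" .
      have "norm (2 * pi * \<i> * (F 0 - FN N 0)) \<le> 2 * pi * (C / R) + 2 * pi * (C / R + C / real N) + norm (contour_integral ?B ?f)"
        using tri boundA boundC by linarith
      also have "norm (2 * pi * \<i> * (F 0 - FN N 0)) = 2 * pi * norm (F 0 - FN N 0)" by (simp add: norm_mult)
      finally show ?thesis by (simp add: field_simps)
    qed
    have B_lim: "(\<lambda>N. contour_integral ?B (\<lambda>z. \<Phi> (Suc N) z / z)) \<longlonglongrightarrow> 0"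
    proof -
      define h where "h = (\<lambda>z. F z * K z / z)"
      have hc: "continuous_on (closed_segment (\<i> * R) ?z1) h" "continuous_on (closed_segment ?z1 ?z2) h" "continuous_on (closed_segment ?z2 (- (\<i> * R))) h"
      proof -
        have "continuous_on X h" if "X \<subseteq> Q" "0 \<notin> X" for X
          unfolding h_def using that Q(4) holomorphic_on_imp_continuous_on[OF F] holomorphic_on_imp_continuous_on[OF K_hol[of X]]
          by (intro continuous_intros) (auto intro: continuous_on_subset)
        moreover have "0 \<notin> X" if "\<And>z. z \<in> X \<Longrightarrow> - z \<notin> \<real>\<^sub>\<le>\<^sub>0" for X
          using that[of 0] by auto
        ultimately show "continuous_on (closed_segment (\<i> * R) ?z1) h" "continuous_on (closed_segment ?z1 ?z2) h" "continuous_on (closed_segment ?z2 (- (\<i> * R))) h"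
          using seg by (metis subsetI)+
      qed
      have eq: "\<Phi> (Suc N) z / z = h z * of_nat (Suc N) powr z" for N z by (simp add: \<Phi>_def h_def mult_ac)
      have int: "(\<lambda>z. h z * of_nat (Suc N) powr z) contour_integrable_on linepath a b"
        if "continuous_on (closed_segment a b) h" for N a b
        using that by (intro contour_integrable_continuous_linepath continuous_intros) (auto simp del: of_nat_Suc)
      have "contour_integral ?B (\<lambda>z. h z * of_nat (Suc N) powr z) = 
         contour_integral ?B1 (\<lambda>z. h z * of_nat (Suc N) powr z) + (contour_integral ?B2 (\<lambda>z. h z * of_nat (Suc N) powr z) +
         contour_integral ?B3 (\<lambda>z. h z * of_nat (Suc N) powr z))" for N
        using int[OF hc(1)] int[OF hc(2)] int[OF hc(3)]
        by (subst contour_integral_join; (subst contour_integral_join)?)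
           (auto intro!: contour_integrable_joinI valid_path_join)
      moreover have "(\<lambda>N. contour_integral ?B1 (\<lambda>z. h z * of_nat (Suc N) powr z) + (contour_integral ?B2 (\<lambda>z. h z * of_nat (Suc N) powr z) +
         contour_integral ?B3 (\<lambda>z. h z * of_nat (Suc N) powr z))) \<longlonglongrightarrow> 0 + (0 + 0)"
        using \<delta> by (intro tendsto_add linepath_decay hc) auto
      ultimately show ?thesis by (simp add: eq del: of_nat_Suc)
    qed
    have "(\<lambda>N. C / real (Suc N) + norm (contour_integral ?B (\<lambda>z. \<Phi> (Suc N) z / z)) / (2 * pi)) \<longlonglongrightarrow> 0 + norm (0::complex) / (2 * pi)"
      by (intro tendsto_intros B_lim LIMSEQ_Suc[OF lim_const_over_n]) auto
    hence "eventually (\<lambda>N. C / real (Suc N) + norm (contour_integral ?B (\<lambda>z. \<Phi> (Suc N) z / z)) / (2 * pi) < e / 2) sequentially"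
      using e by (intro order_tendstoD(2)) auto
    then obtain N0 where N0: "\<And>N. N \<ge> N0 \<Longrightarrow> C / real (Suc N) + norm (contour_integral ?B (\<lambda>z. \<Phi> (Suc N) z / z)) / (2 * pi) < e / 2"
      by (auto simp: eventually_at_top_linorder)
    have "norm (FN N 0 - F 0) < e" if "N \<ge> Suc N0" for N
    proof -
      define M where "M = N - 1"
      have M: "N = Suc M" "M \<ge> N0" using that by (auto simp: M_def)
      have "2 * C / R = 2 * (C / R)" by simp
      hence "2 * C / R \<le> e / 2" using CR by linarith
      hence "norm (F 0 - FN N 0) < e" using key[of N] N0[OF M(2)] unfolding M(1) by linarith
      thus ?thesis by (simp only: norm_minus_commute)
    qed
    thus "\<exists>no. \<forall>N\<ge>no. norm (FN N 0 - F 0) < e" by blast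
  qed
  thus ?thesis unfolding sums_def FN0 .
qed

section \<open>From Newman's theorem to the prime number theorem\<close>

definition psi_series :: "complex \<Rightarrow> complex" where
  "psi_series s = (\<Sum>n. of_real (chebyshev_psi (Suc n)) * zterm (Suc n) (s + 1))"

lemma psi_series_bound:
  assumes "Re s > 0"
  shows "norm (of_real (chebyshev_psi (Suc n)) * zterm (Suc n) (s + 1)) \<le> 
     (4 * norm (s + 1) * norm s) * real (Suc n) powr (- Re s - 1 + 0)"
proof -
  have "norm (of_real (chebyshev_psi (Suc n)) * zterm (Suc n) (s + 1)) = chebyshev_psi (Suc n) * norm (zterm (Suc n) (s + 1))"
    by (simp add: norm_mult chebyshev_psi_nonneg)
  also have "\<dots> \<le> (4 * real (Suc n)) * (norm (s + 1) * norm (1 - (s + 1)) * real (Suc n) powr (- Re (s + 1) - 1))"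
    using assms by (intro mult_mono chebyshev_psi_le zterm_bound) auto
  also have "\<dots> = (4 * norm (s + 1) * norm s) * (real (Suc n) powr 1 * real (Suc n) powr (- Re s - 2))"
    by (simp add: mult_ac add_ac)
  also have "real (Suc n) powr 1 * real (Suc n) powr (- Re s - 2) = real (Suc n) powr (- Re s - 1 + 0)"
    by (subst powr_add [symmetric], rule arg_cong[where f = "\<lambda>e. real (Suc n) powr e"]) simp
  finally show ?thesis .
qed

lemma psi_series_holomorphic: "psi_series holomorphic_on {s. Re s > 0}"
  unfolding psi_series_def
proof (rule holomorphic_suminf(1))
  show "(\<lambda>s. of_real (chebyshev_psi (Suc n)) * zterm (Suc n) (s + 1)) holomorphic_on {s. Re s > 0}" for n
    unfolding zterm_def by (auto intro!: holomorphic_intros simp del: of_nat_Suc)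
  show "\<exists>d>0. \<exists>M. cball x d \<subseteq> {s. Re s > 0} \<and> summable M \<and>
     (\<forall>n. \<forall>y\<in>cball x d. norm (of_real (chebyshev_psi (Suc n)) * zterm (Suc n) (y + 1)) \<le> M n)" if "x \<in> {s. Re s > 0}" for x
    using that by (intro halfplane_series_bound[where P = "\<lambda>s. 4 * norm (s + 1) * norm s"] psi_series_bound continuous_intros) auto
qed (rule open_halfspace_Re_gt)

lemma psi_series_sums:
  assumes "Re s > 0"
  shows "(\<lambda>n. of_real (chebyshev_psi (Suc n)) * zterm (Suc n) (s + 1)) sums psi_series s"
  unfolding psi_series_def
proof (rule summable_sums, rule summable_comparison_test')
  show "summable (\<lambda>n. (4 * norm (s + 1) * norm s) * real (Suc n) powr (- Re s - 1 + 0))"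
    using assms by (intro summable_mult) (subst summable_Suc_iff[of "\<lambda>n. real n powr (- Re s - 1 + 0)"], simp add: summable_real_powr_iff)
qed (rule psi_series_bound[OF assms])

text \<open>Summation by parts; the boundary term tends to 0 because \<open>chebyshev_psi\<close>
  grows at most linearly.\<close>

lemma mangoldt_series_abel:
  assumes s: "Re s > 1"
  shows "(\<lambda>n. of_real (chebyshev_psi (Suc n)) * (of_nat (Suc n) powr (- s) - of_nat (Suc (Suc n)) powr (- s))) sums mangoldt_series s"
proof -
  have eq: "(\<Sum>n<N. of_real (chebyshev_psi (Suc n)) * (of_nat (Suc n) powr (- s) - of_nat (Suc (Suc n)) powr (- s))) =
     (\<Sum>n<N. mangoldt (Suc n) * of_nat (Suc n) powr (- s)) - of_real (chebyshev_psi N) * of_nat (Suc N) powr (- s)" for N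
  proof (induction N)
    case (Suc N)
    have "of_real (chebyshev_psi (Suc N)) = (of_real (chebyshev_psi N) + mangoldt (Suc N) :: complex)"
      by (simp add: chebyshev_psi_Suc)
    thus ?case using Suc by (simp add: algebra_simps del: of_nat_Suc)
  qed (simp add: chebyshev_psi_def)
  have "(\<lambda>N. of_real (chebyshev_psi N) * of_nat (Suc N) powr (- s) :: complex) \<longlonglongrightarrow> 0"
  proof (rule Lim_null_comparison)
    show "\<forall>\<^sub>F N in sequentially. norm (of_real (chebyshev_psi N) * of_nat (Suc N) powr (- s) :: complex) \<le> 4 * real (Suc N) powr (1 - Re s)"
    proof (rule always_eventually, rule allI)
      fix N
      have "norm (of_real (chebyshev_psi N) * of_nat (Suc N) powr (- s) :: complex) = chebyshev_psi N * real (Suc N) powr (- Re s)"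
        by (simp add: norm_mult chebyshev_psi_nonneg del: of_nat_Suc)
      also have "chebyshev_psi N \<le> 4 * real (Suc N)" using chebyshev_psi_le[of N] by simp
      hence "chebyshev_psi N * real (Suc N) powr (- Re s) \<le> 4 * real (Suc N) * real (Suc N) powr (- Re s)"
        by (intro mult_right_mono) auto
      also have "\<dots> = 4 * (real (Suc N) powr 1 * real (Suc N) powr (- Re s))" by simp
      also have "\<dots> = 4 * real (Suc N) powr (1 - Re s)" by (subst powr_add [symmetric]) simp
      finally show "norm (of_real (chebyshev_psi N) * of_nat (Suc N) powr (- s) :: complex) \<le> 4 * real (Suc N) powr (1 - Re s)" .
    qed
    have "(\<lambda>N. 4 * real (Suc N) powr (1 - Re s)) \<longlonglongrightarrow> 4 * 0"
      using s by (intro tendsto_intros tendsto_neg_powr filterlim_compose[OF filterlim_real_sequentially filterlim_Suc]) auto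
    thus "(\<lambda>N. 4 * real (Suc N) powr (1 - Re s)) \<longlonglongrightarrow> 0" by simp
  qed
  from tendsto_diff[OF mangoldt_series_sums[OF s, unfolded sums_def] this]
  show ?thesis unfolding sums_def eq by simp
qed

text \<open>\<open>psi_series\<close> is made for this: the differences of powers in
  \<open>zterm (Suc n) (s + 1)\<close> cancel those of \<open>mangoldt_series_abel\<close> and leave
  \<open>s\<close> times the series of psi(n) n^(-s-1). That series is thus expressed by
  \<open>mangoldt_series\<close> and a function holomorphic for Re s > 0.\<close>

lemma psi_dirichlet_sums:
  assumes s: "Re s > 1"
  shows "(\<lambda>n. of_real (chebyshev_psi (Suc n) / real (Suc n) - 1) * of_nat (Suc n) powr (- s)) sums
     ((psi_series s + mangoldt_series s) / s - zeta_aux s / (s - 1))"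
proof -
  have s1: "s \<noteq> 0" "s - 1 \<noteq> 0" using s by auto
  have "(\<lambda>n. (of_real (chebyshev_psi (Suc n)) * zterm (Suc n) (s + 1) + 
      of_real (chebyshev_psi (Suc n)) * (of_nat (Suc n) powr (- s) - of_nat (Suc (Suc n)) powr (- s))) / s
      - (s - 1) * of_nat (Suc n) powr (- s) / (s - 1)) sums
     ((psi_series s + mangoldt_series s) / s - zeta_aux s / (s - 1))"
    using s by (intro sums_diff sums_divide sums_add psi_series_sums mangoldt_series_abel zeta_aux_sums) auto
  also have "(\<lambda>n. (of_real (chebyshev_psi (Suc n)) * zterm (Suc n) (s + 1) + 
      of_real (chebyshev_psi (Suc n)) * (of_nat (Suc n) powr (- s) - of_nat (Suc (Suc n)) powr (- s))) / s
      - (s - 1) * of_nat (Suc n) powr (- s) / (s - 1)) = 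
      (\<lambda>n. of_real (chebyshev_psi (Suc n) / real (Suc n) - 1) * of_nat (Suc n) powr (- s))"
  proof
    fix n
    define w :: complex where "w = of_nat (Suc n)"
    have w: "w \<noteq> 0" by (simp add: w_def del: of_nat_Suc)
    have "w powr (- (s + 1)) = w powr (- s - 1)" by (rule arg_cong[where f = "\<lambda>e. w powr e"]) simp
    also have "\<dots> = w powr (- s) / w" using w powr_diff[of w "- s" 1] by simp
    finally have "w powr (- (s + 1)) = w powr (- s) / w" .
    hence z: "zterm (Suc n) (s + 1) = s * (w powr (- s) / w) + of_nat (Suc (Suc n)) powr (- s) - w powr (- s)"
      by (simp add: zterm_def w_def)
    have "of_real (chebyshev_psi (Suc n)) * zterm (Suc n) (s + 1) + 
      of_real (chebyshev_psi (Suc n)) * (w powr (- s) - of_nat (Suc (Suc n)) powr (- s)) = s * (of_real (chebyshev_psi (Suc n)) * (w powr (- s) / w))"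
      unfolding z by (simp add: algebra_simps del: of_nat_Suc)
    note fact1 = this
    have fact2: "of_real (chebyshev_psi (Suc n) / real (Suc n) - 1) = of_real (chebyshev_psi (Suc n)) / w - 1"
      by (simp add: w_def)
    show "(of_real (chebyshev_psi (Suc n)) * zterm (Suc n) (s + 1) + 
      of_real (chebyshev_psi (Suc n)) * (of_nat (Suc n) powr (- s) - of_nat (Suc (Suc n)) powr (- s))) / s
      - (s - 1) * of_nat (Suc n) powr (- s) / (s - 1) = of_real (chebyshev_psi (Suc n) / real (Suc n) - 1) * of_nat (Suc n) powr (- s)"
      unfolding w_def[symmetric] fact1 fact2 nonzero_mult_div_cancel_left[OF s1(2)] using s1 w
      by (simp add: left_diff_distrib)
  qed
  finally show ?thesis .
qed

text \<open>Newman's theorem for the bounded coefficients psi(n)/n - 1. The two poles at 1 cancel: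
  \<open>q\<close> vanishes at 1, and \<open>H\<close> is its quotient by \<open>s - 1\<close> with
  the singularity removed. The nonvanishing of \<open>zeta_aux\<close> on the closed half-plane
  makes the remaining terms holomorphic there.\<close>

lemma psi_sum_converges: "summable (\<lambda>n. (chebyshev_psi (Suc n) / real (Suc n) - 1) / real (Suc n))"
proof -
  define q where "q = (\<lambda>s. 1 / s - zeta_aux s)"
  define H where "H = (\<lambda>s. if s = 1 then deriv q 1 else (q s - q 1) / (s - 1))"
  define U where "U = {s. Re s > 0} \<inter> zeta_aux -` (- {0})"
  have op: "open {s. Re s > 0}" by (rule open_halfspace_Re_gt)
  have U: "open U" unfolding U_def
    by (intro continuous_open_preimage holomorphic_on_imp_continuous_on zeta_aux_holomorphic op) auto
  have q: "q holomorphic_on {s. Re s > 0}" unfolding q_def by (intro holomorphic_intros zeta_aux_holomorphic) auto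
  have H: "H holomorphic_on {s. Re s > 0}" unfolding H_def
    by (intro pole_lemma q) (use op in \<open>auto simp: interior_open\<close>)
  define G where "G = (\<lambda>s. psi_series s / s - deriv zeta_aux s / (s * zeta_aux s) + H s)"
  have G: "G holomorphic_on U"
    unfolding G_def
    by (intro holomorphic_intros holomorphic_on_subset[OF psi_series_holomorphic] holomorphic_on_subset[OF H]
        holomorphic_on_subset[OF zeta_aux_holomorphic] holomorphic_on_subset[OF holomorphic_deriv[OF zeta_aux_holomorphic op]])
       (auto simp: U_def)
  have G_eq: "G s = (psi_series s + mangoldt_series s) / s - zeta_aux s / (s - 1)" if s: "Re s > 1" for s
  proof -
    have s1: "s \<noteq> 0" "s - 1 \<noteq> 0" "s \<noteq> 1" using s by auto
    have "1 / (s * (s - 1)) = (1 / s) / (s - 1)" by simp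
    moreover have "q 1 = 0" by (simp add: q_def)
    ultimately have "H s = 1 / (s * (s - 1)) - zeta_aux s / (s - 1)" using s1 by (simp add: H_def q_def diff_divide_distrib)
    thus ?thesis unfolding G_def mangoldt_series_eq'[OF s] using s1 by (simp add: add_divide_distrib diff_divide_distrib mult.commute)
  qed
  define F where "F = (\<lambda>z. G (z + 1))"
  define S where "S = (\<lambda>z. z + 1) -` U"
  have "(\<lambda>n. of_real (chebyshev_psi (Suc n) / real (Suc n) - 1) / of_nat (Suc n)) sums F 0"
  proof (rule newman_tauberian[where S = S and C = 5])
    show "norm (complex_of_real (chebyshev_psi (Suc n) / real (Suc n) - 1)) \<le> 5" for n
    proof -
      have "0 \<le> chebyshev_psi (Suc n) / real (Suc n)" "chebyshev_psi (Suc n) / real (Suc n) \<le> 4"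
        using chebyshev_psi_nonneg[of "Suc n"] chebyshev_psi_le[of "Suc n"] by (simp_all add: field_simps)
      thus ?thesis unfolding norm_of_real by linarith
    qed
    show "open S" unfolding S_def using U by (intro open_vimage continuous_intros)
    show "{z. Re z \<ge> 0} \<subseteq> S" using zeta_aux_nz by (auto simp: S_def U_def)
    have "(G \<circ> (\<lambda>z. z + 1)) holomorphic_on S"
      by (intro holomorphic_on_compose_gen[OF _ G] holomorphic_intros) (auto simp: S_def)
    thus "F holomorphic_on S" by (simp add: F_def o_def)
    show "(\<lambda>n. complex_of_real (chebyshev_psi (Suc n) / real (Suc n) - 1) * of_nat (Suc n) powr (- 1 - z)) sums F z"
      if "Re z > 0" for z
    proof -
      have e: "- (z + 1) = - 1 - z" by simp
      have "Re (z + 1) > 1" using that by simp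
      from psi_dirichlet_sums[OF this, folded G_eq[OF this], unfolded e] show ?thesis by (simp only: F_def)
    qed
  qed
  hence "(\<lambda>n. Re (of_real (chebyshev_psi (Suc n) / real (Suc n) - 1) / of_nat (Suc n))) sums Re (F 0)" by (rule sums_Re)
  also have "(\<lambda>n. Re (of_real (chebyshev_psi (Suc n) / real (Suc n) - 1) / of_nat (Suc n))) = 
     (\<lambda>n. (chebyshev_psi (Suc n) / real (Suc n) - 1) / real (Suc n))"
    by (rule ext) (metis Re_complex_of_real of_real_divide of_real_of_nat_eq)
  finally show ?thesis by (rule sums_summable)
qed

definition chebyshev_theta :: "nat \<Rightarrow> real" where
  "chebyshev_theta n = (\<Sum>p | prime p \<and> p \<le> n. ln (real p))"

text \<open>If \<open>chebyshev_psi N\<close> is at least \<open>(1 + e) * N\<close>, monotonicity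
  keeps the terms of the convergent series above \<open>e / (8 * N)\<close> on the next
  \<open>k\<close> indices, about e N / 4 many, so these terms add up to at least \<open>d\<close>
  and violate Cauchy's criterion. If it is too small, the same happens on the \<open>k\<close>
  indices before \<open>N\<close>.\<close>

lemma psi_asymptotics: "(\<lambda>n. chebyshev_psi n / real n) \<longlonglongrightarrow> 1"
proof (rule LIMSEQ_I)
  fix e0 :: real assume "e0 > 0"
  define e where "e = min e0 (1/2)"
  have e: "e > 0" "e \<le> 1/2" "e \<le> e0" using \<open>e0 > 0\<close> by (auto simp: e_def)
  define c where "c = (\<lambda>n. (chebyshev_psi (Suc n) / real (Suc n) - 1) / real (Suc n))"
  define d where "d = e\<^sup>2 / 64"
  have d: "d > 0" using e by (simp add: d_def)
  obtain M where M: "\<And>m n. m \<ge> M \<Longrightarrow> norm (sum c {m..<n}) < d"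
    using psi_sum_converges d unfolding c_def[symmetric] summable_Cauchy by blast
  define N0 where "N0 = max (2 * M + 2) (nat \<lceil>16 / e\<rceil>)"
  have "norm (chebyshev_psi N / real N - 1) < e" if N: "N \<ge> N0" for N
  proof (rule ccontr)
    assume "\<not> norm (chebyshev_psi N / real N - 1) < e"
    hence far: "\<bar>chebyshev_psi N / real N - 1\<bar> \<ge> e" by simp
    have N1: "N \<ge> 2 * M + 2" "real N \<ge> 16 / e" using N by (auto simp: N0_def)
    hence eN: "e * real N \<ge> 16" using e by (simp add: field_simps)
    define k where "k = nat \<lfloor>e * real N / 4\<rfloor>"
    have k: "real k \<le> e * real N / 4" "real k \<ge> e * real N / 8" "k \<ge> 1"
    proof -
      show "real k \<le> e * real N / 4" using e of_nat_floor[of "e * real N / 4"] by (simp add: k_def)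
      have "real k \<ge> e * real N / 4 - 1" unfolding k_def using e by linarith
      thus k2: "real k \<ge> e * real N / 8" using eN by simp
      thus "k \<ge> 1" using eN by simp
    qed
    have kN: "real k \<le> real N / 8" 
    proof -
      have "e * real N \<le> 1 / 2 * real N" using e by (intro mult_right_mono) auto
      thus ?thesis using k(1) by simp
    qed
    show False
    proof (cases "chebyshev_psi N / real N - 1 \<ge> e")
      case True
      hence psi: "chebyshev_psi N \<ge> (1 + e) * real N" using N1 by (simp add: field_simps)
      have "sum c {N..<N + k} \<ge> (\<Sum>n\<in>{N..<N+k}. e / (8 * real N))"
      proof (rule sum_mono)
        fix n assume n: "n \<in> {N..<N+k}"
        have n': "real (Suc n) \<le> real N + real k" "N \<le> Suc n" using n by auto
        have "chebyshev_psi (Suc n) \<ge> chebyshev_psi N" using n by (intro chebyshev_psi_mono) auto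
        hence diff: "chebyshev_psi (Suc n) - real (Suc n) \<ge> e * real N / 2" using psi n' k(1) e N1 by (simp add: algebra_simps)
        have "real (Suc n) \<le> 2 * real N" using n' kN by simp
        hence "real (Suc n) * real (Suc n) \<le> (2 * real N) * (2 * real N)" by (intro mult_mono) auto
        moreover have "0 \<le> chebyshev_psi (Suc n) - real (Suc n)" using diff eN by linarith
        ultimately have "(e * real N / 2) / ((2 * real N) * (2 * real N)) \<le> (chebyshev_psi (Suc n) - real (Suc n)) / (real (Suc n) * real (Suc n))"
          using diff e N1 by (intro frac_le) (auto simp del: of_nat_Suc)
        also have "\<dots> = c n" unfolding c_def by (simp add: diff_divide_distrib del: of_nat_Suc)
        also have "(e * real N / 2) / ((2 * real N) * (2 * real N)) = e / (8 * real N)" using N1 by (simp add: field_simps)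
        finally show "e / (8 * real N) \<le> c n" .
      qed
      also have "(\<Sum>n\<in>{N..<N+k}. e / (8 * real N)) = real k * (e / (8 * real N))" by simp
      also have "\<dots> \<ge> (e * real N / 8) * (e / (8 * real N))" using k(2) e by (intro mult_right_mono) auto
      also have "(e * real N / 8) * (e / (8 * real N)) = d" using N1 by (simp add: d_def power2_eq_square field_simps)
      finally have "sum c {N..<N + k} \<ge> d" by simp
      thus False using M[of N "N + k"] N1 by (auto simp: abs_if split: if_splits)
    next
      case False
      hence "chebyshev_psi N / real N - 1 \<le> - e" using far by linarith
      hence psi: "chebyshev_psi N \<le> (1 - e) * real N" using N1 by (simp add: field_simps)
      have kN': "k \<le> N" using kN by simp
      have "sum c {N - k..<N} \<le> (\<Sum>n\<in>{N-k..<N}. - (e / (8 * real N)))"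
      proof (rule sum_mono)
        fix n assume n: "n \<in> {N-k..<N}"
        have n': "real (Suc n) \<ge> real N - real k" "Suc n \<le> N" using n kN' by (auto simp: of_nat_diff)
        have "chebyshev_psi (Suc n) \<le> chebyshev_psi N" using n by (intro chebyshev_psi_mono) auto
        hence diff: "real (Suc n) - chebyshev_psi (Suc n) \<ge> e * real N / 2" using psi n' k(1) e N1 by (simp add: algebra_simps)
        have "real (Suc n) \<le> 2 * real N" using n' by simp
        hence "real (Suc n) * real (Suc n) \<le> (2 * real N) * (2 * real N)" by (intro mult_mono) auto
        moreover have "0 \<le> real (Suc n) - chebyshev_psi (Suc n)" using diff eN by linarith
        ultimately have "(e * real N / 2) / ((2 * real N) * (2 * real N)) \<le> (real (Suc n) - chebyshev_psi (Suc n)) / (real (Suc n) * real (Suc n))"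
          using diff e N1 by (intro frac_le) (auto simp del: of_nat_Suc)
        also have "\<dots> = - c n" unfolding c_def by (simp add: diff_divide_distrib del: of_nat_Suc)
        also have "(e * real N / 2) / ((2 * real N) * (2 * real N)) = e / (8 * real N)" using N1 by (simp add: field_simps)
        finally show "c n \<le> - (e / (8 * real N))" by simp
      qed
      also have "\<dots> = - (real k * (e / (8 * real N)))" using kN' by simp
      also have "\<dots> \<le> - ((e * real N / 8) * (e / (8 * real N)))" using k(2) e by (intro le_imp_neg_le mult_right_mono) auto
      also have "(e * real N / 8) * (e / (8 * real N)) = d" using N1 by (simp add: d_def power2_eq_square field_simps)
      finally have "sum c {N - k..<N} \<le> - d" by simp
      moreover have "N - k \<ge> M"
      proof -
        have "real (N - k) \<ge> real M" using kN kN' N1(1) by (simp add: of_nat_diff)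
        thus ?thesis by simp
      qed
      ultimately show False using M[of "N - k" N] by (auto simp: abs_if split: if_splits)
    qed
  qed
  thus "\<exists>no. \<forall>n\<ge>no. norm (chebyshev_psi n / real n - 1) < e0" using e by (meson order_less_le_trans)
qed

text \<open>A proper prime power up to \<open>n\<close> has base at most \<open>sqrt n\<close> and
  exponent at most \<open>log 2 n\<close>; this bounds how many there are, and each contributes at
  most \<open>ln n\<close>.\<close>

lemma psi_minus_theta:
  assumes "n \<ge> 1"
  shows "chebyshev_theta n \<le> chebyshev_psi n"
    and "chebyshev_psi n - chebyshev_theta n \<le> sqrt (real n) * (log 2 (real n) + 1) * ln (real n)"
proof -
  define A where "A = {d\<in>{1..n}. primepow d \<and> \<not> prime d}"
  have theta: "chebyshev_theta n = (\<Sum>d\<in>{d\<in>{1..n}. prime d}. mangoldt d)"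
    unfolding chebyshev_theta_def by (intro sum.cong) (auto simp: Suc_le_eq prime_gt_0_nat)
  have "chebyshev_psi n = (\<Sum>d\<in>{d\<in>{1..n}. prime d} \<union> A. mangoldt d)"
    unfolding chebyshev_psi_def A_def by (intro sum.mono_neutral_right) (auto simp: mangoldt_def)
  also have "\<dots> = chebyshev_theta n + (\<Sum>d\<in>A. mangoldt d)"
    unfolding theta by (intro sum.union_disjoint) (auto simp: A_def)
  finally have eq: "chebyshev_psi n = chebyshev_theta n + (\<Sum>d\<in>A. mangoldt d)" .
  show "chebyshev_theta n \<le> chebyshev_psi n" unfolding eq by (simp add: sum_nonneg mangoldt_nonneg)
  let ?P = "{1..nat \<lfloor>sqrt (real n)\<rfloor>}" and ?K = "{..nat \<lfloor>log 2 (real n)\<rfloor>}"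
  have "A \<subseteq> (\<lambda>(p, k). p ^ k) ` (?P \<times> ?K)"
  proof
    fix d assume d: "d \<in> A"
    then obtain p k where pk: "prime p" "k > 0" "d = p ^ k" by (auto simp: A_def primepow_def)
    have "k \<noteq> 1" using d pk by (auto simp: A_def)
    hence k2: "k \<ge> 2" using pk by simp
    have p2: "p \<ge> 2" using pk prime_ge_2_nat by blast
    have dn: "p ^ k \<le> n" using d pk by (auto simp: A_def)
    have "p ^ 2 \<le> p ^ k" using k2 p2 by (intro power_increasing) auto
    hence "p ^ 2 \<le> n" using dn by simp
    hence "(real p)\<^sup>2 \<le> real n" by (metis of_nat_le_iff of_nat_power)
    hence "real p \<le> sqrt (real n)" by (rule real_le_rsqrt)
    hence "p \<in> ?P" using p2 by (simp add: le_nat_floor)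
    moreover have "2 ^ k \<le> p ^ k" using p2 by (intro power_mono) auto
    hence "2 ^ k \<le> n" using dn by simp
    hence "2 ^ k \<le> real n" by (metis of_nat_le_iff of_nat_numeral of_nat_power)
    hence "real k \<le> log 2 (real n)" using le_log_of_power[of 2 k "real n"] by simp
    hence "k \<in> ?K" by (simp add: le_nat_floor)
    ultimately show "d \<in> (\<lambda>(p, k). p ^ k) ` (?P \<times> ?K)" using pk by force
  qed
  hence "card A \<le> card ((\<lambda>(p, k). p ^ k) ` (?P \<times> ?K))" by (intro card_mono) auto
  also have "\<dots> \<le> card (?P \<times> ?K)" by (intro card_image_le) auto
  also have "\<dots> = nat \<lfloor>sqrt (real n)\<rfloor> * (nat \<lfloor>log 2 (real n)\<rfloor> + 1)" by (simp add: card_cartesian_product)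
  finally have "real (card A) \<le> real (nat \<lfloor>sqrt (real n)\<rfloor> * (nat \<lfloor>log 2 (real n)\<rfloor> + 1))"
    by (simp only: of_nat_le_iff)
  also have "\<dots> = real (nat \<lfloor>sqrt (real n)\<rfloor>) * (real (nat \<lfloor>log 2 (real n)\<rfloor>) + 1)"
    by (simp only: of_nat_mult of_nat_add of_nat_1)
  also have "\<dots> \<le> sqrt (real n) * (log 2 (real n) + 1)" using assms by (intro mult_mono add_mono of_nat_floor) auto
  finally have cA: "real (card A) \<le> sqrt (real n) * (log 2 (real n) + 1)" .
  have "(\<Sum>d\<in>A. mangoldt d) \<le> (\<Sum>d\<in>A. ln (real n))"
  proof (rule sum_mono)
    fix d assume "d \<in> A"
    hence d: "d \<ge> 1" "d \<le> n" by (auto simp: A_def)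
    have "mangoldt d \<le> ln (real d)" using d by (intro mangoldt_le) auto
    also have "\<dots> \<le> ln (real n)" using d by simp
    finally show "mangoldt d \<le> ln (real n)" .
  qed
  also have "\<dots> = real (card A) * ln (real n)" by simp
  also have "\<dots> \<le> sqrt (real n) * (log 2 (real n) + 1) * ln (real n)" using assms by (intro mult_right_mono cA) auto
  finally show "chebyshev_psi n - chebyshev_theta n \<le> sqrt (real n) * (log 2 (real n) + 1) * ln (real n)" unfolding eq by simp
qed

theorem prime_number_theorem: "(\<lambda>n. chebyshev_theta n / real n) \<longlonglongrightarrow> 1"
proof -
  have "(\<lambda>n. (chebyshev_psi n - chebyshev_theta n) / real n) \<longlonglongrightarrow> 0"
  proof (rule tendsto_sandwich[OF _ _ tendsto_const])
    show "eventually (\<lambda>n. 0 \<le> (chebyshev_psi n - chebyshev_theta n) / real n) sequentially"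
      using eventually_ge_at_top[of 1] by eventually_elim (use psi_minus_theta(1) in auto)
    show "eventually (\<lambda>n. (chebyshev_psi n - chebyshev_theta n) / real n \<le> sqrt (real n) * (log 2 (real n) + 1) * ln (real n) / real n) sequentially"
      using eventually_ge_at_top[of 1] by eventually_elim (use psi_minus_theta(2) in \<open>auto intro!: divide_right_mono\<close>)
    show "(\<lambda>n. sqrt (real n) * (log 2 (real n) + 1) * ln (real n) / real n) \<longlonglongrightarrow> 0"
      by real_asymp
  qed
  from tendsto_diff[OF psi_asymptotics this] show ?thesis by (simp add: diff_divide_distrib)
qed

section \<open>Partial fractions and p-adic valuations\<close>

lemma pcompose_pow: "pcompose (p ^ n) q = pcompose p q ^ n" for p q :: "real poly"
  by (induction n) (simp_all add: pcompose_mult one_pCons pcompose_pCons)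

text \<open>Translation by \<open>k\<close> turns the divisor into a power of X, for which
  divisibility is the vanishing of the low coefficients.\<close>

lemma linear_power_dvd_iff_shift:
  fixes Q :: "real poly"
  shows "[:-k, 1:] ^ n dvd Q \<longleftrightarrow> (\<forall>j<n. poly.coeff (pcompose Q [:k, 1:]) j = 0)"
proof -
  have inv: "pcompose (pcompose Q [:k, 1:]) [:-k, 1:] = Q" for Q :: "real poly"
    by (simp add: pcompose_assoc [symmetric] pcompose_pCons)
  have inv': "pcompose (pcompose Q [:-k, 1:]) [:k, 1:] = Q" for Q :: "real poly"
    by (simp add: pcompose_assoc [symmetric] pcompose_pCons)
  have X: "pcompose (Polynomial.monom 1 n) [:-k, 1:] = [:-k, 1:] ^ n" for k :: real
    by (simp add: monom_altdef pcompose_pow pcompose_pCons)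
  have X': "pcompose ([:-k, 1:] ^ n) [:k, 1:] = Polynomial.monom 1 n"
    by (simp add: X[symmetric] inv')
  have "Polynomial.monom 1 n dvd pcompose Q [:k, 1:] \<longleftrightarrow> [:-k, 1:] ^ n dvd Q"
  proof
    assume "Polynomial.monom 1 n dvd pcompose Q [:k, 1:]"
    then obtain R where "pcompose Q [:k, 1:] = Polynomial.monom 1 n * R" by (elim dvdE)
    hence "pcompose (pcompose Q [:k, 1:]) [:-k, 1:] = pcompose (Polynomial.monom 1 n * R) [:-k, 1:]" by (rule arg_cong)
    thus "[:-k, 1:] ^ n dvd Q" by (simp add: inv pcompose_mult X)
  next
    assume "[:-k, 1:] ^ n dvd Q"
    then obtain R where "Q = [:-k, 1:] ^ n * R" by (elim dvdE)
    thus "Polynomial.monom 1 n dvd pcompose Q [:k, 1:]" by (simp add: pcompose_mult X')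
  qed
  thus ?thesis by (simp add: monom_1_dvd_iff')
qed

text \<open>\<open>w k\<close> is the expansion at \<open>k\<close> of the quotient with its pole at
  \<open>k\<close> removed, specified by a product identity so that no power series has to be
  inverted. The difference \<open>Q\<close> of the two numerators is divisible by every
  \<open>[:-k, 1:] ^ ord k\<close>, which is more zeros than its degree allows.\<close>

theorem partial_fractions:
  fixes P :: "real poly" and K :: "real set" and ord :: "real \<Rightarrow> nat" and w :: "real \<Rightarrow> real fps"
  assumes K: "finite K" and deg: "degree P < (\<Sum>k\<in>K. ord k)"
    and w: "\<And>k. k \<in> K \<Longrightarrow> fps_of_poly (pcompose P [:k, 1:]) =
              w k * (\<Prod>k'\<in>K-{k}. (fps_const (k - k') + fps_X) ^ ord k')"
    and t: "t \<notin> K"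
  shows "poly P t / (\<Prod>k\<in>K. (t - k) ^ ord k) = (\<Sum>k\<in>K. \<Sum>i=1..ord k. w k $ (ord k - i) / (t - k) ^ i)"
proof -
  define D where "D = (\<lambda>k. \<Prod>k'\<in>K-{k}. [:-k', 1:] ^ ord k')"
  define T where "T = (\<lambda>k. \<Sum>i=1..ord k. Polynomial.smult (w k $ (ord k - i)) ([:-k, 1:] ^ (ord k - i) * D k))"
  define Q where "Q = P - (\<Sum>k\<in>K. T k)"
  have dvd: "[:-k, 1:] ^ ord k dvd Q" if k: "k \<in> K" for k
  proof -
    have "[:-k, 1:] ^ ord k dvd T k'" if k': "k' \<in> K - {k}" for k'
    proof -
      have "[:-k, 1:] ^ ord k dvd D k'" unfolding D_def using k k' K by (intro dvd_prodI[where f = "\<lambda>k. [:-k, 1:] ^ ord k"]) auto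
      thus ?thesis unfolding T_def by (intro dvd_sum dvd_smult dvd_mult)
    qed
    hence 1: "[:-k, 1:] ^ ord k dvd (\<Sum>k'\<in>K-{k}. T k')" by (intro dvd_sum) auto
    have 2: "[:-k, 1:] ^ ord k dvd P - T k"
      unfolding linear_power_dvd_iff_shift
    proof (intro allI impI)
      fix j assume j: "j < ord k"
      define E where "E = (\<Prod>k'\<in>K-{k}. (fps_const (k - k') + fps_X) ^ ord k')"
      have lin: "fps_of_poly [:c, 1:] = fps_const c + fps_X" for c :: real
        by (simp add: fps_of_poly_pCons)
      have D: "fps_of_poly (pcompose (D k) [:k, 1:]) = E"
        by (simp add: D_def E_def pcompose_prod fps_of_poly_prod pcompose_pow pcompose_pCons fps_of_poly_power lin)
      have "fps_of_poly (pcompose (T k) [:k, 1:]) = (\<Sum>i=1..ord k. fps_const (w k $ (ord k - i)) * (fps_X ^ (ord k - i) * E))"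
        by (simp add: T_def pcompose_sum fps_of_poly_sum pcompose_smult fps_of_poly_smult pcompose_mult fps_of_poly_mult D
             pcompose_pow pcompose_pCons fps_of_poly_power lin)
      also have "\<dots> = (\<Sum>i<ord k. fps_const (w k $ i) * (fps_X ^ i * E))"
        by (rule sum.reindex_bij_witness[of _ "\<lambda>i. ord k - i" "\<lambda>i. ord k - i"]) auto
      also have "\<dots> = (\<Sum>i<ord k. fps_const (w k $ i) * fps_X ^ i) * E"
        by (simp add: sum_distrib_right mult.assoc)
      finally have "fps_of_poly (pcompose (P - T k) [:k, 1:]) = (w k - (\<Sum>i<ord k. fps_const (w k $ i) * fps_X ^ i)) * E"
        by (simp add: pcompose_diff fps_of_poly_diff w[OF k] E_def left_diff_distrib)
      moreover have "(w k - (\<Sum>i<ord k. fps_const (w k $ i) * fps_X ^ i)) $ l = 0" if "l < ord k" for l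
        using that by (simp add: fps_sum_nth if_distrib[of "\<lambda>x. _ * x"] fps_X_power_nth cong: if_cong)
      hence "((w k - (\<Sum>i<ord k. fps_const (w k $ i) * fps_X ^ i)) * E) $ j = 0"
        unfolding fps_mult_nth using j by (intro sum.neutral) auto
      ultimately show "poly.coeff (pcompose (P - T k) [:k, 1:]) j = 0" by (metis fps_of_poly_nth)
    qed
    have "Q = (P - T k) - (\<Sum>k'\<in>K-{k}. T k')" using K k by (simp add: Q_def sum.remove)
    thus ?thesis using 1 2 by (metis dvd_diff)
  qed
  have degT: "degree (T k) < (\<Sum>k\<in>K. ord k)" if k: "k \<in> K" and "(\<Sum>k\<in>K. ord k) > 0" for k
    unfolding T_def
  proof (rule degree_sum_less[OF _ that(2)])
    fix i assume i: "i \<in> {1..ord k}"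
    have "degree (Polynomial.smult (w k $ (ord k - i)) ([:-k, 1:] ^ (ord k - i) * D k)) \<le> degree ([:-k, 1:] ^ (ord k - i) * D k)"
      by (rule degree_smult_le)
    also have "\<dots> \<le> (ord k - i) + degree (D k)"
      by (intro order_trans[OF degree_mult_le] add_right_mono) (simp add: degree_linear_power)
    also have "degree (D k) \<le> (\<Sum>k'\<in>K-{k}. ord k')"
      unfolding D_def using K
      by (intro order_trans[OF degree_prod_sum_le]) (auto simp: degree_linear_power)
    also have "ord k - i + (\<Sum>k'\<in>K-{k}. ord k') < (\<Sum>k\<in>K. ord k)"
      using i K k by (subst sum.remove[of K k]) auto
    finally show "degree (Polynomial.smult (w k $ (ord k - i)) ([:-k, 1:] ^ (ord k - i) * D k)) < (\<Sum>k\<in>K. ord k)" by simp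
  qed
  have pos: "(\<Sum>k\<in>K. ord k) > 0" using deg by simp
  have degQ: "degree Q < (\<Sum>k\<in>K. ord k)"
    unfolding Q_def using degT pos deg by (intro degree_diff_less degree_sum_less) auto
  have "Q = 0"
  proof (rule ccontr)
    assume Q0: "Q \<noteq> 0"
    have ordQ: "ord k \<le> Polynomial.order k Q" if "k \<in> K" for k
      using dvd[OF that] Q0 by (simp add: order_divides)
    have "(\<Sum>k\<in>K. ord k) = (\<Sum>k\<in>{k\<in>K. ord k > 0}. ord k)" using K by (intro sum.mono_neutral_right) auto
    also have "\<dots> \<le> (\<Sum>k\<in>{k\<in>K. ord k > 0}. Polynomial.order k Q)" using ordQ by (intro sum_mono) auto
    also have "\<dots> \<le> (\<Sum>k | poly Q k = 0. Polynomial.order k Q)"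
    proof (rule sum_mono2)
      show "finite {k. poly Q k = 0}" by (rule poly_roots_finite[OF Q0])
      show "{k\<in>K. ord k > 0} \<subseteq> {k. poly Q k = 0}"
        using ordQ Q0 order_root[of Q] by (fastforce dest: order_less_le_trans)
    qed auto
    also have "\<dots> \<le> degree Q" using Q0 by (rule sum_order_le_degree)
    finally show False using degQ by simp
  qed
  hence "P = (\<Sum>k\<in>K. T k)" by (simp add: Q_def)
  hence "poly P t = (\<Sum>k\<in>K. \<Sum>i=1..ord k. w k $ (ord k - i) * ((t - k) ^ (ord k - i) * (\<Prod>k'\<in>K-{k}. (t - k') ^ ord k')))"
    by (simp add: poly_sum T_def D_def poly_prod)
  also have "\<dots> / (\<Prod>k\<in>K. (t - k) ^ ord k) = (\<Sum>k\<in>K. \<Sum>i=1..ord k. w k $ (ord k - i) / (t - k) ^ i)"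
    unfolding sum_divide_distrib
  proof (intro sum.cong refl)
    fix k i assume k: "k \<in> K" and i: "i \<in> {1..ord k}"
    have nz: "t - k' \<noteq> 0" if "k' \<in> K" for k' using t that by auto
    have P0: "(\<Prod>k'\<in>K-{k}. (t - k') ^ ord k') \<noteq> 0" using nz K by (auto simp: prod_zero_iff)
    have "(\<Prod>k\<in>K. (t - k) ^ ord k) = (t - k) ^ ord k * (\<Prod>k'\<in>K-{k}. (t - k') ^ ord k')"
      using K k by (simp add: prod.remove)
    also have "(t - k) ^ ord k = (t - k) ^ (ord k - i) * (t - k) ^ i" using i by (simp flip: power_add)
    finally show "w k $ (ord k - i) * ((t - k) ^ (ord k - i) * (\<Prod>k'\<in>K-{k}. (t - k') ^ ord k')) / (\<Prod>k\<in>K. (t - k) ^ ord k)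
       = w k $ (ord k - i) / (t - k) ^ i"
      using P0 nz[OF k] by (simp add: field_simps)
  qed
  finally show ?thesis .
qed

text \<open>The p-adic valuation of \<open>x\<close> is at least \<open>e\<close>. As a lower bound
  it holds of 0 for every \<open>e\<close> (\<open>p\<close> prime), so sums and products need no
  case distinction.\<close>

definition pval :: "nat \<Rightarrow> int \<Rightarrow> real \<Rightarrow> bool" where
  "pval p e x \<longleftrightarrow> (\<exists>a b :: int. \<not> int p dvd b \<and> x = of_int a / of_int b * real p powi e)"

lemma pval_0 [simp]: "prime p \<Longrightarrow> pval p e 0"
  unfolding pval_def by (intro exI[of _ 0] exI[of _ 1]) (auto dest: prime_gt_1_nat)

lemma pval_1 [simp]: "prime p \<Longrightarrow> pval p 0 1"
  unfolding pval_def by (intro exI[of _ 1] exI[of _ 1]) (auto dest: prime_gt_1_nat)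

lemma pval_mono:
  assumes "pval p e x" "e' \<le> e" "prime p"
  shows "pval p e' x"
proof -
  from assms obtain a b :: int where ab: "\<not> int p dvd b" "x = of_int a / of_int b * real p powi e"
    by (auto simp: pval_def)
  have "real p powi e = real p powi e' * real p ^ nat (e - e')"
    using assms prime_gt_0_nat[OF assms(3)] by (simp flip: power_int_of_nat power_int_add)
  hence "x = of_int (a * int p ^ nat (e - e')) / of_int b * real p powi e'" using ab by simp
  thus ?thesis using ab(1) unfolding pval_def by blast
qed

lemma pval_mult:
  assumes "pval p e x" "pval p f y" "prime p"
  shows "pval p (e + f) (x * y)"
proof -
  from assms obtain a b c d :: int where ab: "\<not> int p dvd b" "x = of_int a / of_int b * real p powi e"
    "\<not> int p dvd d" "y = of_int c / of_int d * real p powi f"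
    unfolding pval_def by blast
  have "\<not> int p dvd b * d" using ab assms(3) by (simp add: prime_dvd_mult_iff)
  moreover have "x * y = of_int (a * c) / of_int (b * d) * real p powi (e + f)"
    using ab prime_gt_0_nat[OF assms(3)] by (simp add: power_int_add)
  ultimately show ?thesis unfolding pval_def by blast
qed

lemma pval_add:
  assumes "pval p e x" "pval p e y" "prime p"
  shows "pval p e (x + y)"
proof -
  from assms obtain a b c d :: int where ab: "\<not> int p dvd b" "x = of_int a / of_int b * real p powi e"
    "\<not> int p dvd d" "y = of_int c / of_int d * real p powi e"
    unfolding pval_def by blast
  have bd: "\<not> int p dvd b * d" using ab assms(3) by (simp add: prime_dvd_mult_iff)
  have "b \<noteq> 0" "d \<noteq> 0" using ab by auto
  hence "x + y = of_int (a * d + c * b) / of_int (b * d) * real p powi e"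
    using ab by (simp add: field_simps)
  thus ?thesis unfolding pval_def using bd by blast
qed

lemma pval_uminus: "pval p e x \<Longrightarrow> pval p e (- x)"
  unfolding pval_def by (metis minus_divide_left minus_mult_left of_int_minus)

lemma pval_sum:
  assumes "\<And>i. i \<in> A \<Longrightarrow> pval p e (f i)" "prime p"
  shows "pval p e (\<Sum>i\<in>A. f i)"
  using assms(1) by (induction A rule: infinite_finite_induct) (auto intro!: pval_add simp: assms(2))

lemma pval_prod:
  assumes "\<And>i. i \<in> A \<Longrightarrow> pval p (e i) (f i)" "prime p"
  shows "pval p (\<Sum>i\<in>A. e i) (\<Prod>i\<in>A. f i)"
  using assms(1) by (induction A rule: infinite_finite_induct) (auto intro!: pval_mult simp: assms(2))

lemma pval_power:
  assumes "pval p e x" "prime p"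
  shows "pval p (e * int n) (x ^ n)"
  using pval_prod[of "{..<n}" p "\<lambda>_. e" "\<lambda>_. x"] assms by (simp add: mult.commute)

lemma pval_of_int [simp]: "prime p \<Longrightarrow> pval p 0 (of_int n)"
  unfolding pval_def by (intro exI[of _ n] exI[of _ 1]) (auto dest: prime_gt_1_nat)

lemma pval_multiplicity:
  assumes "prime p" "n \<noteq> (0 :: int)"
  shows "pval p (int (multiplicity (int p) n)) (of_int n)"
    and "pval p (- int (multiplicity (int p) n)) (1 / of_int n)"
proof -
  have "\<not> is_unit (int p)" using prime_gt_1_nat[OF assms(1)] by auto
  then obtain m where m: "n = int p ^ multiplicity (int p) n * m" "\<not> int p dvd m"
    using multiplicity_decompose'[of n "int p"] assms(2) by metis
  have rn: "of_int n = real p ^ multiplicity (int p) n * of_int m"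
    by (subst m(1)) simp
  show "pval p (int (multiplicity (int p) n)) (of_int n)"
    unfolding pval_def rn using assms by (intro exI[of _ m] exI[of _ 1]) (auto dest: prime_gt_1_nat)
  show "pval p (- int (multiplicity (int p) n)) (1 / of_int n)"
    unfolding pval_def rn using m(2) by (intro exI[of _ 1] exI[of _ m]) (auto simp: power_int_minus field_simps)
qed

text \<open>A prime factor of the reduced denominator would contradict the hypothesis at that
  prime.\<close>

lemma pval_integer:
  assumes "\<And>p. prime p \<Longrightarrow> pval p 0 x"
  shows "x \<in> \<int>"
proof -
  obtain a b :: int where "x = of_int a / of_int b" "b \<noteq> 0"
    using assms[OF two_is_prime_nat] by (auto simp: pval_def)
  hence "x \<in> \<rat>" by auto
  then obtain m n :: int where mn: "n > 0" "coprime m n" "x = of_int m / of_int n"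
    using Rats_cases'[of x] by blast
  have "n = 1"
  proof (rule ccontr)
    assume "n \<noteq> 1"
    then obtain q where q: "prime q" "q dvd n" using mn(1) prime_factor_int[of n] by auto
    define p where "p = nat q"
    have p: "prime p" "int p = q" using q by (auto simp: p_def prime_ge_0_int)
    from assms[OF p(1)] obtain c d :: int where cd: "\<not> int p dvd d" "x = of_int c / of_int d"
      by (auto simp: pval_def)
    have "d \<noteq> 0" using cd by auto
    hence "real_of_int (m * d) = of_int (c * n)" using cd mn by (simp add: field_simps)
    hence "m * d = c * n" by (simp only: of_int_eq_iff)
    hence "q dvd m * d" using q by simp
    hence "q dvd m" using q cd p by (simp add: prime_dvd_mult_iff)
    thus False using q mn(2) by (meson coprime_common_divisor not_prime_unit)
  qed
  thus ?thesis using mn by simp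
qed

text \<open>Each power of X may cost up to \<open>s\<close> powers of \<open>p\<close>. With a
  common slope \<open>s\<close> these bounds are multiplicative, so a product of many linear factors
  and inverses is controlled by its constant terms.\<close>

definition fval :: "nat \<Rightarrow> int \<Rightarrow> nat \<Rightarrow> real fps \<Rightarrow> bool" where
  "fval p e s F \<longleftrightarrow> (\<forall>m. pval p (e - int (s * m)) (F $ m))"

lemma fval_mult:
  assumes "fval p e s F" "fval p f s G" "prime p"
  shows "fval p (e + f) s (F * G)"
  unfolding fval_def fps_mult_nth
proof (intro allI pval_sum assms(3))
  fix m i :: nat assume i: "i \<in> {0..m}"
  have "pval p ((e - int (s * i)) + (f - int (s * (m - i)))) (F $ i * G $ (m - i))"
    using assms by (intro pval_mult) (auto simp: fval_def)
  also have "(e - int (s * i)) + (f - int (s * (m - i))) = e + f - int (s * m)"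
    using i by (simp add: of_nat_diff algebra_simps)
  finally show "pval p (e + f - int (s * m)) (F $ i * G $ (m - i))" .
qed

lemma fval_const: "pval p e c \<Longrightarrow> prime p \<Longrightarrow> fval p e s (fps_const c)"
  unfolding fval_def by (auto simp: fps_const_def)

lemma fval_prod:
  assumes "\<And>i. i \<in> A \<Longrightarrow> fval p (e i) s (f i)" "prime p"
  shows "fval p (\<Sum>i\<in>A. e i) s (\<Prod>i\<in>A. f i)"
  using assms(1)
proof (induction A rule: infinite_finite_induct)
  case (insert x A)
  thus ?case by (auto intro!: fval_mult simp: assms(2))
qed (use fval_const[of p 0 1 s] assms(2) in auto)

lemma fval_linear:
  assumes "prime p" "c \<noteq> (0 :: int)" "multiplicity (int p) c \<le> s"
  shows "fval p (int (multiplicity (int p) c)) s (fps_const (of_int c) + fps_const (of_int d) * fps_X)"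
  unfolding fval_def
proof
  fix m :: nat
  consider "m = 0" | "m = 1" | "m > 1" by linarith
  thus "pval p (int (multiplicity (int p) c) - int (s * m)) ((fps_const (of_int c) + fps_const (of_int d) * fps_X) $ m)"
    using assms pval_multiplicity(1)[OF assms(1,2)] 
    by cases (auto intro: pval_mono[OF pval_of_int])
qed

text \<open>The expansion of 1 / (c + X).\<close>

definition linv :: "real \<Rightarrow> real fps" where
  "linv c = Abs_fps (\<lambda>m. (- 1) ^ m / c ^ Suc m)"

lemma linv_inverse:
  assumes "c \<noteq> 0"
  shows "linv c * (fps_const c + fps_X) = 1"
proof (rule fps_ext)
  fix n
  show "(linv c * (fps_const c + fps_X)) $ n = 1 $ n"
    using assms by (cases n) (auto simp: linv_def distrib_left field_simps)
qed

lemma fval_linv: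
  assumes "prime p" "c \<noteq> (0 :: int)" "multiplicity (int p) c \<le> s"
  shows "fval p (- int (multiplicity (int p) c)) s (linv (of_int c))"
  unfolding fval_def
proof
  fix m :: nat
  let ?v = "multiplicity (int p) c"
  have "pval p ((- int ?v) * int (Suc m)) ((1 / of_int c) ^ Suc m)"
    using assms by (intro pval_power pval_multiplicity(2))
  hence "pval p (0 + (- int ?v) * int (Suc m)) (of_int ((- 1) ^ m) * (1 / of_int c) ^ Suc m)"
    using assms by (intro pval_mult pval_of_int)
  also have "of_int ((- 1) ^ m) * (1 / of_int c) ^ Suc m = linv (of_int c) $ m"
    by (simp add: linv_def power_divide)
  finally show "pval p (- int ?v - int (s * m)) (linv (of_int c) $ m)"
  proof (rule pval_mono)
    have "?v * m \<le> s * m" using assms by simp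
    hence "int ?v * int m \<le> int s * int m" by (metis of_nat_le_iff of_nat_mult)
    thus "- int ?v - int (s * m) \<le> 0 + - int ?v * int (Suc m)" by (simp add: algebra_simps)
  qed (use assms in auto)
qed

section \<open>Linear forms in zeta values\<close>

text \<open>In the quotient described in the overview, the even \<open>u\<close> of the factors 2t -
  u cancel the block L = 121, and the \<open>u = 3 * z\<close> with
  \<open>\<bar>z\<bar> \<le> 53 * N\<close> of the factors 3t - u cancel one block L = 53.
  \<open>zeros2\<close> and \<open>zeros3\<close> index the factors that survive; the constants
  split off are the powers of 2 and 3 in \<open>lead\<close>.\<close>

definition zeros2 :: "nat \<Rightarrow> int set" where
  "zeros2 N = {u. odd u \<and> \<bar>u\<bar> \<le> 242 * int N}"

definition zeros3 :: "nat \<Rightarrow> int set" where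
  "zeros3 N = {u. \<bar>u\<bar> \<le> 363 * int N \<and> \<not> (3 dvd u \<and> \<bar>u\<bar> \<le> 159 * int N)}"

definition block :: "nat \<Rightarrow> int \<Rightarrow> int set" where
  "block N L = {- (L * int N)..L * int N}"

text \<open>Each product over the integers from -M to M is paired with (2M)!, so that for every
  prime power q both have nearly the same number of multiples of q.\<close>

definition norm_factor :: "nat \<Rightarrow> real" where
  "norm_factor N = fact (242 * N) * fact (106 * N) * (\<Prod>L\<in>{19..53}. fact (2 * L * N)) / (fact (484 * N) * fact (726 * N))"

definition lead :: "nat \<Rightarrow> real" where
  "lead N = norm_factor N * 2 ^ (242 * N + 1) * 3 ^ (106 * N + 1)"

definition R :: "nat \<Rightarrow> real \<Rightarrow> real" where
  "R N t = lead N * (\<Prod>u\<in>zeros2 N. 2 * t - of_int u) * (\<Prod>u\<in>zeros3 N. 3 * t - of_int u) /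
     (\<Prod>L\<in>{19..53}. \<Prod>j\<in>block N L. t - of_int j)"

definition pole_order :: "nat \<Rightarrow> int \<Rightarrow> nat" where
  "pole_order N k = card {L\<in>{19..53}. k \<in> block N L}"

text \<open>The expansion of \<open>(t - k) ^ pole_order N k * R N t\<close> in powers of X = t -
  k.\<close>

definition local_series :: "nat \<Rightarrow> int \<Rightarrow> real fps" where
  "local_series N k = fps_const (lead N) *
     (\<Prod>u\<in>zeros2 N. fps_const (of_int (2 * k - u)) + fps_const (of_int 2) * fps_X) *
     (\<Prod>u\<in>zeros3 N. fps_const (of_int (3 * k - u)) + fps_const (of_int 3) * fps_X) *
     (\<Prod>L\<in>{19..53}. \<Prod>j\<in>block N L - {k}. linv (of_int (k - j)))"

definition coef :: "nat \<Rightarrow> int \<Rightarrow> nat \<Rightarrow> real" where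
  "coef N k i = (if 1 \<le> i \<and> i \<le> pole_order N k then local_series N k $ (pole_order N k - i) else 0)"

abbreviation poles :: "nat \<Rightarrow> int set" where
  "poles N \<equiv> {- (53 * int N)..53 * int N}"

lemma finite_zeros [simp]: "finite (zeros2 N)" "finite (zeros3 N)"
proof -
  have "zeros2 N \<subseteq> {- (242 * int N)..242 * int N}" "zeros3 N \<subseteq> {- (363 * int N)..363 * int N}"
    by (auto simp: zeros2_def zeros3_def)
  thus "finite (zeros2 N)" "finite (zeros3 N)" by (auto intro: finite_subset)
qed

lemma finite_block [simp]: "finite (block N L)"
  by (simp add: block_def)

lemma pole_order_le: "pole_order N k \<le> 35"
proof -
  have "pole_order N k \<le> card {19..53::int}" unfolding pole_order_def by (intro card_mono) auto
  thus ?thesis by simp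
qed

lemma card_zeros2: "card (zeros2 N) = 242 * N"
proof -
  have "bij_betw (\<lambda>i. 2 * i + 1) {- (121 * int N)..<121 * int N} (zeros2 N)"
    by (rule bij_betwI[where g = "\<lambda>u. u div 2"]) (auto simp: zeros2_def elim!: oddE)
  thus ?thesis by (simp add: bij_betw_same_card [symmetric])
qed

lemma card_zeros3: "card (zeros3 N) = 620 * N"
proof -
  have eq: "zeros3 N = {- (363 * int N)..363 * int N} - (\<lambda>z. 3 * z) ` {- (53 * int N)..53 * int N}"
    by (auto simp: zeros3_def dvd_def image_iff)
  have "card ((\<lambda>z. 3 * z) ` {- (53 * int N)..53 * int N}) = card {- (53 * int N)..53 * int N}"
    by (intro card_image) (auto simp: inj_on_def)
  thus ?thesis unfolding eq by (subst card_Diff_subset) auto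
qed

lemma sum_block_lengths: "(\<Sum>L\<in>{19..53::int}. card (block N L)) = 2520 * N + 35"
proof -
  have "(\<Sum>L\<in>{19..53::int}. card (block N L)) = (\<Sum>L\<in>{19..53::int}. nat L * (2 * N) + 1)"
    by (intro sum.cong) (auto simp: block_def nat_add_distrib nat_mult_distrib)
  also have "\<dots> = (\<Sum>L\<in>{19..53::int}. nat L) * (2 * N) + 35"
    by (subst sum.distrib) (simp add: sum_distrib_right)
  also have "(\<Sum>L\<in>{19..53::int}. nat L) = (\<Sum>L\<in>{19..53::nat}. L)"
    by (rule sum.reindex_bij_witness[of _ int nat]) auto
  also have "(\<Sum>L\<in>{19..53::nat}. L) = 1260" by (simp add: Sum_Icc_nat)
  finally show ?thesis by simp
qed

lemma prod_blocks:
  fixes f :: "int \<Rightarrow> 'a :: comm_monoid_mult"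
  shows "(\<Prod>L\<in>{19..53}. \<Prod>j\<in>block N L. f j) = (\<Prod>k\<in>poles N. f k ^ pole_order N k)"
proof -
  have "(\<Prod>L\<in>{19..53}. \<Prod>j\<in>block N L. f j) = (\<Prod>L\<in>{19..53}. \<Prod>j\<in>poles N. if j \<in> block N L then f j else 1)"
  proof (rule prod.cong[OF refl])
    fix L :: int assume L: "L \<in> {19..53}"
    have "L * int N \<le> 53 * int N" using L by (intro mult_right_mono) auto
    hence "poles N \<inter> {j. j \<in> block N L} = block N L" by (auto simp: block_def)
    thus "(\<Prod>j\<in>block N L. f j) = (\<Prod>j\<in>poles N. if j \<in> block N L then f j else 1)"
      by (simp add: prod.If_cases)
  qed
  also have "\<dots> = (\<Prod>j\<in>poles N. \<Prod>L\<in>{19..53}. if j \<in> block N L then f j else 1)" by (rule prod.swap)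
  also have "\<dots> = (\<Prod>k\<in>poles N. f k ^ pole_order N k)"
    by (intro prod.cong refl) (simp add: prod.If_cases pole_order_def Int_def conj_commute)
  finally show ?thesis .
qed

lemma prod_blocks_except:
  fixes f :: "int \<Rightarrow> 'a :: comm_monoid_mult"
  shows "(\<Prod>L\<in>{19..53}. \<Prod>j\<in>block N L - {k}. f j) = (\<Prod>j\<in>poles N - {k}. f j ^ pole_order N j)"
proof -
  have "(\<Prod>L\<in>{19..53}. \<Prod>j\<in>block N L - {k}. f j) = (\<Prod>L\<in>{19..53}. \<Prod>j\<in>block N L. if j = k then 1 else f j)"
    by (intro prod.cong refl prod.mono_neutral_cong_left) auto
  also have "\<dots> = (\<Prod>j\<in>poles N. (if j = k then 1 else f j) ^ pole_order N j)" by (rule prod_blocks)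
  also have "\<dots> = (\<Prod>j\<in>poles N - {k}. f j ^ pole_order N j)" by (intro prod.mono_neutral_cong_right) auto
  finally show ?thesis .
qed

lemma R_partial_fractions:
  assumes t: "\<And>k. k \<in> poles N \<Longrightarrow> t \<noteq> of_int k"
  shows "R N t = (\<Sum>k\<in>poles N. \<Sum>i=1..35. coef N k i / (t - of_int k) ^ i)"
proof -
  define P :: "real poly" where "P = Polynomial.smult (lead N) ((\<Prod>u\<in>zeros2 N. [:- of_int u, 2:]) * (\<Prod>u\<in>zeros3 N. [:- of_int u, 3:]))"
  define K :: "real set" where "K = of_int ` poles N"
  have inj: "inj_on real_of_int X" for X by (simp add: inj_on_def)
  have "degree P \<le> 862 * N"
  proof -
    have "degree P \<le> (\<Sum>u\<in>zeros2 N. degree [:- real_of_int u, 2:]) + (\<Sum>u\<in>zeros3 N. degree [:- real_of_int u, 3:])"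
      unfolding P_def
      by (intro order_trans[OF degree_smult_le] order_trans[OF degree_mult_le] add_mono) (auto intro!: order_trans[OF degree_prod_sum_le])
    thus ?thesis by (simp add: card_zeros2 card_zeros3)
  qed
  also have "862 * N < (\<Sum>k\<in>K. pole_order N \<lfloor>k\<rfloor>)"
  proof -
    have "(\<Sum>k\<in>K. pole_order N \<lfloor>k\<rfloor>) = (\<Sum>k\<in>poles N. pole_order N k)"
      unfolding K_def by (subst sum.reindex[OF inj]) simp
    \<comment> \<open>The total pole order is found by feeding the constant 2 to
      \<open>prod_blocks\<close> and comparing exponents.\<close>
    also have "2 ^ \<dots> = (\<Prod>k\<in>poles N. 2 ^ pole_order N k :: nat)" by (simp add: power_sum)
    also have "\<dots> = (\<Prod>L\<in>{19..53::int}. \<Prod>j\<in>block N L. 2)" by (rule prod_blocks[symmetric])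
    also have "\<dots> = 2 ^ (2520 * N + 35)" by (simp add: sum_block_lengths[symmetric] power_sum)
    finally have "(\<Sum>k\<in>K. pole_order N \<lfloor>k\<rfloor>) = 2520 * N + 35" using power_inject_exp[of "2::nat"] by (metis one_less_numeral_iff semiring_norm(76))
    thus ?thesis by simp
  qed
  finally have deg: "degree P < (\<Sum>k\<in>K. pole_order N \<lfloor>k\<rfloor>)" .
  have lin: "fps_of_poly [:c, d:] = fps_const c + fps_const d * fps_X" for c d :: real
    by (simp add: fps_of_poly_pCons mult.commute)
  have "poly P t / (\<Prod>k\<in>K. (t - k) ^ pole_order N \<lfloor>k\<rfloor>) = 
     (\<Sum>k\<in>K. \<Sum>i=1..pole_order N \<lfloor>k\<rfloor>. local_series N \<lfloor>k\<rfloor> $ (pole_order N \<lfloor>k\<rfloor> - i) / (t - k) ^ i)"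
  proof (rule partial_fractions[OF _ deg])
    show "finite K" by (simp add: K_def)
    show "t \<notin> K" unfolding K_def using t by blast
    fix k assume "k \<in> K"
    then obtain l where l: "k = of_int l" "l \<in> poles N" by (auto simp: K_def)
    have Kl: "K - {k} = of_int ` (poles N - {l})" unfolding K_def l by (auto simp: image_set_diff[symmetric] inj_def)
    have E: "(\<Prod>k'\<in>K-{k}. (fps_const (k - k') + fps_X) ^ pole_order N \<lfloor>k'\<rfloor>) =
       (\<Prod>j\<in>poles N - {l}. (fps_const (of_int (l - j)) + fps_X) ^ pole_order N j)"
      unfolding Kl by (subst prod.reindex[OF inj]) (simp add: l)
    have "(\<Prod>L\<in>{19..53}. \<Prod>j\<in>block N L - {l}. linv (of_int (l - j))) * 
       (\<Prod>j\<in>poles N - {l}. (fps_const (of_int (l - j)) + fps_X) ^ pole_order N j) = 1"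
      unfolding prod_blocks_except prod.distrib[symmetric] power_mult_distrib[symmetric]
      by (intro prod.neutral) (auto simp: linv_inverse simp del: of_int_diff)
    hence "local_series N l * (\<Prod>j\<in>poles N - {l}. (fps_const (of_int (l - j)) + fps_X) ^ pole_order N j) =
       fps_const (lead N) *
     (\<Prod>u\<in>zeros2 N. fps_const (of_int (2 * l - u)) + fps_const (of_int 2) * fps_X) *
     (\<Prod>u\<in>zeros3 N. fps_const (of_int (3 * l - u)) + fps_const (of_int 3) * fps_X)"
      unfolding local_series_def by (simp only: mult.assoc mult_1_right)
    also have "\<dots> = fps_of_poly (pcompose P [:k, 1:])"
      by (simp add: P_def pcompose_smult fps_of_poly_smult pcompose_mult fps_of_poly_mult pcompose_prod fps_of_poly_prod
          pcompose_pCons lin l algebra_simps)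
    finally show "fps_of_poly (pcompose P [:k, 1:]) =
       local_series N \<lfloor>k\<rfloor> * (\<Prod>k'\<in>K-{k}. (fps_const (k - k') + fps_X) ^ pole_order N \<lfloor>k'\<rfloor>)"
      unfolding E by (simp add: l)
  qed
  also have "poly P t / (\<Prod>k\<in>K. (t - k) ^ pole_order N \<lfloor>k\<rfloor>) = R N t"
  proof -
    have "(\<Prod>k\<in>K. (t - k) ^ pole_order N \<lfloor>k\<rfloor>) = (\<Prod>L\<in>{19..53}. \<Prod>j\<in>block N L. t - of_int j)"
      unfolding K_def prod_blocks by (subst prod.reindex[OF inj]) simp
    thus ?thesis by (simp add: R_def P_def poly_prod algebra_simps)
  qed
  also have "(\<Sum>k\<in>K. \<Sum>i=1..pole_order N \<lfloor>k\<rfloor>. local_series N \<lfloor>k\<rfloor> $ (pole_order N \<lfloor>k\<rfloor> - i) / (t - k) ^ i) =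
     (\<Sum>k\<in>poles N. \<Sum>i=1..pole_order N k. local_series N k $ (pole_order N k - i) / (t - of_int k) ^ i)"
    unfolding K_def by (subst sum.reindex[OF inj]) simp
  also have "\<dots> = (\<Sum>k\<in>poles N. \<Sum>i=1..35. coef N k i / (t - of_int k) ^ i)"
    using pole_order_le by (intro sum.cong refl sum.mono_neutral_cong_left) (auto simp: coef_def intro: order_trans)
  finally show ?thesis .
qed

text \<open>The numerator has an even number of factors, and each of the 35 blocks an odd
  number.\<close>

lemma R_odd: "R N (- t) = - R N t"
proof -
  have 1: "(\<Prod>u\<in>zeros2 N. 2 * (- t) - of_int u) = (\<Prod>u\<in>zeros2 N. 2 * t - of_int u)"
  proof -
    have "(\<Prod>u\<in>zeros2 N. 2 * (- t) - of_int u) = (\<Prod>u\<in>zeros2 N. - (2 * t - of_int u))"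
      by (rule prod.reindex_bij_witness[of _ uminus uminus]) (auto simp: zeros2_def)
    thus ?thesis unfolding prod_uminus card_zeros2 by (simp add: power_mult)
  qed
  have 2: "(\<Prod>u\<in>zeros3 N. 3 * (- t) - of_int u) = (\<Prod>u\<in>zeros3 N. 3 * t - of_int u)"
  proof -
    have "(\<Prod>u\<in>zeros3 N. 3 * (- t) - of_int u) = (\<Prod>u\<in>zeros3 N. - (3 * t - of_int u))"
      by (rule prod.reindex_bij_witness[of _ uminus uminus]) (auto simp: zeros3_def)
    thus ?thesis unfolding prod_uminus card_zeros3 by (simp add: power_mult)
  qed
  have 3: "(\<Prod>j\<in>block N L. - t - of_int j) = - (\<Prod>j\<in>block N L. t - of_int j)" if "L \<ge> 0" for L
  proof -
    have "(\<Prod>j\<in>block N L. - t - of_int j) = (\<Prod>j\<in>block N L. - (t - of_int j))"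
      by (rule prod.reindex_bij_witness[of _ uminus uminus]) (auto simp: block_def)
    moreover have "card (block N L) = 2 * (nat L * N) + 1" using that by (simp add: block_def nat_add_distrib nat_mult_distrib)
    ultimately show ?thesis unfolding prod_uminus by simp
  qed
  have "(\<Prod>L\<in>{19..53}. \<Prod>j\<in>block N L. - t - of_int j) = (\<Prod>L\<in>{19..53::int}. - (\<Prod>j\<in>block N L. t - of_int j))"
    by (intro prod.cong refl 3) auto
  also have "\<dots> = - (\<Prod>L\<in>{19..53}. \<Prod>j\<in>block N L. t - of_int j)" unfolding prod_uminus by simp
  finally show ?thesis unfolding R_def 1 2 by simp
qed

lemma R_zero:
  assumes "d \<in> {1, 2, 3}" "t = of_int u / of_int d" "\<bar>t\<bar> \<le> 121 * real N" "t \<in> \<int> \<Longrightarrow> \<bar>t\<bar> > 53 * real N"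
  shows "R N t = 0"
proof -
  have main: "\<exists>u\<in>zeros3 N. 3 * t - of_int u = 0" if u: "3 * t = of_int u" for u
  proof (intro bexI[of _ u])
    have "\<bar>real_of_int u\<bar> \<le> 363 * real N" using u assms(3) by linarith
    hence "\<bar>u\<bar> \<le> 363 * int N" by linarith
    moreover have "\<not> (3 dvd u \<and> \<bar>u\<bar> \<le> 159 * int N)"
    proof
      assume a: "3 dvd u \<and> \<bar>u\<bar> \<le> 159 * int N"
      then obtain z where z: "u = 3 * z" by blast
      hence "t = of_int z" using u by simp
      hence "\<bar>t\<bar> > 53 * real N" using assms(4) by simp
      moreover have "\<bar>real_of_int u\<bar> \<le> 159 * real N" using a by linarith
      ultimately show False using u by linarith
    qed
    ultimately show "u \<in> zeros3 N" by (simp add: zeros3_def)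
  qed (use u in simp)
  have "(\<exists>u\<in>zeros2 N. 2 * t - of_int u = 0) \<or> (\<exists>u\<in>zeros3 N. 3 * t - of_int u = 0)"
  \<comment> \<open>In all other cases \<open>3 * t\<close> is an integer, so \<open>t\<close> is a
    zero of the second product.\<close>
  proof (cases "d = 2 \<and> odd u")
    case True
    have "2 * t = of_int u" using True assms(2) by simp
    moreover from this have "\<bar>real_of_int u\<bar> \<le> 242 * real N" using assms(3) by linarith
    hence "\<bar>u\<bar> \<le> 242 * int N" by linarith
    ultimately have "u \<in> zeros2 N \<and> 2 * t - of_int u = 0" using True by (simp add: zeros2_def)
    thus ?thesis by blast
  next
    case False
    consider "d = 1" | "d = 2" "even u" | "d = 3" using assms(1) False by auto
    thus ?thesis
    proof cases
      case 1
      hence "3 * t = of_int (3 * u)" using assms(2) by simp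
      from main[OF this] show ?thesis by blast
    next
      case 2
      then obtain v where "u = 2 * v" by blast
      hence "3 * t = of_int (3 * v)" using assms(2) 2 by simp
      from main[OF this] show ?thesis by blast
    next
      case 3
      hence "3 * t = of_int u" using assms(2) by simp
      from main[OF this] show ?thesis by blast
    qed
  qed
  hence "(\<Prod>u\<in>zeros2 N. 2 * t - of_int u) = 0 \<or> (\<Prod>u\<in>zeros3 N. 3 * t - of_int u) = 0"
    by (auto simp: prod_zero_iff)
  thus ?thesis by (auto simp: R_def)
qed

section \<open>Summation of R over the points u/d\<close>

definition polar :: "nat \<Rightarrow> int \<Rightarrow> real \<Rightarrow> real" where
  "polar N k x = (\<Sum>i=1..35. coef N k i / x ^ i)"

definition rho :: "nat \<Rightarrow> nat \<Rightarrow> real" where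
  "rho N i = (\<Sum>k\<in>poles N. coef N k i)"

text \<open>What the zeta series that start after \<open>d * (53 * N - k)\<close> and
  \<open>d * (53 * N + k)\<close> lack to be complete.\<close>

definition rat_part :: "nat \<Rightarrow> nat \<Rightarrow> real" where
  "rat_part N d = (\<Sum>k\<in>poles N.
      (\<Sum>v=1..nat (int d * (53 * int N - k)). polar N k (real v / real d)) -
      (\<Sum>v=1..nat (int d * (53 * int N + k)). polar N k (- (real v / real d))))"

definition R_sum :: "nat \<Rightarrow> nat \<Rightarrow> real" where
  "R_sum N d = (\<Sum>n. R N (real (53 * d * N + 1 + n) / real d))"

lemma zeta_sums:
  assumes "i \<ge> 2"
  shows "(\<lambda>n. 1 / real (Suc n) ^ i) sums zeta (real i)"
proof -
  have eq: "real (Suc n) powr (- real i) = 1 / real (Suc n) ^ i" for n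
    by (simp add: powr_minus powr_realpow field_simps del: of_nat_Suc)
  have "summable (\<lambda>n. real (Suc n) powr (- real i))"
    by (subst summable_Suc_iff[of "\<lambda>n. real n powr (- real i)"]) (use assms in \<open>simp add: summable_real_powr_iff\<close>)
  thus ?thesis unfolding zeta_def eq by (rule summable_sums)
qed

text \<open>For \<open>i = 1\<close> the harmonic series is made summable by subtracting
  \<open>1 / Suc n\<close>, so that all \<open>i\<close> are handled alike. The subtractions cancel
  later because the residues add up to 0.\<close>

lemma zeta_tail_sums:
  assumes "i \<ge> 1"
  shows "(\<lambda>n. 1 / real (c + 1 + n) ^ i - (if i = 1 then 1 / real (Suc n) else 0)) sums
     ((if i = 1 then 0 else zeta (real i)) - (\<Sum>v=1..c. 1 / real v ^ i))"
proof (induction c)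
  case 0
  show ?case using zeta_sums[of i] assms by (cases "i = 1") auto
next
  case (Suc c)
  have "(\<lambda>n. 1 / real (c + 1 + n) ^ i) \<longlonglongrightarrow> 0"
    using assms by real_asymp
  from telescope_sums[OF this]
  have "(\<lambda>n. 1 / real (c + 1 + Suc n) ^ i - 1 / real (c + 1 + n) ^ i) sums (0 - 1 / real (c + 1) ^ i)" by simp
  from sums_add[OF Suc this] show ?case by (simp add: algebra_simps)
qed

lemma R_bound_at_infinity:
  assumes t: "t \<ge> 1000 * (real N + 1)"
  shows "\<bar>R N t\<bar> \<le> (lead N * 3 ^ (242 * N) * 4 ^ (620 * N) * 2 ^ (2520 * N + 35)) / t ^ 2"
proof -
  have t1: "t \<ge> 1" "t \<ge> 1000 * real N" using t by auto
  have lead: "lead N \<ge> 0" unfolding lead_def norm_factor_def by (auto intro!: mult_nonneg_nonneg divide_nonneg_nonneg prod_nonneg)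
  have "(\<Prod>u\<in>zeros2 N. \<bar>2 * t - of_int u\<bar>) \<le> (\<Prod>u\<in>zeros2 N. 3 * t)"
    using t by (intro prod_mono) (auto simp: zeros2_def)
  hence z2: "(\<Prod>u\<in>zeros2 N. \<bar>2 * t - of_int u\<bar>) \<le> (3 * t) ^ (242 * N)" by (simp add: card_zeros2)
  have "(\<Prod>u\<in>zeros3 N. \<bar>3 * t - of_int u\<bar>) \<le> (\<Prod>u\<in>zeros3 N. 4 * t)"
    using t by (intro prod_mono) (auto simp: zeros3_def)
  hence z3: "(\<Prod>u\<in>zeros3 N. \<bar>3 * t - of_int u\<bar>) \<le> (4 * t) ^ (620 * N)" by (simp add: card_zeros3)
  have "(\<Prod>L\<in>{19..53::int}. \<Prod>j\<in>block N L. t / 2) \<le> (\<Prod>L\<in>{19..53}. \<Prod>j\<in>block N L. \<bar>t - of_int j\<bar>)"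
  proof (intro prod_mono conjI prod_nonneg)
    fix L j assume L: "L \<in> {19..53::int}" and j: "j \<in> block N L"
    have "L * int N \<le> 53 * int N" using L by (intro mult_right_mono) auto
    hence "j \<le> 53 * int N" using j by (auto simp: block_def)
    hence "real_of_int j \<le> 53 * real N" by linarith
    thus "t / 2 \<le> \<bar>t - of_int j\<bar>" using t1 by linarith
  qed (use t1 in auto)
  moreover have "(\<Prod>L\<in>{19..53::int}. \<Prod>j\<in>block N L. t / 2) = (t / 2) ^ (2520 * N + 35)"
    by (simp add: sum_block_lengths[symmetric] power_sum)
  ultimately have den: "(t / 2) ^ (2520 * N + 35) \<le> (\<Prod>L\<in>{19..53}. \<Prod>j\<in>block N L. \<bar>t - of_int j\<bar>)" by simp
  have "\<bar>R N t\<bar> = lead N * (\<Prod>u\<in>zeros2 N. \<bar>2 * t - of_int u\<bar>) * (\<Prod>u\<in>zeros3 N. \<bar>3 * t - of_int u\<bar>) /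
     (\<Prod>L\<in>{19..53}. \<Prod>j\<in>block N L. \<bar>t - of_int j\<bar>)"
    using lead unfolding R_def abs_mult abs_divide abs_prod by simp
  also have "\<dots> \<le> lead N * (3 * t) ^ (242 * N) * (4 * t) ^ (620 * N) / (t / 2) ^ (2520 * N + 35)"
    using z2 z3 den lead t1 by (intro frac_le mult_mono mult_nonneg_nonneg prod_nonneg) auto
  also have "\<dots> = (lead N * 3 ^ (242 * N) * 4 ^ (620 * N) * 2 ^ (2520 * N + 35)) * (t ^ (862 * N) / t ^ (2520 * N + 35))"
    by (simp add: power_mult_distrib power_divide power_add[symmetric])
  also have "t ^ (862 * N) / t ^ (2520 * N + 35) \<le> 1 / t ^ 2"
  proof -
    have "t ^ (862 * N) * t ^ 2 \<le> t ^ (2520 * N + 35)"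
      unfolding power_add[symmetric] using t1 by (intro power_increasing) auto
    thus ?thesis using t1 by (simp add: field_simps)
  qed
  finally show ?thesis using lead by (simp add: mult_left_mono)
qed

text \<open>The sum of the residues is the limit of t R(t) at infinity, and R decays
  quadratically.\<close>

lemma rho_1: "rho N 1 = 0"
proof -
  define C where "C = lead N * 3 ^ (242 * N) * 4 ^ (620 * N) * 2 ^ (2520 * N + 35)"
  have "(\<lambda>n. real n * R N (real n)) \<longlonglongrightarrow> 0"
  proof (rule Lim_null_comparison)
    show "eventually (\<lambda>n. norm (real n * R N (real n)) \<le> C / real n) sequentially"
      using eventually_ge_at_top[of "1000 * (N + 1)"]
    proof eventually_elim
      case (elim n)
      have "real n \<ge> real (1000 * (N + 1))" using elim by (simp only: of_nat_le_iff)
      hence n: "real n \<ge> 1000 * (real N + 1)" by simp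
      have "norm (real n * R N (real n)) = real n * \<bar>R N (real n)\<bar>" by (simp add: abs_mult)
      also have "\<dots> \<le> real n * (C / real n ^ 2)"
        unfolding C_def by (intro mult_left_mono R_bound_at_infinity n) auto
      also have "\<dots> = C / real n" using n by (simp add: power2_eq_square)
      finally show ?case .
    qed
    show "(\<lambda>n. C / real n) \<longlonglongrightarrow> 0" by (rule lim_const_over_n)
  qed
  moreover have "(\<lambda>n. real n * R N (real n)) \<longlonglongrightarrow> (\<Sum>k\<in>poles N. \<Sum>i=1..35. if i = 1 then coef N k i else 0)"
  proof (rule Lim_transform_eventually)
    have lim: "(\<lambda>n. coef N k i * (real n / (real n - of_int k) ^ i)) \<longlonglongrightarrow> (if i = 1 then coef N k i else 0)" if "i \<in> {1..35}" for i k
    proof (cases "i = 1")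
      case True
      have "(\<lambda>n. real n / (real n - of_int k)) \<longlonglongrightarrow> 1" by real_asymp
      from tendsto_mult[OF tendsto_const[of "coef N k i"] this] show ?thesis using True by simp
    next
      case False
      hence "real i > 1" using that by auto
      hence "(\<lambda>n. real n / (real n - of_int k) ^ i) \<longlonglongrightarrow> 0"
      proof -
        have lim: "(\<lambda>n. (real n / (real n - of_int k)) * (1 / (real n - of_int k)) ^ (i - 1)) \<longlonglongrightarrow> 1 * 0 ^ (i - 1)"
          by (intro tendsto_mult tendsto_power; real_asymp)
        have zero: "0 ^ (i - 1) = (0::real)" using False that by (simp add: power_0_left)
        have eq: "(real n / (real n - of_int k)) * (1 / (real n - of_int k)) ^ (i - 1) = real n / (real n - of_int k) ^ i" for n
          using that by (cases i) (auto simp: power_divide)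
        from lim[unfolded eq zero] show ?thesis by simp
      qed
      from tendsto_mult[OF tendsto_const[of "coef N k i"] this] show ?thesis using False by simp
    qed
    show "(\<lambda>n. \<Sum>k\<in>poles N. \<Sum>i=1..35. coef N k i * (real n / (real n - of_int k) ^ i)) \<longlonglongrightarrow> 
       (\<Sum>k\<in>poles N. \<Sum>i=1..35. if i = 1 then coef N k i else 0)"
      by (intro tendsto_sum lim)
    show "eventually (\<lambda>n. (\<Sum>k\<in>poles N. \<Sum>i=1..35. coef N k i * (real n / (real n - of_int k) ^ i)) = real n * R N (real n)) sequentially"
      using eventually_gt_at_top[of "53 * N"]
    proof eventually_elim
      case (elim n)
      have "real n > real (53 * N)" using elim by (simp only: of_nat_less_iff)
      hence "R N (real n) = (\<Sum>k\<in>poles N. \<Sum>i=1..35. coef N k i / (real n - of_int k) ^ i)"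
        by (intro R_partial_fractions) auto
      thus ?case by (simp add: sum_distrib_left mult_ac)
    qed
  qed
  ultimately have "(\<Sum>k\<in>poles N. \<Sum>i=1..35. if i = 1 then coef N k i else 0) = 0"
    using LIMSEQ_unique by blast
  thus ?thesis by (simp add: rho_def)
qed

text \<open>By oddness \<open>2 * R N t = R N t - R N (- t)\<close>. Expanding both terms gives
  zeta(i) the factor 1 - (-1)^i, so only odd \<open>i\<close> survive. The powers of
  \<open>d\<close> come from writing \<open>1 / (u / d - k) ^ i\<close> as
  \<open>d ^ i / (u - d * k) ^ i\<close>.\<close>

theorem R_sum_linear_form:
  assumes d: "d \<ge> 1"
  shows "(\<lambda>n. R N (real (53 * d * N + 1 + n) / real d)) sums R_sum N d"
    and "2 * R_sum N d = (\<Sum>i\<in>{i\<in>{3..35}. odd i}. 2 * real d ^ i * rho N i * zeta (real i)) - rat_part N d"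
proof -
  define c where "c = (\<lambda>k. nat (int d * (53 * int N - k)))"
  define c' where "c' = (\<lambda>k. nat (int d * (53 * int N + k)))"
  define g where "g = (\<lambda>i c n. 1 / real (c + 1 + n) ^ i - (if i = 1 then 1 / real (Suc n) else 0) :: real)"
  define z where "z = (\<lambda>i::nat. if i = 1 then 0 else zeta (real i))"
  define H where "H = (\<lambda>i c. \<Sum>v=1..c. 1 / real v ^ i :: real)"
  have R_eq: "2 * R N (real (53 * d * N + 1 + n) / real d) =
     (\<Sum>k\<in>poles N. \<Sum>i=1..35. coef N k i * real d ^ i * (g i (c k) n - (- 1) ^ i * g i (c' k) n))" for n
  proof -
    define u where "u = real (53 * d * N + 1 + n)"
    have u: "u > 53 * (real d * real N)" by (simp add: u_def algebra_simps)
    have kb: "real_of_int k * real d \<le> 53 * (real d * real N)" "- (53 * (real d * real N)) \<le> real_of_int k * real d" if k: "k \<in> poles N" for k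
    proof -
      have "real_of_int k \<le> 53 * real N" "- (53 * real N) \<le> real_of_int k" using k by simp_all
      hence "real_of_int k * real d \<le> (53 * real N) * real d" "(- (53 * real N)) * real d \<le> real_of_int k * real d"
        by (intro mult_right_mono; simp)+
      thus "real_of_int k * real d \<le> 53 * (real d * real N)" "- (53 * (real d * real N)) \<le> real_of_int k * real d"
        by (simp_all add: algebra_simps)
    qed
    have nz: "u / real d \<noteq> of_int k" "- (u / real d) \<noteq> of_int k" if "k \<in> poles N" for k
      using kb[OF that] u d by (auto simp: field_simps)
    have cu: "real (c k + 1 + n) = u - real d * of_int k" "real (c' k + 1 + n) = u + real d * of_int k" if k: "k \<in> poles N" for k
    proof -
      have "0 \<le> int d * (53 * int N - k)" "0 \<le> int d * (53 * int N + k)" using k by auto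
      hence "real (c k) = real d * (53 * real N - of_int k)" "real (c' k) = real d * (53 * real N + of_int k)"
        by (simp_all add: c_def c'_def)
      thus "real (c k + 1 + n) = u - real d * of_int k" "real (c' k + 1 + n) = u + real d * of_int k"
        by (simp_all add: u_def algebra_simps)
    qed
    have "2 * R N (u / real d) = R N (u / real d) - R N (- (u / real d))" by (simp add: R_odd)
    also have "\<dots> = (\<Sum>k\<in>poles N. \<Sum>i=1..35. coef N k i / (u / real d - of_int k) ^ i - coef N k i / (- (u / real d) - of_int k) ^ i)"
      by (subst (1 2) R_partial_fractions) (use nz in \<open>auto simp: sum_subtractf\<close>)
    also have "\<dots> = (\<Sum>k\<in>poles N. \<Sum>i=1..35. coef N k i * real d ^ i * (1 / real (c k + 1 + n) ^ i - (- 1) ^ i * (1 / real (c' k + 1 + n) ^ i)))"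
    proof (intro sum.cong refl)
      fix k i assume k: "k \<in> poles N"
      have "u / real d - of_int k = (u - real d * of_int k) / real d" using d by (simp add: diff_divide_distrib)
      also have "\<dots> = real (c k + 1 + n) / real d" by (simp only: cu[OF k])
      finally have e1: "u / real d - of_int k = real (c k + 1 + n) / real d" .
      have "- (u / real d) - of_int k = (- 1) * ((u + real d * of_int k) / real d)" using d by (simp add: add_divide_distrib)
      also have "\<dots> = (- 1) * (real (c' k + 1 + n) / real d)" by (simp only: cu[OF k])
      finally have e2: "- (u / real d) - of_int k = (- 1) * (real (c' k + 1 + n) / real d)" .
      show "coef N k i / (u / real d - of_int k) ^ i - coef N k i / (- (u / real d) - of_int k) ^ i =
         coef N k i * real d ^ i * (1 / real (c k + 1 + n) ^ i - (- 1) ^ i * (1 / real (c' k + 1 + n) ^ i))"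
        unfolding e1 e2 power_mult_distrib power_divide
        by (cases "even i") (simp_all add: right_diff_distrib distrib_left)
    qed
    \<comment> \<open>The harmonic corrections of \<open>zeta_tail_sums\<close> are inserted;
      together they form a multiple of \<open>rho N 1\<close>, which is 0.\<close>
    also have "\<dots> = (\<Sum>k\<in>poles N. \<Sum>i=1..35. coef N k i * real d ^ i * (g i (c k) n - (- 1) ^ i * g i (c' k) n)
         + (if i = 1 then coef N k 1 * real d * (2 / real (Suc n)) else 0))"
      by (intro sum.cong refl) (auto simp: g_def algebra_simps)
    also have "\<dots> = (\<Sum>k\<in>poles N. \<Sum>i=1..35. coef N k i * real d ^ i * (g i (c k) n - (- 1) ^ i * g i (c' k) n))
         + rho N 1 * (real d * (2 / real (Suc n)))"
      by (simp add: sum.distrib rho_def sum_distrib_right sum_divide_distrib mult.assoc)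
    finally show ?thesis by (simp add: rho_1[unfolded One_nat_def] u_def)
  qed
  have "(\<lambda>n. \<Sum>k\<in>poles N. \<Sum>i=1..35. coef N k i * real d ^ i * (g i (c k) n - (- 1) ^ i * g i (c' k) n)) sums
     (\<Sum>k\<in>poles N. \<Sum>i=1..35. coef N k i * real d ^ i * ((z i - H i (c k)) - (- 1) ^ i * (z i - H i (c' k))))" (is "_ sums ?S")
    unfolding g_def z_def H_def by (intro sums_sum sums_mult sums_diff zeta_tail_sums) auto
  hence "(\<lambda>n. 2 * R N (real (53 * d * N + 1 + n) / real d)) sums ?S" by (simp only: R_eq)
  from sums_divide[OF this, of 2] have s: "(\<lambda>n. R N (real (53 * d * N + 1 + n) / real d)) sums (?S / 2)" by simp
  thus "(\<lambda>n. R N (real (53 * d * N + 1 + n) / real d)) sums R_sum N d"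
    unfolding R_sum_def by (simp add: sums_iff)
  have "R_sum N d = ?S / 2" using s unfolding R_sum_def by (simp add: sums_iff)
  hence "2 * R_sum N d = ?S" by simp
  also have "\<dots> = (\<Sum>k\<in>poles N. (\<Sum>i=1..35. coef N k i * real d ^ i * (1 - (- 1) ^ i) * z i)
       - ((\<Sum>i=1..35. coef N k i * real d ^ i * H i (c k)) - (\<Sum>i=1..35. coef N k i * real d ^ i * (- 1) ^ i * H i (c' k))))"
    by (intro sum.cong refl, simp only: sum_subtractf[symmetric], intro sum.cong refl) (simp add: algebra_simps)
  also have "\<dots> = (\<Sum>k\<in>poles N. \<Sum>i=1..35. coef N k i * real d ^ i * (1 - (- 1) ^ i) * z i) - rat_part N d"
  proof -
    have "(\<Sum>i=1..35. coef N k i * real d ^ i * H i m) = (\<Sum>v=1..m. polar N k (real v / real d))" for k m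
    proof -
      have "(\<Sum>i=1..35. coef N k i * real d ^ i * H i m) = (\<Sum>i=1..35. \<Sum>v=1..m. coef N k i / (real v / real d) ^ i)"
        unfolding H_def sum_distrib_left by (intro sum.cong refl) (simp add: power_divide)
      also have "\<dots> = (\<Sum>v=1..m. polar N k (real v / real d))" unfolding polar_def by (rule sum.swap)
      finally show ?thesis .
    qed
    moreover have "(\<Sum>i=1..35. coef N k i * real d ^ i * (- 1) ^ i * H i m) = (\<Sum>v=1..m. polar N k (- (real v / real d)))" for k m
    proof -
      have "(\<Sum>i=1..35. coef N k i * real d ^ i * (- 1) ^ i * H i m) = (\<Sum>i=1..35. \<Sum>v=1..m. coef N k i / (- (real v / real d)) ^ i)"
        unfolding H_def sum_distrib_left
      proof (intro sum.cong refl)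
        fix i v :: nat
        show "coef N k i * real d ^ i * (- 1) ^ i * (1 / real v ^ i) = coef N k i / (- (real v / real d)) ^ i"
          by (cases "even i") (simp_all add: power_divide)
      qed
      also have "\<dots> = (\<Sum>v=1..m. polar N k (- (real v / real d)))" unfolding polar_def by (rule sum.swap)
      finally show ?thesis .
    qed
    ultimately show ?thesis by (simp add: sum_subtractf rat_part_def c_def c'_def)
  qed
  also have "(\<Sum>k\<in>poles N. \<Sum>i=1..35. coef N k i * real d ^ i * (1 - (- 1) ^ i) * z i) =
     (\<Sum>i=1..35. real d ^ i * (1 - (- 1) ^ i) * rho N i * z i)"
    by (subst sum.swap) (simp add: rho_def sum_distrib_left sum_distrib_right mult_ac)
  also have "\<dots> = (\<Sum>i\<in>{i\<in>{3..35}. odd i}. 2 * real d ^ i * rho N i * zeta (real i))"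
  proof (rule sum.mono_neutral_cong_right)
    show "\<forall>i\<in>{1..35} - {i \<in> {3..35}. odd i}. real d ^ i * (1 - (- 1) ^ i) * rho N i * z i = 0"
    proof
      fix i :: nat assume i: "i \<in> {1..35} - {i \<in> {3..35}. odd i}"
      hence "even i \<or> i = 1" by (cases "i = 2") auto
      thus "real d ^ i * (1 - (- 1) ^ i) * rho N i * z i = 0" by (auto simp: z_def)
    qed
  qed (auto simp: z_def)
  finally show "2 * R_sum N d = (\<Sum>i\<in>{i\<in>{3..35}. odd i}. 2 * real d ^ i * rho N i * zeta (real i)) - rat_part N d" .
qed

section \<open>Bounding the denominators\<close>

definition cnt :: "int \<Rightarrow> int \<Rightarrow> int \<Rightarrow> int \<Rightarrow> int" where
  "cnt p d M k = int (card {u. \<bar>u\<bar> \<le> M \<and> p dvd (d * k - u)})"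

lemma cnt_shift: "cnt p d M (k + p * s) = cnt p d M k"
proof -
  have "p dvd (d * (k + p * s) - u) \<longleftrightarrow> p dvd (d * k - u)" for u
    using dvd_add_left_iff[of p "d * p * s" "d * k - u"] by (simp add: algebra_simps)
  thus ?thesis unfolding cnt_def by simp
qed

lemma cnt_uminus: "cnt p d M (- k) = cnt p d M k"
proof -
  have "bij_betw uminus {u. \<bar>u\<bar> \<le> M \<and> p dvd (d * k - u)} {u. \<bar>u\<bar> \<le> M \<and> p dvd (d * (- k) - u)}"
  proof (rule bij_betwI[where g = uminus])
    have "p dvd (- (d * k) - u) \<longleftrightarrow> p dvd (d * k + u)" for u
      by (metis add.commute dvd_minus_iff minus_add_distrib uminus_add_conv_diff diff_conv_add_uminus)
    thus "uminus \<in> {u. \<bar>u\<bar> \<le> M \<and> p dvd (d * k - u)} \<rightarrow> {u. \<bar>u\<bar> \<le> M \<and> p dvd (d * (- k) - u)}"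
      "uminus \<in> {u. \<bar>u\<bar> \<le> M \<and> p dvd (d * (- k) - u)} \<rightarrow> {u. \<bar>u\<bar> \<le> M \<and> p dvd (d * k - u)}"
      by auto
  qed auto
  thus ?thesis unfolding cnt_def by (simp add: bij_betw_same_card)
qed

text \<open>The solutions are \<open>d * k - p * m\<close> with \<open>m\<close> in an interval. The
  hypothesis \<open>d * k - p \<le> M\<close> makes the second floor at least -1, so the formula for
  the length does not become negative.\<close>

lemma cnt_eq_floor:
  assumes p: "p > 0" and "d * k \<ge> 0" and "d * k - p \<le> M" and "M \<ge> 0"
  shows "cnt p d M k = (M + d * k) div p + (M - d * k) div p + 1"
proof -
  have "bij_betw (\<lambda>m. d * k - p * m) {- ((M - d * k) div p)..(M + d * k) div p}
          {u. \<bar>u\<bar> \<le> M \<and> p dvd (d * k - u)}"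
  proof (rule bij_betw_byWitness[where f' = "\<lambda>u. (d * k - u) div p"])
    show "\<forall>m\<in>{- ((M - d * k) div p)..(M + d * k) div p}. (d * k - (d * k - p * m)) div p = m"
      using p by simp
    show "\<forall>u\<in>{u. \<bar>u\<bar> \<le> M \<and> p dvd d * k - u}. d * k - p * ((d * k - u) div p) = u"
      by simp
    have "\<bar>d * k - p * m\<bar> \<le> M" if "- ((M - d * k) div p) \<le> m" "m \<le> (M + d * k) div p" for m
    proof -
      have "p * m \<le> p * ((M + d * k) div p)" "p * (- m) \<le> p * ((M - d * k) div p)"
        using that p by (intro mult_left_mono; simp)+
      moreover have "p * ((M + d * k) div p) \<le> M + d * k" "p * ((M - d * k) div p) \<le> M - d * k"
        using p by (simp_all add: minus_mod_eq_mult_div [symmetric])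
      ultimately show ?thesis by auto
    qed
    thus "(\<lambda>m. d * k - p * m) ` {- ((M - d * k) div p)..(M + d * k) div p}
          \<subseteq> {u. \<bar>u\<bar> \<le> M \<and> p dvd d * k - u}" by auto
    have "- ((M - d * k) div p) \<le> (d * k - u) div p \<and> (d * k - u) div p \<le> (M + d * k) div p"
      if u: "\<bar>u\<bar> \<le> M" "p dvd d * k - u" for u
    proof -
      obtain m where m: "d * k - u = p * m" using u(2) by (auto elim: dvdE)
      have eq: "(d * k - u) div p = m" using m p by simp
      have "p * m \<le> M + d * k" "p * (- m) \<le> M - d * k" using u(1) by (simp_all flip: m)
      hence "(p * m) div p \<le> (M + d * k) div p" "(p * (- m)) div p \<le> (M - d * k) div p"
        using p by (intro zdiv_mono1; simp)+
      hence "m \<le> (M + d * k) div p" "- m \<le> (M - d * k) div p"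
        using p nonzero_mult_div_cancel_left[of p "- m"] by simp_all
      thus ?thesis using eq by simp
    qed
    thus "(\<lambda>u. (d * k - u) div p) ` {u. \<bar>u\<bar> \<le> M \<and> p dvd d * k - u}
      \<subseteq> {- ((M - d * k) div p)..(M + d * k) div p}" by auto
  qed
  hence "card {- ((M - d * k) div p)..(M + d * k) div p} = card {u. \<bar>u\<bar> \<le> M \<and> p dvd (d * k - u)}"
    by (rule bij_betw_same_card)
  hence "cnt p d M k = int (card {- ((M - d * k) div p)..(M + d * k) div p})"
    by (simp only: cnt_def)
  moreover have "(M - d * k) div p \<ge> - 1" 
  proof -
    have "(p * (- 1)) div p \<le> (M - d * k) div p" using assms by (intro zdiv_mono1) auto
    thus ?thesis using p by (simp only: nonzero_mult_div_cancel_left)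
  qed
  moreover have "(M + d * k) div p \<ge> 0" using assms by (simp add: pos_imp_zdiv_nonneg_iff)
  ultimately show ?thesis by simp
qed

section \<open>Maximising the count over a cell by a sweep\<close>

fun max_prefix :: "int \<Rightarrow> int list \<Rightarrow> int list \<Rightarrow> int" where
  "max_prefix c [] ds = c"
| "max_prefix c (u # us) [] = max_prefix (c + 1) us []"
| "max_prefix c (u # us) (d # ds) =
     (if d \<le> u then max c (max_prefix (c - 1) (u # us) ds) else max_prefix (c + 1) us (d # ds))"

lemma max_prefix_ge: "c \<le> max_prefix c us ds"
  by (induction c us ds rule: max_prefix.induct) auto

text \<open>\<open>max_prefix\<close> merges the two lists and records the largest running value,
  which is reached just before a down step or at the end. An up step counts once it is strictly
  passed and a down step as soon as it is met, so a tie is decided for the down step.\<close>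

lemma max_prefix_bound:
  assumes "sorted us" "sorted ds"
  shows "c + int (length (filter (\<lambda>u. real_of_int u < Y) us)) - int (length (filter (\<lambda>d. real_of_int d \<le> Y) ds))
           \<le> max_prefix c us ds"
  using assms
proof (induction c us ds rule: max_prefix.induct)
  case (2 c u us)
  then show ?case using max_prefix_ge[of "c + 1" us "[]"] by auto
next
  case (3 c u us d ds)
  show ?case
  proof (cases "d \<le> u")
    case True
    show ?thesis
    proof (cases "real_of_int d \<le> Y")
      case True
      then show ?thesis using 3 \<open>d \<le> u\<close> by auto
    next
      case False
      hence "\<not> real_of_int x < Y" if "x \<in> set (u # us)" for x
        using that 3(3) \<open>d \<le> u\<close> by auto
      hence "filter (\<lambda>u. real_of_int u < Y) (u # us) = []" by (simp add: filter_empty_conv)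
      then show ?thesis using \<open>d \<le> u\<close> by (metis add.right_neutral diff_ge_0_iff_ge diff_le_eq le_add_same_cancel1 list.size(3) max.coboundedI1 max_prefix.simps(3) of_nat_0 of_nat_0_le_iff)
    qed
  next
    case False
    show ?thesis
    proof (cases "real_of_int u < Y")
      case True
      then show ?thesis using 3 False by auto
    next
      case F: False
      hence "\<not> real_of_int x < Y" if "x \<in> set (u # us)" for x
        using that 3(3) by auto
      hence "filter (\<lambda>u. real_of_int u < Y) (u # us) = []" by (simp add: filter_empty_conv)
      then show ?thesis using False max_prefix_ge[of "c + 1" us "d # ds"] by simp
    qed
  qed
qed auto

text \<open>All blocks of the quotient before cancellation; the last two are those that cancel
  against the numerator. With them restored, every product runs over a full interval.\<close>

definition block_lens :: "int list" where
  "block_lens = [19..53] @ [53, 121]"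

text \<open>
  For \<open>p\<close> in the cell \<open>(\<alpha>, \<beta>)\<close>, the points at which the count of multiples of \<open>p\<close>
  can go up or down as \<open>k mod p\<close> grows, in units where \<open>p\<close> has length \<open>6 * \<alpha> * \<beta>\<close>.
\<close>

definition ups :: "int \<Rightarrow> int \<Rightarrow> int list" where
  "ups \<alpha> \<beta> = map (\<lambda>L. (\<alpha> - 8 * L mod \<alpha>) * (6 * \<beta>)) block_lens @
     (let f = (1936 mod \<beta>) * 3 * \<alpha> in [f]) @
     (let f = (2904 mod \<beta>) * 2 * \<alpha>; T = 2 * \<alpha> * \<beta> in [f, T + f])"

definition downs :: "int \<Rightarrow> int \<Rightarrow> int list" where
  "downs \<alpha> \<beta> = map (\<lambda>L. (8 * L mod \<alpha>) * (6 * \<beta>)) block_lens @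
     (let f = (1936 mod \<beta>) * 3 * \<alpha>; T = 3 * \<alpha> * \<beta> in [T - f]) @
     (let f = (2904 mod \<beta>) * 2 * \<alpha>; T = 2 * \<alpha> * \<beta> in [T - f, 2 * T - f])"

definition base_count :: "int \<Rightarrow> int \<Rightarrow> int" where
  "base_count \<alpha> \<beta> = sum_list (map (\<lambda>L. 2 * (8 * L div \<alpha>) + 1) block_lens)
      - (2 * (1936 div \<beta>) + 1) - (2 * (2904 div \<beta>) + 1)"

text \<open>\<open>lo\<close> and \<open>hi\<close> bound the residue \<open>k\<close>: two poles in
  one class force \<open>p - k \<le> 53 * N\<close>, hence \<open>k / p\<close> is at least 1 - 424
  / alpha with 424 = 8 * 53, and by symmetry \<open>k\<close> is at most \<open>p / 2\<close>. If no
  residue satisfies both, the value is 0.\<close>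

definition cell_max :: "int \<Rightarrow> int \<Rightarrow> int" where
  "cell_max \<alpha> \<beta> = (let lo = max 0 (6 * \<beta> * (\<alpha> - 424)); hi = 3 * \<alpha> * \<beta>; us = ups \<alpha> \<beta>; ds = downs \<alpha> \<beta> in
     if hi < lo then 0 else
     max 0 (max_prefix
       (base_count \<alpha> \<beta> + int (length (filter (\<lambda>x. x < lo) us)) - int (length (filter (\<lambda>x. x \<le> lo) ds)))
       (sort (filter (\<lambda>x. lo \<le> x \<and> x \<le> hi) us)) (sort (filter (\<lambda>x. lo < x \<and> x \<le> hi) ds))))"

text \<open>3871 = 8 * 484 - 1 and 5807 = 8 * 726 - 1. The lower end of a cell is a strict bound, so
  \<open>484 * N / p\<close> stays strictly below 8 * 484 / alpha, which saves one when this is an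
  integer.\<close>

definition cell_norm :: "int \<Rightarrow> int \<Rightarrow> int" where
  "cell_norm \<alpha> \<beta> = (3871 div \<alpha>) + (5807 div \<alpha>) - sum_list (map (\<lambda>L. 16 * L div \<beta>) block_lens)"

definition cell_bound :: "int \<Rightarrow> int \<Rightarrow> int" where
  "cell_bound \<alpha> \<beta> = cell_max \<alpha> \<beta> + cell_norm \<alpha> \<beta>"

lemma length_filter_split:
  assumes "real_of_int lo \<le> Y" "Y \<le> real_of_int hi"
  shows "length (filter (\<lambda>u. real_of_int u < Y) us) =
           length (filter (\<lambda>x. x < lo) us) + length (filter (\<lambda>u. real_of_int u < Y) (filter (\<lambda>x. lo \<le> x \<and> x \<le> hi) us))"
    and "length (filter (\<lambda>u. real_of_int u \<le> Y) us) =
           length (filter (\<lambda>x. x \<le> lo) us) + length (filter (\<lambda>u. real_of_int u \<le> Y) (filter (\<lambda>x. lo < x \<and> x \<le> hi) us))"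
  using assms by (induction us) auto

lemma length_filter_sort: "length (filter P (sort xs)) = length (filter P xs)"
  by (metis mset_filter mset_sort size_mset)

lemma length_filter_Cons: "int (length (filter P (x # xs))) = of_bool (P x) + int (length (filter P xs))"
  by simp

lemma sum_list_of_bool: "(\<Sum>x\<leftarrow>xs. of_bool (P x)) = int (length (filter P xs))"
  by (induction xs) auto

context
  fixes p N k \<alpha> \<beta> :: int and Y :: real
  assumes p: "p > 0" and N: "N \<ge> 0" and ab: "\<alpha> > 0" "\<beta> > 0" and cell: "\<alpha> * N < 8 * p" "8 * p \<le> \<beta> * N"
    and k: "0 \<le> k" "2 * k \<le> p"
  defines "Y \<equiv> 6 * \<alpha> * \<beta> * k / p"
begin

text \<open>\<open>L * N / p\<close> lies below 8 L / alpha = q + f / alpha. The floor of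
  \<open>(L * N + k) / p\<close> can exceed q only once \<open>k / p\<close> exceeds 1 - f / alpha,
  and the floor of \<open>(L * N - k) / p\<close> is below q as soon as \<open>k / p\<close> reaches
  f / alpha.\<close>

lemma cnt_block_le:
  assumes L: "L > 0"
  shows "cnt p 1 (L * N) k \<le> 2 * (8 * L div \<alpha>) + 1 + of_bool (real_of_int ((\<alpha> - 8 * L mod \<alpha>) * (6 * \<beta>)) < Y)
            - of_bool (real_of_int ((8 * L mod \<alpha>) * (6 * \<beta>)) \<le> Y)"
proof -
  define q where "q = 8 * L div \<alpha>"
  define f where "f = 8 * L mod \<alpha>"
  have f: "8 * L = \<alpha> * q + f" "0 \<le> f" "f < \<alpha>" using ab by (simp_all add: q_def f_def)
  have h: "\<alpha> * (L * N) < p * (\<alpha> * q + f)" 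
    using mult_strict_left_mono[OF cell(1) L] unfolding f(1)[symmetric] by (simp add: mult.commute mult.left_commute)
  define x where "x = (L * N + k) div p"
  define y where "y = (L * N - k) div p"
  have x: "p * x \<le> L * N + k" and y: "p * y \<le> L * N - k"
    using p by (simp_all add: x_def y_def minus_mod_eq_mult_div [symmetric])
  have x': "\<alpha> * p * x < \<alpha> * p * q + p * f + \<alpha> * k"
    using mult_left_mono[OF x, of \<alpha>] ab h by (simp add: algebra_simps)
  have y': "\<alpha> * p * y < \<alpha> * p * q + p * f - \<alpha> * k"
    using mult_left_mono[OF y, of \<alpha>] ab h by (simp add: algebra_simps)
  have ap: "\<alpha> * p > 0" using ab p by simp
  have pf: "p * f < \<alpha> * p" using f p by (simp add: mult.commute)
  have ak: "0 \<le> \<alpha> * k" "\<alpha> * k \<le> \<alpha> * p" using ab k by simp_all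
  have Y_iff: "real_of_int (z * (6 * \<beta>)) < Y \<longleftrightarrow> z * p < \<alpha> * k" "real_of_int (z * (6 * \<beta>)) \<le> Y \<longleftrightarrow> z * p \<le> \<alpha> * k" for z
  proof -
    have "real_of_int (z * (6 * \<beta>)) < Y \<longleftrightarrow> (6 * \<beta>) * real_of_int (z * p) < (6 * \<beta>) * real_of_int (\<alpha> * k)"
      using p by (simp add: Y_def field_simps)
    also have "\<dots> \<longleftrightarrow> real_of_int (z * p) < real_of_int (\<alpha> * k)" using ab by (subst mult_less_cancel_left_pos) auto
    finally show "real_of_int (z * (6 * \<beta>)) < Y \<longleftrightarrow> z * p < \<alpha> * k" by linarith
    have "real_of_int (z * (6 * \<beta>)) \<le> Y \<longleftrightarrow> (6 * \<beta>) * real_of_int (z * p) \<le> (6 * \<beta>) * real_of_int (\<alpha> * k)"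
      using p by (simp add: Y_def field_simps)
    also have "\<dots> \<longleftrightarrow> real_of_int (z * p) \<le> real_of_int (\<alpha> * k)" using ab by (subst mult_le_cancel_left_pos) auto
    finally show "real_of_int (z * (6 * \<beta>)) \<le> Y \<longleftrightarrow> z * p \<le> \<alpha> * k" by linarith
  qed
  have cmp: "z \<ge> w + 1 \<Longrightarrow> \<alpha> * p * z \<ge> \<alpha> * p * w + \<alpha> * p" for z w
    using mult_left_mono[of "w + 1" z "\<alpha> * p"] ap by (simp add: algebra_simps)
  have X: "x \<le> q + of_bool ((\<alpha> - f) * p < \<alpha> * k)"
  proof (cases "x \<le> q")
    case False
    hence "(\<alpha> - f) * p < \<alpha> * k" using cmp[of q x] x' by (simp add: algebra_simps)
    moreover have "x \<le> q + 1"
    proof (rule ccontr)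
      assume "\<not> x \<le> q + 1"
      hence "\<alpha> * p * x \<ge> \<alpha> * p * (q + 1) + \<alpha> * p" using cmp[of "q + 1" x] by simp
      thus False using x' pf ak by (simp add: algebra_simps)
    qed
    ultimately show ?thesis by simp
  qed auto
  have Yb: "y \<le> q - of_bool (f * p \<le> \<alpha> * k)"
  proof -
    have "y \<le> q"
    proof (rule ccontr)
      assume "\<not> y \<le> q"
      thus False using cmp[of q y] y' pf ak by simp
    qed
    moreover have "y \<noteq> q" if "f * p \<le> \<alpha> * k" using y' that by (auto simp: algebra_simps)
    ultimately show ?thesis by auto
  qed
  have "cnt p 1 (L * N) k = x + y + 1" unfolding x_def y_def
    using cnt_eq_floor[of p 1 k "L * N"] p k L N by simp
  thus ?thesis using X Yb unfolding Y_iff q_def[symmetric] f_def[symmetric] by linarith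
qed

text \<open>The counterpart for the numerator, where counts are bounded from below and the upper end
  of the cell enters: \<open>H / \<beta>\<close> is a lower bound for \<open>M / p\<close>. The
  second claim is the first with \<open>j\<close> and \<open>d\<close> negated.\<close>

lemma zero_aux:
  fixes d M H :: int
  assumes H: "H * p \<le> \<beta> * M"
  shows "(j * \<beta> - H mod \<beta>) * p \<le> d * \<beta> * k \<Longrightarrow> H div \<beta> + j \<le> (M + d * k) div p"
    and "d * \<beta> * k \<le> (H mod \<beta> + j * \<beta>) * p \<Longrightarrow> H div \<beta> - j \<le> (M - d * k) div p"
proof -
  define q where "q = H div \<beta>"
  define f where "f = H mod \<beta>"
  have f: "H = \<beta> * q + f" using ab by (simp_all add: q_def f_def)
  have 1: "H div \<beta> + j \<le> (M + d * k) div p" if "(j * \<beta> - H mod \<beta>) * p \<le> d * \<beta> * k" for j d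
  proof -
    have "\<beta> * ((q + j) * p) \<le> \<beta> * (M + d * k)"
    proof -
      have "(j * \<beta> - f) * p \<le> d * \<beta> * k" using that by (simp only: f_def)
      moreover have "(\<beta> * q + f) * p \<le> \<beta> * M" using H by (simp only: f[symmetric])
      ultimately show ?thesis by (simp add: algebra_simps)
    qed
    hence "(q + j) * p \<le> M + d * k" using ab by simp
    from zdiv_mono1[OF this p] show ?thesis using p by (simp add: q_def)
  qed
  show "(j * \<beta> - H mod \<beta>) * p \<le> d * \<beta> * k \<Longrightarrow> H div \<beta> + j \<le> (M + d * k) div p" by (rule 1)
  show "d * \<beta> * k \<le> (H mod \<beta> + j * \<beta>) * p \<Longrightarrow> H div \<beta> - j \<le> (M - d * k) div p"
    using 1[of "-j" "-d"] by (simp add: algebra_simps)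
qed

lemma Y_iff:
  assumes "c * d = 6" "d > (0::int)"
  shows "real_of_int (z * c * \<alpha>) < Y \<longleftrightarrow> z * p < d * \<beta> * k"
    and "real_of_int (z * c * \<alpha>) \<le> Y \<longleftrightarrow> z * p \<le> d * \<beta> * k"
proof -
  have "c > 0" using assms by (metis zero_less_mult_pos2 zero_less_numeral)
  have Y: "Y = real_of_int (c * \<alpha>) * real_of_int (d * \<beta> * k) / p"
    using assms(1) by (simp add: Y_def field_simps flip: of_int_mult)
  have ca: "real_of_int (c * \<alpha>) > 0" using \<open>c > 0\<close> ab by simp
  have "real_of_int (z * c * \<alpha>) < Y \<longleftrightarrow> real_of_int (c * \<alpha>) * real_of_int (z * p) < real_of_int (c * \<alpha>) * real_of_int (d * \<beta> * k)"
    using p unfolding Y by (simp add: field_simps)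
  thus "real_of_int (z * c * \<alpha>) < Y \<longleftrightarrow> z * p < d * \<beta> * k"
    using ca by (simp only: mult_less_cancel_left_pos of_int_less_iff)
  have "real_of_int (z * c * \<alpha>) \<le> Y \<longleftrightarrow> real_of_int (c * \<alpha>) * real_of_int (z * p) \<le> real_of_int (c * \<alpha>) * real_of_int (d * \<beta> * k)"
    using p unfolding Y by (simp add: field_simps)
  thus "real_of_int (z * c * \<alpha>) \<le> Y \<longleftrightarrow> z * p \<le> d * \<beta> * k"
    using ca by (simp only: mult_le_cancel_left_pos of_int_le_iff)
qed

lemma cnt_halves_ge:
  "cnt p 2 (242 * N) k \<ge> 2 * (1936 div \<beta>) + 1 + of_bool (real_of_int (3 * \<alpha> * \<beta> - (1936 mod \<beta>) * 3 * \<alpha>) \<le> Y)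
     - of_bool (real_of_int ((1936 mod \<beta>) * 3 * \<alpha>) < Y)"
proof -
  let ?g = "1936 mod \<beta>"
  have H: "1936 * p \<le> \<beta> * (242 * N)" using cell(2) by linarith
  have g: "0 \<le> ?g" using ab by simp
  have e1: "3 * \<alpha> * \<beta> - ?g * 3 * \<alpha> = (1 * \<beta> - ?g) * 3 * \<alpha>" by (simp add: algebra_simps)
  have g0: "(0 * \<beta> - ?g) * p \<le> 2 * \<beta> * k"
  proof -
    have "0 \<le> ?g * p" "0 \<le> 2 * \<beta> * k" using g p ab k by simp_all
    thus ?thesis by simp
  qed
  have x: "(242 * N + 2 * k) div p \<ge> 1936 div \<beta> + of_bool (real_of_int (3 * \<alpha> * \<beta> - ?g * 3 * \<alpha>) \<le> Y)"
    unfolding e1 using zero_aux(1)[OF H, of 1 2] zero_aux(1)[OF H g0] Y_iff(2)[of 3 2 "1 * \<beta> - ?g"] 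
    by auto
  have "2 * k * \<beta> \<le> p * \<beta>" using k ab by (intro mult_right_mono; simp)
  moreover have "?g * p \<ge> 0" using p g by simp
  ultimately have "2 * \<beta> * k \<le> (?g + 1 * \<beta>) * p" by (simp add: algebra_simps)
  hence y: "(242 * N - 2 * k) div p \<ge> 1936 div \<beta> - of_bool (real_of_int (?g * 3 * \<alpha>) < Y)"
    using zero_aux(2)[OF H, of 2 0] zero_aux(2)[OF H, of 2 1] Y_iff(1)[of 3 2 ?g] by (auto simp: not_less)
  have "cnt p 2 (242 * N) k = (242 * N + 2 * k) div p + (242 * N - 2 * k) div p + 1"
    using cnt_eq_floor[of p 2 k "242 * N"] p k N by simp
  thus ?thesis using x y by linarith
qed

text \<open>\<open>3 * k / p\<close> runs up to 3/2, so each of the two floors can change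
  twice.\<close>

lemma cnt_thirds_ge:
  assumes "3 * k - p \<le> 363 * N"
  shows "cnt p 3 (363 * N) k \<ge> 2 * (2904 div \<beta>) + 1 
     + of_bool (real_of_int (2 * \<alpha> * \<beta> - (2904 mod \<beta>) * 2 * \<alpha>) \<le> Y)
     + of_bool (real_of_int (2 * (2 * \<alpha> * \<beta>) - (2904 mod \<beta>) * 2 * \<alpha>) \<le> Y)
     - of_bool (real_of_int ((2904 mod \<beta>) * 2 * \<alpha>) < Y)
     - of_bool (real_of_int (2 * \<alpha> * \<beta> + (2904 mod \<beta>) * 2 * \<alpha>) < Y)"
proof -
  let ?g = "2904 mod \<beta>"
  have H: "2904 * p \<le> \<beta> * (363 * N)" using cell(2) by linarith
  have g: "0 \<le> ?g" "?g < \<beta>" using ab by simp_all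
  have e1: "2 * \<alpha> * \<beta> - ?g * 2 * \<alpha> = (1 * \<beta> - ?g) * 2 * \<alpha>" 
    "2 * (2 * \<alpha> * \<beta>) - ?g * 2 * \<alpha> = (2 * \<beta> - ?g) * 2 * \<alpha>"
    "2 * \<alpha> * \<beta> + ?g * 2 * \<alpha> = (?g + 1 * \<beta>) * 2 * \<alpha>" by (simp_all add: algebra_simps)
  have mono: "(1 * \<beta> - ?g) * p \<le> (2 * \<beta> - ?g) * p" "?g * p \<le> (?g + 1 * \<beta>) * p"
    using ab p by (intro mult_right_mono; simp)+
  have g0: "(0 * \<beta> - ?g) * p \<le> 3 * \<beta> * k"
  proof -
    have "0 \<le> ?g * p" "0 \<le> 3 * \<beta> * k" using g p ab k by simp_all
    thus ?thesis by simp
  qed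
  have x: "(363 * N + 3 * k) div p \<ge> 2904 div \<beta> + of_bool (real_of_int (2 * \<alpha> * \<beta> - ?g * 2 * \<alpha>) \<le> Y)
           + of_bool (real_of_int (2 * (2 * \<alpha> * \<beta>) - ?g * 2 * \<alpha>) \<le> Y)"
    unfolding e1 using zero_aux(1)[OF H, of 1 3] zero_aux(1)[OF H g0] zero_aux(1)[OF H, of 2 3]
      Y_iff(2)[of 2 3 "1 * \<beta> - ?g"] Y_iff(2)[of 2 3 "2 * \<beta> - ?g"] mono
    by auto
  have "3 * k * \<beta> \<le> 2 * p * \<beta>" using k ab by (intro mult_right_mono; simp)
  moreover have "?g * p \<ge> 0" using p g by simp
  ultimately have "3 * \<beta> * k \<le> (?g + 2 * \<beta>) * p" by (simp add: algebra_simps)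
  hence y: "(363 * N - 3 * k) div p \<ge> 2904 div \<beta> - of_bool (real_of_int (?g * 2 * \<alpha>) < Y)
             - of_bool (real_of_int (2 * \<alpha> * \<beta> + ?g * 2 * \<alpha>) < Y)"
    unfolding e1 using zero_aux(2)[OF H, of 3 0] zero_aux(2)[OF H, of 3 1] zero_aux(2)[OF H, of 3 2] 
      Y_iff(1)[of 2 3 ?g] Y_iff(1)[of 2 3 "?g + 1 * \<beta>"] mono by (auto simp: not_less)
  have "cnt p 3 (363 * N) k = (363 * N + 3 * k) div p + (363 * N - 3 * k) div p + 1"
    using cnt_eq_floor[of p 3 k "363 * N"] p k N assms by simp
  thus ?thesis using x y by linarith
qed

text \<open>The three estimates bound the count by the base value plus the up steps passed minus the
  down steps passed. The steps before \<open>lo\<close> are passed in any case, those beyond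
  \<open>hi\<close> never, and the rest are swept.\<close>

lemma cell_max_bound_reduced:
  assumes lo: "p - k \<le> 53 * N"
  shows "(\<Sum>L\<leftarrow>block_lens. cnt p 1 (L * N) k) - cnt p 2 (242 * N) k - cnt p 3 (363 * N) k \<le> cell_max \<alpha> \<beta>"
proof -
  let ?u = "\<lambda>L. (\<alpha> - 8 * L mod \<alpha>) * (6 * \<beta>)" and ?d = "\<lambda>L. (8 * L mod \<alpha>) * (6 * \<beta>)"
  have lo3: "3 * k - p \<le> 363 * N" using lo k N by linarith
  have pos: "L > 0" if "L \<in> set block_lens" for L using that by (auto simp: block_lens_def)
  have "(\<Sum>L\<leftarrow>block_lens. cnt p 1 (L * N) k) \<le>
     (\<Sum>L\<leftarrow>block_lens. 2 * (8 * L div \<alpha>) + 1 + of_bool (real_of_int (?u L) < Y) - of_bool (real_of_int (?d L) \<le> Y))"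
    by (intro sum_list_mono cnt_block_le pos)
  also have "\<dots> = (\<Sum>L\<leftarrow>block_lens. 2 * (8 * L div \<alpha>) + 1) 
      + int (length (filter (\<lambda>u. real_of_int u < Y) (map ?u block_lens)))
      - int (length (filter (\<lambda>u. real_of_int u \<le> Y) (map ?d block_lens)))"
    by (simp add: sum_list_addf sum_list_subtractf filter_map o_def flip: sum_list_of_bool)
  finally have 1: "(\<Sum>L\<leftarrow>block_lens. cnt p 1 (L * N) k) - cnt p 2 (242 * N) k - cnt p 3 (363 * N) k \<le>
      base_count \<alpha> \<beta> + int (length (filter (\<lambda>u. real_of_int u < Y) (ups \<alpha> \<beta>)))
      - int (length (filter (\<lambda>u. real_of_int u \<le> Y) (downs \<alpha> \<beta>)))"
    using cnt_halves_ge cnt_thirds_ge[OF lo3]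
    unfolding base_count_def ups_def downs_def Let_def filter_append length_append of_nat_add
      length_filter_Cons list.size of_nat_0 filter.simps(1) by linarith
  define lo where "lo = max 0 (6 * \<beta> * (\<alpha> - 424))"
  define hi where "hi = 3 * \<alpha> * \<beta>"
  have Y0: "Y \<ge> 0" using p ab k by (simp add: Y_def)
  have "8 * \<alpha> * (p - k) \<le> 8 * \<alpha> * (53 * N)" using lo ab by (intro mult_left_mono) auto
  also have "\<dots> = 424 * (\<alpha> * N)" by simp
  also have "\<dots> \<le> 424 * (8 * p)" using cell(1) by linarith
  finally have "\<alpha> * (p - k) \<le> 424 * p" by simp
  hence "(\<alpha> - 424) * p \<le> \<alpha> * k" by (simp add: algebra_simps)
  hence "6 * \<beta> * ((\<alpha> - 424) * p) \<le> 6 * \<beta> * (\<alpha> * k)" using ab by (intro mult_left_mono) auto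
  hence "real_of_int (6 * \<beta> * (\<alpha> - 424) * p) \<le> real_of_int (6 * \<beta> * (\<alpha> * k))" 
    by (simp only: of_int_le_iff mult.assoc)
  hence "real_of_int (6 * \<beta> * (\<alpha> - 424)) \<le> Y" using p by (simp add: Y_def field_simps)
  hence loY: "real_of_int lo \<le> Y" using Y0 by (simp add: lo_def max_def)
  have "6 * \<alpha> * \<beta> * k \<le> 3 * \<alpha> * \<beta> * p" using mult_left_mono[OF k(2), of "3 * \<alpha> * \<beta>"] ab by simp
  hence "real_of_int (6 * \<alpha> * \<beta> * k) \<le> real_of_int (3 * \<alpha> * \<beta> * p)" by (simp only: of_int_le_iff)
  hence hiY: "Y \<le> real_of_int hi" using p by (simp add: Y_def hi_def field_simps)
  have nlt: "\<not> hi < lo" using loY hiY by linarith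
  note 1
  also have "base_count \<alpha> \<beta> + int (length (filter (\<lambda>u. real_of_int u < Y) (ups \<alpha> \<beta>)))
      - int (length (filter (\<lambda>u. real_of_int u \<le> Y) (downs \<alpha> \<beta>))) =
     (base_count \<alpha> \<beta> + int (length (filter (\<lambda>x. x < lo) (ups \<alpha> \<beta>))) - int (length (filter (\<lambda>x. x \<le> lo) (downs \<alpha> \<beta>))))
     + int (length (filter (\<lambda>u. real_of_int u < Y) (sort (filter (\<lambda>x. lo \<le> x \<and> x \<le> hi) (ups \<alpha> \<beta>)))))
     - int (length (filter (\<lambda>u. real_of_int u \<le> Y) (sort (filter (\<lambda>x. lo < x \<and> x \<le> hi) (downs \<alpha> \<beta>)))))"
    unfolding length_filter_sort length_filter_split(1)[OF loY hiY, of "ups \<alpha> \<beta>"] 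
      length_filter_split(2)[OF loY hiY, of "downs \<alpha> \<beta>"] by simp
  also have "\<dots> \<le> max_prefix
       (base_count \<alpha> \<beta> + int (length (filter (\<lambda>x. x < lo) (ups \<alpha> \<beta>))) - int (length (filter (\<lambda>x. x \<le> lo) (downs \<alpha> \<beta>))))
       (sort (filter (\<lambda>x. lo \<le> x \<and> x \<le> hi) (ups \<alpha> \<beta>))) (sort (filter (\<lambda>x. lo < x \<and> x \<le> hi) (downs \<alpha> \<beta>)))"
    by (intro max_prefix_bound) auto
  also have "\<dots> \<le> cell_max \<alpha> \<beta>"
    using nlt unfolding cell_max_def Let_def lo_def hi_def by simp
  finally show ?thesis .
qed

end

text \<open>\<open>cnt\<close> depends only on the residue of \<open>k\<close> and is even in it, so
  the residue may be taken at most p/2. Two distinct poles with least residue \<open>j\<close>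
  cannot both equal \<open>j\<close>, and one that differs has absolute value at least
  \<open>p - j\<close>.\<close>

lemma cell_max_bound:
  fixes p N k k' \<alpha> \<beta> :: int
  assumes "p > 0" "N \<ge> 0" "\<alpha> > 0" "\<beta> > 0" "\<alpha> * N < 8 * p" "8 * p \<le> \<beta> * N"
    and "\<bar>k\<bar> \<le> 53 * N" "\<bar>k'\<bar> \<le> 53 * N" "k \<noteq> k'" "p dvd (k - k')"
  shows "(\<Sum>L\<leftarrow>block_lens. cnt p 1 (L * N) k) - cnt p 2 (242 * N) k - cnt p 3 (363 * N) k \<le> cell_max \<alpha> \<beta>"
proof -
  let ?F = "\<lambda>k. (\<Sum>L\<leftarrow>block_lens. cnt p 1 (L * N) k) - cnt p 2 (242 * N) k - cnt p 3 (363 * N) k"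
  have main: "?F k \<le> cell_max \<alpha> \<beta>"
    if k: "\<bar>k\<bar> \<le> 53 * N" "\<bar>k'\<bar> \<le> 53 * N" "k \<noteq> k'" "p dvd (k - k')" and small: "2 * (k mod p) \<le> p" for k k'
  proof -
    define j where "j = k mod p"
    have j: "0 \<le> j" "2 * j \<le> p" "j < p" using small \<open>p > 0\<close> by (auto simp: j_def)
    have kj: "k = j + p * (k div p)" by (simp add: j_def)
    have kj': "k' = j + p * (k' div p)" using that(4) by (simp add: j_def mod_eq_dvd_iff[symmetric])
    have far: "p - j \<le> \<bar>j + p * m\<bar>" if "m \<noteq> 0" for m
    proof (cases "m > 0")
      case True
      hence "p * m \<ge> p * 1" using \<open>p > 0\<close> by (intro mult_left_mono) auto
      thus ?thesis using j by linarith
    next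
      case False
      hence "p * m \<le> p * (-1)" using \<open>p > 0\<close> that by (intro mult_left_mono) auto
      thus ?thesis using j by linarith
    qed
    have "k div p \<noteq> 0 \<or> k' div p \<noteq> 0" using kj kj' that(3) by force
    hence "p - j \<le> 53 * N" using far[of "k div p"] far[of "k' div p"] k(1,2) kj kj' by force
    hence "?F j \<le> cell_max \<alpha> \<beta>" using assms j by (intro cell_max_bound_reduced) auto
    moreover have "?F k = ?F j" by (subst (1 2 3) kj) (simp add: cnt_shift)
    ultimately show ?thesis by simp
  qed
  show ?thesis
  proof (cases "2 * (k mod p) \<le> p")
    case True
    thus ?thesis using main[of k k'] assms by auto
  next
    case False
    have "k mod p \<noteq> 0" using False \<open>p > 0\<close> by auto
    hence "(-k) mod p = p - k mod p" using zmod_zminus1_eq_if[of k p] by simp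
    hence s: "2 * ((-k) mod p) \<le> p" using False by simp
    have "p dvd (- k - (- k'))" using assms(10) by (metis dvd_minus_iff minus_diff_eq minus_diff_commute uminus_add_conv_diff add.commute diff_minus_eq_add)
    hence "?F (- k) \<le> cell_max \<alpha> \<beta>" using main[of "-k" "-k'"] assms s by auto
    thus ?thesis by (simp add: cnt_uminus)
  qed
qed

section \<open>Valuations of the coefficients and of the polar parts\<close>

lemma cnt_bounds:
  assumes q: "q > 0" and M: "M \<ge> 0"
  shows "(2 * M) div q \<le> cnt q d M k" "cnt q d M k \<le> (2 * M) div q + 1"
proof -
  define A where "A = d * k + M"
  define B where "B = d * k - M - 1"
  have "bij_betw (\<lambda>m. d * k - q * m) {B div q<..A div q} {u. \<bar>u\<bar> \<le> M \<and> q dvd (d * k - u)}"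
  proof (rule bij_betwI[where g = "\<lambda>u. (d * k - u) div q"])
    have "\<bar>d * k - q * m\<bar> \<le> M" if "B div q < m" "m \<le> A div q" for m
    proof -
      have "q * m \<le> q * (A div q)" "q * (B div q + 1) \<le> q * m" using that q by (intro mult_left_mono; simp)+
      moreover have "q * (A div q) \<le> A" "B < q * (B div q + 1)" 
        using q by (simp_all add: minus_mod_eq_mult_div [symmetric] distrib_left)
      ultimately show ?thesis by (simp add: A_def B_def abs_le_iff)
    qed
    thus "(\<lambda>m. d * k - q * m) \<in> {B div q<..A div q} \<rightarrow> {u. \<bar>u\<bar> \<le> M \<and> q dvd (d * k - u)}" by auto
    have "B div q < (d * k - u) div q \<and> (d * k - u) div q \<le> A div q" if u: "\<bar>u\<bar> \<le> M" "q dvd d * k - u" for u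
    proof -
      obtain m where m: "d * k - u = q * m" using u(2) by (auto elim: dvdE)
      have "q * m \<le> A" "B < q * m" using u(1) by (simp_all add: A_def B_def flip: m)
      have "q * (B div q) \<le> B" using q by (simp add: minus_mod_eq_mult_div [symmetric])
      hence "q * (B div q) < q * m" using \<open>B < q * m\<close> by simp
      hence "B div q < m" using q by (simp only: mult_less_cancel_left_pos)
      moreover have "m \<le> A div q" using q zdiv_mono1[OF \<open>q * m \<le> A\<close> q] by simp
      ultimately have "m \<le> A div q" "B div q < m" by simp_all
      thus ?thesis using m q by simp
    qed
    thus "(\<lambda>u. (d * k - u) div q) \<in> {u. \<bar>u\<bar> \<le> M \<and> q dvd (d * k - u)} \<rightarrow> {B div q<..A div q}" by auto
  qed (use q in auto)
  from bij_betw_same_card[OF this]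
  have c: "cnt q d M k = int (nat (A div q - B div q))" unfolding cnt_def by simp
  have A: "A = B + (2 * M + 1)" by (simp add: A_def B_def)
  have e: "A = q * (A div q) + A mod q" "B = q * (B div q) + B mod q" "2 * M = q * ((2 * M) div q) + (2 * M) mod q" by simp_all
  have r: "0 \<le> A mod q" "A mod q < q" "0 \<le> B mod q" "B mod q < q" "0 \<le> (2 * M) mod q" "(2 * M) mod q < q" using q by simp_all
  define x where "x = A div q - B div q - (2 * M) div q"
  have eq: "q * x = B mod q + (2 * M) mod q + 1 - A mod q"
    unfolding x_def right_diff_distrib using A e by linarith
  have "x > - 1"
  proof (rule ccontr)
    assume "\<not> x > - 1"
    hence "q * x \<le> q * (- 1)" using q by (intro mult_left_mono) auto
    thus False using eq r by linarith
  qed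
  moreover have "x < 2"
  proof (rule ccontr)
    assume "\<not> x < 2"
    hence "q * x \<ge> q * 2" using q by (intro mult_left_mono) auto
    thus False using eq r by linarith
  qed
  moreover have "(2 * M) div q \<ge> 0" using q M by (simp add: pos_imp_zdiv_nonneg_iff)
  ultimately show "(2 * M) div q \<le> cnt q d M k" "cnt q d M k \<le> (2 * M) div q + 1"
    unfolding c by (simp_all add: x_def)
qed

text \<open>The contribution of \<open>q = p ^ i\<close> to the exponent of \<open>p\<close> in
  \<open>norm_factor\<close> by Legendre's formula.\<close>

definition norm_exp :: "nat \<Rightarrow> int \<Rightarrow> int" where
  "norm_exp N q = (\<Sum>L\<leftarrow>block_lens. (2 * (L * int N)) div q) - (484 * int N) div q - (726 * int N) div q"

text \<open>The excess of the multiples of \<open>q\<close> in the denominator over those supplied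
  by the numerator and the normalising factorials.\<close>

definition cost :: "nat \<Rightarrow> int \<Rightarrow> int \<Rightarrow> int" where
  "cost N q k = (\<Sum>L\<leftarrow>block_lens. cnt q 1 (L * int N) k) - cnt q 2 (242 * int N) k - cnt q 3 (363 * int N) k - norm_exp N q"

lemma sum_list_block_lens: "(\<Sum>L\<leftarrow>block_lens. f L) = (\<Sum>L\<in>{19..53}. f L) + f 53 + f (121 :: int)" for f :: "int \<Rightarrow> int"
proof -
  have "(\<Sum>L\<leftarrow>[19..53]. f L) = (\<Sum>L\<in>{19..53}. f L)"
    by (simp only: sum_list_distinct_conv_sum_set distinct_upto set_upto)
  thus ?thesis by (simp add: block_lens_def)
qed

lemma length_block_lens: "length block_lens = 37"
  by (simp add: block_lens_def)

lemma block_lens_pos: "L \<in> set block_lens \<Longrightarrow> L > 0"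
  by (auto simp: block_lens_def)

text \<open>\<open>2 * M + 1\<close> consecutive integers contain \<open>2 * M div q\<close>
  multiples of \<open>q\<close> or one more, and only the 37 blocks can have the additional one to
  their disadvantage.\<close>

lemma cost_le:
  assumes "q > 0"
  shows "cost N q k \<le> 37"
proof -
  have "(\<Sum>L\<leftarrow>block_lens. cnt q 1 (L * int N) k) \<le> (\<Sum>L\<leftarrow>block_lens. (2 * (L * int N)) div q + 1)"
    using block_lens_pos assms by (intro sum_list_mono cnt_bounds) (auto intro!: mult_nonneg_nonneg intro: less_imp_le)
  also have "\<dots> = (\<Sum>L\<leftarrow>block_lens. (2 * (L * int N)) div q) + 37"
    by (simp add: sum_list_addf sum_list_triv length_block_lens)
  finally show ?thesis
    using cnt_bounds(1)[OF assms, of "242 * int N" 2 k] cnt_bounds(1)[OF assms, of "363 * int N" 3 k]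
    by (simp add: cost_def norm_exp_def)
qed

context
  fixes p \<Lambda> N :: nat
  assumes p: "prime p" and \<Lambda>: "726 * N < p ^ Suc \<Lambda>"
begin

private abbreviation (input) mult :: "int \<Rightarrow> nat" where "mult \<equiv> multiplicity (int p)"

text \<open>\<open>726 * N\<close> dominates all differences and all factorial arguments to which
  this is applied, so no power beyond \<open>p ^ \<Lambda>\<close> ever divides one of them.\<close>

lemma multiplicity_le:
  assumes "x \<noteq> 0" "\<bar>x\<bar> \<le> 726 * int N"
  shows "mult x \<le> \<Lambda>"
proof (rule ccontr)
  assume "\<not> mult x \<le> \<Lambda>"
  hence "int p ^ Suc \<Lambda> dvd x" by (intro multiplicity_dvd') auto
  hence "int p ^ Suc \<Lambda> \<le> \<bar>x\<bar>" using assms by (intro zdvd_imp_le) auto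
  also have "\<dots> \<le> int (726 * N)" using assms by simp
  also have "\<dots> < int (p ^ Suc \<Lambda>)" using \<Lambda> by (simp only: of_nat_less_iff)
  finally show False by simp
qed

lemma multiplicity_eq_sum:
  assumes "x \<noteq> 0" "\<bar>x\<bar> \<le> 726 * int N"
  shows "int (mult x) = (\<Sum>i=1..\<Lambda>. of_bool (int p ^ i dvd x))"
proof -
  have "(\<Sum>i=1..\<Lambda>. of_bool (int p ^ i dvd x)) = (\<Sum>i=1..\<Lambda>. of_bool (i \<le> mult x) :: int)"
    using assms p prime_gt_1_nat[OF p] by (intro sum.cong refl) (subst power_dvd_iff_le_multiplicity, auto)
  also have "\<dots> = (\<Sum>i=1..mult x. 1)"
    using multiplicity_le[OF assms] by (intro sum.mono_neutral_cong_right) auto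
  finally show ?thesis by simp
qed

lemma sum_multiplicity_block:
  assumes M: "0 \<le> M" and b: "M + \<bar>d * k\<bar> \<le> 726 * int N"
  shows "(\<Sum>u\<in>{-M..M} - {d * k}. int (mult (d * k - u))) = (\<Sum>i=1..\<Lambda>. cnt (int p ^ i) d M k - of_bool (\<bar>d * k\<bar> \<le> M))"
proof -
  have "(\<Sum>u\<in>{-M..M} - {d * k}. int (mult (d * k - u))) = (\<Sum>u\<in>{-M..M} - {d * k}. \<Sum>i=1..\<Lambda>. of_bool (int p ^ i dvd (d * k - u)))"
    using b by (intro sum.cong refl multiplicity_eq_sum) auto
  also have "\<dots> = (\<Sum>i=1..\<Lambda>. \<Sum>u\<in>{-M..M} - {d * k}. of_bool (int p ^ i dvd (d * k - u)))" by (rule sum.swap)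
  also have "\<dots> = (\<Sum>i=1..\<Lambda>. cnt (int p ^ i) d M k - of_bool (\<bar>d * k\<bar> \<le> M))"
  proof (intro sum.cong refl)
    fix i
    have "(\<Sum>u\<in>{-M..M}. of_bool (int p ^ i dvd (d * k - u))) = cnt (int p ^ i) d M k"
      unfolding cnt_def by (simp add: sum.If_cases of_bool_def Int_def abs_le_iff conj_commute conj_left_commute)
         (intro arg_cong[where f = card], auto)
    moreover have "(\<Sum>u\<in>{-M..M} - {d * k}. f u) = (\<Sum>u\<in>{-M..M}. f u) - (if d * k \<in> {-M..M} then f (d * k) else 0)" for f :: "int \<Rightarrow> int"
      by (simp add: sum_diff1)
    ultimately show "(\<Sum>u\<in>{-M..M} - {d * k}. of_bool (int p ^ i dvd (d * k - u))) = cnt (int p ^ i) d M k - of_bool (\<bar>d * k\<bar> \<le> M)"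
      by (simp only: abs_le_iff) auto
  qed
  finally show ?thesis .
qed

lemma multiplicity_fact: "n \<le> 726 * N \<Longrightarrow> int (mult (fact n)) = (\<Sum>i=1..\<Lambda>. int n div int p ^ i)"
proof (induction n)
  case (Suc n)
  have "mult (fact (Suc n)) = mult (int (Suc n)) + mult (fact n)"
    unfolding fact_Suc using p by (subst prime_elem_multiplicity_mult_distrib) auto
  moreover have "int (mult (int (Suc n))) = (\<Sum>i=1..\<Lambda>. of_bool (int p ^ i dvd int (Suc n)))"
    using Suc.prems by (intro multiplicity_eq_sum) auto
  moreover have "int (Suc n) div int p ^ i = int n div int p ^ i + of_bool (int p ^ i dvd int (Suc n))" for i
  proof -
    have "int (Suc n div p ^ i) = int (n div p ^ i) + of_bool (p ^ i dvd Suc n)"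
      by (simp add: div_Suc dvd_eq_mod_eq_0)
    thus ?thesis by (simp only: of_nat_power[symmetric] of_nat_div of_nat_dvd_iff)
  qed
  ultimately show ?case using Suc by (simp only: sum.distrib) simp
qed (use p in auto)

lemma pval_fact:
  assumes "n \<le> 726 * N"
  shows "pval p (\<Sum>i=1..\<Lambda>. int n div int p ^ i) (fact n)" "pval p (- (\<Sum>i=1..\<Lambda>. int n div int p ^ i)) (1 / fact n)"
  using pval_multiplicity[OF p, of "fact n"] multiplicity_fact[OF assms] by simp_all

lemma pval_norm_factor: "pval p (\<Sum>i=1..\<Lambda>. norm_exp N (int p ^ i)) (norm_factor N)"
proof -
  let ?v = "\<lambda>n. \<Sum>i=1..\<Lambda>. int n div int p ^ i"
  have "pval p (?v (242 * N) + ?v (106 * N) + (\<Sum>L\<in>{19..53}. ?v (2 * L * N)) + - ?v (484 * N) + - ?v (726 * N))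
     (fact (242 * N) * fact (106 * N) * (\<Prod>L\<in>{19..53}. fact (2 * L * N)) * (1 / fact (484 * N)) * (1 / fact (726 * N)))"
    by (intro pval_mult p pval_prod pval_fact) auto
  also have "fact (242 * N) * fact (106 * N) * (\<Prod>L\<in>{19..53}. fact (2 * L * N)) * (1 / fact (484 * N)) * (1 / fact (726 * N)) = norm_factor N"
    by (simp add: norm_factor_def)
  also have "?v (242 * N) + ?v (106 * N) + (\<Sum>L\<in>{19..53}. ?v (2 * L * N)) + - ?v (484 * N) + - ?v (726 * N) =
     (\<Sum>i=1..\<Lambda>. norm_exp N (int p ^ i))"
  proof -
    have "(\<Sum>L\<in>{19..53}. ?v (2 * L * N)) = (\<Sum>i=1..\<Lambda>. \<Sum>L\<in>{19..53}. int (2 * L * N) div int p ^ i)" by (rule sum.swap)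
    also have "\<dots> = (\<Sum>i=1..\<Lambda>. \<Sum>L\<in>{19..53}. (2 * (L * int N)) div int p ^ i)"
      by (intro sum.cong refl sum.reindex_bij_witness[of _ nat int]) (auto simp: mult.assoc)
    finally show ?thesis
      by (simp add: norm_exp_def sum_list_block_lens sum.distrib sum_subtractf)
  qed
  finally show ?thesis .
qed

text \<open>Once the cancelled factors are restored, each level \<open>p ^ i\<close> contributes a
  difference of counts over full intervals. The missing factor at \<open>k\<close> itself lowers the
  count of every block containing \<open>k\<close>, which yields \<open>pole_order N k\<close>; for
  the two numerator products and the two restored blocks this effect cancels.\<close>

lemma local_series_val:
  assumes k: "k \<in> poles N"
  shows "fval p (\<Sum>i=1..\<Lambda>. int (pole_order N k) - cost N (int p ^ i) k) \<Lambda> (local_series N k)"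
proof -
  have kb: "\<bar>k\<bar> \<le> 53 * int N" using k by auto
  have LN: "L * int N \<le> 53 * int N" if "L \<in> {19..53}" for L using that by (intro mult_right_mono) auto
  let ?n2 = "\<Sum>u\<in>zeros2 N. int (mult (2 * k - u))"
  let ?n3 = "\<Sum>u\<in>zeros3 N. int (mult (3 * k - u))"
  let ?den = "\<Sum>L\<in>{19..53}. \<Sum>j\<in>block N L - {k}. - int (mult (k - j))"
  let ?S = "\<lambda>d M. \<Sum>u\<in>{-M..M} - {d * k}. int (mult (d * k - u))"
  have m23: "pval p (int (mult 2)) 2" "pval p (int (mult 3)) 3"
    using pval_multiplicity(1)[OF p, of 2] pval_multiplicity(1)[OF p, of 3] by simp_all
  have lead: "pval p ((\<Sum>i=1..\<Lambda>. norm_exp N (int p ^ i)) + int (mult 2) * int (242 * N + 1) + int (mult 3) * int (106 * N + 1)) (lead N)"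
    unfolding lead_def by (intro pval_mult pval_power pval_norm_factor m23 p)
  have "fval p ((\<Sum>i=1..\<Lambda>. norm_exp N (int p ^ i)) + int (mult 2) * int (242 * N + 1) + int (mult 3) * int (106 * N + 1) + ?n2 + ?n3 + ?den) \<Lambda> (local_series N k)"
    unfolding local_series_def
  proof (intro fval_mult fval_prod fval_const lead fval_linear fval_linv p multiplicity_le)
    fix u assume u: "u \<in> zeros2 N"
    thus "2 * k - u \<noteq> 0" by (auto simp: zeros2_def)
    show "\<bar>2 * k - u\<bar> \<le> 726 * int N" using u kb by (auto simp: zeros2_def)
  next
    fix u assume u: "u \<in> zeros3 N"
    thus "3 * k - u \<noteq> 0" using kb by (auto simp: zeros3_def)
    show "\<bar>3 * k - u\<bar> \<le> 726 * int N" using u kb by (auto simp: zeros3_def)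
  next
    fix L j assume "L \<in> {19..53::int}" "j \<in> block N L - {k}"
    thus "k - j \<noteq> 0" "\<bar>k - j\<bar> \<le> 726 * int N" using kb LN[of L] by (auto simp: block_def)
  qed (use kb in \<open>auto simp: zeros2_def zeros3_def\<close>)
  also have "(\<Sum>i=1..\<Lambda>. norm_exp N (int p ^ i)) + int (mult 2) * int (242 * N + 1) + int (mult 3) * int (106 * N + 1) + ?n2 + ?n3 + ?den
     = int (mult 2) + int (mult 3) + (\<Sum>i=1..\<Lambda>. norm_exp N (int p ^ i)) + ?S 2 (242 * int N) + ?S 3 (363 * int N)
       - ?S 1 (121 * int N) - ?S 1 (53 * int N) - (\<Sum>L\<in>{19..53}. ?S 1 (L * int N))"
  proof -
    \<comment> \<open>The even \<open>u\<close> are \<open>2 * z\<close>; the multiplicities of 2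
      that they carry are those of the power of 2 in \<open>lead\<close>, up to one copy.\<close>
    have A: "?S 2 (242 * int N) = ?n2 + (\<Sum>z\<in>{-(121 * int N)..121 * int N} - {k}. int (mult 2) + int (mult (k - z)))"
    proof -
      have "{-(242 * int N)..242 * int N} - {2 * k} = zeros2 N \<union> (\<lambda>z. 2 * z) ` ({-(121 * int N)..121 * int N} - {k})"
        by (auto simp: zeros2_def image_iff elim!: evenE) 
      moreover have "zeros2 N \<inter> (\<lambda>z. 2 * z) ` ({-(121 * int N)..121 * int N} - {k}) = {}" by (auto simp: zeros2_def)
      ultimately have "?S 2 (242 * int N) = ?n2 + (\<Sum>u\<in>(\<lambda>z. 2 * z) ` ({-(121 * int N)..121 * int N} - {k}). int (mult (2 * k - u)))"
        by (simp add: sum.union_disjoint)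
      also have "(\<Sum>u\<in>(\<lambda>z. 2 * z) ` ({-(121 * int N)..121 * int N} - {k}). int (mult (2 * k - u))) =
          (\<Sum>z\<in>{-(121 * int N)..121 * int N} - {k}. int (mult (2 * (k - z))))"
        by (subst sum.reindex) (auto simp: inj_on_def right_diff_distrib)
      also have "\<dots> = (\<Sum>z\<in>{-(121 * int N)..121 * int N} - {k}. int (mult 2) + int (mult (k - z)))"
        using p by (intro sum.cong refl, subst prime_elem_multiplicity_mult_distrib) auto
      finally show ?thesis .
    qed
    have B: "?S 3 (363 * int N) = ?n3 + (\<Sum>z\<in>{-(53 * int N)..53 * int N} - {k}. int (mult 3) + int (mult (k - z)))"
    proof -
      have "{-(363 * int N)..363 * int N} - {3 * k} = zeros3 N \<union> (\<lambda>z. 3 * z) ` ({-(53 * int N)..53 * int N} - {k})"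
        using kb by (auto simp: zeros3_def image_iff elim!: dvdE) 
      moreover have "zeros3 N \<inter> (\<lambda>z. 3 * z) ` ({-(53 * int N)..53 * int N} - {k}) = {}" by (auto simp: zeros3_def)
      ultimately have "?S 3 (363 * int N) = ?n3 + (\<Sum>u\<in>(\<lambda>z. 3 * z) ` ({-(53 * int N)..53 * int N} - {k}). int (mult (3 * k - u)))"
        by (simp add: sum.union_disjoint)
      also have "(\<Sum>u\<in>(\<lambda>z. 3 * z) ` ({-(53 * int N)..53 * int N} - {k}). int (mult (3 * k - u))) =
          (\<Sum>z\<in>{-(53 * int N)..53 * int N} - {k}. int (mult (3 * (k - z))))"
        by (subst sum.reindex) (auto simp: inj_on_def right_diff_distrib)
      also have "\<dots> = (\<Sum>z\<in>{-(53 * int N)..53 * int N} - {k}. int (mult 3) + int (mult (k - z)))"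
        using p by (intro sum.cong refl, subst prime_elem_multiplicity_mult_distrib) auto
      finally show ?thesis .
    qed
    have cards: "card ({-(121 * int N)..121 * int N} - {k}) = 242 * N" "card ({-(53 * int N)..53 * int N} - {k}) = 106 * N"
      using kb by (auto simp: card_Diff_singleton_if)
    have "?den = - (\<Sum>L\<in>{19..53}. ?S 1 (L * int N))" by (simp add: block_def sum_negf)
    moreover have "(\<Sum>z\<in>{-(121 * int N)..121 * int N} - {k}. int (mult 2) + int (mult (k - z))) =
        int (242 * N) * int (mult 2) + ?S 1 (121 * int N)"
      unfolding sum.distrib sum_constant cards by simp
    moreover have "(\<Sum>z\<in>{-(53 * int N)..53 * int N} - {k}. int (mult 3) + int (mult (k - z))) =
        int (106 * N) * int (mult 3) + ?S 1 (53 * int N)"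
      unfolding sum.distrib sum_constant cards by simp
    ultimately show ?thesis unfolding A B by (simp add: algebra_simps)
  qed
  also have "\<dots> = int (mult 2) + int (mult 3) + (\<Sum>i=1..\<Lambda>. int (pole_order N k) - cost N (int p ^ i) k)"
  proof -
    have s: "?S 2 (242 * int N) = (\<Sum>i=1..\<Lambda>. cnt (int p ^ i) 2 (242 * int N) k - 1)"
       "?S 3 (363 * int N) = (\<Sum>i=1..\<Lambda>. cnt (int p ^ i) 3 (363 * int N) k - 1)"
       "?S 1 (121 * int N) = (\<Sum>i=1..\<Lambda>. cnt (int p ^ i) 1 (121 * int N) k - 1)"
       "?S 1 (53 * int N) = (\<Sum>i=1..\<Lambda>. cnt (int p ^ i) 1 (53 * int N) k - 1)"
      using kb by (subst sum_multiplicity_block; auto)+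
    have "(\<Sum>L\<in>{19..53}. ?S 1 (L * int N)) = (\<Sum>L\<in>{19..53}. \<Sum>i=1..\<Lambda>. cnt (int p ^ i) 1 (L * int N) k - of_bool (k \<in> block N L))"
    proof (intro sum.cong refl)
      fix L :: int assume L: "L \<in> {19..53}"
      have "k \<in> block N L \<longleftrightarrow> \<bar>1 * k\<bar> \<le> L * int N" by (auto simp: block_def abs_le_iff)
      thus "?S 1 (L * int N) = (\<Sum>i=1..\<Lambda>. cnt (int p ^ i) 1 (L * int N) k - of_bool (k \<in> block N L))"
        using sum_multiplicity_block[of "L * int N" 1 k] LN[OF L] L kb by auto
    qed
    also have "\<dots> = (\<Sum>i=1..\<Lambda>. \<Sum>L\<in>{19..53}. cnt (int p ^ i) 1 (L * int N) k - of_bool (k \<in> block N L))" by (rule sum.swap)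
    also have "\<dots> = (\<Sum>i=1..\<Lambda>. (\<Sum>L\<in>{19..53}. cnt (int p ^ i) 1 (L * int N) k) - int (pole_order N k))"
      by (simp add: sum_subtractf pole_order_def of_bool_def sum.If_cases Int_def conj_commute)
    finally have "(\<Sum>L\<in>{19..53}. ?S 1 (L * int N)) = \<dots>" .
    thus ?thesis unfolding s cost_def sum_list_block_lens
      by (simp add: sum.distrib sum_subtractf)
  qed
  \<comment> \<open>The leftover multiplicities of 2 and 3 are nonnegative and are dropped.\<close>
  finally show ?thesis
    unfolding fval_def using p by (auto elim!: pval_mono[rotated -1])
qed

lemma coef_val:
  assumes k: "k \<in> poles N"
  shows "pval p ((\<Sum>j=1..\<Lambda>. int (pole_order N k) - cost N (int p ^ j) k) - int (\<Lambda> * (pole_order N k - i))) (coef N k i)"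
proof (cases "1 \<le> i \<and> i \<le> pole_order N k")
  case True
  show ?thesis using local_series_val[OF k, unfolded fval_def, rule_format, of "pole_order N k - i"] True
    by (simp only: coef_def if_True simp_thms)
next
  case False
  hence "coef N k i = 0" by (auto simp: coef_def)
  thus ?thesis using p by simp
qed

lemma val_frac:
  assumes "v \<noteq> (0 :: int)" "\<bar>v\<bar> \<le> 726 * int N" "d \<ge> 1"
  shows "pval p (- (int (\<Lambda> * i))) (1 / (of_int v / real d) ^ i)"
proof -
  have "pval p (- int (mult v) * int i) ((1 / of_int v) ^ i)" using assms p by (intro pval_power pval_multiplicity(2))
  hence "pval p (0 + (- int (mult v) * int i)) (of_int (int d ^ i) * (1 / of_int v) ^ i)"
    using p by (intro pval_mult pval_of_int)
  also have "of_int (int d ^ i) * (1 / of_int v) ^ i = 1 / (of_int v / real d) ^ i"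
    using assms by (simp add: power_divide)
  finally show ?thesis
  proof (rule pval_mono[OF _ _ p])
    have "mult v * i \<le> \<Lambda> * i" using multiplicity_le[OF assms(1,2)] by simp
    hence "int (mult v) * int i \<le> int (\<Lambda> * i)" by (metis of_nat_le_iff of_nat_mult)
    thus "- int (\<Lambda> * i) \<le> 0 + - int (mult v) * int i" by simp
  qed
qed

text \<open>Division by the i-th power of \<open>v / d\<close> costs at most
  \<open>\<Lambda> * i\<close>, and \<open>coef N k i\<close> costs
  \<open>\<Lambda> * (pole_order N k - i)\<close>; the total is independent of
  \<open>i\<close>.\<close>

lemma polar_val:
  assumes k: "k \<in> poles N" and v: "v \<noteq> 0" "\<bar>v\<bar> \<le> 726 * int N" "d \<ge> 1"
  shows "pval p ((\<Sum>j=1..\<Lambda>. int (pole_order N k) - cost N (int p ^ j) k) - int (\<Lambda> * pole_order N k)) (polar N k (of_int v / real d))"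
  unfolding polar_def
proof (intro pval_sum p)
  fix i :: nat
  show "pval p ((\<Sum>j=1..\<Lambda>. int (pole_order N k) - cost N (int p ^ j) k) - int (\<Lambda> * pole_order N k)) (coef N k i / (of_int v / real d) ^ i)"
  proof (cases "1 \<le> i \<and> i \<le> pole_order N k")
    case True
    have "pval p (((\<Sum>j=1..\<Lambda>. int (pole_order N k) - cost N (int p ^ j) k) - int (\<Lambda> * (pole_order N k - i))) + (- (int (\<Lambda> * i))))
       (coef N k i * (1 / (of_int v / real d) ^ i))"
      using v by (intro pval_mult coef_val k val_frac p) auto
    also have "((\<Sum>j=1..\<Lambda>. int (pole_order N k) - cost N (int p ^ j) k) - int (\<Lambda> * (pole_order N k - i))) + (- (int (\<Lambda> * i)))
       = (\<Sum>j=1..\<Lambda>. int (pole_order N k) - cost N (int p ^ j) k) - int (\<Lambda> * pole_order N k)"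
      using True by (simp add: of_nat_diff algebra_simps)
    finally show ?thesis by simp
  next
    case False
    hence "coef N k i = 0" by (auto simp: coef_def)
    thus ?thesis using p by simp
  qed
qed

text \<open>72 = 37 + 35, the bound for the cost at one level plus the largest pole order.\<close>

lemma coef_val_crude:
  assumes k: "k \<in> poles N"
  shows "pval p (- int (72 * \<Lambda>)) (coef N k i)"
proof (rule pval_mono[OF coef_val[OF k] _ p])
  have "(\<Sum>j=1..\<Lambda>. int (pole_order N k) - cost N (int p ^ j) k) \<ge> (\<Sum>j=1..\<Lambda>. - 37)"
    using cost_le[of "int p ^ _" N k] prime_gt_0_nat[OF p] by (intro sum_mono) (smt (verit) of_nat_0_le_iff of_nat_0_less_iff zero_less_power)
  moreover have "\<Lambda> * (pole_order N k - i) \<le> \<Lambda> * 35" using pole_order_le[of N k] by (intro mult_left_mono) auto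
  hence "int (\<Lambda> * (pole_order N k - i)) \<le> int (\<Lambda> * 35)" by (simp only: of_nat_le_iff)
  ultimately show "- int (72 * \<Lambda>) \<le> (\<Sum>j=1..\<Lambda>. int (pole_order N k) - cost N (int p ^ j) k) - int (\<Lambda> * (pole_order N k - i))"
    by simp
qed

lemma polar_val_crude:
  assumes k: "k \<in> poles N" and v: "v \<noteq> 0" "\<bar>v\<bar> \<le> 726 * int N" "d \<ge> 1"
  shows "pval p (- int (72 * \<Lambda>)) (polar N k (of_int v / real d))"
proof (rule pval_mono[OF polar_val[OF k v] _ p])
  have "(\<Sum>j=1..\<Lambda>. int (pole_order N k) - cost N (int p ^ j) k) \<ge> (\<Sum>j=1..\<Lambda>. - 37)"
    using cost_le[of "int p ^ _" N k] prime_gt_0_nat[OF p] by (intro sum_mono) (smt (verit) of_nat_0_le_iff of_nat_0_less_iff zero_less_power)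
  moreover have "\<Lambda> * pole_order N k \<le> \<Lambda> * 35" using pole_order_le[of N k] by (intro mult_left_mono) auto
  hence "int (\<Lambda> * pole_order N k) \<le> int (\<Lambda> * 35)" by (simp only: of_nat_le_iff)
  ultimately show "- int (72 * \<Lambda>) \<le> (\<Sum>j=1..\<Lambda>. int (pole_order N k) - cost N (int p ^ j) k) - int (\<Lambda> * pole_order N k)"
    by simp
qed

end

section \<open>Primes with p^2 > 726 N\<close>

lemma fval_integral:
  assumes "prime p"
  shows "fval p 0 0 (fps_const (of_int c) + fps_const (of_int d) * fps_X)"
  unfolding fval_def
proof
  fix m :: nat
  consider "m = 0" | "m = 1" | "m > 1" by linarith
  thus "pval p (0 - int (0 * m)) ((fps_const (of_int c) + fps_const (of_int d) * fps_X) $ m)"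
    using assms by cases auto
qed

context
  fixes p N :: nat
  assumes p: "prime p" and p2: "726 * N < p\<^sup>2" and p5: "p > 3"
begin

lemma pval_norm_factor': "pval p (norm_exp N (int p)) (norm_factor N)"
  using pval_norm_factor[of p N 1] p p2 by (simp add: power2_eq_square)

text \<open>If \<open>k\<close> is the only pole in its class modulo \<open>p\<close>, all
  \<open>k - j\<close> in the denominator are units, the numerator is integral, and only the
  normalisation remains.\<close>

lemma local_series_val_single:
  assumes k: "k \<in> poles N" and single: "\<And>j. j \<in> poles N \<Longrightarrow> int p dvd (k - j) \<Longrightarrow> j = k"
  shows "fval p (norm_exp N (int p)) 0 (local_series N k)"
proof -
  have ints: "pval p 0 2" "pval p 0 3" using pval_of_int[OF p, of 2] pval_of_int[OF p, of 3] by simp_all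
  have lead: "pval p (norm_exp N (int p) + 0 * int (242 * N + 1) + 0 * int (106 * N + 1)) (lead N)"
    unfolding lead_def by (intro pval_mult pval_power pval_norm_factor' ints p)
  have "fval p (norm_exp N (int p) + 0 * int (242 * N + 1) + 0 * int (106 * N + 1) + (\<Sum>u\<in>zeros2 N. 0) + (\<Sum>u\<in>zeros3 N. 0) +
      (\<Sum>L\<in>{19..53}. \<Sum>j\<in>block N L - {k}. - int (multiplicity (int p) (k - j)))) 0 (local_series N k)"
    unfolding local_series_def
  proof (intro fval_mult fval_prod fval_const lead fval_integral fval_linv p)
    fix L j assume L: "L \<in> {19..53::int}" and j: "j \<in> block N L - {k}"
    show "k - j \<noteq> 0" using j by auto
    have "L * int N \<le> 53 * int N" using L by (intro mult_right_mono) auto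
    hence "\<not> int p dvd (k - j)" using single[of j] j by (auto simp: block_def)
    thus "multiplicity (int p) (k - j) \<le> 0" by (simp add: not_dvd_imp_multiplicity_0)
  qed
  also have "(\<Sum>L\<in>{19..53}. \<Sum>j\<in>block N L - {k}. - int (multiplicity (int p) (k - j))) = 0"
  proof (intro sum.neutral ballI)
    fix L j assume L: "L \<in> {19..53::int}" and j: "j \<in> block N L - {k}"
    have "L * int N \<le> 53 * int N" using L by (intro mult_right_mono) auto
    hence "\<not> int p dvd (k - j)" using single[of j] j by (auto simp: block_def)
    thus "- int (multiplicity (int p) (k - j)) = 0" by (simp add: not_dvd_imp_multiplicity_0)
  qed
  finally show ?thesis by simp
qed

context
  fixes c :: int
  assumes multi: "\<And>k k'. k \<in> poles N \<Longrightarrow> k' \<in> poles N \<Longrightarrow> k \<noteq> k' \<Longrightarrow> int p dvd (k - k') \<Longrightarrow> cost N (int p) k \<le> c"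
    and single: "(\<exists>k\<in>poles N. \<forall>j\<in>poles N. int p dvd (k - j) \<longrightarrow> j = k) \<Longrightarrow> - norm_exp N (int p) \<le> c"
begin

text \<open>With a second pole in the class the single level leaves the valuation
  \<open>i - cost N (int p) k\<close>, which is at least \<open>- c\<close>; without one the
  normalisation alone decides.\<close>

lemma coef_val_fine:
  assumes k: "k \<in> poles N"
  shows "pval p (- c) (coef N k i)"
proof (cases "1 \<le> i \<and> i \<le> pole_order N k")
  case i: True
  show ?thesis
  proof (cases "\<forall>j\<in>poles N. int p dvd (k - j) \<longrightarrow> j = k")
    case True
    have "pval p (norm_exp N (int p) - int (0 * (pole_order N k - i))) (coef N k i)"
      using local_series_val_single[OF k] True i by (auto simp: fval_def coef_def)
    moreover have "- norm_exp N (int p) \<le> c" using single True k by blast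
    ultimately show ?thesis using p by (elim pval_mono) auto
  next
    case False
    then obtain k' where k': "k' \<in> poles N" "k \<noteq> k'" "int p dvd (k - k')" by auto
    have c: "cost N (int p) k \<le> c" using multi[OF k k'] .
    have "pval p ((\<Sum>j=1..1. int (pole_order N k) - cost N (int p ^ j) k) - int (1 * (pole_order N k - i))) (coef N k i)"
      using p p2 by (intro coef_val k) (auto simp: power2_eq_square)
    thus ?thesis using p i c by (elim pval_mono) (auto simp: of_nat_diff)
  qed
next
  case False
  hence "coef N k i = 0" by (auto simp: coef_def)
  thus ?thesis using p by simp
qed

lemma polar_val_unit:
  assumes k: "k \<in> poles N" and v: "\<not> int p dvd v" "d \<ge> 1"
  shows "pval p (- c) (polar N k (of_int v / real d))"
  unfolding polar_def
proof (intro pval_sum p)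
  fix i :: nat
  have "v \<noteq> 0" using v by auto
  have "pval p (0 + - int (multiplicity (int p) v) * int i) (of_int (int d ^ i) * (1 / of_int v) ^ i)"
    using p \<open>v \<noteq> 0\<close> by (intro pval_mult pval_of_int pval_power pval_multiplicity(2))
  also have "of_int (int d ^ i) * (1 / of_int v) ^ i = 1 / (of_int v / real d) ^ i"
    using v by (simp add: power_divide)
  finally have "pval p (- c + 0) (coef N k i * (1 / (of_int v / real d) ^ i))"
    using v by (intro pval_mult coef_val_fine k p) (simp add: not_dvd_imp_multiplicity_0)
  thus "pval p (- c) (coef N k i / (of_int v / real d) ^ i)" by simp
qed

text \<open>The delicate case is \<open>p\<close> dividing \<open>v\<close> with \<open>k\<close>
  alone in its class: a direct estimate would lose a power of \<open>p\<close> for each power of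
  \<open>v\<close>. The condition on \<open>k + v / d\<close> places this point in the range where
  \<open>R_zero\<close> applies.\<close>

lemma polar_val_fine:
  assumes k: "k \<in> poles N" and v: "v \<noteq> 0" and d: "d \<in> {1, 2, 3}" and t: "\<bar>of_int k + of_int v / real d\<bar> \<le> 53 * real N"
  shows "pval p (- c) (polar N k (of_int v / real d))"
proof (cases "int p dvd v")
  case False
  have "d \<ge> 1" using d by auto
  thus ?thesis by (rule polar_val_unit[OF k False])
next
  case pv: True
  have d0: "d \<ge> 1" using d by auto
  have pd: "\<not> int p dvd int d" 
  proof -
    have "\<not> p dvd d" using p5 d by (auto dest: dvd_imp_le)
    thus ?thesis by simp
  qed
  have kN: "\<bar>real_of_int k\<bar> \<le> 53 * real N" using k by auto
  have vb: "\<bar>v\<bar> \<le> 726 * int N"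
  proof -
    have "\<bar>of_int v / real d\<bar> \<le> 106 * real N" using t kN by linarith
    hence "\<bar>real_of_int v\<bar> \<le> 106 * real N * real d" using d0 by (simp add: abs_div field_simps)
    also have "\<dots> \<le> 106 * real N * 3" using d by (intro mult_left_mono) auto
    finally show ?thesis by linarith
  qed
  show ?thesis
  proof (cases "\<forall>j\<in>poles N. int p dvd (k - j) \<longrightarrow> j = k")
    case False
    then obtain k' where k': "k' \<in> poles N" "k \<noteq> k'" "int p dvd (k - k')" by auto
    have c: "cost N (int p) k \<le> c" using multi[OF k k'] .
    have "pval p ((\<Sum>j=1..1. int (pole_order N k) - cost N (int p ^ j) k) - int (1 * pole_order N k)) (polar N k (of_int v / real d))"
      using p p2 v vb d0 by (intro polar_val k) (auto simp: power2_eq_square)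
    thus ?thesis using p c by (elim pval_mono) auto
  next
    case True
    define T where "T = real_of_int k + of_int v / real d"
    have T_eq: "T = of_int (int d * k + v) / real d" using d0 by (simp add: T_def field_simps)
    \<comment> \<open>An integral \<open>T\<close> would be a second pole congruent to
      \<open>k\<close> modulo \<open>p\<close>.\<close>
    have nonint: "T \<noteq> of_int z" for z
    proof
      assume Tz: "T = of_int z"
      hence "real_of_int v = real d * of_int (z - k)" using d0 by (simp add: T_def field_simps)
      hence "real_of_int v = real_of_int (int d * (z - k))" by simp
      hence vz: "v = int d * (z - k)" by (simp only: of_int_eq_iff)
      hence "int p dvd z - k" using pv pd p by (auto simp: prime_dvd_mult_iff)
      hence "int p dvd k - z" by (metis dvd_minus_iff minus_diff_eq)
      moreover have "z \<in> poles N"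
      proof -
        have "\<bar>real_of_int z\<bar> \<le> 53 * real N" using t Tz by (simp add: T_def)
        thus ?thesis by (auto simp: abs_le_iff)
      qed
      ultimately have "z = k" using True by auto
      thus False using vz v by simp
    qed
    \<comment> \<open>Since \<open>R N\<close> vanishes at \<open>T\<close>, the polar part at \<open>k\<close> is minus the sum of the others, where the argument is a unit at \<open>p\<close>.\<close>
    have "R N T = 0"
    proof (rule R_zero)
      show "T = of_int (int d * k + v) / of_int (int d)" using T_eq by simp
      show "int d \<in> {1, 2, 3}" using d by auto
      show "\<bar>T\<bar> \<le> 121 * real N" using t by (simp add: T_def)
      show "T \<in> \<int> \<Longrightarrow> \<bar>T\<bar> > 53 * real N" using nonint by (auto elim!: Ints_cases)
    qed
    moreover have "R N T = (\<Sum>j\<in>poles N. polar N j (T - of_int j))"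
      unfolding polar_def by (rule R_partial_fractions) (rule nonint)
    ultimately have "polar N k (T - of_int k) = - (\<Sum>j\<in>poles N - {k}. polar N j (T - of_int j))"
      using k by (simp add: sum.remove)
    moreover have "pval p (- c) (- (\<Sum>j\<in>poles N - {k}. polar N j (T - of_int j)))"
    proof (intro pval_uminus pval_sum p)
      fix j assume j: "j \<in> poles N - {k}"
      have eq: "T - of_int j = of_int (int d * (k - j) + v) / real d" using d0 by (simp add: T_eq field_simps)
      have "\<not> int p dvd (int d * (k - j))" using True j pd p by (auto simp: prime_dvd_mult_iff)
      hence "\<not> int p dvd (int d * (k - j) + v)" using pv by (simp add: dvd_add_left_iff)
      thus "pval p (- c) (polar N j (T - of_int j))" unfolding eq using j d0 by (intro polar_val_unit) auto
    qed
    ultimately show ?thesis by (simp add: T_def)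
  qed
qed

end

end

section \<open>Evaluating the cells\<close>

fun cell_cost :: "int list \<Rightarrow> int" where
  "cell_cost (x # y # xs) = max 0 (cell_bound x y) * (y - x) + cell_cost (y # xs)"
| "cell_cost _ = 0"

lemma cell_cost_append: "cell_cost (xs @ x # ys) = cell_cost (xs @ [x]) + cell_cost (x # ys)"
  by (induction xs rule: cell_cost.induct) (cases ys; simp)+

definition breakpoints1 :: "int list" where
  "breakpoints1 = [57, 58, 59, 60, 61, 62, 63, 64, 65, 66, 67, 68, 69, 70, 71, 72, 73, 74, 75, 76, 77, 78, 80, 82, 84,
     85, 86, 88, 90, 92, 93, 94, 96, 98, 100, 101, 102, 104, 106, 108]"

definition breakpoints2 :: "int list" where
  "breakpoints2 = [110, 112, 114, 116, 118, 120, 121, 123, 125, 128, 130, 132, 134, 136, 138, 140, 142, 144, 146, 148,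
     149, 152, 155, 158, 160, 163, 166, 169, 172, 176, 180, 184, 186, 188, 192, 195, 200, 202, 204, 208]"

definition breakpoints3 :: "int list" where
  "breakpoints3 = [212, 215, 218, 224, 228, 232, 235, 240, 242, 247, 253, 256, 259, 264, 268, 272, 276, 277, 280, 288,
     292, 296, 300, 304, 306, 320, 323, 336, 344, 352, 360, 368, 376, 384, 387, 388, 392, 400, 408, 416]"

definition breakpoints4 :: "int list" where
  "breakpoints4 = [424, 432, 438, 448, 456, 464, 472, 480, 484, 488, 496, 504, 512, 520, 528, 536, 544, 554, 560, 568,
     576, 584, 592, 600, 608, 616, 624, 632, 640, 645, 648, 656, 664, 672, 680, 688, 696, 704, 712, 720,
     728, 736, 744, 752, 760, 768, 776, 784, 800, 816, 830, 848, 968, 1162, 1291, 1452, 1936, 2904, 3872,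
     5808]"

text \<open>Each of the first three evaluations ends with the first breakpoint of the next, so that
  \<open>cell_cost_append\<close> glues them without losing a cell.\<close>

lemma cell_cost_1: "cell_cost (breakpoints1 @ [110]) = 1361"
  by code_simp

lemma cell_cost_2: "cell_cost (breakpoints2 @ [212]) = 2355"
  by code_simp

lemma cell_cost_3: "cell_cost (breakpoints3 @ [424]) = 4900"
  by code_simp

lemma cell_cost_4: "cell_cost breakpoints4 = 19273"
  by code_simp


definition breakpoints :: "int list" where
  "breakpoints = breakpoints1 @ breakpoints2 @ breakpoints3 @ breakpoints4"

lemma cell_cost_breakpoints: "cell_cost breakpoints = 27889"
proof -
  have "breakpoints = breakpoints1 @ 110 # tl breakpoints2 @ 212 # tl breakpoints3 @ 424 # tl breakpoints4"
    by (simp add: breakpoints_def breakpoints1_def breakpoints2_def breakpoints3_def breakpoints4_def)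
  also have "cell_cost \<dots> = cell_cost (breakpoints1 @ [110]) + (cell_cost ((110 # tl breakpoints2) @ [212]) +
      (cell_cost ((212 # tl breakpoints3) @ [424]) + cell_cost (424 # tl breakpoints4)))"
  proof -
    have "cell_cost ((212 # tl breakpoints3) @ 424 # tl breakpoints4) =
        cell_cost ((212 # tl breakpoints3) @ [424]) + cell_cost (424 # tl breakpoints4)"
      by (rule cell_cost_append)
    moreover have "cell_cost ((110 # tl breakpoints2) @ 212 # tl breakpoints3 @ 424 # tl breakpoints4) =
        cell_cost ((110 # tl breakpoints2) @ [212]) + cell_cost (212 # tl breakpoints3 @ 424 # tl breakpoints4)"
      by (rule cell_cost_append)
    moreover have "cell_cost (breakpoints1 @ 110 # tl breakpoints2 @ 212 # tl breakpoints3 @ 424 # tl breakpoints4) =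
        cell_cost (breakpoints1 @ [110]) + cell_cost (110 # tl breakpoints2 @ 212 # tl breakpoints3 @ 424 # tl breakpoints4)"
      by (rule cell_cost_append)
    ultimately show ?thesis by (simp only: append_Cons)
  qed
  finally have eq: "cell_cost breakpoints = cell_cost (breakpoints1 @ [110]) + (cell_cost ((110 # tl breakpoints2) @ [212]) +
      (cell_cost ((212 # tl breakpoints3) @ [424]) + cell_cost (424 # tl breakpoints4)))" .
  have "110 # tl breakpoints2 = breakpoints2" "212 # tl breakpoints3 = breakpoints3" "424 # tl breakpoints4 = breakpoints4"
    by (simp_all add: breakpoints2_def breakpoints3_def breakpoints4_def)
  thus ?thesis unfolding eq by (simp only: cell_cost_1 cell_cost_2 cell_cost_3 cell_cost_4)
qed

text \<open>
  A triple \<open>(\<alpha>, \<beta>, c)\<close> stands for the primes \<open>p\<close> with \<open>\<alpha> / 8 < p / N \<le> \<beta> / 8\<close>,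
  whose exponent in the denominator is at most \<open>c\<close>.  The breakpoints were found by computer; a finer
  subdivision gives a smaller total cost.
\<close>

definition cells :: "(int \<times> int \<times> int) list" where
  "cells = (0, 57, 37) # map (\<lambda>(\<alpha>, \<beta>). (\<alpha>, \<beta>, max 0 (cell_bound \<alpha> \<beta>))) (zip breakpoints (tl breakpoints))"

text \<open>27889 from the breakpoints plus 37 * 57 for the first cell. Divided by 8 this is just
  below the 3750 of the final estimate.\<close>

lemma sum_cells: "(\<Sum>(\<alpha>, \<beta>, c)\<leftarrow>cells. c * (\<beta> - \<alpha>)) = 29998"
proof -
  have "(\<Sum>(\<alpha>, \<beta>, c)\<leftarrow>map (\<lambda>(\<alpha>, \<beta>). (\<alpha>, \<beta>, max 0 (cell_bound \<alpha> \<beta>))) (zip xs (tl xs)). c * (\<beta> - \<alpha>)) = cell_cost xs" for xs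
    by (induction xs rule: cell_cost.induct) auto
  thus ?thesis by (simp add: cells_def cell_cost_breakpoints)
qed

lemma zip_breakpoints:
  assumes "(\<alpha>, \<beta>) \<in> set (zip breakpoints (tl breakpoints))"
  shows "57 \<le> \<alpha>" "\<alpha> \<le> \<beta>" "\<beta> \<le> 5808"
proof -
  have "list_all (\<lambda>(a, b). 57 \<le> a \<and> a \<le> b \<and> b \<le> 5808) (zip breakpoints (tl breakpoints))"
    by code_simp
  with assms show "57 \<le> \<alpha>" "\<alpha> \<le> \<beta>" "\<beta> \<le> 5808" by (auto simp: list_all_iff)
qed

lemma cells_bounds:
  assumes "(\<alpha>, \<beta>, c) \<in> set cells"
  shows "0 \<le> \<alpha>" "\<alpha> \<le> \<beta>" "\<beta> \<le> 5808" "0 \<le> c"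
  using assms zip_breakpoints by (fastforce simp: cells_def)+

lemma zip_tl_cover:
  fixes x N :: int
  assumes "xs \<noteq> []" "hd xs * N < x" "x \<le> last xs * N"
  shows "\<exists>a b. (a, b) \<in> set (zip xs (tl xs)) \<and> a * N < x \<and> x \<le> b * N"
  using assms
proof (induction xs rule: cell_cost.induct)
  case (1 y z xs)
  thus ?case by (cases "z * N < x") (auto simp: not_less)
qed auto

lemma cells_cover:
  assumes "x > 0" "x \<le> 5808 * (N :: int)"
  shows "\<exists>\<alpha> \<beta> c. (\<alpha>, \<beta>, c) \<in> set cells \<and> \<alpha> * N < x \<and> x \<le> \<beta> * N"
proof (cases "x \<le> 57 * N")
  case True
  thus ?thesis using assms by (intro exI[of _ 0] exI[of _ 57] exI[of _ 37]) (simp add: cells_def)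
next
  case False
  have "breakpoints \<noteq> []" "hd breakpoints = 57" "last breakpoints = 5808"
    by (simp_all add: breakpoints_def breakpoints1_def, simp add: breakpoints4_def)
  with zip_tl_cover[of breakpoints N x] False assms obtain a b where
    "(a, b) \<in> set (zip breakpoints (tl breakpoints))" "a * N < x" "x \<le> b * N" by auto
  thus ?thesis by (intro exI[of _ a] exI[of _ b] exI[of _ "max 0 (cell_bound a b)"]) (auto simp: cells_def image_iff)
qed

text \<open>The small primes with \<open>p\<^sup>2 \<le> 726 * N\<close> contribute only \<open>exp (o N)\<close>, so a crude exponent suffices for them.\<close>

definition den_exp :: "nat \<Rightarrow> nat \<Rightarrow> nat" where
  "den_exp N p = (if p\<^sup>2 \<le> 726 * N then 72 * (floorlog p (726 * N) - 1)
     else \<Sum>(\<alpha>, \<beta>, c)\<leftarrow>cells. if \<alpha> * int N < 8 * int p \<and> 8 * int p \<le> \<beta> * int N then nat c else 0)"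

definition den :: "nat \<Rightarrow> nat" where
  "den N = (\<Prod>p | prime p \<and> p \<le> 726 * N. p ^ den_exp N p)"

lemma norm_exp_le_cell_norm:
  assumes p: "p > 0" and \<alpha>: "\<alpha> > 0" and \<beta>: "\<beta> > 0" and cell: "\<alpha> * int N < 8 * p" "8 * p \<le> \<beta> * int N"
  shows "- norm_exp N p \<le> cell_norm \<alpha> \<beta>"
proof -
  have N: "int N \<ge> 0" by simp
  have up: "(a * int N) div p \<le> (8 * a - 1) div \<alpha>" if a: "a > 0" for a
  proof (cases "(a * int N) div p \<ge> 1")
    case True
    define q where "q = (a * int N) div p"
    have "p * q \<le> a * int N" using p by (simp add: q_def minus_mod_eq_mult_div [symmetric])
    have "q * (\<alpha> * int N) < q * (8 * p)" using True cell by (intro mult_strict_left_mono) (auto simp: q_def)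
    also have "\<dots> \<le> 8 * a * int N" using \<open>p * q \<le> a * int N\<close> by (simp add: mult_ac)
    finally have "q * \<alpha> * int N < 8 * a * int N" by (simp add: mult_ac)
    hence "q * \<alpha> < 8 * a" using N by (simp add: mult_less_cancel_right)
    hence "q * \<alpha> \<le> 8 * a - 1" by simp
    hence "q * \<alpha> div \<alpha> \<le> (8 * a - 1) div \<alpha>" using \<alpha> by (intro zdiv_mono1)
    thus ?thesis using \<alpha> by (simp add: q_def)
  next
    case False
    have "0 \<le> (8 * a - 1) div \<alpha>" using a \<alpha> by (simp add: pos_imp_zdiv_nonneg_iff)
    thus ?thesis using False by linarith
  qed
  have low: "16 * L div \<beta> \<le> (2 * (L * int N)) div p" if "L \<in> set block_lens" for L
  proof -
    define m where "m = 16 * L div \<beta>"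
    have "m \<ge> 0" using block_lens_pos[OF that] \<beta> by (simp add: m_def pos_imp_zdiv_nonneg_iff)
    have "\<beta> * m \<le> 16 * L" using \<beta> by (simp add: m_def minus_mod_eq_mult_div [symmetric])
    hence "\<beta> * m * int N \<le> 16 * L * int N" by (intro mult_right_mono) auto
    moreover have "m * (8 * p) \<le> m * (\<beta> * int N)" using \<open>m \<ge> 0\<close> cell by (intro mult_left_mono) auto
    ultimately have "m * p \<le> 2 * (L * int N)" by (simp add: mult_ac)
    hence "m * p div p \<le> (2 * (L * int N)) div p" using p by (intro zdiv_mono1)
    thus ?thesis using p by (simp add: m_def)
  qed
  have "cell_norm \<alpha> \<beta> + norm_exp N p \<ge> 0"
    using up[of 484] up[of 726] sum_list_mono[of block_lens "\<lambda>L. 16 * L div \<beta>" "\<lambda>L. (2 * (L * int N)) div p"] low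
    by (simp add: cell_norm_def norm_exp_def)
  thus ?thesis by simp
qed

context
  fixes N p :: nat
  assumes N: "N \<ge> 1" and p: "prime p"
begin

lemma crude_exponent:
  assumes "p\<^sup>2 \<le> 726 * N"
  shows "726 * N < p ^ Suc (floorlog p (726 * N) - 1)" "p ^ (floorlog p (726 * N) - 1) \<le> 726 * N"
proof -
  have b: "p ^ (floorlog p (726 * N) - 1) \<le> 726 * N \<and> 726 * N < p ^ floorlog p (726 * N)"
    using N prime_gt_1_nat[OF p] by (intro floorlog_bounds) auto
  thus "p ^ (floorlog p (726 * N) - 1) \<le> 726 * N" by simp
  have "floorlog p (726 * N) \<noteq> 0" using b N by (intro notI) simp
  thus "726 * N < p ^ Suc (floorlog p (726 * N) - 1)" using b by simp
qed

text \<open>Provides, with \<open>c = den_exp N p\<close>, the two hypotheses under which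
  \<open>coef_val_fine\<close> and \<open>polar_val_fine\<close> were proved.\<close>

lemma fine_exponent:
  assumes p2: "726 * N < p\<^sup>2"
  shows "k \<in> poles N \<Longrightarrow> k' \<in> poles N \<Longrightarrow> k \<noteq> k' \<Longrightarrow> int p dvd (k - k') \<Longrightarrow> cost N (int p) k \<le> int (den_exp N p)"
    and "\<exists>k\<in>poles N. \<forall>j\<in>poles N. int p dvd (k - j) \<longrightarrow> j = k \<Longrightarrow> - norm_exp N (int p) \<le> int (den_exp N p)"
proof -
  have p0: "int p > 0" using prime_gt_0_nat[OF p] by simp
  have "(k \<in> poles N \<longrightarrow> k' \<in> poles N \<longrightarrow> k \<noteq> k' \<longrightarrow> int p dvd (k - k') \<longrightarrow> cost N (int p) k \<le> int (den_exp N p)) \<and>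
     ((\<exists>k\<in>poles N. \<forall>j\<in>poles N. int p dvd (k - j) \<longrightarrow> j = k) \<longrightarrow> - norm_exp N (int p) \<le> int (den_exp N p))"
  proof (cases "p \<le> 726 * N")
    case True
    then obtain \<alpha> \<beta> c where cell: "(\<alpha>, \<beta>, c) \<in> set cells" "\<alpha> * int N < 8 * int p" "8 * int p \<le> \<beta> * int N"
      using cells_cover[of "8 * int p" "int N"] p0 by auto
    note cb = cells_bounds[OF cell(1)]
    have "nat c \<le> den_exp N p"
    proof -
      have "nat c \<in> set (map (\<lambda>(\<alpha>, \<beta>, c). if \<alpha> * int N < 8 * int p \<and> 8 * int p \<le> \<beta> * int N then nat c else 0) cells)"
        using cell by (force simp: image_iff)
      from member_le_sum_list[OF this] show ?thesis using p2 by (simp add: den_exp_def)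
    qed
    hence c: "c \<le> int (den_exp N p)" using cb by linarith
    show ?thesis
    \<comment> \<open>In the first cell \<open>8 * p \<le> 57 * N\<close>, so every pole
      \<open>k\<close> has a companion \<open>k - p\<close> or \<open>k + p\<close> and the general
      bound \<open>cost_le\<close> suffices.\<close>
    proof (cases "(\<alpha>, \<beta>, c) = (0, 57, 37)")
      case True
      have "cost N (int p) k \<le> c" using cost_le[OF p0, of N k] True by simp
      moreover have "\<exists>j\<in>poles N. int p dvd (k - j) \<and> j \<noteq> k" if "k \<in> poles N" for k
      proof (cases "k \<ge> 0")
        case True
        thus ?thesis using that cell(3) \<open>(\<alpha>, \<beta>, c) = _\<close> p0 by (intro bexI[of _ "k - int p"]) auto
      next
        case False
        thus ?thesis using that cell(3) \<open>(\<alpha>, \<beta>, c) = _\<close> p0 by (intro bexI[of _ "k + int p"]) auto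
      qed
      ultimately show ?thesis using c by force
    next
      case False
      hence ab: "(\<alpha>, \<beta>) \<in> set (zip breakpoints (tl breakpoints))" and ceq: "c = max 0 (cell_bound \<alpha> \<beta>)"
        using cell(1) by (auto simp: cells_def)
      have pos: "\<alpha> > 0" "\<beta> > 0" using zip_breakpoints[OF ab] by auto
      have nrm: "- norm_exp N (int p) \<le> cell_norm \<alpha> \<beta>"
        by (rule norm_exp_le_cell_norm[OF p0 pos cell(2,3)])
      have "cell_max \<alpha> \<beta> \<ge> 0" by (simp add: cell_max_def Let_def)
      hence "cell_norm \<alpha> \<beta> \<le> c" by (simp add: ceq cell_bound_def)
      moreover have "cost N (int p) k \<le> c" if "k \<in> poles N" "k' \<in> poles N" "k \<noteq> k'" "int p dvd (k - k')" 
      proof -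
        have "(\<Sum>L\<leftarrow>block_lens. cnt (int p) 1 (L * int N) k) - cnt (int p) 2 (242 * int N) k - cnt (int p) 3 (363 * int N) k \<le> cell_max \<alpha> \<beta>"
          using that by (intro cell_max_bound[OF p0 _ pos cell(2,3), of k k']) auto
        thus ?thesis using nrm by (simp add: cost_def ceq cell_bound_def)
      qed
      ultimately show ?thesis using nrm c by force
    qed
  next
    case False
    \<comment> \<open>Beyond \<open>726 * N\<close>, distinct poles, at most \<open>106 * N\<close>
      apart, are never congruent, and the subtracted floors in \<open>norm_exp\<close> are
      0.\<close>
    have "(k \<in> poles N \<longrightarrow> k' \<in> poles N \<longrightarrow> k \<noteq> k' \<longrightarrow> \<not> int p dvd (k - k'))"
    proof (intro impI notI)
      assume *: "k \<in> poles N" "k' \<in> poles N" "k \<noteq> k'" "int p dvd (k - k')"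
      hence "int p \<le> \<bar>k - k'\<bar>" using zdvd_imp_le[of "int p" "\<bar>k - k'\<bar>"] by auto
      thus False using * False by auto
    qed
    moreover have "norm_exp N (int p) \<ge> 0"
    proof -
      have "(\<Sum>L\<leftarrow>block_lens. (2 * (L * int N)) div int p) \<ge> 0"
        using block_lens_pos p0 by (intro sum_list_nonneg) (auto simp: pos_imp_zdiv_nonneg_iff intro!: mult_nonneg_nonneg dest!: block_lens_pos)
      thus ?thesis using False by (simp add: norm_exp_def)
    qed
    ultimately show ?thesis by auto
  qed
  thus "k \<in> poles N \<Longrightarrow> k' \<in> poles N \<Longrightarrow> k \<noteq> k' \<Longrightarrow> int p dvd (k - k') \<Longrightarrow> cost N (int p) k \<le> int (den_exp N p)"
    "\<exists>k\<in>poles N. \<forall>j\<in>poles N. int p dvd (k - j) \<longrightarrow> j = k \<Longrightarrow> - norm_exp N (int p) \<le> int (den_exp N p)" by blast+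
qed

lemma p_gt_3:
  assumes p2: "726 * N < p\<^sup>2"
  shows "p > 3"
proof (rule ccontr)
  assume "\<not> p > 3"
  hence "p\<^sup>2 \<le> 3\<^sup>2" by (intro power_mono) auto
  thus False using p2 N by simp
qed

lemma coef_val_den:
  assumes "k \<in> poles N"
  shows "pval p (- int (den_exp N p)) (coef N k i)"
proof (cases "p\<^sup>2 \<le> 726 * N")
  case True
  thus ?thesis using coef_val_crude[OF p crude_exponent(1)[OF True] assms] by (simp add: den_exp_def)
next
  case False
  hence p2: "726 * N < p\<^sup>2" by simp
  show ?thesis by (rule coef_val_fine[OF p p2 p_gt_3[OF p2] fine_exponent[OF p2] assms])
qed

lemma polar_val_den:
  assumes "k \<in> poles N" "v \<noteq> 0" "d \<in> {1, 2, 3}" "\<bar>of_int k + of_int v / real d\<bar> \<le> 53 * real N"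
  shows "pval p (- int (den_exp N p)) (polar N k (of_int v / real d))"
proof (cases "p\<^sup>2 \<le> 726 * N")
  case True
  have d0: "d \<ge> 1" using assms by auto
  have vb: "\<bar>v\<bar> \<le> 726 * int N"
  proof -
    have "\<bar>of_int v / real d\<bar> \<le> 106 * real N" using assms by auto
    hence "\<bar>real_of_int v\<bar> \<le> 106 * real N * real d" using d0 by (simp add: abs_div field_simps)
    also have "\<dots> \<le> 106 * real N * 3" using assms by (intro mult_left_mono) auto
    finally show ?thesis by linarith
  qed
  show ?thesis using polar_val_crude[OF p crude_exponent(1)[OF True] assms(1,2) vb d0] True by (simp add: den_exp_def)
next
  case False
  hence p2: "726 * N < p\<^sup>2" by simp
  show ?thesis by (rule polar_val_fine[OF p p2 p_gt_3[OF p2] fine_exponent[OF p2] assms])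
qed

lemma pval_den: "pval p (int (den_exp N p)) (real (den N))"
proof (cases "p \<le> 726 * N")
  case True
  have "finite {p. prime p \<and> p \<le> 726 * N}" by simp
  hence "den N = p ^ den_exp N p * (\<Prod>q\<in>{q. prime q \<and> q \<le> 726 * N} - {p}. q ^ den_exp N q)"
    unfolding den_def using True p by (subst prod.remove[of _ p]) auto
  then obtain m where m: "den N = p ^ den_exp N p * m" by blast
  have "pval p (int (multiplicity (int p) (int p)) * int (den_exp N p) + 0) (of_int (int p) ^ den_exp N p * of_int (int m))"
    using p prime_gt_0_nat[OF p] by (intro pval_mult pval_power pval_multiplicity(1) pval_of_int) auto
  moreover have "multiplicity (int p) (int p) = 1"
    using p by (intro multiplicity_self) (auto dest: prime_gt_1_nat)
  ultimately show ?thesis by (simp add: m)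
next
  case False
  have "\<not> p\<^sup>2 \<le> 726 * N" using False self_le_power[of p 2] prime_ge_1_nat[OF p] by (auto simp del: self_le_power)
  moreover have "(\<Sum>(\<alpha>, \<beta>, c)\<leftarrow>cells. if \<alpha> * int N < 8 * int p \<and> 8 * int p \<le> \<beta> * int N then nat c else 0) = 0"
  proof -
    have "(\<lambda>(\<alpha>, \<beta>, c). if \<alpha> * int N < 8 * int p \<and> 8 * int p \<le> \<beta> * int N then nat c else 0) x = 0" if "x \<in> set cells" for x
    proof -
      obtain \<alpha> \<beta> c where x: "x = (\<alpha>, \<beta>, c)" by (cases x) auto
      have "\<beta> * int N \<le> 5808 * int N" using cells_bounds(3) that x by (intro mult_right_mono) auto
      thus ?thesis using False x by auto
    qed
    hence "map (\<lambda>(\<alpha>, \<beta>, c). if \<alpha> * int N < 8 * int p \<and> 8 * int p \<le> \<beta> * int N then nat c else 0) cells = map (\<lambda>_. 0) cells"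
      by (intro map_cong) auto
    thus ?thesis by (simp only: sum_list_0)
  qed
  ultimately have "den_exp N p = 0" by (simp only: den_exp_def if_False)
  thus ?thesis using pval_of_int[OF p, of "int (den N)"] by simp
qed

end

lemma den_rho_integer:
  assumes "N \<ge> 1"
  shows "real (den N) * rho N i \<in> \<int>"
proof (rule pval_integer)
  fix p :: nat assume p: "prime p"
  have "pval p (int (den_exp N p) + - int (den_exp N p)) (real (den N) * rho N i)"
    unfolding rho_def using assms p by (intro pval_mult pval_den pval_sum coef_val_den)
  thus "pval p 0 (real (den N) * rho N i)" by simp
qed

text \<open>The limits of the sums in \<open>rat_part\<close> say that the points
  \<open>k + v / d\<close> and \<open>k - v / d\<close> stay between \<open>- 53 * N\<close> and
  \<open>53 * N\<close>, the range in which \<open>polar_val_den\<close> holds.\<close>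

lemma den_rat_part_integer:
  assumes "N \<ge> 1" and d: "d \<in> {1, 2, 3}"
  shows "real (den N) * rat_part N d \<in> \<int>"
proof (rule pval_integer)
  fix p :: nat assume p: "prime p"
  have d0: "real d > 0" using d by auto
  have a: "pval p (- int (den_exp N p)) (polar N k (real v / real d))"
    if k: "k \<in> poles N" and v: "v \<in> {1..nat (int d * (53 * int N - k))}" for k v
  proof -
    have "int v \<le> int d * (53 * int N - k)" using v by auto
    hence "real_of_int (int v) \<le> real_of_int (int d * (53 * int N - k))" by (simp only: of_int_le_iff)
    hence "real v / real d \<le> 53 * real N - of_int k" using d0 by (simp add: field_simps)
    moreover have "real v / real d \<ge> 0" by simp
    moreover have "- (53 * real N) \<le> of_int k" using k by auto
    ultimately have "\<bar>of_int k + of_int (int v) / real d\<bar> \<le> 53 * real N"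
      unfolding of_int_of_nat_eq abs_le_iff by linarith
    from polar_val_den[OF assms(1) p k _ d this] v show ?thesis by simp
  qed
  have b: "pval p (- int (den_exp N p)) (polar N k (- (real v / real d)))"
    if k: "k \<in> poles N" and v: "v \<in> {1..nat (int d * (53 * int N + k))}" for k v
  proof -
    have "int v \<le> int d * (53 * int N + k)" using v by auto
    hence "real_of_int (int v) \<le> real_of_int (int d * (53 * int N + k))" by (simp only: of_int_le_iff)
    hence "real v / real d \<le> 53 * real N + of_int k" using d0 by (simp add: field_simps)
    moreover have "real v / real d \<ge> 0" by simp
    moreover have "of_int k \<le> 53 * real N" using k by auto
    ultimately have "\<bar>of_int k + of_int (- int v) / real d\<bar> \<le> 53 * real N"
      unfolding of_int_minus of_int_of_nat_eq abs_le_iff minus_divide_left [symmetric] by linarith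
    from polar_val_den[OF assms(1) p k _ d this] v show ?thesis by simp
  qed
  have "pval p (int (den_exp N p) + - int (den_exp N p)) (real (den N) * rat_part N d)"
    unfolding rat_part_def diff_conv_add_uminus[of "sum _ _"] using assms p
    by (intro pval_mult pval_den pval_sum pval_add pval_uminus a b)
  thus "pval p 0 (real (den N) * rat_part N d)" by simp
qed


section \<open>Growth of the common denominator\<close>

lemma chebyshev_theta_mult_limit:
  assumes "a \<ge> (0 :: int)"
  shows "(\<lambda>N. chebyshev_theta (nat (a * int N div 8)) / real N) \<longlonglongrightarrow> of_int a / 8"
proof (cases "a = 0")
  case True
  thus ?thesis by (simp add: chebyshev_theta_def)
next
  case False
  with assms have a: "a > 0" by simp
  define m where "m = (\<lambda>N. nat (a * int N div 8))"
  have bounds: "of_int a * real N / 8 - 1 \<le> real (m N)" "real (m N) \<le> of_int a * real N / 8" for N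
  proof -
    have "a * int N div 8 \<ge> 0" using a by (simp add: pos_imp_zdiv_nonneg_iff)
    hence "real (m N) = of_int (a * int N div 8)" by (simp add: m_def)
    also have "\<dots> = of_int \<lfloor>of_int (a * int N) / of_int 8 :: real\<rfloor>" by (simp only: floor_divide_of_int_eq)
    finally have "real (m N) = of_int \<lfloor>of_int (a * int N) / 8 :: real\<rfloor>" by simp
    thus "of_int a * real N / 8 - 1 \<le> real (m N)" "real (m N) \<le> of_int a * real N / 8" 
      by (simp_all add: of_int_floor_le) linarith
  qed
  have lim: "(\<lambda>N. real (m N) / real N) \<longlonglongrightarrow> of_int a / 8"
  proof (rule tendsto_sandwich[OF _ _ _ tendsto_const])
    show "eventually (\<lambda>N. of_int a / 8 - 1 / real N \<le> real (m N) / real N) sequentially"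
      using eventually_gt_at_top[of 0]
    proof eventually_elim
      case (elim N)
      have "(of_int a * real N / 8 - 1) / real N \<le> real (m N) / real N" by (intro divide_right_mono bounds) simp
      thus ?case using elim by (simp add: diff_divide_distrib)
    qed
    show "eventually (\<lambda>N. real (m N) / real N \<le> of_int a / 8) sequentially"
      using eventually_gt_at_top[of 0] by eventually_elim (use bounds in \<open>simp add: field_simps\<close>)
    show "(\<lambda>N. of_int a / 8 - 1 / real N) \<longlonglongrightarrow> of_int a / 8" by real_asymp
  qed
  have "filterlim m at_top sequentially"
  proof (subst filterlim_sequentially_iff_filterlim_real, rule filterlim_at_top_mono)
    show "filterlim (\<lambda>N. of_int a * real N / 8 - 1) at_top sequentially" using a by real_asymp
  qed (use bounds in auto)
  from filterlim_compose[OF prime_number_theorem this] 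
  have "(\<lambda>N. chebyshev_theta (m N) / real (m N) * (real (m N) / real N)) \<longlonglongrightarrow> 1 * (of_int a / 8)"
    by (intro tendsto_mult lim)
  moreover have "chebyshev_theta (m N) / real (m N) * (real (m N) / real N) = chebyshev_theta (m N) / real N" for N
    by (cases "m N = 0") (auto simp: chebyshev_theta_def)
  ultimately show ?thesis by (simp only: m_def mult_1_left)
qed

text \<open>For a small prime \<open>p ^ \<Lambda>\<close> is at most \<open>726 * N\<close>, so its
  contribution is bounded independently of \<open>p\<close>.\<close>

lemma den_exp_ln_le:
  assumes "N \<ge> 1" "prime p" "p \<le> 726 * N"
  shows "real (den_exp N p) * ln (real p) \<le> (if p\<^sup>2 \<le> 726 * N then 72 * ln (726 * real N) else 0) +
    (\<Sum>(\<alpha>, \<beta>, c)\<leftarrow>cells. of_int c * (if \<alpha> * int N < 8 * int p \<and> 8 * int p \<le> \<beta> * int N then ln (real p) else 0))"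
proof -
  have lnp: "ln (real p) \<ge> 0" using prime_ge_1_nat[OF assms(2)] by simp
  have nn: "(\<Sum>(\<alpha>, \<beta>, c)\<leftarrow>cells. of_int c * (if \<alpha> * int N < 8 * int p \<and> 8 * int p \<le> \<beta> * int N then ln (real p) else 0)) \<ge> 0"
    using lnp cells_bounds(4) by (intro sum_list_nonneg) auto
  show ?thesis
  proof (cases "p\<^sup>2 \<le> 726 * N")
    case True
    define \<Lambda> where "\<Lambda> = floorlog p (726 * N) - 1"
    have "real (p ^ \<Lambda>) \<le> real (726 * N)" using crude_exponent(2)[OF assms(1,2) True] unfolding \<Lambda>_def by (simp only: of_nat_le_iff)
    hence "ln (real p ^ \<Lambda>) \<le> ln (726 * real N)" using prime_gt_0_nat[OF assms(2)] assms(1) by (subst ln_le_cancel_iff) auto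
    hence "72 * (real \<Lambda> * ln (real p)) \<le> 72 * ln (726 * real N)" using prime_gt_0_nat[OF assms(2)] by (simp add: ln_realpow)
    moreover have "real (den_exp N p) = 72 * real \<Lambda>" using True by (simp add: den_exp_def \<Lambda>_def)
    ultimately show ?thesis using True nn by simp
  next
    case False
    have "real (\<Sum>(\<alpha>, \<beta>, c)\<leftarrow>xs. if \<alpha> * int N < 8 * int p \<and> 8 * int p \<le> \<beta> * int N then nat c else 0) * ln (real p)
       = (\<Sum>(\<alpha>, \<beta>, c)\<leftarrow>xs. of_int c * (if \<alpha> * int N < 8 * int p \<and> 8 * int p \<le> \<beta> * int N then ln (real p) else 0))"
      if "\<forall>(\<alpha>, \<beta>, c)\<in>set xs. c \<ge> 0" for xs
      using that by (induction xs) (auto simp: distrib_right)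
    moreover have "\<forall>(\<alpha>, \<beta>, c)\<in>set cells. c \<ge> 0" using cells_bounds(4) by auto
    ultimately have "real (den_exp N p) * ln (real p) =
        (\<Sum>(\<alpha>, \<beta>, c)\<leftarrow>cells. of_int c * (if \<alpha> * int N < 8 * int p \<and> 8 * int p \<le> \<beta> * int N then ln (real p) else 0))"
      using False by (simp only: den_exp_def if_False)
    thus ?thesis using False by simp
  qed
qed

lemma sum_ln_cell:
  assumes "0 \<le> \<alpha>" "\<alpha> \<le> \<beta>" "\<beta> \<le> 5808"
  shows "(\<Sum>p | prime p \<and> p \<le> 726 * N. if \<alpha> * int N < 8 * int p \<and> 8 * int p \<le> \<beta> * int N then ln (real p) else 0) =
     chebyshev_theta (nat (\<beta> * int N div 8)) - chebyshev_theta (nat (\<alpha> * int N div 8))"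
proof -
  have eq: "p \<le> nat (x * int N div 8) \<longleftrightarrow> 8 * int p \<le> x * int N" if "x \<ge> 0" for x p
  proof -
    have "x * int N div 8 \<ge> 0" using that by (simp add: pos_imp_zdiv_nonneg_iff)
    thus ?thesis by linarith
  qed
  have mono: "\<alpha> * int N \<le> \<beta> * int N" "\<beta> * int N \<le> 5808 * int N" using assms by (auto intro: mult_right_mono)
  have "(\<Sum>p | prime p \<and> p \<le> 726 * N. if \<alpha> * int N < 8 * int p \<and> 8 * int p \<le> \<beta> * int N then ln (real p) else 0) =
     (\<Sum>p\<in>{p. prime p \<and> p \<le> nat (\<beta> * int N div 8)} - {p. prime p \<and> p \<le> nat (\<alpha> * int N div 8)}. ln (real p))"
    using assms mono by (intro sum.mono_neutral_cong_right) (auto simp: eq)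
  also have "\<dots> = chebyshev_theta (nat (\<beta> * int N div 8)) - chebyshev_theta (nat (\<alpha> * int N div 8))"
    unfolding chebyshev_theta_def
  proof (rule sum_diff)
    show "{p. prime p \<and> p \<le> nat (\<alpha> * int N div 8)} \<subseteq> {p. prime p \<and> p \<le> nat (\<beta> * int N div 8)}"
      using mono assms by (auto simp: eq)
  qed simp
  finally show ?thesis .
qed

text \<open>There are at most sqrt (726 N) small primes. For the cells, the logarithms of the primes
  in one of them add up to a difference of two values of \<open>chebyshev_theta\<close>.\<close>

lemma ln_den_le:
  assumes N: "N \<ge> 1"
  shows "ln (real (den N)) \<le> 72 * ln (726 * real N) * sqrt (726 * real N) +
    (\<Sum>(\<alpha>, \<beta>, c)\<leftarrow>cells. of_int c * (chebyshev_theta (nat (\<beta> * int N div 8)) - chebyshev_theta (nat (\<alpha> * int N div 8))))"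
proof -
  let ?P = "{p. prime p \<and> p \<le> 726 * N}"
  have "ln (real (den N)) = (\<Sum>p\<in>?P. real (den_exp N p) * ln (real p))"
    unfolding den_def of_nat_prod by (subst ln_prod) (auto simp: ln_realpow prime_gt_0_nat intro!: sum.cong)
  also have "\<dots> \<le> (\<Sum>p\<in>?P. (if p\<^sup>2 \<le> 726 * N then 72 * ln (726 * real N) else 0) +
      (\<Sum>(\<alpha>, \<beta>, c)\<leftarrow>cells. of_int c * (if \<alpha> * int N < 8 * int p \<and> 8 * int p \<le> \<beta> * int N then ln (real p) else 0)))"
    using N by (intro sum_mono den_exp_ln_le) auto
  also have "\<dots> = (\<Sum>p\<in>?P. if p\<^sup>2 \<le> 726 * N then 72 * ln (726 * real N) else 0) +
      (\<Sum>(\<alpha>, \<beta>, c)\<leftarrow>cells. of_int c * (\<Sum>p\<in>?P. if \<alpha> * int N < 8 * int p \<and> 8 * int p \<le> \<beta> * int N then ln (real p) else 0))"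
  proof -
    have "(\<Sum>p\<in>?P. \<Sum>(\<alpha>, \<beta>, c)\<leftarrow>xs. of_int c * (if \<alpha> * int N < 8 * int p \<and> 8 * int p \<le> \<beta> * int N then ln (real p) else 0)) =
      (\<Sum>(\<alpha>, \<beta>, c)\<leftarrow>xs. of_int c * (\<Sum>p\<in>?P. if \<alpha> * int N < 8 * int p \<and> 8 * int p \<le> \<beta> * int N then ln (real p) else 0))" for xs
      by (induction xs) (auto simp: sum.distrib sum_distrib_left intro!: sum.cong)
    thus ?thesis by (simp only: sum.distrib)
  qed
  also have "(\<Sum>p\<in>?P. if p\<^sup>2 \<le> 726 * N then 72 * ln (726 * real N) else 0) \<le> 72 * ln (726 * real N) * sqrt (726 * real N)"
  proof -
    have sub: "?P \<inter> {p. p\<^sup>2 \<le> 726 * N} \<subseteq> {1..nat \<lfloor>sqrt (726 * real N)\<rfloor>}"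
    proof
      fix p assume "p \<in> ?P \<inter> {p. p\<^sup>2 \<le> 726 * N}"
      hence p: "prime p" "p\<^sup>2 \<le> 726 * N" by auto
      hence "real (p\<^sup>2) \<le> real (726 * N)" by (simp only: of_nat_le_iff)
      hence "real p \<le> sqrt (726 * real N)" by (intro real_le_rsqrt) simp
      hence "p \<le> nat \<lfloor>sqrt (726 * real N)\<rfloor>" by (simp add: le_nat_floor)
      thus "p \<in> {1..nat \<lfloor>sqrt (726 * real N)\<rfloor>}" using prime_ge_1_nat[OF p(1)] by simp
    qed
    have "(\<Sum>p\<in>?P. if p\<^sup>2 \<le> 726 * N then 72 * ln (726 * real N) else 0) = (\<Sum>p\<in>?P \<inter> {p. p\<^sup>2 \<le> 726 * N}. 72 * ln (726 * real N))"
      by (intro sum.mono_neutral_cong_right) auto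
    also have "\<dots> \<le> (\<Sum>p\<in>{1..nat \<lfloor>sqrt (726 * real N)\<rfloor>}. 72 * ln (726 * real N))"
      using N by (intro sum_mono2 sub) auto
    also have "\<dots> = real (nat \<lfloor>sqrt (726 * real N)\<rfloor>) * (72 * ln (726 * real N))" by simp
    also have "\<dots> \<le> sqrt (726 * real N) * (72 * ln (726 * real N))" using N by (intro mult_right_mono) auto
    finally show ?thesis by (simp add: mult_ac)
  qed
  also have "(\<Sum>(\<alpha>, \<beta>, c)\<leftarrow>cells. of_int c * (\<Sum>p\<in>?P. if \<alpha> * int N < 8 * int p \<and> 8 * int p \<le> \<beta> * int N then ln (real p) else 0)) =
    (\<Sum>(\<alpha>, \<beta>, c)\<leftarrow>cells. of_int c * (chebyshev_theta (nat (\<beta> * int N div 8)) - chebyshev_theta (nat (\<alpha> * int N div 8))))"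
    using cells_bounds by (intro arg_cong[where f = sum_list] map_cong refl) (auto simp: sum_ln_cell split: prod.splits)
  finally show ?thesis by simp
qed

lemma ln_den_asymptotics: "eventually (\<lambda>N. ln (real (den N)) \<le> 3750 * real N) sequentially"
proof -
  define B where "B = (\<lambda>xs N. \<Sum>(\<alpha>, \<beta>, c)\<leftarrow>xs. of_int c *
     (chebyshev_theta (nat (\<beta> * int N div 8)) / real N - chebyshev_theta (nat (\<alpha> * int N div 8)) / real N))"
  have "B xs \<longlonglongrightarrow> of_int (\<Sum>(\<alpha>, \<beta>, c)\<leftarrow>xs. c * (\<beta> - \<alpha>)) / 8" if "\<forall>(\<alpha>, \<beta>, c)\<in>set xs. 0 \<le> \<alpha> \<and> \<alpha> \<le> \<beta>" for xs
    using that
  proof (induction xs)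
    case (Cons x xs)
    obtain \<alpha> \<beta> c where x: "x = (\<alpha>, \<beta>, c)" by (cases x) auto
    have "(\<lambda>N. of_int c * (chebyshev_theta (nat (\<beta> * int N div 8)) / real N - chebyshev_theta (nat (\<alpha> * int N div 8)) / real N) + B xs N)
       \<longlonglongrightarrow> of_int c * (of_int \<beta> / 8 - of_int \<alpha> / 8) + of_int (\<Sum>(\<alpha>, \<beta>, c)\<leftarrow>xs. c * (\<beta> - \<alpha>)) / 8"
      using Cons x by (intro tendsto_add tendsto_mult tendsto_const tendsto_diff chebyshev_theta_mult_limit) auto
    also have "of_int c * (of_int \<beta> / 8 - of_int \<alpha> / 8) + of_int (\<Sum>(\<alpha>, \<beta>, c)\<leftarrow>xs. c * (\<beta> - \<alpha>)) / 8 =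
        real_of_int (c * (\<beta> - \<alpha>) + (\<Sum>(\<alpha>, \<beta>, c)\<leftarrow>xs. c * (\<beta> - \<alpha>))) / 8"
      by (simp add: diff_divide_distrib add_divide_distrib right_diff_distrib)
    finally show ?case by (simp add: x B_def)
  qed (simp add: B_def)
  moreover have "\<forall>(\<alpha>, \<beta>, c)\<in>set cells. 0 \<le> \<alpha> \<and> \<alpha> \<le> \<beta>" using cells_bounds(1,2) by auto
  ultimately have "B cells \<longlonglongrightarrow> of_int (\<Sum>(\<alpha>, \<beta>, c)\<leftarrow>cells. c * (\<beta> - \<alpha>)) / 8" by blast
  hence "B cells \<longlonglongrightarrow> 29998 / 8" unfolding sum_cells by simp
  moreover have "(\<lambda>N. 72 * ln (726 * real N) * sqrt (726 * real N) / real N) \<longlonglongrightarrow> 0" by real_asymp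
  ultimately have "(\<lambda>N. 72 * ln (726 * real N) * sqrt (726 * real N) / real N + B cells N) \<longlonglongrightarrow> 0 + 29998 / 8"
    by (rule tendsto_add[rotated])
  hence "eventually (\<lambda>N. 72 * ln (726 * real N) * sqrt (726 * real N) / real N + B cells N < 3750) sequentially"
    by (rule order_tendstoD) simp
  thus ?thesis using eventually_ge_at_top[of 1]
  proof eventually_elim
    case (elim N)
    have "(\<Sum>(\<alpha>, \<beta>, c)\<leftarrow>xs. of_int c * (chebyshev_theta (nat (\<beta> * int N div 8)) - chebyshev_theta (nat (\<alpha> * int N div 8)))) = real N * B xs N" for xs
      using elim by (induction xs) (auto simp: B_def field_simps)
    with ln_den_le[OF elim(2)] have "ln (real (den N)) \<le> real N * (72 * ln (726 * real N) * sqrt (726 * real N) / real N + B cells N)"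
      using elim by (simp add: distrib_left)
    also have "\<dots> \<le> real N * 3750" using elim by (intro mult_left_mono) auto
    finally show ?case by simp
  qed
qed

section \<open>Asymptotics of the linear forms\<close>

text \<open>Half of \<open>t\<close> times the derivative of ln (t^2 - a^2), that is, the
  contribution of a symmetric pair of zeros shared between its members. Hence
  \<open>log_slope N t\<close> is \<open>t\<close> times the logarithmic derivative of
  \<open>R N\<close>.\<close>

definition zphi :: "real \<Rightarrow> real \<Rightarrow> real" where
  "zphi a t = t\<^sup>2 / (t\<^sup>2 - a\<^sup>2)"

definition log_slope :: "nat \<Rightarrow> real \<Rightarrow> real" where
  "log_slope N t = (\<Sum>u\<in>zeros2 N. zphi (of_int u / 2) t) + (\<Sum>u\<in>zeros3 N. zphi (of_int u / 3) t)
     - (\<Sum>L\<in>{19..53}. \<Sum>j\<in>block N L. zphi (of_int j) t)"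

definition log_R :: "nat \<Rightarrow> real \<Rightarrow> real" where
  "log_R N t = ln (lead N) + (\<Sum>u\<in>zeros2 N. ln (2 * t - of_int u)) + (\<Sum>u\<in>zeros3 N. ln (3 * t - of_int u))
     - (\<Sum>L\<in>{19..53}. \<Sum>j\<in>block N L. ln (t - of_int j))"

lemma lead_pos: "lead N > 0"
  unfolding lead_def norm_factor_def by (intro mult_pos_pos divide_pos_pos prod_pos) (auto simp: fact_gt_zero)

lemma zeros2_abs: "u \<in> zeros2 N \<Longrightarrow> \<bar>of_int u / 2\<bar> \<le> 121 * real N"
  and zeros3_abs: "u \<in> zeros3 N \<Longrightarrow> \<bar>of_int u / 3\<bar> \<le> 121 * real N"
  by (auto simp: zeros2_def zeros3_def abs_le_iff)

lemma block_abs: "L \<in> {19..53} \<Longrightarrow> j \<in> block N L \<Longrightarrow> \<bar>real_of_int j\<bar> \<le> 53 * real N"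
proof -
  assume L: "L \<in> {19..53}" "j \<in> block N L"
  have "L * int N \<le> 53 * int N" using L by (intro mult_right_mono) auto
  hence "\<bar>j\<bar> \<le> 53 * int N" using L by (auto simp: block_def)
  thus ?thesis by linarith
qed

lemma R_eq_exp:
  assumes "t > 121 * real N"
  shows "R N t = exp (log_R N t)"
proof -
  have p2: "2 * t - of_int u > 0" if "u \<in> zeros2 N" for u using zeros2_abs[OF that] assms by linarith
  have p3: "3 * t - of_int u > 0" if "u \<in> zeros3 N" for u using zeros3_abs[OF that] assms by linarith
  have p1: "t - of_int j > 0" if "L \<in> {19..53}" "j \<in> block N L" for L j using block_abs[OF that] assms by linarith
  show ?thesis unfolding R_def log_R_def exp_diff exp_add using p1 p2 p3 lead_pos[of N]
    by (auto simp: exp_sum intro!: arg_cong2[where f = "(/)"] arg_cong2[where f = "(*)"] prod.cong)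
qed

lemma sum_symmetric:
  assumes "finite S" "\<And>u. u \<in> S \<Longrightarrow> - u \<in> S" "t > 0" "c > 0" "\<And>u. u \<in> S \<Longrightarrow> \<bar>real_of_int u\<bar> < c * t"
  shows "(\<Sum>u\<in>S. c / (c * t - of_int u)) = (\<Sum>u\<in>S. zphi (of_int u / c) t) / t"
proof -
  have "(\<Sum>u\<in>S. c / (c * t - of_int u)) = (\<Sum>u\<in>S. c / (c * t + of_int u))"
    by (rule sum.reindex_bij_witness[of _ uminus uminus]) (use assms in auto)
  hence "2 * (\<Sum>u\<in>S. c / (c * t - of_int u)) = (\<Sum>u\<in>S. c / (c * t - of_int u) + c / (c * t + of_int u))"
    by (simp add: sum.distrib)
  also have "\<dots> = (\<Sum>u\<in>S. 2 * (zphi (of_int u / c) t / t))"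
  proof (intro sum.cong refl)
    fix u assume "u \<in> S"
    hence u: "\<bar>real_of_int u\<bar> < c * t" using assms by auto
    hence nz: "c * t - of_int u > 0" "c * t + of_int u > 0" by linarith+
    hence prd: "(c * t - of_int u) * (c * t + of_int u) > 0" by simp
    have e: "(c * t - of_int u) * (c * t + of_int u) = c\<^sup>2 * (t\<^sup>2 - (of_int u / c)\<^sup>2)"
      using assms by (simp add: field_simps power2_eq_square)
    have "c / (c * t - of_int u) + c / (c * t + of_int u) = 2 * c\<^sup>2 * t / ((c * t - of_int u) * (c * t + of_int u))"
      using nz by (simp add: field_simps power2_eq_square)
    also have "\<dots> = 2 * (zphi (of_int u / c) t / t)"
      unfolding e zphi_def using assms by (simp add: power2_eq_square)
    finally show "c / (c * t - of_int u) + c / (c * t + of_int u) = 2 * (zphi (of_int u / c) t / t)" .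
  qed
  also have "\<dots> = 2 * ((\<Sum>u\<in>S. zphi (of_int u / c) t) / t)" by (simp only: sum_distrib_left sum_divide_distrib)
  finally show ?thesis by simp
qed

lemma log_slope_eq:
  assumes t: "t > 121 * real N"
  shows "log_slope N t / t = (\<Sum>u\<in>zeros2 N. 2 / (2 * t - of_int u)) + (\<Sum>u\<in>zeros3 N. 3 / (3 * t - of_int u))
     - (\<Sum>L\<in>{19..53}. \<Sum>j\<in>block N L. 1 / (t - of_int j))"
proof -
  have t0: "t > 0" using t by (smt (verit) of_nat_0_le_iff)
  have "(\<Sum>u\<in>zeros2 N. 2 / (2 * t - of_int u)) = (\<Sum>u\<in>zeros2 N. zphi (of_int u / 2) t) / t"
  proof (rule sum_symmetric)
    show "\<bar>real_of_int u\<bar> < 2 * t" if "u \<in> zeros2 N" for u using zeros2_abs[OF that] t by linarith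
    show "- u \<in> zeros2 N" if "u \<in> zeros2 N" for u using that by (simp add: zeros2_def)
  qed (use t0 in auto)
  moreover have "(\<Sum>u\<in>zeros3 N. 3 / (3 * t - of_int u)) = (\<Sum>u\<in>zeros3 N. zphi (of_int u / 3) t) / t"
  proof (rule sum_symmetric)
    show "\<bar>real_of_int u\<bar> < 3 * t" if "u \<in> zeros3 N" for u using zeros3_abs[OF that] t by linarith
    show "- u \<in> zeros3 N" if "u \<in> zeros3 N" for u using that by (simp add: zeros3_def)
  qed (use t0 in auto)
  moreover have "(\<Sum>j\<in>block N L. 1 / (t - of_int j)) = (\<Sum>j\<in>block N L. zphi (of_int j) t) / t" if L: "L \<in> {19..53}" for L
  proof -
    have "(\<Sum>j\<in>block N L. 1 / (1 * t - of_int j)) = (\<Sum>j\<in>block N L. zphi (of_int j / 1) t) / t"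
    proof (rule sum_symmetric)
      show "\<bar>real_of_int j\<bar> < 1 * t" if "j \<in> block N L" for j using block_abs[OF L that] t by linarith
      show "- j \<in> block N L" if "j \<in> block N L" for j using that by (auto simp: block_def)
    qed (use t0 in auto)
    thus ?thesis by simp
  qed
  ultimately show ?thesis
    by (simp add: log_slope_def add_divide_distrib diff_divide_distrib sum_divide_distrib)
qed

lemma log_R_deriv:
  assumes t: "t > 121 * real N"
  shows "(log_R N has_real_derivative log_slope N t / t) (at t)"
proof -
  have p2: "2 * t - of_int u > 0" if "u \<in> zeros2 N" for u using zeros2_abs[OF that] assms by linarith
  have p3: "3 * t - of_int u > 0" if "u \<in> zeros3 N" for u using zeros3_abs[OF that] assms by linarith
  have p1: "t - of_int j > 0" if "L \<in> {19..53}" "j \<in> block N L" for L j using block_abs[OF that] assms by linarith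
  show ?thesis unfolding log_R_def[abs_def] log_slope_eq[OF t]
    by (auto intro!: derivative_eq_intros sum.cong dest: p1 p2 p3 simp: divide_simps)
qed

lemma log_slope_diff:
  assumes s: "s > 121 * real N" and t: "t > 121 * real N"
  defines "w \<equiv> \<lambda>a. a\<^sup>2 / ((s\<^sup>2 - a\<^sup>2) * (t\<^sup>2 - a\<^sup>2))"
  shows "log_slope N s - log_slope N t = (t\<^sup>2 - s\<^sup>2) * ((\<Sum>u\<in>zeros2 N. w (of_int u / 2)) + (\<Sum>u\<in>zeros3 N. w (of_int u / 3))
     - (\<Sum>L\<in>{19..53}. \<Sum>j\<in>block N L. w (of_int j)))"
proof -
  have e: "zphi a s - zphi a t = (t\<^sup>2 - s\<^sup>2) * w a" if "\<bar>a\<bar> \<le> 121 * real N" for a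
  proof -
    have "\<bar>a\<bar>\<^sup>2 < s\<^sup>2" "\<bar>a\<bar>\<^sup>2 < t\<^sup>2" using that s t by (intro power_strict_mono; simp)+
    hence "a\<^sup>2 < s\<^sup>2" "a\<^sup>2 < t\<^sup>2" by simp_all
    thus ?thesis by (simp add: zphi_def w_def divide_simps) (simp add: algebra_simps)
  qed
  have "log_slope N s - log_slope N t = (\<Sum>u\<in>zeros2 N. zphi (of_int u / 2) s - zphi (of_int u / 2) t)
     + (\<Sum>u\<in>zeros3 N. zphi (of_int u / 3) s - zphi (of_int u / 3) t)
     - (\<Sum>L\<in>{19..53}. \<Sum>j\<in>block N L. zphi (of_int j) s - zphi (of_int j) t)"
    by (simp add: log_slope_def sum_subtractf)
  also have "\<dots> = (\<Sum>u\<in>zeros2 N. (t\<^sup>2 - s\<^sup>2) * w (of_int u / 2)) + (\<Sum>u\<in>zeros3 N. (t\<^sup>2 - s\<^sup>2) * w (of_int u / 3))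
     - (\<Sum>L\<in>{19..53}. \<Sum>j\<in>block N L. (t\<^sup>2 - s\<^sup>2) * w (of_int j))"
  proof (intro arg_cong2[where f = "(-)"] arg_cong2[where f = "(+)"] sum.cong refl e zeros2_abs zeros3_abs)
    fix L j assume "L \<in> {19..53}" "j \<in> block N L"
    thus "\<bar>real_of_int j\<bar> \<le> 121 * real N" using block_abs[of L j N] by simp
  qed
  also have "\<dots> = (t\<^sup>2 - s\<^sup>2) * ((\<Sum>u\<in>zeros2 N. w (of_int u / 2)) + (\<Sum>u\<in>zeros3 N. w (of_int u / 3))
     - (\<Sum>L\<in>{19..53}. \<Sum>j\<in>block N L. w (of_int j)))"
    by (simp only: sum_distrib_left right_diff_distrib distrib_left)
  finally show ?thesis .
qed

lemma sum_squares_symmetric: "3 * (\<Sum>j\<in>{- int M..int M}. (real_of_int j)\<^sup>2) = real M * (real M + 1) * (2 * real M + 1)"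
proof (induction M)
  case (Suc M)
  have "{- int (Suc M)..int (Suc M)} = insert (- int (Suc M)) (insert (int (Suc M)) {- int M..int M})" by auto
  hence "(\<Sum>j\<in>{- int (Suc M)..int (Suc M)}. (real_of_int j)\<^sup>2) = (\<Sum>j\<in>{- int M..int M}. (real_of_int j)\<^sup>2) + 2 * (real (Suc M))\<^sup>2"
    by (simp add: power2_eq_square algebra_simps)
  thus ?case using Suc by (simp add: algebra_simps power2_eq_square)
qed simp

lemma sum_squares_poles:
  assumes N: "N \<ge> 1"
  shows "(\<Sum>L\<in>{19..53}. \<Sum>j\<in>block N L. (real_of_int j)\<^sup>2) \<le> 1460000 * real N ^ 3"
proof -
  have "(\<Sum>L\<in>{19..53}. \<Sum>j\<in>block N L. (real_of_int j)\<^sup>2) \<le> (\<Sum>L\<in>{19..53}. 13 / 18 * (real_of_int L ^ 3 * real N ^ 3))"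
  proof (intro sum_mono)
    fix L :: int assume L: "L \<in> {19..53}"
    define M where "M = nat (L * int N)"
    have M_eq: "int M = L * int N" using L by (simp add: M_def)
    have "L * int N \<ge> 19 * 1" using L N by (intro mult_mono) auto
    hence M19: "real M \<ge> 19" using M_eq by linarith
    have "19 * real M \<le> real M * real M" using M19 by (intro mult_right_mono) auto
    moreover have "(real M + 1) * (2 * real M + 1) = 2 * (real M * real M) + 3 * real M + 1" by (simp add: algebra_simps)
    \<comment> \<open>\<open>M \<ge> 19\<close> keeps the lower-order terms below a twelfth of the
      leading term \<open>2 * M * M\<close>.\<close>
    ultimately have "(real M + 1) * (2 * real M + 1) \<le> 13 / 6 * (real M * real M)" using M19 by linarith
    hence "real M * ((real M + 1) * (2 * real M + 1)) \<le> real M * (13 / 6 * (real M * real M))" by (intro mult_left_mono) auto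
    hence "real M * (real M + 1) * (2 * real M + 1) \<le> 13 / 6 * real M ^ 3" by (simp only: power3_eq_cube mult_ac)
    moreover have "3 * (\<Sum>j\<in>block N L. (real_of_int j)\<^sup>2) = real M * (real M + 1) * (2 * real M + 1)"
      unfolding block_def M_eq [symmetric] by (rule sum_squares_symmetric)
    ultimately have "(\<Sum>j\<in>block N L. (real_of_int j)\<^sup>2) \<le> 13 / 18 * real M ^ 3" by linarith
    also have "real M = real_of_int L * real N" using M_eq by (metis of_int_mult of_int_of_nat_eq)
    finally show "(\<Sum>j\<in>block N L. (real_of_int j)\<^sup>2) \<le> 13 / 18 * (real_of_int L ^ 3 * real N ^ 3)" by (simp add: power_mult_distrib)
  qed
  also have "\<dots> = 13 / 18 * (\<Sum>L\<in>{19..53}. real_of_int L ^ 3) * real N ^ 3"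
    by (simp add: sum_distrib_left sum_distrib_right mult.assoc)
  also have "(\<Sum>L\<in>{19..53}. real_of_int L ^ 3) = of_int (\<Sum>L\<in>{19..53}. L ^ 3)" by simp
  also have "(\<Sum>L\<in>{19..53::int}. L ^ 3) = 2018520" by code_simp
  also have "13 / 18 * real_of_int 2018520 * real N ^ 3 \<le> 1460000 * real N ^ 3" by (intro mult_right_mono) auto
  finally show ?thesis .
qed

text \<open>\<open>w a / a\<^sup>2\<close> grows with the absolute value of \<open>a\<close> and is
  compared with its value \<open>q\<close> at the outermost pole \<open>B\<close>. The poles give at
  most 1460000 N^3 q, while the thirds between 87 N and 121 N alone give at least 204 * 87^2 N^3 q =
  1544076 N^3 q.\<close>

lemma log_slope_antimono:
  assumes N: "N \<ge> 1" and s: "s > 121 * real N" and st: "s \<le> t"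
  shows "log_slope N t \<le> log_slope N s"
proof -
  define w where "w = (\<lambda>a. a\<^sup>2 / ((s\<^sup>2 - a\<^sup>2) * (t\<^sup>2 - a\<^sup>2)))"
  define B where "B = 53 * real N"
  define q where "q = 1 / ((s\<^sup>2 - B\<^sup>2) * (t\<^sup>2 - B\<^sup>2))"
  have t: "t > 121 * real N" using s st by simp
  have N0: "real N > 0" using N by simp
  have pos: "s\<^sup>2 - a\<^sup>2 > 0" "t\<^sup>2 - a\<^sup>2 > 0" if "\<bar>a\<bar> \<le> 121 * real N" for a
  proof -
    have "\<bar>a\<bar>\<^sup>2 < s\<^sup>2" "\<bar>a\<bar>\<^sup>2 < t\<^sup>2" using that s t by (intro power_strict_mono; simp)+
    thus "s\<^sup>2 - a\<^sup>2 > 0" "t\<^sup>2 - a\<^sup>2 > 0" by simp_all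
  qed
  have w0: "w a \<ge> 0" if "\<bar>a\<bar> \<le> 121 * real N" for a
    using pos[OF that] by (auto simp: w_def)
  have w_le: "w a \<le> a\<^sup>2 * q" if "\<bar>a\<bar> \<le> B" for a
  proof -
    have b: "s\<^sup>2 - B\<^sup>2 > 0" "t\<^sup>2 - B\<^sup>2 > 0" using pos[of B] N0 by (auto simp: B_def)
    have "\<bar>a\<bar>\<^sup>2 \<le> B\<^sup>2" using that by (intro power_mono) auto
    hence ab: "a\<^sup>2 \<le> B\<^sup>2" by simp
    hence "(s\<^sup>2 - B\<^sup>2) * (t\<^sup>2 - B\<^sup>2) \<le> (s\<^sup>2 - a\<^sup>2) * (t\<^sup>2 - a\<^sup>2)" using b by (intro mult_mono) auto
    hence "a\<^sup>2 / ((s\<^sup>2 - a\<^sup>2) * (t\<^sup>2 - a\<^sup>2)) \<le> a\<^sup>2 / ((s\<^sup>2 - B\<^sup>2) * (t\<^sup>2 - B\<^sup>2))"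
      using b ab by (intro divide_left_mono mult_pos_pos) auto
    thus ?thesis by (simp add: w_def q_def)
  qed
  have w_ge: "w a \<ge> a\<^sup>2 * q" if "\<bar>a\<bar> \<ge> B" "\<bar>a\<bar> \<le> 121 * real N" for a
  proof -
    note b = pos[OF that(2)]
    have "B\<^sup>2 \<le> \<bar>a\<bar>\<^sup>2" using that N0 by (intro power_mono) (auto simp: B_def)
    hence ab: "B\<^sup>2 \<le> a\<^sup>2" by simp
    hence "(s\<^sup>2 - a\<^sup>2) * (t\<^sup>2 - a\<^sup>2) \<le> (s\<^sup>2 - B\<^sup>2) * (t\<^sup>2 - B\<^sup>2)" using b by (intro mult_mono) auto
    hence "a\<^sup>2 / ((s\<^sup>2 - B\<^sup>2) * (t\<^sup>2 - B\<^sup>2)) \<le> a\<^sup>2 / ((s\<^sup>2 - a\<^sup>2) * (t\<^sup>2 - a\<^sup>2))"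
      using b ab by (intro divide_left_mono mult_pos_pos) auto
    thus ?thesis by (simp add: w_def q_def)
  qed
  have q0: "q \<ge> 0" using pos[of B] N0 by (auto simp: q_def B_def)
  have "(\<Sum>L\<in>{19..53}. \<Sum>j\<in>block N L. w (of_int j)) \<le> (\<Sum>L\<in>{19..53}. \<Sum>j\<in>block N L. (of_int j)\<^sup>2 * q)"
    using block_abs by (intro sum_mono w_le) (auto simp: B_def)
  also have "\<dots> = (\<Sum>L\<in>{19..53}. \<Sum>j\<in>block N L. (of_int j)\<^sup>2) * q" by (simp add: sum_distrib_right)
  also have "\<dots> \<le> (1460000 * real N ^ 3) * q" using q0 sum_squares_poles[OF N] by (intro mult_right_mono)
  also have "\<dots> \<le> (\<Sum>u\<in>zeros3 N. w (of_int u / 3))"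
  proof -
    define A where "A = {261 * int N<..363 * int N} \<union> {- (363 * int N)..<- (261 * int N)}"
    have A: "A \<subseteq> zeros3 N" by (auto simp: A_def zeros3_def)
    have "card A = card {261 * int N<..363 * int N} + card {- (363 * int N)..<- (261 * int N)}"
      unfolding A_def by (intro card_Un_disjoint) auto
    hence cA: "card A = 204 * N" by simp
    have "1460000 * real N ^ 3 * q \<le> 204 * real N * ((87 * real N)\<^sup>2 * q)"
      using q0 by (simp add: power2_eq_square power3_eq_cube mult.assoc [symmetric] mult_right_mono)
    also have "\<dots> = (\<Sum>u\<in>A. (87 * real N)\<^sup>2 * q)" by (simp add: cA)
    also have "\<dots> \<le> (\<Sum>u\<in>A. w (of_int u / 3))"
    proof (intro sum_mono)
      fix u assume u: "u \<in> A"
      hence "261 * int N \<le> \<bar>u\<bar>" by (auto simp: A_def)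
      hence a: "87 * real N \<le> \<bar>of_int u / 3\<bar>" by linarith
      have "(87 * real N)\<^sup>2 \<le> (of_int u / 3)\<^sup>2" using power_mono[OF a, of 2] by (simp only: power2_abs of_nat_0_le_iff mult_nonneg_nonneg zero_le_numeral)
      hence "(87 * real N)\<^sup>2 * q \<le> (of_int u / 3)\<^sup>2 * q" using q0 by (rule mult_right_mono)
      also have "\<dots> \<le> w (of_int u / 3)" using a N0 zeros3_abs u A by (intro w_ge) (auto simp: B_def)
      finally show "(87 * real N)\<^sup>2 * q \<le> w (of_int u / 3)" .
    qed
    also have "\<dots> \<le> (\<Sum>u\<in>zeros3 N. w (of_int u / 3))" using A w0 zeros3_abs by (intro sum_mono2) auto
    finally show ?thesis .
  qed
  also have "\<dots> \<le> (\<Sum>u\<in>zeros2 N. w (of_int u / 2)) + (\<Sum>u\<in>zeros3 N. w (of_int u / 3))"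
    using w0 zeros2_abs by (simp add: sum_nonneg)
  finally have "0 \<le> (\<Sum>u\<in>zeros2 N. w (of_int u / 2)) + (\<Sum>u\<in>zeros3 N. w (of_int u / 3)) - (\<Sum>L\<in>{19..53}. \<Sum>j\<in>block N L. w (of_int j))"
    by simp
  moreover have "0 \<le> t\<^sup>2 - s\<^sup>2" using st s by (simp add: power_mono)
  ultimately have "0 \<le> (t\<^sup>2 - s\<^sup>2) * ((\<Sum>u\<in>zeros2 N. w (of_int u / 2)) + (\<Sum>u\<in>zeros3 N. w (of_int u / 3)) - (\<Sum>L\<in>{19..53}. \<Sum>j\<in>block N L. w (of_int j)))"
    by (rule mult_nonneg_nonneg[rotated])
  hence "0 \<le> log_slope N s - log_slope N t" unfolding log_slope_diff[OF s t] w_def .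
  thus ?thesis by simp
qed

text \<open>1 / y^2 <= 1 / (y - 1) - 1 / y makes the sum telescope from the centre outwards.\<close>

lemma sum_inverse_squares:
  assumes "x > real U + 1"
  shows "(\<Sum>u\<in>{- int U..int U}. 1 / (x - \<bar>of_int u\<bar>)\<^sup>2) \<le> 2 / (x - real U - 1)"
proof -
  have "(\<Sum>u\<in>{- int V..int V}. 1 / (x - \<bar>of_int u\<bar>)\<^sup>2) \<le> 2 / (x - real V - 1) - 2 / x" if "V \<le> U" for V
    using that
  proof (induction V)
    case 0
    have "1 / x\<^sup>2 \<le> 2 / (x - 1) - 2 / x" using assms by (simp add: divide_simps power2_eq_square)
    thus ?case by simp
  next
    case (Suc V)
    have "{- int (Suc V)..int (Suc V)} = insert (- int (Suc V)) (insert (int (Suc V)) {- int V..int V})" by auto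
    hence "(\<Sum>u\<in>{- int (Suc V)..int (Suc V)}. 1 / (x - \<bar>of_int u\<bar>)\<^sup>2) =
      (\<Sum>u\<in>{- int V..int V}. 1 / (x - \<bar>of_int u\<bar>)\<^sup>2) + 2 * (1 / (x - real (Suc V))\<^sup>2)" by (simp add: add.commute)
    moreover have "1 / (x - real (Suc V))\<^sup>2 \<le> 1 / (x - real (Suc V) - 1) - 1 / (x - real V - 1)"
    proof -
      define y where "y = x - real (Suc V)"
      have "real (Suc V) \<le> real U" using Suc.prems by linarith
      hence y: "y > 1" using assms by (simp add: y_def)
      have "1 / y\<^sup>2 \<le> 1 / (y - 1) - 1 / y" using y by (simp add: divide_simps power2_eq_square)
      thus ?thesis by (simp add: y_def algebra_simps)
    qed
    ultimately show ?case using Suc by simp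
  qed
  from this[of U] assms show ?thesis by (smt (verit) divide_nonneg_nonneg of_nat_0_le_iff order_refl)
qed

text \<open>Bounds how fast the slope can decrease at distance \<open>D\<close> from the outermost
  zero. The poles only help; the halves give 8 / D and the thirds 9 / D, and 34 = 2 * (8 + 9) with
  the 2 from \<open>t + s \<le> 2 * t\<close>.\<close>

lemma log_slope_drop:
  assumes N: "N \<ge> 1" and D: "D \<ge> 1" and s: "s \<ge> 121 * real N + D" and st: "s \<le> t"
  shows "log_slope N s - log_slope N t \<le> 34 * (t - s) * (121 * real N) / D"
proof -
  define Z where "Z = 121 * real N"
  define w where "w = (\<lambda>a. a\<^sup>2 / ((s\<^sup>2 - a\<^sup>2) * (t\<^sup>2 - a\<^sup>2)))"
  have sZ: "s > Z" "t > Z" and Z0: "Z > 0" using N D s st by (auto simp: Z_def)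
  have w_le: "w a \<le> (Z / t) * (1 / (s - \<bar>a\<bar>)\<^sup>2)" and w0: "w a \<ge> 0" if "\<bar>a\<bar> \<le> Z" for a
  proof -
    define b where "b = \<bar>a\<bar>"
    have b: "0 \<le> b" "b \<le> Z" "a\<^sup>2 = b\<^sup>2" using that by (auto simp: b_def)
    have "(s\<^sup>2 - b\<^sup>2) * (t\<^sup>2 - b\<^sup>2) = ((s - b) * (s + b)) * ((t - b) * (t + b))" by (simp add: power2_eq_square algebra_simps)
    also have "\<dots> \<ge> ((s - b) * s) * ((s - b) * t)" using b sZ st by (intro mult_mono) auto
    finally have m: "(s - b)\<^sup>2 * (s * t) \<le> (s\<^sup>2 - b\<^sup>2) * (t\<^sup>2 - b\<^sup>2)" by (simp add: power2_eq_square mult_ac)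
    have p: "(s - b)\<^sup>2 * (s * t) > 0" using b sZ Z0 by (intro mult_pos_pos) auto
    show "w a \<ge> 0" unfolding w_def b(3) using m p by (intro divide_nonneg_pos) auto
    have p': "(s\<^sup>2 - b\<^sup>2) * (t\<^sup>2 - b\<^sup>2) > 0" using m p by linarith
    have "w a \<le> b\<^sup>2 / ((s - b)\<^sup>2 * (s * t))" unfolding w_def b(3)
      by (rule divide_left_mono[OF m _ mult_pos_pos[OF p' p]]) simp
    also have "\<dots> \<le> (Z * s) / ((s - b)\<^sup>2 * (s * t))"
      using p b sZ unfolding power2_eq_square[of b] by (intro divide_right_mono mult_mono) auto
    also have "\<dots> = (Z / t) * (1 / (s - b)\<^sup>2)" using sZ Z0 by (simp add: field_simps)
    finally show "w a \<le> (Z / t) * (1 / (s - \<bar>a\<bar>)\<^sup>2)" by (simp add: b_def)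
  qed
  have c: "(\<Sum>u\<in>S. w (of_int u / c)) \<le> (Z / t) * (c\<^sup>2 * (2 / (c * s - real U - 1)))"
    if S: "S \<subseteq> {- int U..int U}" and c: "c > 0" "real U = c * Z" and gt: "c * s > real U + 1" for S c U
  proof -
    have "(\<Sum>u\<in>S. w (of_int u / c)) \<le> (\<Sum>u\<in>{- int U..int U}. w (of_int u / c))"
    proof (intro sum_mono2 S)
      fix u assume "u \<in> {- int U..int U} - S"
      hence "\<bar>real_of_int u\<bar> \<le> real U" by auto
      thus "0 \<le> w (of_int u / c)" using c by (intro w0) (simp add: abs_div field_simps)
    qed auto
    also have "\<dots> \<le> (\<Sum>u\<in>{- int U..int U}. (Z / t) * (c\<^sup>2 * (1 / (c * s - \<bar>of_int u\<bar>)\<^sup>2)))"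
    proof (intro sum_mono)
      fix u assume "u \<in> {- int U..int U}"
      hence u: "\<bar>real_of_int u\<bar> \<le> real U" by auto
      have "w (of_int u / c) \<le> (Z / t) * (1 / (s - \<bar>of_int u / c\<bar>)\<^sup>2)" using u c by (intro w_le) (simp add: abs_div field_simps)
      also have "s - \<bar>of_int u / c\<bar> = (c * s - \<bar>of_int u\<bar>) / c" using c by (simp add: abs_div field_simps)
      finally show "w (of_int u / c) \<le> (Z / t) * (c\<^sup>2 * (1 / (c * s - \<bar>of_int u\<bar>)\<^sup>2))" by (simp add: power_divide)
    qed
    also have "\<dots> = (Z / t) * (c\<^sup>2 * (\<Sum>u\<in>{- int U..int U}. 1 / (c * s - \<bar>of_int u\<bar>)\<^sup>2))"
      by (simp add: sum_distrib_left)
    also have "\<dots> \<le> (Z / t) * (c\<^sup>2 * (2 / (c * s - real U - 1)))"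
      using sum_inverse_squares[OF gt] Z0 sZ by (intro mult_left_mono) auto
    finally show ?thesis .
  qed
  have "(\<Sum>u\<in>zeros2 N. w (of_int u / 2)) \<le> (Z / t) * (2\<^sup>2 * (2 / (2 * s - real (242 * N) - 1)))"
    using s D by (intro c) (auto simp: zeros2_def Z_def)
  also have "\<dots> \<le> (Z / t) * (2\<^sup>2 * (2 / D))"
    using s D Z0 sZ by (intro mult_left_mono divide_left_mono mult_pos_pos) auto
  finally have b2: "(\<Sum>u\<in>zeros2 N. w (of_int u / 2)) \<le> (Z / t) * (8 / D)" by simp
  have "(\<Sum>u\<in>zeros3 N. w (of_int u / 3)) \<le> (Z / t) * (3\<^sup>2 * (2 / (3 * s - real (363 * N) - 1)))"
    using s D by (intro c) (auto simp: zeros3_def Z_def)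
  also have "\<dots> \<le> (Z / t) * (3\<^sup>2 * (2 / (2 * D)))"
    using s D Z0 sZ by (intro mult_left_mono divide_left_mono mult_pos_pos) auto
  finally have b3: "(\<Sum>u\<in>zeros3 N. w (of_int u / 3)) \<le> (Z / t) * (9 / D)" by simp
  have "(\<Sum>L\<in>{19..53}. \<Sum>j\<in>block N L. w (of_int j)) \<ge> 0"
  proof (intro sum_nonneg w0)
    fix L j assume "L \<in> {19..53}" "j \<in> block N L"
    from block_abs[OF this] show "\<bar>real_of_int j\<bar> \<le> Z" by (simp add: Z_def)
  qed
  note blk = this
  have le: "(\<Sum>u\<in>zeros2 N. w (of_int u / 2)) + (\<Sum>u\<in>zeros3 N. w (of_int u / 3)) - (\<Sum>L\<in>{19..53}. \<Sum>j\<in>block N L. w (of_int j)) \<le> (Z / t) * (17 / D)"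
  proof -
    define e where "e = (Z / t) * (1 / D)"
    have "(Z / t) * (8 / D) = 8 * e" "(Z / t) * (9 / D) = 9 * e" "(Z / t) * (17 / D) = 17 * e" by (simp_all add: e_def)
    thus ?thesis using b2 b3 blk by linarith
  qed
  have "log_slope N s - log_slope N t = (t\<^sup>2 - s\<^sup>2) * ((\<Sum>u\<in>zeros2 N. w (of_int u / 2)) + (\<Sum>u\<in>zeros3 N. w (of_int u / 3))
     - (\<Sum>L\<in>{19..53}. \<Sum>j\<in>block N L. w (of_int j)))"
    unfolding w_def using sZ by (intro log_slope_diff) (auto simp: Z_def)
  also have "\<dots> \<le> (t\<^sup>2 - s\<^sup>2) * ((Z / t) * (17 / D))"
    using st sZ Z0 by (intro mult_left_mono le) (simp add: power_mono)
  also have "\<dots> \<le> ((t - s) * (2 * t)) * ((Z / t) * (17 / D))"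
  proof (intro mult_right_mono)
    have "t\<^sup>2 - s\<^sup>2 = (t - s) * (t + s)" by (simp add: power2_eq_square algebra_simps)
    also have "\<dots> \<le> (t - s) * (2 * t)" using st by (intro mult_left_mono) auto
    finally show "t\<^sup>2 - s\<^sup>2 \<le> (t - s) * (2 * t)" .
  qed (use Z0 sZ D in auto)
  also have "\<dots> = (34 * (t - s) * Z / D) * (t / t)" by (simp only: times_divide_times_eq times_divide_eq_right times_divide_eq_left) (simp add: mult_ac)
  also have "t / t = 1" using sZ Z0 by simp
  finally show ?thesis by (simp only: Z_def mult_1_right)
qed

lemma card_poles: "(\<Sum>L\<in>{19..53}. \<Sum>j\<in>block N L. (1::real)) = 2520 * real N + 35"
proof -
  have "(\<Sum>L\<in>{19..53}. \<Sum>j\<in>block N L. (1::real)) = (\<Sum>L\<in>{19..53}. 2 * real N * real_of_int L + 1)"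
    by (intro sum.cong refl) (auto simp: block_def)
  also have "\<dots> = 2 * real N * of_int (\<Sum>L\<in>{19..53}. L) + 35" by (simp add: sum.distrib sum_distrib_left)
  also have "(\<Sum>L\<in>{19..53::int}. L) = 1260" by code_simp
  finally show ?thesis by simp
qed

lemma zphi_ge_1: "\<bar>a\<bar> < t \<Longrightarrow> zphi a t \<ge> 1"
proof -
  assume a: "\<bar>a\<bar> < t"
  hence "\<bar>a\<bar>\<^sup>2 < t\<^sup>2" by (intro power_strict_mono) auto
  hence "a\<^sup>2 < t\<^sup>2" by simp
  thus ?thesis by (simp add: zphi_def)
qed

lemma zphi_le:
  assumes "\<bar>a\<bar> \<le> b" "b < t"
  shows "zphi a t \<le> t\<^sup>2 / (t\<^sup>2 - b\<^sup>2)"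
proof -
  have "\<bar>a\<bar>\<^sup>2 \<le> b\<^sup>2" "b\<^sup>2 < t\<^sup>2" using assms abs_ge_zero[of a]
    by (intro power_mono power_strict_mono; linarith)+
  hence "a\<^sup>2 \<le> b\<^sup>2" "b\<^sup>2 < t\<^sup>2" by simp_all
  thus ?thesis unfolding zphi_def by (intro divide_left_mono mult_pos_pos) auto
qed

text \<open>Beyond 200 N each of the 862 N zeros weighs at most 8 / 5, against more than 2520 N from
  the poles. The value -2 is what makes R decay like 1 / t^2.\<close>

lemma log_slope_far:
  assumes N: "N \<ge> 1" and t: "t \<ge> 200 * real N"
  shows "log_slope N t \<le> -2"
proof -
  have N0: "real N \<ge> 1" using N by simp
  have z: "zphi a t \<le> 8 / 5" if "\<bar>a\<bar> \<le> 121 * real N" for a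
  proof -
    have "zphi a t \<le> t\<^sup>2 / (t\<^sup>2 - (121 * real N)\<^sup>2)" using that t N0 by (intro zphi_le) auto
    also have "\<dots> \<le> 8 / 5"
    proof -
      define q where "q = (real N)\<^sup>2"
      have "(200 * real N)\<^sup>2 \<le> t\<^sup>2" using t by (intro power_mono) auto
      hence qt: "40000 * q \<le> t\<^sup>2" by (simp add: q_def power_mult_distrib)
      have q0: "q > 0" using N0 by (simp add: q_def)
      have qs: "t\<^sup>2 - 14641 * q > 0" using qt q0 by argo
      have qs2: "5 * t\<^sup>2 \<le> 8 * (t\<^sup>2 - 14641 * q)" using qt q0 by argo
      have "(121 * real N)\<^sup>2 = 14641 * q" by (simp add: q_def power_mult_distrib)
      thus ?thesis using qs qs2 by (simp add: divide_simps)
    qed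
    finally show ?thesis .
  qed
  have h2: "(\<Sum>u\<in>zeros2 N. zphi (of_int u / 2) t) \<le> 1936 / 5 * real N"
    using sum_bounded_above[of "zeros2 N" "\<lambda>u. zphi (of_int u / 2) t" "8 / 5"] z zeros2_abs by (simp add: card_zeros2)
  have h3: "(\<Sum>u\<in>zeros3 N. zphi (of_int u / 3) t) \<le> 992 * real N"
    using sum_bounded_above[of "zeros3 N" "\<lambda>u. zphi (of_int u / 3) t" "8 / 5"] z zeros3_abs by (simp add: card_zeros3)
  have h1: "(\<Sum>L\<in>{19..53}. \<Sum>j\<in>block N L. zphi (of_int j) t) \<ge> (\<Sum>L\<in>{19..53}. \<Sum>j\<in>block N L. (1::real))"
  proof (intro sum_mono zphi_ge_1)
    fix L j assume "L \<in> {19..53}" "j \<in> block N L"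
    from block_abs[OF this] show "\<bar>real_of_int j\<bar> < t" using t N0 by linarith
  qed
  show ?thesis unfolding log_slope_def using h1 h2 h3 N0 unfolding card_poles by argo
qed

text \<open>121^2 / (121^2 - 53^2) is just below 99 / 80, and 3162 leaves room for the 35 additional
  poles.\<close>

lemma poles_zphi_le:
  assumes N: "N \<ge> 1" and t: "t \<ge> 121 * real N"
  shows "(\<Sum>L\<in>{19..53}. \<Sum>j\<in>block N L. zphi (of_int j) t) \<le> 3162 * real N"
proof -
  have N0: "real N \<ge> 1" using N by simp
  have "(\<Sum>L\<in>{19..53}. \<Sum>j\<in>block N L. zphi (of_int j) t) \<le> (\<Sum>L\<in>{19..53}. \<Sum>j\<in>block N L. 99 / 80 * 1)"
  proof (intro sum_mono)
    fix L j assume "L \<in> {19..53}" "j \<in> block N L"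
    have "zphi (of_int j) t \<le> t\<^sup>2 / (t\<^sup>2 - (53 * real N)\<^sup>2)"
      using block_abs[OF \<open>L \<in> _\<close> \<open>j \<in> _\<close>] t N0 by (intro zphi_le) auto
    also have "\<dots> \<le> 99 / 80 * 1"
    proof -
      define q where "q = (real N)\<^sup>2"
      have "(121 * real N)\<^sup>2 \<le> t\<^sup>2" using t by (intro power_mono) auto
      hence qt: "14641 * q \<le> t\<^sup>2" by (simp add: q_def power_mult_distrib)
      have q0: "q > 0" using N0 by (simp add: q_def)
      have qs: "t\<^sup>2 - 2809 * q > 0" using qt q0 by argo
      have qs2: "80 * t\<^sup>2 \<le> 99 * (t\<^sup>2 - 2809 * q)" using qt q0 by argo
      have "(53 * real N)\<^sup>2 = 2809 * q" by (simp add: q_def power_mult_distrib)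
      thus ?thesis using qs qs2 by (simp add: divide_simps)
    qed
    finally show "zphi (of_int j) t \<le> 99 / 80 * 1" .
  qed
  also have "\<dots> = 99 / 80 * (2520 * real N + 35)" by (simp only: card_poles flip: sum_distrib_left)
  also have "\<dots> \<le> 3162 * real N" using N0 by simp
  finally show ?thesis .
qed

lemma log_slope_ge:
  assumes N: "N \<ge> 1" and t: "t > 121 * real N"
  shows "log_slope N t \<ge> - 3162 * real N"
proof -
  have "(\<Sum>u\<in>zeros2 N. zphi (of_int u / 2) t) \<ge> (\<Sum>u\<in>zeros2 N. 0)" "(\<Sum>u\<in>zeros3 N. zphi (of_int u / 3) t) \<ge> (\<Sum>u\<in>zeros3 N. 0)"
    using zeros2_abs[of _ N] zeros3_abs[of _ N] t by (intro sum_mono order.trans[OF zero_le_one zphi_ge_1]; fastforce)+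
  thus ?thesis using poles_zphi_le[OF N, of t] t by (simp add: log_slope_def)
qed

text \<open>For fixed \<open>D\<close> the thirds just below 121 N contribute a harmonic sum, of
  order N ln N after scaling, which eventually beats the linear bound for the poles. This drives the
  peak away from 121 N.\<close>

lemma log_slope_near:
  assumes D: "D > 0"
  shows "eventually (\<lambda>N. log_slope N (121 * real N + D) \<ge> 0) sequentially"
proof -
  define h where "h = (\<lambda>N. ln ((3 * D + 102 * real N) / (3 * D)))"
  have "filterlim h at_top sequentially" unfolding h_def using D by real_asymp
  \<comment> \<open>18 is enough because 121 / 2 * 3 * 18 = 3267 exceeds 3162.\<close>
  hence "eventually (\<lambda>N. h N \<ge> 18) sequentially" by (simp add: filterlim_at_top)
  thus ?thesis using eventually_ge_at_top[of 1]
  proof eventually_elim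
    case (elim N)
    define t where "t = 121 * real N + D"
    have N0: "real N \<ge> 1" using elim by simp
    define A where "A = (\<lambda>m. 363 * int N - int m) ` {..<102 * N}"
    have A: "A \<subseteq> zeros3 N" by (auto simp: A_def zeros3_def)
    have inj: "inj_on (\<lambda>m. 363 * int N - int m) {..<102 * N}" by (auto simp: inj_on_def)
    have har: "(\<Sum>m<n. 1 / (3 * D + real m)) \<ge> ln ((3 * D + real n) / (3 * D))" for n
    proof (induction n)
      case (Suc n)
      define y where "y = 3 * D + real n"
      have y: "y > 0" using D by (simp add: y_def add_pos_nonneg)
      have "(1 + 1 / y) * y = 3 * D + real (Suc n)" using y by (simp add: distrib_right) (simp add: y_def)
      hence "(3 * D + real (Suc n)) / (3 * D) = (1 + 1 / y) * (y / (3 * D))" by (metis times_divide_eq_right)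
      moreover have "ln ((1 + 1 / y) * (y / (3 * D))) = ln (1 + 1 / y) + ln (y / (3 * D))"
        using y D by (intro ln_mult_pos) (auto simp: add_pos_pos)
      ultimately have "ln ((3 * D + real (Suc n)) / (3 * D)) = ln (1 + 1 / y) + ln (y / (3 * D))" by (simp only:)
      also have "ln (1 + 1 / y) \<le> 1 / y" using y by (intro ln_add_one_self_le_self) auto
      finally show ?case using Suc by (simp add: y_def)
    qed (use D in auto)
    have "3162 * real N \<le> (t / 2) * (3 * 18)" using D by (simp add: t_def)
    also have "\<dots> \<le> (t / 2) * (3 * (\<Sum>m<102 * N. 1 / (3 * D + real m)))"
      using elim(1) har[of "102 * N"] D by (intro mult_left_mono) (auto simp: h_def t_def)
    also have "\<dots> = (\<Sum>m<102 * N. (t / 2) * (3 / (3 * D + real m)))" by (simp add: sum_distrib_left)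
    also have "\<dots> \<le> (\<Sum>m<102 * N. zphi (of_int (363 * int N - int m) / 3) t)"
    proof (intro sum_mono)
      fix m assume "m \<in> {..<102 * N}"
      define a where "a = real_of_int (363 * int N - int m) / 3"
      have "real m < real (102 * N)" using \<open>m \<in> _\<close> by (simp only: of_nat_less_iff lessThan_iff)
      moreover have "a = 121 * real N - real m / 3" by (simp add: a_def)
      ultimately have a: "0 \<le> a" "a < t" "3 * D + real m = 3 * (t - a)" using D by (simp_all add: t_def)
      have "t\<^sup>2 - a\<^sup>2 = (t - a) * (t + a)" by (simp add: power2_eq_square algebra_simps)
      also have "\<dots> \<le> (t - a) * (2 * t)" using a by (intro mult_left_mono) auto
      finally have le: "t\<^sup>2 - a\<^sup>2 \<le> (t - a) * (2 * t)" .
      have "a\<^sup>2 < t\<^sup>2" using a by (intro power_strict_mono) auto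
      hence "t\<^sup>2 / ((t - a) * (2 * t)) \<le> zphi a t" unfolding zphi_def using le a by (intro divide_left_mono mult_pos_pos) auto
      moreover have "(t / 2) * (3 / (3 * D + real m)) = t\<^sup>2 / ((t - a) * (2 * t))"
      proof -
        define e where "e = t - a"
        have "3 * D + real m = 3 * e" "e > 0" "t > 0" using a by (simp_all add: e_def)
        thus ?thesis unfolding e_def [symmetric] by (simp add: power2_eq_square)
      qed
      ultimately show "(t / 2) * (3 / (3 * D + real m)) \<le> zphi (of_int (363 * int N - int m) / 3) t" by (simp add: a_def)
    qed
    also have "\<dots> = (\<Sum>u\<in>A. zphi (of_int u / 3) t)" unfolding A_def by (simp add: sum.reindex[OF inj])
    also have "\<dots> \<le> (\<Sum>u\<in>zeros3 N. zphi (of_int u / 3) t)"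
    proof (intro sum_mono2 A)
      fix u assume "u \<in> zeros3 N - A"
      hence "\<bar>of_int u / 3\<bar> < t" using zeros3_abs[of u N] D by (auto simp: t_def)
      from zphi_ge_1[OF this] show "0 \<le> zphi (of_int u / 3) t" by simp
    qed auto
    finally have "3162 * real N \<le> (\<Sum>u\<in>zeros3 N. zphi (of_int u / 3) t)" .
    moreover have "(\<Sum>u\<in>zeros2 N. zphi (of_int u / 2) t) \<ge> 0"
    proof (intro sum_nonneg)
      fix u assume "u \<in> zeros2 N"
      hence "\<bar>of_int u / 2\<bar> < t" using zeros2_abs[of u N] D by (auto simp: t_def)
      from zphi_ge_1[OF this] show "0 \<le> zphi (of_int u / 2) t" by simp
    qed
    moreover have "(\<Sum>L\<in>{19..53}. \<Sum>j\<in>block N L. zphi (of_int j) t) \<le> 3162 * real N"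
      using D elim by (intro poles_zphi_le) (auto simp: t_def)
    ultimately show ?case by (simp add: log_slope_def t_def)
  qed
qed

section \<open>The peak and the comparison of the three sums\<close>

definition peak :: "nat \<Rightarrow> real" where
  "peak N = Sup {t. t > 121 * real N \<and> log_slope N t \<ge> 0}"

text \<open>Up to 121 N the points over which R is summed are zeros of R, so the value 0 there
  changes no sum and gives a function that is nonnegative and unimodal on the whole line.\<close>

definition R_pos :: "nat \<Rightarrow> real \<Rightarrow> real" where
  "R_pos N t = (if t \<le> 121 * real N then 0 else R N t)"

definition R_max :: "nat \<Rightarrow> real" where
  "R_max N = exp (log_R N (peak N))"

lemma log_R_mvt:
  assumes "121 * real N < a" "a < b"
  shows "\<exists>z. a < z \<and> z < b \<and> log_R N b - log_R N a = (b - a) * (log_slope N z / z)"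
  using assms by (intro MVT2 log_R_deriv) auto

context
  fixes N :: nat and D :: real
  assumes N: "N \<ge> 1" and D: "D > 0" and near: "log_slope N (121 * real N + D) \<ge> 0"
begin

lemma peak_bdd: "bdd_above {t. t > 121 * real N \<and> log_slope N t \<ge> 0}" (is "bdd_above ?P")
  and peak_ne: "{t. t > 121 * real N \<and> log_slope N t \<ge> 0} \<noteq> {}"
  and peak_ge: "121 * real N + D \<le> peak N"
proof -
  have le: "t \<le> 200 * real N" if "t \<in> ?P" for t
    using that log_slope_far[OF N, of t] by force
  have mem: "121 * real N + D \<in> ?P" using near D by simp
  show bdd: "bdd_above ?P" using le by (intro bdd_aboveI)
  show ne: "?P \<noteq> {}" using mem by blast
  show "121 * real N + D \<le> peak N" unfolding peak_def by (rule cSup_upper[OF mem bdd])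
qed

lemma peak_gt: "121 * real N < peak N"
  using peak_ge D by linarith

lemma log_slope_before_peak:
  assumes "121 * real N < z" "z < peak N"
  shows "log_slope N z \<ge> 0"
proof -
  obtain s where "s > 121 * real N" "log_slope N s \<ge> 0" "z < s"
    using assms(2) less_cSup_iff[OF peak_ne peak_bdd] unfolding peak_def by auto
  thus ?thesis using log_slope_antimono[OF N assms(1), of s] by linarith
qed

lemma log_slope_after_peak:
  assumes "peak N < z"
  shows "log_slope N z < 0"
proof (rule ccontr)
  assume "\<not> log_slope N z < 0"
  hence "z \<in> {t. t > 121 * real N \<and> log_slope N t \<ge> 0}" using assms peak_gt by auto
  from cSup_upper[OF this peak_bdd] show False using assms by (simp add: peak_def)
qed

lemma log_R_mono:
  assumes "121 * real N < a" "a \<le> b" "b \<le> peak N"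
  shows "log_R N a \<le> log_R N b"
proof (cases "a = b")
  case False
  hence "a < b" using assms by simp
  then obtain z where z: "a < z" "z < b" "log_R N b - log_R N a = (b - a) * (log_slope N z / z)"
    using log_R_mvt[OF assms(1)] by blast
  have "log_slope N z \<ge> 0" using z assms by (intro log_slope_before_peak) auto
  moreover have "z > 0" using z assms(1) by (smt (verit) of_nat_0_le_iff)
  ultimately have "(b - a) * (log_slope N z / z) \<ge> 0" using assms by (intro mult_nonneg_nonneg divide_nonneg_pos) auto
  thus ?thesis using z by linarith
qed simp

lemma log_R_antimono:
  assumes "peak N \<le> a" "a \<le> b"
  shows "log_R N b \<le> log_R N a"
proof (cases "a = b")
  case False
  hence "a < b" using assms by simp
  then obtain z where z: "a < z" "z < b" "log_R N b - log_R N a = (b - a) * (log_slope N z / z)"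
    using log_R_mvt[of N a b] assms peak_gt by auto
  have "log_slope N z < 0" using z assms by (intro log_slope_after_peak) auto
  moreover have "z > 0" using z assms(1) peak_gt by (smt (verit) of_nat_0_le_iff)
  ultimately have "(b - a) * (log_slope N z / z) \<le> 0" using assms by (intro mult_nonneg_nonpos divide_nonpos_pos) auto
  thus ?thesis using z by linarith
qed simp

lemma R_pos_nonneg: "R_pos N t \<ge> 0"
  by (simp add: R_pos_def R_eq_exp)

lemma R_pos_mono: "a \<le> b \<Longrightarrow> b \<le> peak N \<Longrightarrow> R_pos N a \<le> R_pos N b"
  using R_pos_nonneg[of b] log_R_mono[of a b] by (auto simp: R_pos_def R_eq_exp)

lemma R_pos_antimono: "peak N \<le> a \<Longrightarrow> a \<le> b \<Longrightarrow> R_pos N b \<le> R_pos N a"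
  using peak_gt log_R_antimono[of a b] by (auto simp: R_pos_def R_eq_exp)

lemma R_pos_peak: "R_pos N (peak N) = R_max N"
  using peak_gt by (simp add: R_pos_def R_max_def R_eq_exp)

lemma R_pos_le: "R_pos N t \<le> R_max N"
  using R_pos_mono[of t "peak N"] R_pos_antimono[of "peak N" t] by (cases "t \<le> peak N") (auto simp: R_pos_peak)

text \<open>Beyond 200 N the function t^2 R(t) does not increase, because the slope is at most -2;
  up to there the maximum is bound enough.\<close>

lemma R_pos_tail:
  assumes t: "t > 0"
  shows "R_pos N t \<le> R_max N * (200 * real N)\<^sup>2 * (1 / t\<^sup>2)"
proof (cases "t \<le> 200 * real N")
  case True
  hence "t\<^sup>2 \<le> (200 * real N)\<^sup>2" using t by (intro power_mono) auto
  hence "1 \<le> (200 * real N)\<^sup>2 * (1 / t\<^sup>2)" using t by simp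
  hence "R_max N * 1 \<le> R_max N * ((200 * real N)\<^sup>2 * (1 / t\<^sup>2))" by (intro mult_left_mono) (auto simp: R_max_def)
  thus ?thesis using R_pos_le[of t] by (simp add: mult.assoc)
next
  case False
  define T where "T = 200 * real N"
  have T: "T > 0" "T < t" "T > 121 * real N" using False N by (auto simp: T_def)
  have "log_R N t + 2 * ln t \<le> log_R N T + 2 * ln T"
  proof (rule DERIV_nonpos_imp_nonincreasing[where f = "\<lambda>x. log_R N x + 2 * ln x"])
    fix x assume x: "T \<le> x" "x \<le> t"
    have "((\<lambda>x. log_R N x + 2 * ln x) has_real_derivative log_slope N x / x + 2 * (1 / x)) (at x)"
      using x T by (intro DERIV_add log_R_deriv DERIV_cmult DERIV_ln_divide) auto
    moreover have "log_slope N x / x + 2 * (1 / x) = (log_slope N x + 2) / x" by (simp add: add_divide_distrib)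
    moreover have "(log_slope N x + 2) / x \<le> 0"
      using log_slope_far[OF N, of x] x T by (intro divide_nonpos_pos) (auto simp: T_def)
    ultimately show "\<exists>y. ((\<lambda>x. log_R N x + 2 * ln x) has_real_derivative y) (at x) \<and> y \<le> 0" by auto
  qed (use T in auto)
  moreover have "2 * ln t = ln (t\<^sup>2)" "2 * ln T = ln (T\<^sup>2)" using t T by (simp_all add: ln_realpow)
  ultimately have "exp (log_R N t + ln (t\<^sup>2)) \<le> exp (log_R N T + ln (T\<^sup>2))" by simp
  hence "R N t * t\<^sup>2 \<le> R N T * T\<^sup>2" using T t by (simp add: exp_add R_eq_exp)
  moreover have "R N T \<le> R_max N" using R_pos_le[of T] T by (simp add: R_pos_def)
  hence "R N T * T\<^sup>2 \<le> R_max N * T\<^sup>2" by (intro mult_right_mono) auto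
  ultimately have "R N t \<le> R_max N * T\<^sup>2 / t\<^sup>2" using t by (simp add: pos_le_divide_eq)
  thus ?thesis using T by (simp add: R_pos_def T_def)
qed

text \<open>\<open>V\<close> is monotone with total increase at most \<open>2 * R_max N\<close>, so it bounds the total variation of \<open>R_pos N\<close>.\<close>

lemma R_pos_variation:
  defines "V \<equiv> \<lambda>t. if t \<le> peak N then R_pos N t else 2 * R_max N - R_pos N t"
  assumes "a \<le> b"
  shows "\<bar>R_pos N b - R_pos N a\<bar> \<le> V b - V a"
  using assms(2) R_pos_mono[of a b] R_pos_antimono[of a b] R_pos_le[of a] R_pos_le[of b] R_pos_nonneg[of a] R_pos_nonneg[of b]
  by (auto simp: V_def)

lemma R_sum_sums:
  assumes d: "d \<in> {1, 2, 3}"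
  shows "(\<lambda>n. R_pos N (real (53 * d * N + 1 + n) / real d)) sums R_sum N d"
proof -
  have "R N (real (53 * d * N + 1 + n) / real d) = R_pos N (real (53 * d * N + 1 + n) / real d)" for n
  proof (cases "real (53 * d * N + 1 + n) / real d \<le> 121 * real N")
    case True
    have d0: "real d > 0" using d by auto
    have "real (53 * d * N + 1 + n) > 53 * real N * real d" by (simp add: mult_ac)
    hence gt: "real (53 * d * N + 1 + n) / real d > 53 * real N" using d0 by (simp add: pos_less_divide_eq)
    have "R N (real (53 * d * N + 1 + n) / real d) = 0"
    proof (rule R_zero)
      show "int d \<in> {1, 2, 3}" using d by auto
      show "real (53 * d * N + 1 + n) / real d = real_of_int (int (53 * d * N + 1 + n)) / of_int (int d)" by simp
      show "\<bar>real (53 * d * N + 1 + n) / real d\<bar> \<le> 121 * real N" using True d0 by simp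
      show "53 * real N < \<bar>real (53 * d * N + 1 + n) / real d\<bar>" using gt d0 by simp
    qed
    thus ?thesis using True by (simp add: R_pos_def)
  qed (simp add: R_pos_def)
  moreover have "d \<ge> 1" using d by auto
  ultimately show ?thesis using R_sum_linear_form(1)[of d N] by simp
qed

text \<open>The \<open>d\<close> sample points between \<open>c n\<close> and
  \<open>c (Suc n)\<close> are all compared with the right end; the errors are bounded by increments
  of \<open>V\<close>, which telescope.\<close>

lemma R_sum_compare:
  assumes d: "d \<in> {1, 2, 3}"
  shows "\<bar>R_sum N d - real d * R_sum N 1\<bar> \<le> 2 * real d * R_max N"
proof -
  define V where "V = (\<lambda>t. if t \<le> peak N then R_pos N t else 2 * R_max N - R_pos N t)"
  have V: "\<bar>R_pos N b - R_pos N a\<bar> \<le> V b - V a" if "a \<le> b" for a b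
    using R_pos_variation[OF that] by (simp only: V_def)
  have d0: "d > 0" using d by auto
  define c where "c = (\<lambda>n. 53 * real N + real n)"
  have pt: "real (53 * d * N + 1 + (n * d + j)) / real d = c n + (1 + real j) / real d" for n j
    using d0 by (simp add: c_def field_simps)
  have "(\<lambda>n. \<Sum>i\<in>{n * d..<n * d + d}. R_pos N (real (53 * d * N + 1 + i) / real d)) sums R_sum N d"
    by (rule sums_group[OF R_sum_sums[OF d] d0])
  moreover have "(\<Sum>i\<in>{n * d..<n * d + d}. R_pos N (real (53 * d * N + 1 + i) / real d)) = (\<Sum>j<d. R_pos N (c n + (1 + real j) / real d))" for n
    unfolding pt [symmetric] by (rule sum.reindex_bij_witness[of _ "\<lambda>j. n * d + j" "\<lambda>i. i - n * d"]) auto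
  ultimately have s1: "(\<lambda>n. \<Sum>j<d. R_pos N (c n + (1 + real j) / real d)) sums R_sum N d" by simp
  have "(\<lambda>n. R_pos N (c (Suc n))) sums R_sum N 1" using R_sum_sums[of 1] by (simp add: c_def add_ac)
  hence "(\<lambda>n. real d * R_pos N (c (Suc n))) sums (real d * R_sum N 1)" by (rule sums_mult)
  from sums_diff[OF s1 this] have lim: "(\<lambda>m. \<Sum>n<m. (\<Sum>j<d. R_pos N (c n + (1 + real j) / real d)) - real d * R_pos N (c (Suc n)))
      \<longlonglongrightarrow> R_sum N d - real d * R_sum N 1" unfolding sums_def .
  have step: "\<bar>(\<Sum>j<d. R_pos N (c n + (1 + real j) / real d)) - real d * R_pos N (c (Suc n))\<bar> \<le> real d * (V (c (Suc n)) - V (c n))" for n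
  proof -
    have "(\<Sum>j<d. R_pos N (c n + (1 + real j) / real d)) - real d * R_pos N (c (Suc n)) =
        - (\<Sum>j<d. R_pos N (c (Suc n)) - R_pos N (c n + (1 + real j) / real d))" by (simp add: sum_subtractf)
    also have "\<bar>\<dots>\<bar> \<le> (\<Sum>j<d. \<bar>R_pos N (c (Suc n)) - R_pos N (c n + (1 + real j) / real d)\<bar>)" 
      unfolding abs_minus_cancel by (rule sum_abs)
    also have "\<dots> \<le> (\<Sum>j<d. V (c (Suc n)) - V (c n))"
    proof (intro sum_mono)
      fix j assume "j \<in> {..<d}"
      hence "(1 + real j) / real d \<le> 1" "0 \<le> (1 + real j) / real d" using d0 by auto
      hence "c n + (1 + real j) / real d \<le> c (Suc n)" "c n \<le> c n + (1 + real j) / real d" by (simp_all add: c_def)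
      from V[OF this(1)] V[OF this(2)] 
      show "\<bar>R_pos N (c (Suc n)) - R_pos N (c n + (1 + real j) / real d)\<bar> \<le> V (c (Suc n)) - V (c n)" by linarith
    qed
    finally show ?thesis by simp
  qed
  have part: "\<bar>\<Sum>n<m. (\<Sum>j<d. R_pos N (c n + (1 + real j) / real d)) - real d * R_pos N (c (Suc n))\<bar> \<le> 2 * real d * R_max N" for m
  proof -
    have "\<bar>\<Sum>n<m. (\<Sum>j<d. R_pos N (c n + (1 + real j) / real d)) - real d * R_pos N (c (Suc n))\<bar> \<le> (\<Sum>n<m. real d * (V (c (Suc n)) - V (c n)))"
      by (rule order.trans[OF sum_abs]) (intro sum_mono step)
    also have "\<dots> = real d * (V (c m) - V (c 0))" 
      by (simp only: sum_distrib_left [symmetric] sum_lessThan_telescope[of "\<lambda>n. V (c n)"])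
    also have "\<dots> \<le> real d * (2 * R_max N)"
      using R_pos_nonneg[of "c m"] R_pos_nonneg[of "c 0"] R_pos_le[of "c m"] R_pos_le[of "c 0"]
      by (intro mult_left_mono) (auto simp: V_def)
    finally show ?thesis by (simp add: mult_ac)
  qed
  show ?thesis by (rule LIMSEQ_le_const2[OF tendsto_rabs[OF lim]]) (use part in auto)
qed

lemma R_sum_upper: "R_sum N 1 \<le> R_max N * (200 * real N)\<^sup>2 * zeta 2"
proof (rule sums_le)
  show "(\<lambda>n. R_pos N (real (53 * 1 * N + 1 + n) / real 1)) sums R_sum N 1" by (rule R_sum_sums) simp
  show "(\<lambda>n. R_max N * (200 * real N)\<^sup>2 * (1 / real (Suc n) ^ 2)) sums (R_max N * (200 * real N)\<^sup>2 * zeta 2)"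
    using zeta_sums[of 2] by (intro sums_mult) simp
  show "R_pos N (real (53 * 1 * N + 1 + n) / real 1) \<le> R_max N * (200 * real N)\<^sup>2 * (1 / real (Suc n) ^ 2)" for n
  proof -
    have "R_pos N (real (53 * 1 * N + 1 + n) / real 1) \<le> R_max N * (200 * real N)\<^sup>2 * (1 / (real (53 * 1 * N + 1 + n) / real 1)\<^sup>2)"
      by (rule R_pos_tail) simp
    also have "\<dots> \<le> R_max N * (200 * real N)\<^sup>2 * (1 / real (Suc n) ^ 2)"
      by (intro mult_left_mono divide_left_mono power_mono) (auto simp: R_max_def)
    finally show ?thesis .
  qed
qed

text \<open>A peak before 122 N is within N of it, and in between the derivative of
  \<open>log_R\<close> is at least -3162 / 121 > -27. A later peak gains nothing, since by
  hypothesis \<open>log_R\<close> no longer increases after 122 N.\<close>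

lemma R_max_le:
  assumes "log_slope N (122 * real N) \<le> 0"
  shows "R_max N \<le> R N (122 * real N) * exp (27 * real N)"
proof -
  have N0: "real N \<ge> 1" using N by simp
  have "log_R N (peak N) \<le> log_R N (122 * real N) + 27 * real N"
  proof (cases "peak N < 122 * real N")
    case True
    then obtain z where z: "peak N < z" "z < 122 * real N" 
      "log_R N (122 * real N) - log_R N (peak N) = (122 * real N - peak N) * (log_slope N z / z)"
      using log_R_mvt[of N "peak N" "122 * real N"] peak_gt by blast
    have z0: "z > 121 * real N" using z peak_gt by linarith
    have "- 27 \<le> - (3162 * real N) / (121 * real N)" using N0 by simp
    also have "\<dots> \<le> - (3162 * real N) / z"
    proof -
      have "3162 * real N / z \<le> 3162 * real N / (121 * real N)" using z0 N0 by (intro divide_left_mono) auto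
      thus ?thesis by simp
    qed
    also have "\<dots> \<le> log_slope N z / z" using log_slope_ge[OF N z0] z0 N0 by (intro divide_right_mono) auto
    finally have l: "- 27 \<le> log_slope N z / z" .
    have len: "0 \<le> 122 * real N - peak N" "122 * real N - peak N \<le> real N" using z z0 peak_gt by linarith+
    have "(122 * real N - peak N) * (- 27) \<le> (122 * real N - peak N) * (log_slope N z / z)" by (rule mult_left_mono[OF l len(1)])
    moreover have "27 * (122 * real N - peak N) \<le> 27 * real N" using len by simp
    ultimately show ?thesis unfolding z(3) [symmetric] by argo
  next
    case False
    hence "log_R N (peak N) \<le> log_R N (122 * real N)"
    proof (cases "peak N = 122 * real N")
      case ne: False
      hence "122 * real N < peak N" using False by simp
      then obtain z where z: "122 * real N < z" "z < peak N" 
        "log_R N (peak N) - log_R N (122 * real N) = (peak N - 122 * real N) * (log_slope N z / z)"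
        using log_R_mvt[of N "122 * real N" "peak N"] N0 by auto
      have "log_slope N z \<le> 0" using log_slope_antimono[OF N, of "122 * real N" z] z assms N0 by auto
      hence "(peak N - 122 * real N) * (log_slope N z / z) \<le> 0" using z N0 by (intro mult_nonneg_nonpos divide_nonpos_pos) auto
      thus ?thesis using z by linarith
    qed simp
    thus ?thesis using N0 by simp
  qed
  hence "R_max N \<le> exp (log_R N (122 * real N) + 27 * real N)" by (simp add: R_max_def)
  also have "\<dots> = R N (122 * real N) * exp (27 * real N)" using N0 by (simp add: exp_add R_eq_exp)
  finally show ?thesis .
qed

end

text \<open>Over the \<open>K\<close> sample points that follow the peak \<open>log_R\<close> drops
  by at most 1: the slope is nonnegative just before the peak and decreases slowly at distance
  \<open>D\<close> by \<open>log_slope_drop\<close>. Each of these points therefore contributes at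
  least \<open>R_max N / exp 1\<close>.\<close>

lemma R_sum_lower:
  assumes N: "N \<ge> 1" and D: "D \<ge> 1" "D \<ge> 34 * real K * (real K + 1)" and near: "log_slope N (121 * real N + (D + 1)) \<ge> 0"
  shows "R_sum N 1 \<ge> real K * R_max N / 3"
proof (cases "K = 0")
  case True
  have D1: "D + 1 > 0" using D by simp
  show ?thesis using True sums_le[OF _ sums_zero R_sum_sums[OF N D1 near, of 1]] R_pos_nonneg[OF N D1 near] by simp
next
  case False
  have D1: "D + 1 > 0" using D by simp
  note pk = peak_ge[OF N D1 near] peak_gt[OF N D1 near]
  define t where "t = peak N + real K"
  have K: "real K \<ge> 1" using False by simp
  have "log_R N (peak N) - 1 \<le> log_R N t"
  proof -
    obtain z where z: "peak N < z" "z < t" "log_R N t - log_R N (peak N) = (t - peak N) * (log_slope N z / z)"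
      using log_R_mvt[of N "peak N" t] pk K by (auto simp: t_def)
    have z0: "z > 121 * real N" "121 * real N > 0" using z pk N by auto
    \<comment> \<open>Nonnegativity of the slope is known strictly before the peak; this step back
      by 1 is the reason for \<open>D + 1\<close> in \<open>near\<close>.\<close>
    define s where "s = peak N - 1"
    have s: "s \<ge> 121 * real N + D" "s \<le> t" "s < peak N" "t - s = real K + 1" using pk K by (auto simp: s_def t_def)
    have "0 \<le> log_slope N s" using s D by (intro log_slope_before_peak[OF N D1 near]) auto
    hence "- (34 * (real K + 1) * (121 * real N) / D) \<le> log_slope N t" using log_slope_drop[OF N D(1) s(1,2)] s(4) by simp
    also have "\<dots> \<le> log_slope N z" using z z0 by (intro log_slope_antimono N) auto
    finally have "log_slope N z / z \<ge> - (34 * (real K + 1) * (121 * real N) / D) / z" using z0 by (intro divide_right_mono) auto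
    moreover have "- (34 * (real K + 1) * (121 * real N) / D) / z \<ge> - (34 * (real K + 1) * (121 * real N) / D) / (121 * real N)"
    proof -
      have "(34 * (real K + 1) * (121 * real N) / D) / z \<le> (34 * (real K + 1) * (121 * real N) / D) / (121 * real N)"
        using z0 D K by (intro divide_left_mono) auto
      thus ?thesis by simp
    qed
    moreover have "- (34 * (real K + 1) * (121 * real N) / D) / (121 * real N) = - (34 * (real K + 1) / D)" using z0 by simp
    ultimately have "- (34 * (real K + 1) / D) \<le> log_slope N z / z" by linarith
    hence "real K * (- (34 * (real K + 1) / D)) \<le> real K * (log_slope N z / z)" by (intro mult_left_mono) auto
    moreover have "real K * (34 * (real K + 1) / D) \<le> 1" using D by (simp add: pos_divide_le_eq mult_ac)
    ultimately show ?thesis using z(3) by (simp add: t_def)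
  qed
  hence "exp (log_R N (peak N) - 1) \<le> exp (log_R N t)" by simp
  hence "R_max N / exp 1 \<le> R_pos N t" using pk K by (auto simp: R_max_def R_pos_def R_eq_exp exp_diff t_def)
  moreover have "R_max N / 3 \<le> R_max N / exp 1" using exp_le by (intro divide_left_mono) (auto simp: R_max_def)
  ultimately have Rt: "R_max N / 3 \<le> R_pos N t" by linarith
  define m where "m = nat (\<lfloor>peak N\<rfloor> - 53 * int N)"
  have "\<lfloor>peak N\<rfloor> \<ge> 121 * int N" using pk by (simp add: le_floor_iff)
  hence m: "real m = of_int \<lfloor>peak N\<rfloor> - 53 * real N" by (simp add: m_def)
  have "real K * (R_max N / 3) = (\<Sum>n\<in>{m..<m + K}. R_max N / 3)" by simp
  also have "\<dots> \<le> (\<Sum>n\<in>{m..<m + K}. R_pos N (real (53 * 1 * N + 1 + n) / real 1))"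
  proof (intro sum_mono order.trans[OF Rt] R_pos_antimono[OF N D1 near])
    fix n assume "n \<in> {m..<m + K}"
    hence "m \<le> n" "n + 1 \<le> m + K" by auto
    hence "real m \<le> real n" "real n + 1 \<le> real m + real K" by linarith+
    thus "peak N \<le> real (53 * 1 * N + 1 + n) / real 1" "real (53 * 1 * N + 1 + n) / real 1 \<le> t"
      using m by (auto simp: t_def) linarith+
  qed
  also have "\<dots> \<le> (\<Sum>n. R_pos N (real (53 * 1 * N + 1 + n) / real 1))"
    using R_pos_nonneg[OF N D1 near] R_sum_sums[OF N D1 near, of 1] by (intro sum_le_suminf) (auto simp: sums_iff)
  also have "\<dots> = R_sum N 1" using R_sum_sums[OF N D1 near, of 1] by (simp add: sums_iff)
  finally show ?thesis by simp
qed

text \<open>18 / K is the error 2 * 3 * \<open>R_max N\<close> of \<open>R_sum_compare\<close>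
  relative to the lower bound \<open>K * R_max N / 3\<close>.\<close>

lemma R_sum_ratio_bound:
  assumes K: "K \<ge> 1"
  shows "eventually (\<lambda>N. R_sum N 1 > 0 \<and> (\<forall>d\<in>{1,2,3}. \<bar>R_sum N d / R_sum N 1 - real d\<bar> \<le> 18 / real K)) sequentially"
proof -
  define D where "D = 34 * real K * (real K + 1)"
  have "34 * real K * (real K + 1) \<ge> 1 * 1" using K by (intro mult_mono) auto
  hence D: "D \<ge> 1" "D + 1 > 0" by (simp_all add: D_def)
  show ?thesis using log_slope_near[OF D(2)] eventually_ge_at_top[of 1]
  proof eventually_elim
    case (elim N)
    have M: "R_max N > 0" by (simp add: R_max_def)
    have low: "R_sum N 1 \<ge> real K * R_max N / 3" by (rule R_sum_lower[OF elim(2) D(1) _ elim(1)]) (simp add: D_def)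
    have "real K * R_max N / 3 > 0" using M K by simp
    hence pos: "R_sum N 1 > 0" using low by linarith
    have "\<bar>R_sum N d / R_sum N 1 - real d\<bar> \<le> 18 / real K" if d: "d \<in> {1,2,3}" for d
    proof -
      have "R_sum N d / R_sum N 1 - real d = (R_sum N d - real d * R_sum N 1) / R_sum N 1" using pos by (simp add: diff_divide_distrib)
      also have "\<bar>\<dots>\<bar> = \<bar>R_sum N d - real d * R_sum N 1\<bar> / R_sum N 1" using pos by (simp add: abs_div)
      also have "\<dots> \<le> 2 * real d * R_max N / R_sum N 1"
        using R_sum_compare[OF elim(2) D(2) elim(1) d] pos by (intro divide_right_mono) auto
      also have "\<dots> \<le> 2 * 3 * R_max N / R_sum N 1" using d M pos by (intro divide_right_mono mult_right_mono) auto
      also have "\<dots> \<le> 2 * 3 * R_max N / (real K * R_max N / 3)" using low M K pos by (intro divide_left_mono) auto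
      also have "\<dots> = 18 / real K" using M by simp
      finally show ?thesis .
    qed
    with pos show ?case by blast
  qed
qed

lemma R_sum_pos: "eventually (\<lambda>N. R_sum N 1 > 0) sequentially"
  using R_sum_ratio_bound[of 1] by (auto elim!: eventually_mono)

lemma R_sum_ratio_limit:
  assumes d: "d \<in> {1, 2, 3}"
  shows "(\<lambda>N. R_sum N d / R_sum N 1) \<longlonglongrightarrow> real d"
proof (rule tendstoI)
  fix e :: real assume e: "e > 0"
  obtain K where K: "real K > 18 / e" using reals_Archimedean2 by blast
  have "18 / e > 0" using e by simp
  hence K1: "K \<ge> 1" using K by (cases K) auto
  have lt: "18 / real K < e" using K e K1 by (simp add: divide_simps mult.commute)
  show "eventually (\<lambda>N. dist (R_sum N d / R_sum N 1) (real d) < e) sequentially"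
    using R_sum_ratio_bound[OF K1]
  proof (elim eventually_mono conjE)
    fix N assume "\<forall>d\<in>{1,2,3}. \<bar>R_sum N d / R_sum N 1 - real d\<bar> \<le> 18 / real K"
    with d lt have "\<bar>R_sum N d / R_sum N 1 - real d\<bar> < e" by (meson le_less_trans)
    thus "dist (R_sum N d / R_sum N 1) (real d) < e" by (simp only: dist_real_def)
  qed
qed

lemma zeta_2_nonneg: "zeta 2 \<ge> 0"
  using sums_le[OF _ sums_zero zeta_sums[of 2]] by simp

lemma R_sum_upper_bound:
  assumes "eventually (\<lambda>N. log_slope N (122 * real N) \<le> 0) sequentially"
  shows "eventually (\<lambda>N. R_sum N 1 \<le> R N (122 * real N) * exp (27 * real N) * (200 * real N)\<^sup>2 * zeta 2) sequentially"
  using assms log_slope_near[of 1, simplified] eventually_ge_at_top[of 1]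
proof eventually_elim
  case (elim N)
  have "R_sum N 1 \<le> R_max N * (200 * real N)\<^sup>2 * zeta 2" by (rule R_sum_upper[OF elim(3) _ elim(2)]) simp
  also have "\<dots> \<le> R N (122 * real N) * exp (27 * real N) * (200 * real N)\<^sup>2 * zeta 2"
    using R_max_le[OF elim(3) _ elim(2) elim(1)] zeta_2_nonneg by (intro mult_right_mono) auto
  finally show ?case .
qed

section \<open>Certified values of logarithms\<close>

definition ln_num :: "int \<Rightarrow> int" where
  "ln_num n = (let a = n - 64; z = n + 64 in
     (2000000 * (315 * a * z ^ 8 + 105 * a ^ 3 * z ^ 6 + 63 * a ^ 5 * z ^ 4 + 45 * a ^ 7 * z ^ 2 + 35 * a ^ 9)) div (315 * z ^ 9))"

text \<open>\<open>ln_num n\<close> is the floor of 10^6 times five terms of ln (n / 64) = 2 artanh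
  y with y = (n - 64) / (n + 64); the coefficients 1, 1/3, ..., 1/9 have the common denominator 315.
  Of the error 61, 60 is for the remainder at the largest argument 175 and 1 for the floor.\<close>

lemma ln_num_bounds:
  assumes "64 < n" "n \<le> 175"
  shows "real_of_int (ln_num n) \<le> 1000000 * (ln (real_of_int n) - 6 * ln 2)"
    and "1000000 * (ln (real_of_int n) - 6 * ln 2) \<le> real_of_int (ln_num n) + 61"
proof -
  define a z where "a = real_of_int n - 64" and "z = real_of_int n + 64"
  define y where "y = a / z"
  have az: "a > 0" "z > 0" using assms by (auto simp: a_def z_def)
  have y: "(real_of_int n / 64 - 1) / (real_of_int n / 64 + 1) = y" using assms by (simp add: y_def a_def z_def divide_simps) (simp add: algebra_simps)
  have y0: "y > 0" using az by (simp add: y_def)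
  have y1: "y \<le> 111 / 239" using assms by (simp add: y_def a_def z_def divide_simps)
  define A where "A = (\<Sum>k<5. 2 * y ^ (2 * k + 1) / of_nat (2 * k + 1))"
  define e where "e = y ^ (2 * 5 + 1) / (1 - y\<^sup>2) / of_nat (2 * 5 + 1)"
  have "ln (real_of_int n / 64) \<in> {A..A + 2 * e}"
    using ln_approx_bounds[of "real_of_int n / 64" 5] assms unfolding y A_def e_def by simp
  moreover have "ln (64 :: real) = 6 * ln 2" using ln_realpow[of 2 6] by simp
  moreover have "ln (real_of_int n / 64) = ln (real_of_int n) - ln 64" using assms by (intro ln_divide_pos) auto
  ultimately have ln: "A \<le> ln (real_of_int n) - 6 * ln 2" "ln (real_of_int n) - 6 * ln 2 \<le> A + 2 * e" by auto
  have "e \<le> (111 / 239) ^ 11 / (1 - (111 / 239)\<^sup>2) / 11"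
  proof -
    have "y ^ 11 \<le> (111 / 239) ^ 11" "y\<^sup>2 \<le> (111 / 239)\<^sup>2" using y0 y1 by (intro power_mono; simp)+
    moreover have "(111 / 239 :: real)\<^sup>2 < 1" by (simp add: power2_eq_square)
    ultimately show ?thesis unfolding e_def using y0 by (intro frac_le) auto
  qed
  also have "\<dots> \<le> 3 / 100000" by (simp add: power_divide)
  finally have e: "2 * e \<le> 6 / 100000" by simp
  define P where "P = 2000000 * (315 * (n - 64) * (n + 64) ^ 8 + 105 * (n - 64) ^ 3 * (n + 64) ^ 6 + 63 * (n - 64) ^ 5 * (n + 64) ^ 4 + 45 * (n - 64) ^ 7 * (n + 64) ^ 2 + 35 * (n - 64) ^ 9)"
  have "1000000 * A = 2000000 * (y + y ^ 3 / 3 + y ^ 5 / 5 + y ^ 7 / 7 + y ^ 9 / 9)"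
    by (simp add: A_def eval_nat_numeral)
  also have "\<dots> = 2000000 * (315 * a * z ^ 8 + 105 * a ^ 3 * z ^ 6 + 63 * a ^ 5 * z ^ 4 + 45 * a ^ 7 * z ^ 2 + 35 * a ^ 9) / (315 * z ^ 9)"
  proof -
    have "y * z = a" using az by (simp add: y_def)
    hence "a = y * z" by simp
    thus ?thesis using az by (simp add: power_mult_distrib divide_simps) (simp add: algebra_simps eval_nat_numeral)
  qed
  also have "\<dots> = of_int P / of_int (315 * (n + 64) ^ 9)" by (simp add: P_def a_def z_def)
  finally have PA: "1000000 * A = of_int P / of_int (315 * (n + 64) ^ 9)" .
  have "ln_num n = \<lfloor>of_int P / of_int (315 * (n + 64) ^ 9) :: real\<rfloor>"
    by (simp only: floor_divide_of_int_eq ln_num_def Let_def P_def)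
  hence "real_of_int (ln_num n) \<le> 1000000 * A" "1000000 * A \<le> real_of_int (ln_num n) + 1"
    unfolding PA by (simp_all only: of_int_floor_le) linarith
  note q = this
  show "real_of_int (ln_num n) \<le> 1000000 * (ln (real_of_int n) - 6 * ln 2)"
    using ln q by argo
  show "1000000 * (ln (real_of_int n) - 6 * ln 2) \<le> real_of_int (ln_num n) + 61"
    using ln q e by argo
qed

lemma ln_2_bounds: "69314 / 100000 \<le> ln (2 :: real)" "ln (2 :: real) \<le> 69315 / 100000"
  using ln_approx_bounds[of 2 5] by (simp_all add: eval_nat_numeral)

text \<open>\<open>ln_num\<close> is a lower bound, so the error 61 is charged to the positive
  coefficients alone.\<close>

lemma ln_combination_bound:
  assumes "\<forall>(c, n)\<in>set cs. 64 < n \<and> n \<le> 175"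
  shows "1000000 * (\<Sum>(c, n)\<leftarrow>cs. of_int c * ln (real_of_int n)) \<le>
     of_int (\<Sum>(c, n)\<leftarrow>cs. c * ln_num n + 61 * max 0 c) + 6000000 * of_int (\<Sum>(c, n)\<leftarrow>cs. c) * ln 2"
  using assms
proof (induction cs)
  case (Cons x cs)
  obtain c n where x: "x = (c, n)" by (cases x)
  have n: "64 < n" "n \<le> 175" using Cons.prems x by auto
  define l where "l = 1000000 * (ln (real_of_int n) - 6 * ln 2)"
  have "of_int c * l \<le> of_int (c * ln_num n + 61 * max 0 c)"
  proof (cases "c \<ge> 0")
    case True
    hence "of_int c * l \<le> of_int c * (real_of_int (ln_num n) + 61)"
      using ln_num_bounds(2)[OF n] unfolding l_def by (intro mult_left_mono) auto
    thus ?thesis using True by (simp add: algebra_simps)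
  next
    case False
    hence "of_int c * l \<le> of_int c * real_of_int (ln_num n)"
      using ln_num_bounds(1)[OF n] unfolding l_def by (intro mult_left_mono_neg) auto
    thus ?thesis using False by simp
  qed
  moreover have "of_int c * l = 1000000 * (of_int c * ln (real_of_int n)) - 6000000 * of_int c * ln 2"
    by (simp add: l_def algebra_simps)
  ultimately have h: "1000000 * (of_int c * ln (real_of_int n)) \<le> of_int (c * ln_num n + 61 * max 0 c) + 6000000 * of_int c * ln 2" by linarith
  have ih: "1000000 * (\<Sum>(c, n)\<leftarrow>cs. of_int c * ln (real_of_int n)) \<le>
     of_int (\<Sum>(c, n)\<leftarrow>cs. c * ln_num n + 61 * max 0 c) + 6000000 * of_int (\<Sum>(c, n)\<leftarrow>cs. c) * ln 2"
    using Cons by simp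
  show ?case using add_mono[OF h ih] by (simp add: x algebra_simps)
qed simp

text \<open>\<open>Phi\<close> with every logarithm moved to an argument in the range of
  \<open>ln_num_bounds\<close> by extracting powers of 2: the multiples of ln 3 are collected as
  4860 ln 96, those of ln 11 as -1936 ln 88, and \<open>2 * L\<close> is doubled for
  \<open>L \<le> 32\<close>.\<close>

definition phi_terms :: "(int \<times> int) list" where
  "phi_terms = [(4860, 96), (- 1936, 88), (106, 106), (69, 69), (- 175, 175)] @
     map (\<lambda>L. (2 * L, if L \<le> 32 then 4 * L else 2 * L)) [19..53] @
     map (\<lambda>L. (122 - L, 122 - L)) [19..53] @ map (\<lambda>L. (- (122 + L), 122 + L)) [19..53]"

definition slope_terms :: "(int \<times> int) list" where
  "slope_terms = [(20, 96), (1, 69), (- 1, 175)] @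
     map (\<lambda>L. (1, 122 - L)) [19..53] @ map (\<lambda>L. (- 1, 122 + L)) [19..53]"

lemma phi_terms_eval:
  "list_all (\<lambda>(c, n). 64 < n \<and> n \<le> 175) phi_terms"
  "(\<Sum>(c, n)\<leftarrow>phi_terms. c) = 2924"
  "(\<Sum>(c, n)\<leftarrow>phi_terms. c * ln_num n + 61 * max 0 c) \<le> - 1967000000"
  by code_simp+

lemma slope_terms_eval:
  "list_all (\<lambda>(c, n). 64 < n \<and> n \<le> 175) slope_terms"
  "(\<Sum>(c, n)\<leftarrow>slope_terms. c) = 20"
  "(\<Sum>(c, n)\<leftarrow>slope_terms. c * ln_num n + 61 * max 0 c) \<le> - 14260000"
  by code_simp+

lemma ln_factor:
  "ln (88 :: real) = 3 * ln 2 + ln 11" "ln (96 :: real) = 5 * ln 2 + ln 3"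
  "ln (242 :: real) = ln 2 + 2 * ln 11" "ln (484 :: real) = 2 * ln 2 + 2 * ln 11"
  "ln (726 :: real) = ln 2 + ln 3 + 2 * ln 11" "ln (486 :: real) = ln 2 + 5 * ln 3"
  "ln (729 :: real) = 6 * ln 3" "ln (243 :: real) = 5 * ln 3"
  using ln_mult_pos[of "2 ^ 3" 11] ln_mult_pos[of "2 ^ 5" 3] ln_mult_pos[of 2 "11 ^ 2"] ln_mult_pos[of "2 ^ 2" "11 ^ 2"]
    ln_mult_pos[of "2 * 3" "11 ^ 2"] ln_mult_pos[of 2 3] ln_mult_pos[of 2 "3 ^ 5"]
    ln_realpow[of 2 2] ln_realpow[of 2 3] ln_realpow[of 2 5] ln_realpow[of 3 5] ln_realpow[of 3 6] ln_realpow[of 11 2]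
  by simp_all

lemma sum_list_interval: "(\<Sum>L\<leftarrow>[19..53]. f L) = (\<Sum>L\<in>{19..53}. f L)" for f :: "int \<Rightarrow> real"
  by (simp only: sum_list_distinct_conv_sum_set distinct_upto set_upto)

text \<open>The constant bounds \<open>log_slope N (122 * N) / (122 * N)\<close> from above in the
  limit. The 100 ln 2 in the proof comes from ln 3 = ln 96 - 5 ln 2.\<close>

lemma slope_constant_neg: "20 * ln 3 - ln (175 / 69 :: real) - (\<Sum>L\<in>{19..53}. ln ((122 + real_of_int L) / (122 - real_of_int L))) < 0"
proof -
  have "(\<Sum>(c, n)\<leftarrow>slope_terms. of_int c * ln (real_of_int n)) =
     20 * ln 96 + ln 69 - ln 175 + (\<Sum>L\<in>{19..53}. ln (122 - real_of_int L)) - (\<Sum>L\<in>{19..53}. ln (122 + real_of_int L))"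
    unfolding slope_terms_def by (simp add: o_def sum_list_interval sum_negf del: upto.simps upto_rec_numeral)
  also have "\<dots> = 20 * ln 3 + 100 * ln 2 - ln (175 / 69) - (\<Sum>L\<in>{19..53}. ln ((122 + real_of_int L) / (122 - real_of_int L)))"
  proof -
    have "(\<Sum>L\<in>{19..53}. ln ((122 + real_of_int L) / (122 - real_of_int L))) = (\<Sum>L\<in>{19..53}. ln (122 + real_of_int L) - ln (122 - real_of_int L))"
      by (intro sum.cong refl ln_divide_pos) auto
    thus ?thesis by (simp add: ln_factor ln_divide_pos sum_subtractf)
  qed
  finally have eq: "(\<Sum>(c, n)\<leftarrow>slope_terms. of_int c * ln (real_of_int n)) = \<dots>" .
  have "real_of_int (\<Sum>(c, n)\<leftarrow>slope_terms. c * ln_num n + 61 * max 0 c) \<le> real_of_int (- 14260000)"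
    using slope_terms_eval(3) by (simp only: of_int_le_iff)
  moreover have "1000000 * (\<Sum>(c, n)\<leftarrow>slope_terms. of_int c * ln (real_of_int n)) \<le>
     of_int (\<Sum>(c, n)\<leftarrow>slope_terms. c * ln_num n + 61 * max 0 c) + 6000000 * of_int (\<Sum>(c, n)\<leftarrow>slope_terms. c) * ln 2"
    using slope_terms_eval(1) by (intro ln_combination_bound) (simp add: list_all_iff)
  ultimately have "1000000 * (20 * ln 3 + 100 * ln 2 - ln (175 / 69) - (\<Sum>L\<in>{19..53}. ln ((122 + real_of_int L) / (122 - real_of_int L))))
      \<le> - 14260000 + 120000000 * ln 2" unfolding eq slope_terms_eval(2) by simp
  thus ?thesis using ln_2_bounds by argo
qed

text \<open>The coefficient of N in \<open>log_R N (122 * N)\<close> when each factorial is replaced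
  by the main term of Stirling's formula.\<close>

definition Phi :: real where
  "Phi = 242 * ln 242 + 106 * ln 106 + (\<Sum>L\<in>{19..53}. 2 * real_of_int L * ln (2 * real_of_int L)) - 484 * ln 484 - 726 * ln 726
     + (486 * ln 486 - 2 * ln 2) + (729 * ln 729 - 3 * ln 3) - 243 * ln 243 - (175 * ln 175 - 69 * ln 69)
     - (\<Sum>L\<in>{19..53}. (122 + real_of_int L) * ln (122 + real_of_int L) - (122 - real_of_int L) * ln (122 - real_of_int L))"

lemma Phi_le: "Phi \<le> - 3789"
proof -
  have "(\<Sum>L\<in>{19..53::int}. 2 * real_of_int L * ln (2 * real_of_int L)) =
    (\<Sum>L\<in>{19..53}. 2 * real_of_int L * ln (real_of_int (if L \<le> 32 then 4 * L else 2 * L)) - (if L \<le> 32 then 2 * real_of_int L else 0) * ln 2)"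
  proof (intro sum.cong refl)
    fix L :: int assume "L \<in> {19..53}"
    hence "ln (4 * real_of_int L) = ln 2 + ln (2 * real_of_int L)" using ln_mult_pos[of 2 "2 * real_of_int L"] by simp
    thus "2 * real_of_int L * ln (2 * real_of_int L) =
      2 * real_of_int L * ln (real_of_int (if L \<le> 32 then 4 * L else 2 * L)) - (if L \<le> 32 then 2 * real_of_int L else 0) * ln 2"
      by (simp add: algebra_simps)
  qed
  also have "\<dots> = (\<Sum>L\<in>{19..53}. 2 * real_of_int L * ln (real_of_int (if L \<le> 32 then 4 * L else 2 * L))) - of_int (\<Sum>L\<in>{19..53}. if L \<le> 32 then 2 * L else 0) * ln 2"
    by (simp add: sum_subtractf sum_distrib_right if_distrib[of real_of_int] cong: if_cong)
  also have "(\<Sum>L\<in>{19..53::int}. if L \<le> 32 then 2 * L else 0) = 714" by code_simp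
  finally have s1: "(\<Sum>L\<in>{19..53::int}. 2 * real_of_int L * ln (2 * real_of_int L)) =
     (\<Sum>L\<in>{19..53}. 2 * real_of_int L * ln (real_of_int (if L \<le> 32 then 4 * L else 2 * L))) - 714 * ln 2" by simp
  have "(\<Sum>(c, n)\<leftarrow>phi_terms. of_int c * ln (real_of_int n)) = 4860 * ln 96 - 1936 * ln 88 + 106 * ln 106 + 69 * ln 69 - 175 * ln 175
     + (\<Sum>L\<in>{19..53}. 2 * real_of_int L * ln (real_of_int (if L \<le> 32 then 4 * L else 2 * L)))
     + (\<Sum>L\<in>{19..53}. (122 - real_of_int L) * ln (122 - real_of_int L)) - (\<Sum>L\<in>{19..53}. (122 + real_of_int L) * ln (122 + real_of_int L))"
    unfolding phi_terms_def by (simp add: o_def sum_list_interval sum_negf [symmetric] minus_mult_left [symmetric] del: upto.simps upto_rec_numeral)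
      (simp add: algebra_simps sum_negf sum_subtractf sum.distrib)
  hence eq: "(\<Sum>(c, n)\<leftarrow>phi_terms. of_int c * ln (real_of_int n)) = Phi + (714 + 968 + 24300 - 5808) * ln 2"
    unfolding Phi_def s1 by (simp add: ln_factor sum_subtractf)
  have "real_of_int (\<Sum>(c, n)\<leftarrow>phi_terms. c * ln_num n + 61 * max 0 c) \<le> real_of_int (- 1967000000)"
    using phi_terms_eval(3) by (simp only: of_int_le_iff)
  moreover have "1000000 * (\<Sum>(c, n)\<leftarrow>phi_terms. of_int c * ln (real_of_int n)) \<le>
     of_int (\<Sum>(c, n)\<leftarrow>phi_terms. c * ln_num n + 61 * max 0 c) + 6000000 * of_int (\<Sum>(c, n)\<leftarrow>phi_terms. c) * ln 2"
    using phi_terms_eval(1) by (intro ln_combination_bound) (simp add: list_all_iff)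
  \<comment> \<open>This amounts to Phi <= -1967 - 2630 ln 2, which is slightly below -3789.\<close>
  ultimately have "1000000 * (Phi + 20174 * ln 2) \<le> - 1967000000 + 17544000000 * ln 2"
    unfolding eq phi_terms_eval(2) by simp
  thus ?thesis using ln_2_bounds by argo
qed

section \<open>Evaluation at 122 N\<close>

lemma sum_zeros2: "(\<Sum>u\<in>zeros2 N. f u) = (\<Sum>u\<in>{- int (242 * N)..int (242 * N)}. f u) - (\<Sum>z\<in>{- int (121 * N)..int (121 * N)}. f (2 * z))"
  for f :: "int \<Rightarrow> real"
proof -
  have eq: "{- int (242 * N)..int (242 * N)} = zeros2 N \<union> (\<lambda>z. 2 * z) ` {- int (121 * N)..int (121 * N)}"
    by (auto simp: zeros2_def image_iff elim!: evenE)
  have "(\<Sum>u\<in>{- int (242 * N)..int (242 * N)}. f u) = (\<Sum>u\<in>zeros2 N. f u) + (\<Sum>u\<in>(\<lambda>z. 2 * z) ` {- int (121 * N)..int (121 * N)}. f u)"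
    unfolding eq by (intro sum.union_disjoint finite_zeros finite_imageI finite_atLeastAtMost_int) (auto simp: zeros2_def)
  thus ?thesis by (simp add: sum.reindex inj_on_def)
qed

lemma sum_zeros3: "(\<Sum>u\<in>zeros3 N. f u) = (\<Sum>u\<in>{- int (363 * N)..int (363 * N)}. f u) - (\<Sum>z\<in>{- int (53 * N)..int (53 * N)}. f (3 * z))"
  for f :: "int \<Rightarrow> real"
proof -
  have eq: "{- int (363 * N)..int (363 * N)} = zeros3 N \<union> (\<lambda>z. 3 * z) ` {- int (53 * N)..int (53 * N)}"
    by (auto simp: zeros3_def image_iff dvd_def)
  have "(\<Sum>u\<in>{- int (363 * N)..int (363 * N)}. f u) = (\<Sum>u\<in>zeros3 N. f u) + (\<Sum>u\<in>(\<lambda>z. 3 * z) ` {- int (53 * N)..int (53 * N)}. f u)"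
    unfolding eq by (intro sum.union_disjoint finite_zeros finite_imageI finite_atLeastAtMost_int) (auto simp: zeros3_def)
  thus ?thesis by (simp add: sum.reindex inj_on_def)
qed

lemma sum_shift:
  assumes "M \<le> T"
  shows "(\<Sum>u\<in>{- int M..int M}. h (real T - of_int u)) = (\<Sum>w\<in>{T - M..T + M}. h (real w))"
  by (rule sum.reindex_bij_witness[of _ "\<lambda>w. int T - int w" "\<lambda>u. nat (int T - u)"]) (use assms in auto)

lemma block_nat: "L \<in> {19..53} \<Longrightarrow> block N L = {- int (nat L * N)..int (nat L * N)}"
  by (auto simp: block_def)

lemma harmonic_bounds:
  assumes "a \<ge> 1" "a \<le> b + 1"
  shows "ln ((real b + 1) / real a) \<le> (\<Sum>w\<in>{a..b}. 1 / real w)"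
    and "a \<ge> 2 \<Longrightarrow> (\<Sum>w\<in>{a..b}. 1 / real w) \<le> ln (real b / (real a - 1))"
proof -
  have "(\<Sum>w\<in>{a..<b + 1}. ln (real (Suc w)) - ln (real w)) \<le> (\<Sum>w\<in>{a..<b + 1}. 1 / real w)"
  proof (intro sum_mono)
    fix w assume "w \<in> {a..<b + 1}"
    hence w: "real w > 0" using assms by auto
    have "1 + 1 / real w = real (Suc w) / real w" using w by (simp add: field_simps)
    hence "ln (real (Suc w)) - ln (real w) = ln (1 + 1 / real w)" using w ln_divide_pos[of "real (Suc w)" "real w"] by simp
    also have "\<dots> \<le> 1 / real w" using w by (intro ln_add_one_self_le_self) auto
    finally show "ln (real (Suc w)) - ln (real w) \<le> 1 / real w" .
  qed
  also have "(\<Sum>w\<in>{a..<b + 1}. ln (real (Suc w)) - ln (real w)) = ln (real (b + 1)) - ln (real a)"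
    using assms by (intro sum_Suc_diff') auto
  finally show "ln ((real b + 1) / real a) \<le> (\<Sum>w\<in>{a..b}. 1 / real w)"
    using assms ln_divide_pos[of "real b + 1" "real a"] by (simp add: atLeastLessThanSuc_atLeastAtMost add.commute)
  assume a: "a \<ge> 2"
  have "(\<Sum>w\<in>{a..<b + 1}. 1 / real w) \<le> (\<Sum>w\<in>{a..<b + 1}. ln (real (Suc w) - 1) - ln (real w - 1))"
  proof (intro sum_mono)
    fix w assume "w \<in> {a..<b + 1}"
    hence w: "real w \<ge> 2" using a by auto
    have "ln (1 + - (1 / real w)) \<le> - (1 / real w)" using w by (intro ln_add_one_self_le_self2) auto
    moreover have "1 + - (1 / real w) = (real w - 1) / real w" using w by (simp add: field_simps)
    hence "ln (1 + - (1 / real w)) = ln (real w - 1) - ln (real w)" using w ln_divide_pos[of "real w - 1" "real w"] by simp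
    ultimately show "1 / real w \<le> ln (real (Suc w) - 1) - ln (real w - 1)" by simp
  qed
  also have "\<dots> = ln (real (b + 1) - 1) - ln (real a - 1)"
    using assms by (intro sum_Suc_diff') auto
  finally have le: "(\<Sum>w\<in>{a..b}. 1 / real w) \<le> ln (real b) - ln (real a - 1)" by (simp add: atLeastLessThanSuc_atLeastAtMost)
  show "(\<Sum>w\<in>{a..b}. 1 / real w) \<le> ln (real b / (real a - 1))" using le a assms by (subst ln_divide_pos) auto
qed

text \<open>At 122 N the sums of \<open>log_slope_eq\<close> become harmonic sums over intervals
  with ends proportional to N. Those with positive sign are bounded above and the others below, and
  the resulting logarithms converge to the constant of \<open>slope_constant_neg\<close>.\<close>

lemma log_slope_122: "eventually (\<lambda>N. log_slope N (122 * real N) \<le> 0) sequentially"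
proof -
  define S where "S = (\<Sum>L\<in>{19..53}. ln ((122 + real_of_int L) / (122 - real_of_int L)))"
  define U where "U = (\<lambda>N. 2 * ln (486 * real N / (2 * real N - 1)) + 3 * ln (729 * real N / (3 * real N - 1)) - ln 243 - ln (175 / 69) - S)"
  have "U \<longlonglongrightarrow> 2 * ln 243 + 3 * ln 243 - ln 243 - ln (175 / 69) - S"
  proof -
    have "(\<lambda>N. ln (486 * real N / (2 * real N - 1))) \<longlonglongrightarrow> ln 243" "(\<lambda>N. ln (729 * real N / (3 * real N - 1))) \<longlonglongrightarrow> ln 243"
      by real_asymp+
    thus ?thesis unfolding U_def by (intro tendsto_diff tendsto_add tendsto_mult tendsto_const)
  qed
  moreover have "2 * ln 243 + 3 * ln 243 - ln 243 - ln (175 / 69) - S < 0"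
    using slope_constant_neg by (simp add: S_def ln_factor)
  ultimately have "eventually (\<lambda>N. U N < 0) sequentially" by (rule order_tendstoD)
  thus ?thesis using eventually_ge_at_top[of 1]
  proof eventually_elim
    case (elim N)
    have N: "N \<ge> 1" "real N > 0" using elim by auto
    have t: "122 * real N > 121 * real N" using N by simp
    have low: "ln (b / a) \<le> (\<Sum>w\<in>{A..B}. 1 / real w)"
      if "real A = a * real N" "real B = b * real N" "a > 0" "A \<le> B" "A \<ge> 1" for a b :: real and A B
    proof -
      have "a * real N \<le> b * real N" using that by (metis of_nat_le_iff)
      hence "b > 0" using that N by simp
      have "b / a \<le> (real B + 1) / real A" using that N by (simp add: divide_simps)
      hence "ln (b / a) \<le> ln ((real B + 1) / real A)" using that \<open>b > 0\<close> by (intro ln_mono) auto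
      also have "\<dots> \<le> (\<Sum>w\<in>{A..B}. 1 / real w)" using that by (intro harmonic_bounds) auto
      finally show ?thesis .
    qed
    have "log_slope N (122 * real N) / (122 * real N) = 
       (\<Sum>u\<in>zeros2 N. 2 / (2 * (122 * real N) - of_int u)) + (\<Sum>u\<in>zeros3 N. 3 / (3 * (122 * real N) - of_int u))
       - (\<Sum>L\<in>{19..53}. \<Sum>j\<in>block N L. 1 / (122 * real N - of_int j))" by (rule log_slope_eq[OF t])
    moreover have "(\<Sum>u\<in>zeros2 N. 2 / (2 * (122 * real N) - of_int u)) \<le> 2 * ln (486 * real N / (2 * real N - 1)) - ln 243"
    proof -
      have "(\<Sum>u\<in>{- int (242 * N)..int (242 * N)}. 2 / (2 * (122 * real N) - of_int u)) = 2 * (\<Sum>w\<in>{2 * N..486 * N}. 1 / real w)"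
      proof -
        have "(\<Sum>u\<in>{- int (242 * N)..int (242 * N)}. 2 / (2 * (122 * real N) - of_int u)) =
           2 * (\<Sum>u\<in>{- int (242 * N)..int (242 * N)}. 1 / (real (244 * N) - of_int u))" by (simp add: sum_distrib_left)
        thus ?thesis using sum_shift[of "242 * N" "244 * N" "\<lambda>w. 1 / w"] by simp
      qed
      moreover have "(\<Sum>w\<in>{2 * N..486 * N}. 1 / real w) \<le> ln (real (486 * N) / (real (2 * N) - 1))"
        using N by (intro harmonic_bounds) auto
      moreover have "(\<Sum>z\<in>{- int (121 * N)..int (121 * N)}. 2 / (2 * (122 * real N) - of_int (2 * z))) = (\<Sum>w\<in>{N..243 * N}. 1 / real w)"
      proof -
        have "(\<Sum>z\<in>{- int (121 * N)..int (121 * N)}. 2 / (2 * (122 * real N) - of_int (2 * z))) = (\<Sum>z\<in>{- int (121 * N)..int (121 * N)}. 1 / (real (122 * N) - of_int z))"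
        proof (intro sum.cong refl)
          fix z
          have "2 * (122 * real N) - of_int (2 * z) = 2 * (real (122 * N) - of_int z)" by simp
          moreover have "2 / (2 * y) = 1 / y" for y :: real by simp
          ultimately show "2 / (2 * (122 * real N) - of_int (2 * z)) = 1 / (real (122 * N) - of_int z)" by (simp only:)
        qed
        thus ?thesis using sum_shift[of "121 * N" "122 * N" "\<lambda>w. 1 / w"] by simp
      qed
      moreover have "ln (243 / 1) \<le> (\<Sum>w\<in>{N..243 * N}. 1 / real w)" using N by (intro low) auto
      ultimately show ?thesis by (simp add: sum_zeros2)
    qed
    moreover have "(\<Sum>u\<in>zeros3 N. 3 / (3 * (122 * real N) - of_int u)) \<le> 3 * ln (729 * real N / (3 * real N - 1)) - ln (175 / 69)"
    proof -
      have "(\<Sum>u\<in>{- int (363 * N)..int (363 * N)}. 3 / (3 * (122 * real N) - of_int u)) = 3 * (\<Sum>w\<in>{3 * N..729 * N}. 1 / real w)"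
      proof -
        have "(\<Sum>u\<in>{- int (363 * N)..int (363 * N)}. 3 / (3 * (122 * real N) - of_int u)) =
           3 * (\<Sum>u\<in>{- int (363 * N)..int (363 * N)}. 1 / (real (366 * N) - of_int u))" by (simp add: sum_distrib_left)
        thus ?thesis using sum_shift[of "363 * N" "366 * N" "\<lambda>w. 1 / w"] by simp
      qed
      moreover have "(\<Sum>w\<in>{3 * N..729 * N}. 1 / real w) \<le> ln (real (729 * N) / (real (3 * N) - 1))"
        using N by (intro harmonic_bounds) auto
      moreover have "(\<Sum>z\<in>{- int (53 * N)..int (53 * N)}. 3 / (3 * (122 * real N) - of_int (3 * z))) = (\<Sum>w\<in>{69 * N..175 * N}. 1 / real w)"
      proof -
        have "(\<Sum>z\<in>{- int (53 * N)..int (53 * N)}. 3 / (3 * (122 * real N) - of_int (3 * z))) = (\<Sum>z\<in>{- int (53 * N)..int (53 * N)}. 1 / (real (122 * N) - of_int z))"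
        proof (intro sum.cong refl)
          fix z
          have "3 * (122 * real N) - of_int (3 * z) = 3 * (real (122 * N) - of_int z)" by simp
          moreover have "3 / (3 * y) = 1 / y" for y :: real by simp
          ultimately show "3 / (3 * (122 * real N) - of_int (3 * z)) = 1 / (real (122 * N) - of_int z)" by (simp only:)
        qed
        thus ?thesis using sum_shift[of "53 * N" "122 * N" "\<lambda>w. 1 / w"] by simp
      qed
      moreover have "ln (175 / 69) \<le> (\<Sum>w\<in>{69 * N..175 * N}. 1 / real w)" using N by (intro low) auto
      ultimately show ?thesis by (simp add: sum_zeros3)
    qed
    moreover have "S \<le> (\<Sum>L\<in>{19..53}. \<Sum>j\<in>block N L. 1 / (122 * real N - of_int j))"
      unfolding S_def
    proof (intro sum_mono)
      fix L :: int assume L: "L \<in> {19..53}"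
      define l where "l = nat L"
      have l: "real_of_int L = real l" "19 \<le> l" "l \<le> 53" using L by (auto simp: l_def)
      have lN: "l * N \<le> 53 * N" using l by simp
      have "(\<Sum>j\<in>block N L. 1 / (122 * real N - of_int j)) = (\<Sum>w\<in>{122 * N - l * N..122 * N + l * N}. 1 / real w)"
        unfolding block_nat[OF L] l_def [symmetric] using sum_shift[of "l * N" "122 * N" "\<lambda>w. 1 / w"] l by simp
      moreover have "ln ((122 + real l) / (122 - real l)) \<le> (\<Sum>w\<in>{122 * N - l * N..122 * N + l * N}. 1 / real w)"
      proof (rule low)
        show "1 \<le> 122 * N - l * N" using lN N by linarith
        show "real (122 * N - l * N) = (122 - real l) * real N"
          using of_nat_diff[of "l * N" "122 * N", where 'a = real] lN N by (simp add: left_diff_distrib)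
      qed (use l in \<open>auto simp: distrib_right\<close>)
      ultimately show "ln ((122 + real_of_int L) / (122 - real_of_int L)) \<le> (\<Sum>j\<in>block N L. 1 / (122 * real N - of_int j))"
        by (simp add: l(1))
    qed
    ultimately have "log_slope N (122 * real N) / (122 * real N) \<le> U N" unfolding U_def by argo
    hence "log_slope N (122 * real N) / (122 * real N) \<le> 0" using elim by linarith
    thus ?case using N by (simp add: divide_le_0_iff)
  qed
qed


text \<open>A weak form of Stirling's formula, by induction from 1 / (x + 1) <= ln (x + 1) - ln x <=
  1 / x. A logarithmic error suffices against bounds linear in N.\<close>

lemma ln_fact_bounds:
  assumes "n \<ge> 1"
  shows "real n * ln (real n) - real n \<le> ln (fact n)" "ln (fact n) \<le> real n * ln (real n) - real n + ln (real n) + 1"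
proof -
  have "real n * ln (real n) - real n \<le> ln (fact n) \<and> ln (fact n) \<le> real n * ln (real n) - real n + ln (real n) + 1"
    using assms
  proof (induction n rule: dec_induct)
    case (step n)
    define x where "x = real n"
    have x: "x \<ge> 1" using step by (simp add: x_def)
    have f: "ln (fact (Suc n) :: real) = ln (x + 1) + ln (fact n)" by (simp add: x_def ln_mult_pos add_ac fact_gt_zero del: of_nat_Suc)
    have e: "1 + 1 / x = (x + 1) / x" "1 + - (1 / (x + 1)) = x / (x + 1)" using x by (simp_all add: field_simps)
    have "ln (1 + 1 / x) \<le> 1 / x" using x by (intro ln_add_one_self_le_self) auto
    hence u: "ln (x + 1) - ln x \<le> 1 / x" using x ln_divide_pos[of "x + 1" x] by (simp add: e)
    have "ln (1 + - (1 / (x + 1))) \<le> - (1 / (x + 1))" using x by (intro ln_add_one_self_le_self2) auto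
    hence "ln (x / (x + 1)) \<le> - (1 / (x + 1))" unfolding e(2) .
    hence v: "1 / (x + 1) \<le> ln (x + 1) - ln x" using x ln_divide_pos[of x "x + 1"] by simp
    have "x * (ln (x + 1) - ln x) \<le> x * (1 / x)" using x u by (intro mult_left_mono) auto
    hence u': "x * (ln (x + 1) - ln x) \<le> 1" using x by simp
    have "(x + 1) * (1 / (x + 1)) \<le> (x + 1) * (ln (x + 1) - ln x)" using x v by (intro mult_left_mono) auto
    hence v': "1 \<le> (x + 1) * (ln (x + 1) - ln x)" using x by simp
    have ih: "x * ln x - x \<le> ln (fact n)" "ln (fact n) \<le> x * ln x - x + ln x + 1" using step.IH by (auto simp: x_def)
    have "(x + 1) * ln (x + 1) - (x + 1) \<le> ln (fact (Suc n))" unfolding f using ih u' by (simp add: algebra_simps)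
    moreover have "ln (fact (Suc n)) \<le> (x + 1) * ln (x + 1) - (x + 1) + ln (x + 1) + 1" unfolding f using ih v' by (simp add: algebra_simps)
    moreover have "real (Suc n) = x + 1" by (simp add: x_def)
    ultimately show ?case by (simp only:)
  qed simp
  thus "real n * ln (real n) - real n \<le> ln (fact n)" "ln (fact n) \<le> real n * ln (real n) - real n + ln (real n) + 1" by auto
qed

lemma sum_ln:
  assumes "1 \<le> a" "a \<le> b"
  shows "(\<Sum>w\<in>{a..b}. ln (real w)) = ln (fact b) - ln (fact (a - 1))"
proof -
  obtain a' where a': "a = Suc a'" using assms by (cases a) auto
  have f: "ln (fact (Suc n) :: real) = ln (real (Suc n)) + ln (fact n)" for n by (simp add: ln_mult_pos fact_gt_zero del: of_nat_Suc)
  have "(\<Sum>w\<in>{a'<..b}. ln (real w)) = ln (fact b) - ln (fact a')" if "a' \<le> b" for b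
    using that
  proof (induction b rule: dec_induct)
    case (step n)
    have "{a'<..Suc n} = insert (Suc n) {a'<..n}" using step by auto
    thus ?case using step by (simp add: f del: fact_Suc of_nat_Suc)
  qed simp
  from this[of b] show ?thesis using assms by (simp add: a' atLeastSucAtMost_greaterThanAtMost)
qed

text \<open>\<open>x * ln x - x\<close> at \<open>x = c * N\<close>, split so that the second
  summand is linear in \<open>c\<close>; these summands cancel once all factorials are
  combined.\<close>

definition stirling :: "nat \<Rightarrow> real \<Rightarrow> real" where
  "stirling N c = real N * (c * ln c) + c * (real N * (ln (real N) - 1))"

definition stirling_error :: "nat \<Rightarrow> real" where
  "stirling_error N = ln (800 * real N) + 1"

lemma ln_fact_stirling:
  assumes N: "N \<ge> 1" and c: "1 \<le> c" "c \<le> 800"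
  shows "stirling N (real c) \<le> ln (fact (c * N))" "ln (fact (c * N)) \<le> stirling N (real c) + stirling_error N"
    and "stirling N (real c) - stirling_error N \<le> ln (fact (c * N - 1))" "ln (fact (c * N - 1)) \<le> stirling N (real c) + stirling_error N"
proof -
  have cN: "c * N \<ge> 1" using N c by simp
  have ln_cN: "ln (real (c * N)) = ln (real c) + ln (real N)" using N c ln_mult_pos[of "real c" "real N"] by simp
  have st: "real (c * N) * ln (real (c * N)) - real (c * N) = stirling N (real c)"
    unfolding ln_cN by (simp add: stirling_def algebra_simps)
  have le: "ln (real (c * N)) \<le> ln (800 * real N)" "0 \<le> ln (real (c * N))"
    using N c cN by (auto intro!: ln_mono mult_right_mono ln_ge_zero simp del: of_nat_mult) (simp add: mult_right_mono)
  show a: "stirling N (real c) \<le> ln (fact (c * N))" "ln (fact (c * N)) \<le> stirling N (real c) + stirling_error N"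
    using ln_fact_bounds[OF cN] le unfolding st stirling_error_def by linarith+
  have "fact (c * N) = real (c * N) * fact (c * N - 1)" using cN by (intro fact_reduce) auto
  hence "ln (fact (c * N) :: real) = ln (real (c * N)) + ln (fact (c * N - 1))" using cN ln_mult_pos[of "real (c * N)" "fact (c * N - 1)"] by (simp add: fact_gt_zero)
  thus "stirling N (real c) - stirling_error N \<le> ln (fact (c * N - 1))" "ln (fact (c * N - 1)) \<le> stirling N (real c) + stirling_error N"
    using a le unfolding stirling_error_def by linarith+
qed

lemma sum_int_nat: "(\<Sum>L\<in>{19..53::int}. f (real_of_int L)) = (\<Sum>l\<in>{19..53::nat}. f (real l))"
  by (rule sum.reindex_bij_witness[of _ int nat]) auto

lemma log_R_122:
  assumes N: "N \<ge> 1"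
  shows "log_R N (122 * real N) = (ln (fact (242 * N)) + ln (fact (106 * N)) + (\<Sum>l\<in>{19..53}. ln (fact (2 * l * N)))
     - ln (fact (484 * N)) - ln (fact (726 * N))) + (ln (fact (486 * N)) - ln (fact (2 * N - 1))) - (ln (fact (243 * N)) - ln (fact (1 * N - 1)))
     + (ln (fact (729 * N)) - ln (fact (3 * N - 1))) - (ln (fact (175 * N)) - ln (fact (69 * N - 1)))
     - (\<Sum>l\<in>{19..53}. ln (fact ((122 + l) * N)) - ln (fact ((122 - l) * N - 1)))"
proof -
  have fp: "(fact n :: real) > 0" for n by simp
  have "ln (norm_factor N) = ln (fact (242 * N)) + ln (fact (106 * N)) + (\<Sum>l\<in>{19..53}. ln (fact (2 * l * N))) - ln (fact (484 * N)) - ln (fact (726 * N))"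
    unfolding norm_factor_def by (simp add: ln_divide_pos ln_mult_pos prod_pos ln_prod)
  moreover have "ln (lead N) = ln (norm_factor N) + real (242 * N + 1) * ln 2 + real (106 * N + 1) * ln 3"
  proof -
    have "norm_factor N > 0" unfolding norm_factor_def by (intro mult_pos_pos divide_pos_pos prod_pos) auto
    thus ?thesis unfolding lead_def by (simp add: ln_mult_pos ln_realpow del: of_nat_add of_nat_mult power_Suc power_add)
  qed
  moreover have "(\<Sum>u\<in>zeros2 N. ln (2 * (122 * real N) - of_int u)) = (ln (fact (486 * N)) - ln (fact (2 * N - 1)))
      - (real (242 * N + 1) * ln 2 + (ln (fact (243 * N)) - ln (fact (1 * N - 1))))"
  proof -
    have "(\<Sum>u\<in>{- int (242 * N)..int (242 * N)}. ln (2 * (122 * real N) - of_int u)) = (\<Sum>w\<in>{2 * N..486 * N}. ln (real w))"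
      using sum_shift[of "242 * N" "244 * N" ln] by simp
    moreover have "(\<Sum>z\<in>{- int (121 * N)..int (121 * N)}. ln (2 * (122 * real N) - of_int (2 * z))) = real (242 * N + 1) * ln 2 + (\<Sum>w\<in>{N..243 * N}. ln (real w))"
    proof -
      have "(\<Sum>z\<in>{- int (121 * N)..int (121 * N)}. ln (2 * (122 * real N) - of_int (2 * z))) = (\<Sum>z\<in>{- int (121 * N)..int (121 * N)}. ln 2 + ln (real (122 * N) - of_int z))"
      proof (intro sum.cong refl)
        fix z assume "z \<in> {- int (121 * N)..int (121 * N)}"
        hence "real_of_int z < real (122 * N)" using N by auto
        thus "ln (2 * (122 * real N) - of_int (2 * z)) = ln 2 + ln (real (122 * N) - of_int z)"
          using ln_mult_pos[of 2 "real (122 * N) - of_int z"] by (simp add: right_diff_distrib)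
      qed
      thus ?thesis using sum_shift[of "121 * N" "122 * N" ln] by (simp add: sum.distrib)
    qed
    ultimately show ?thesis unfolding sum_zeros2 using N by (simp add: sum_ln)
  qed
  moreover have "(\<Sum>u\<in>zeros3 N. ln (3 * (122 * real N) - of_int u)) = (ln (fact (729 * N)) - ln (fact (3 * N - 1)))
      - (real (106 * N + 1) * ln 3 + (ln (fact (175 * N)) - ln (fact (69 * N - 1))))"
  proof -
    have "(\<Sum>u\<in>{- int (363 * N)..int (363 * N)}. ln (3 * (122 * real N) - of_int u)) = (\<Sum>w\<in>{3 * N..729 * N}. ln (real w))"
      using sum_shift[of "363 * N" "366 * N" ln] by simp
    moreover have "(\<Sum>z\<in>{- int (53 * N)..int (53 * N)}. ln (3 * (122 * real N) - of_int (3 * z))) = real (106 * N + 1) * ln 3 + (\<Sum>w\<in>{69 * N..175 * N}. ln (real w))"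
    proof -
      have "(\<Sum>z\<in>{- int (53 * N)..int (53 * N)}. ln (3 * (122 * real N) - of_int (3 * z))) = (\<Sum>z\<in>{- int (53 * N)..int (53 * N)}. ln 3 + ln (real (122 * N) - of_int z))"
      proof (intro sum.cong refl)
        fix z assume "z \<in> {- int (53 * N)..int (53 * N)}"
        hence "real_of_int z < real (122 * N)" using N by auto
        thus "ln (3 * (122 * real N) - of_int (3 * z)) = ln 3 + ln (real (122 * N) - of_int z)"
          using ln_mult_pos[of 3 "real (122 * N) - of_int z"] by (simp add: right_diff_distrib)
      qed
      thus ?thesis using sum_shift[of "53 * N" "122 * N" ln] by (simp add: sum.distrib)
    qed
    ultimately show ?thesis unfolding sum_zeros3 using N by (simp add: sum_ln)
  qed
  moreover have "(\<Sum>L\<in>{19..53}. \<Sum>j\<in>block N L. ln (122 * real N - of_int j)) = (\<Sum>l\<in>{19..53}. ln (fact ((122 + l) * N)) - ln (fact ((122 - l) * N - 1)))"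
  proof (rule sum.reindex_bij_witness[of _ int nat])
    fix L :: int assume L: "L \<in> {19..53}"
    define l where "l = nat L"
    have l: "19 \<le> l" "l \<le> 53" using L by (auto simp: l_def)
    have lN: "l * N \<le> 53 * N" "122 * N - l * N = (122 - l) * N" "122 * N + l * N = (122 + l) * N" using l by (auto simp: diff_mult_distrib distrib_right)
    have "(122 - l) * N \<ge> 1" using l N by simp
    moreover have "(122 - l) * N \<le> (122 + l) * N" by (intro mult_right_mono) auto
    moreover have "(\<Sum>j\<in>block N L. ln (122 * real N - of_int j)) = (\<Sum>w\<in>{122 * N - l * N..122 * N + l * N}. ln (real w))"
      unfolding block_nat[OF L] l_def [symmetric] using sum_shift[of "l * N" "122 * N" ln] l by simp
    ultimately show "ln (fact ((122 + nat L) * N)) - ln (fact ((122 - nat L) * N - 1)) = (\<Sum>j\<in>block N L. ln (122 * real N - of_int j))"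
      unfolding lN(2,3) l_def [symmetric] by (simp add: sum_ln)
  qed auto
  ultimately show ?thesis unfolding log_R_def by (simp only:) 
qed

lemma log_R_122_le:
  assumes N: "N \<ge> 1"
  shows "log_R N (122 * real N) \<le> - 3789 * real N + 200 * stirling_error N"
proof -
  define E where "E = stirling_error N"
  define A where "A = real N * (ln (real N) - 1)"
  note b = ln_fact_stirling[OF N, folded E_def]
  have "(\<Sum>l\<in>{19..53}. ln (fact (2 * l * N))) \<le> (\<Sum>l\<in>{19..53::nat}. stirling N (2 * real l) + E)"
  proof (intro sum_mono)
    fix l :: nat assume "l \<in> {19..53}"
    thus "ln (fact (2 * l * N)) \<le> stirling N (2 * real l) + E" using b(2)[of "2 * l"] by simp
  qed
  also have "\<dots> = real N * (\<Sum>L\<in>{19..53}. 2 * real_of_int L * ln (2 * real_of_int L)) + 2520 * A + 35 * E"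
  proof -
    have "(\<Sum>l\<in>{19..53::nat}. stirling N (2 * real l) + E) = (\<Sum>L\<in>{19..53}. real N * (2 * real_of_int L * ln (2 * real_of_int L)) + 2 * A * real_of_int L + E)"
      by (subst sum_int_nat[symmetric, of "\<lambda>x. stirling N (2 * x) + E"]) (simp add: stirling_def A_def mult_ac)
    also have "\<dots> = real N * (\<Sum>L\<in>{19..53}. 2 * real_of_int L * ln (2 * real_of_int L)) + 2 * A * of_int (\<Sum>L\<in>{19..53}. L) + 35 * E"
      by (simp add: sum.distrib sum_distrib_left)
    also have "(\<Sum>L\<in>{19..53::int}. L) = 1260" by code_simp
    finally show ?thesis by simp
  qed
  finally have h1: "(\<Sum>l\<in>{19..53}. ln (fact (2 * l * N))) \<le> real N * (\<Sum>L\<in>{19..53}. 2 * real_of_int L * ln (2 * real_of_int L)) + 2520 * A + 35 * E" .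
  have "(\<Sum>l\<in>{19..53}. ln (fact ((122 + l) * N)) - ln (fact ((122 - l) * N - 1))) \<ge> (\<Sum>l\<in>{19..53::nat}. stirling N (122 + real l) - stirling N (122 - real l) - E)"
  proof (intro sum_mono)
    fix l :: nat assume "l \<in> {19..53}"
    hence l: "1 \<le> 122 + l" "122 + l \<le> 800" "1 \<le> 122 - l" "122 - l \<le> 800" "real (122 + l) = 122 + real l" "real (122 - l) = 122 - real l"
      by (auto simp: of_nat_diff)
    show "stirling N (122 + real l) - stirling N (122 - real l) - E \<le> ln (fact ((122 + l) * N)) - ln (fact ((122 - l) * N - 1))"
      using b(1)[OF l(1,2)] b(4)[OF l(3,4)] unfolding l(5,6) by linarith
  qed
  moreover have "(\<Sum>l\<in>{19..53::nat}. stirling N (122 + real l) - stirling N (122 - real l) - E) =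
      real N * (\<Sum>L\<in>{19..53}. (122 + real_of_int L) * ln (122 + real_of_int L) - (122 - real_of_int L) * ln (122 - real_of_int L)) + 2520 * A - 35 * E"
  proof -
    have "(\<Sum>l\<in>{19..53::nat}. stirling N (122 + real l) - stirling N (122 - real l) - E) = 
      (\<Sum>L\<in>{19..53}. real N * ((122 + real_of_int L) * ln (122 + real_of_int L) - (122 - real_of_int L) * ln (122 - real_of_int L)) + 2 * A * real_of_int L - E)"
      by (subst sum_int_nat[symmetric, of "\<lambda>x. stirling N (122 + x) - stirling N (122 - x) - E"]) 
         (simp add: stirling_def A_def [symmetric], intro sum.cong refl, simp add: algebra_simps)
    also have "\<dots> = real N * (\<Sum>L\<in>{19..53}. (122 + real_of_int L) * ln (122 + real_of_int L) - (122 - real_of_int L) * ln (122 - real_of_int L))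
        + 2 * A * of_int (\<Sum>L\<in>{19..53}. L) - 35 * E"
    proof -
      have "(\<Sum>L\<in>{19..53}. real N * g L + 2 * A * real_of_int L - E) = real N * sum g {19..53} + 2 * A * of_int (\<Sum>L\<in>{19..53}. L) - 35 * E" for g
        by (simp add: sum.distrib sum_subtractf sum_distrib_left)
      thus ?thesis .
    qed
    also have "(\<Sum>L\<in>{19..53::int}. L) = 1260" by code_simp
    finally show ?thesis by simp
  qed
  ultimately have h2: "(\<Sum>l\<in>{19..53}. ln (fact ((122 + l) * N)) - ln (fact ((122 - l) * N - 1))) \<ge>
     real N * (\<Sum>L\<in>{19..53}. (122 + real_of_int L) * ln (122 + real_of_int L) - (122 - real_of_int L) * ln (122 - real_of_int L)) + 2520 * A - 35 * E" by simp
  have st: "stirling N c = real N * (c * ln c) + c * A" for c by (simp add: stirling_def A_def)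
  have "E \<ge> 0" using N by (simp add: E_def stirling_error_def)
  \<comment> \<open>The coefficients of \<open>A\<close> add up to 0 over all factorials, so only
    \<open>N * Phi\<close> and the errors remain.\<close>
  have "log_R N (122 * real N) \<le> real N * Phi + 90 * E"
    unfolding log_R_122[OF N] Phi_def
    using h1 h2 b(2)[of 242, unfolded st] b(2)[of 106, unfolded st] b(1)[of 484, unfolded st] b(1)[of 726, unfolded st] b(2)[of 486, unfolded st]
      b(3)[of 2, unfolded st] b(1)[of 243, unfolded st] b(4)[of 1, unfolded st] b(2)[of 729, unfolded st] b(3)[of 3, unfolded st] b(1)[of 175, unfolded st]
      b(4)[of 69, unfolded st] \<open>E \<ge> 0\<close>
    by (simp add: distrib_left right_diff_distrib)
  also have "\<dots> \<le> real N * (- 3789) + 200 * E" using Phi_le \<open>E \<ge> 0\<close> by (intro add_mono mult_left_mono) auto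
  finally show ?thesis by (simp add: E_def)
qed

section \<open>Irrationality\<close>

lemma den_pos: "den N > 0"
  unfolding den_def by (intro prod_pos) (auto intro: prime_gt_0_nat)

text \<open>3750 - 3789 + 27 = -12, so the product still decays exponentially against the polynomial
  factors.\<close>

lemma den_R_sum_limit: "(\<lambda>N. real (den N) * R_sum N 1) \<longlonglongrightarrow> 0"
proof (rule tendsto_sandwich[OF _ _ tendsto_const])
  show "eventually (\<lambda>N. 0 \<le> real (den N) * R_sum N 1) sequentially"
    using R_sum_pos by eventually_elim simp
  show "eventually (\<lambda>N. real (den N) * R_sum N 1 \<le>
      exp (- 12 * real N + 200 * (ln (800 * real N) + 1)) * (200 * real N)\<^sup>2 * zeta 2) sequentially"
    using ln_den_asymptotics R_sum_upper_bound[OF log_slope_122] eventually_ge_at_top[of 1] R_sum_pos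
  proof eventually_elim
    case (elim N)
    have N: "N \<ge> 1" using elim by simp
    have "real (den N) = exp (ln (real (den N)))" using den_pos[of N] by simp
    also have "\<dots> \<le> exp (3750 * real N)" using elim by simp
    finally have d: "real (den N) \<le> exp (3750 * real N)" .
    have "R_sum N 1 \<le> R N (122 * real N) * exp (27 * real N) * (200 * real N)\<^sup>2 * zeta 2" using elim by simp
    also have "R N (122 * real N) = exp (log_R N (122 * real N))" using N by (intro R_eq_exp) simp
    also have "exp (log_R N (122 * real N)) * exp (27 * real N) * (200 * real N)\<^sup>2 * zeta 2 \<le>
        exp (- 3789 * real N + 200 * stirling_error N) * exp (27 * real N) * (200 * real N)\<^sup>2 * zeta 2"
      using log_R_122_le[OF N] zeta_2_nonneg by (intro mult_right_mono) auto
    finally have r: "R_sum N 1 \<le> exp (- 3789 * real N + 200 * stirling_error N) * exp (27 * real N) * (200 * real N)\<^sup>2 * zeta 2" .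
    have "real (den N) * R_sum N 1 \<le> exp (3750 * real N) * (exp (- 3789 * real N + 200 * stirling_error N) * exp (27 * real N) * (200 * real N)\<^sup>2 * zeta 2)"
      using d r elim by (intro mult_mono) auto
    also have "\<dots> = (exp (3750 * real N) * exp (- 3789 * real N + 200 * stirling_error N) * exp (27 * real N)) * (200 * real N)\<^sup>2 * zeta 2"
      by (simp only: mult.assoc)
    also have "exp (3750 * real N) * exp (- 3789 * real N + 200 * stirling_error N) * exp (27 * real N) = exp (- 12 * real N + 200 * (ln (800 * real N) + 1))"
      by (simp only: exp_add [symmetric] stirling_error_def) simp
    finally show ?case .
  qed
  have "(\<lambda>N. exp (- 12 * real N + 200 * (ln (800 * real N) + 1)) * (200 * real N)\<^sup>2) \<longlonglongrightarrow> 0"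
    by real_asymp
  from tendsto_mult_right[OF this, of "zeta 2"]
  show "(\<lambda>N. exp (- 12 * real N + 200 * (ln (800 * real N) + 1)) * (200 * real N)\<^sup>2 * zeta 2) \<longlonglongrightarrow> 0" by simp
qed

lemma Rats_common_denominator:
  assumes "finite I" "\<And>i. i \<in> I \<Longrightarrow> x i \<in> \<rat>"
  shows "\<exists>q::nat. q > 0 \<and> (\<forall>i\<in>I. real q * x i \<in> \<int>)"
  using assms
proof (induction I rule: finite_induct)
  case empty
  show ?case by (intro exI[of _ 1]) auto
next
  case (insert j I)
  then obtain q where q: "q > 0" "\<forall>i\<in>I. real q * x i \<in> \<int>" by auto
  have "x j \<in> \<rat>" using insert by auto
  then obtain a b where ab: "b > 0" "x j = of_int a / of_int b" by (elim Rats_cases') auto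
  have b: "real (nat b) = of_int b" using ab by simp
  show ?case
  proof (intro exI[of _ "q * nat b"] conjI ballI)
    show "q * nat b > 0" using q ab by simp
    fix i assume "i \<in> insert j I"
    then consider "i = j" | "i \<in> I" by auto
    thus "real (q * nat b) * x i \<in> \<int>"
    proof cases
      case 1
      have "real (q * nat b) * x i = of_int (int q * a)" using ab b 1 by simp
      thus ?thesis by (metis Ints_of_int)
    next
      case 2
      have "real (q * nat b) * x i = of_int b * (real q * x i)" using b by simp
      thus ?thesis using q 2 by (metis Ints_mult Ints_of_int)
    qed
  qed
qed

text \<open>The cross product of \<open>(1, 2 ^ 3, 3 ^ 3)\<close> and \<open>(1, 2 ^ i, 3 ^ i)\<close>, hence orthogonal to both.\<close>

definition weight :: "nat \<Rightarrow> nat \<Rightarrow> int" where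
  "weight i d = (if d = 1 then 8 * 3 ^ i - 27 * 2 ^ i else if d = 2 then 27 - 3 ^ i else 2 ^ i - 8)"

lemma weight_sums:
  "(\<Sum>d\<in>{1,2,3}. real_of_int (weight i d) * real d ^ 3) = 0"
  "(\<Sum>d\<in>{1,2,3}. real_of_int (weight i d) * real d ^ i) = 0"
  "(\<Sum>d\<in>{1,2,3}. real_of_int (weight i d) * real d) = 6 * (3 ^ i - 4 * 2 ^ i + 5)"
  by (simp_all add: weight_def algebra_simps)

lemma weight_pos:
  assumes "i \<ge> 5"
  shows "6 * (3 ^ i - 4 * 2 ^ i + 5) > (0 :: real)"
proof -
  have "4 * (2 :: real) ^ i \<le> 3 ^ i" using assms
  proof (induction i rule: dec_induct)
    case (step n)
    have "4 * (2 :: real) ^ Suc n \<le> 3 * (4 * 2 ^ n)" by simp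
    also have "\<dots> \<le> 3 * 3 ^ n" using step.IH by (rule mult_left_mono) simp
    finally show ?case by simp
  qed simp
  thus ?thesis by simp
qed

text \<open>\<open>i0\<close> names the value that is eliminated along with zeta(3), so the
  conclusion excludes it; in this form the lemma can be applied twice to produce two irrational
  values.\<close>

lemma not_at_most_one_irrational:
  assumes i0: "5 \<le> i0"
  shows "\<exists>i\<in>{5..35}. odd i \<and> i \<noteq> i0 \<and> zeta (real i) \<notin> \<rat>"
proof (rule ccontr)
  assume "\<not> ?thesis"
  hence rat: "zeta (real i) \<in> \<rat>" if "i \<in> {i \<in> {5..35}. odd i \<and> i \<noteq> i0}" for i using that by blast
  define I where "I = {i \<in> {5..35}. odd i \<and> i \<noteq> i0}"
  have "finite I" by (simp add: I_def)
  then obtain q where q: "q > 0" "\<forall>i\<in>I. real q * zeta (real i) \<in> \<int>"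
    using Rats_common_denominator[of I "\<lambda>i. zeta (real i)"] rat by (auto simp: I_def)
  define \<Lambda> where "\<Lambda> = (\<lambda>N. \<Sum>d\<in>{1,2,3}. of_int (weight i0 d) * (2 * R_sum N d))"
  have form: "\<Lambda> N = (\<Sum>i\<in>I. of_int (2 * (\<Sum>d\<in>{1,2,3}. weight i0 d * int d ^ i)) * rho N i * zeta (real i))
      - (\<Sum>d\<in>{1,2,3}. of_int (weight i0 d) * rat_part N d)" for N
  proof -
    let ?J = "{i\<in>{3..35}. odd i}"
    have "\<Lambda> N = (\<Sum>d\<in>{1,2,3}. of_int (weight i0 d) * ((\<Sum>i\<in>?J. 2 * real d ^ i * rho N i * zeta (real i)) - rat_part N d))"
      unfolding \<Lambda>_def
    proof (intro sum.cong refl)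
      fix d :: nat assume "d \<in> {1, 2, 3}"
      hence "d \<ge> 1" by auto
      thus "of_int (weight i0 d) * (2 * R_sum N d) = of_int (weight i0 d) * ((\<Sum>i\<in>?J. 2 * real d ^ i * rho N i * zeta (real i)) - rat_part N d)"
        by (simp only: R_sum_linear_form(2))
    qed
    also have "\<dots> = (\<Sum>d\<in>{1,2,3}. \<Sum>i\<in>?J. of_int (weight i0 d) * (2 * real d ^ i * rho N i * zeta (real i)))
        - (\<Sum>d\<in>{1,2,3}. of_int (weight i0 d) * rat_part N d)"
      by (simp only: right_diff_distrib sum_subtractf sum_distrib_left)
    also have "(\<Sum>d\<in>{1,2,3}. \<Sum>i\<in>?J. of_int (weight i0 d) * (2 * real d ^ i * rho N i * zeta (real i))) =
        (\<Sum>i\<in>?J. \<Sum>d\<in>{1,2,3}. of_int (weight i0 d) * (2 * real d ^ i * rho N i * zeta (real i)))" by (rule sum.swap)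
    also have "\<dots> = (\<Sum>i\<in>?J. 2 * (\<Sum>d\<in>{1,2,3}. of_int (weight i0 d) * real d ^ i) * rho N i * zeta (real i))"
      by (simp only: sum_distrib_left sum_distrib_right mult_ac)
    also have "\<dots> = (\<Sum>i\<in>I. 2 * (\<Sum>d\<in>{1,2,3}. of_int (weight i0 d) * real d ^ i) * rho N i * zeta (real i))"
    proof (rule sum.mono_neutral_right)
      show "\<forall>i\<in>?J - I. 2 * (\<Sum>d\<in>{1,2,3}. of_int (weight i0 d) * real d ^ i) * rho N i * zeta (real i) = 0"
      proof
        fix i assume i: "i \<in> ?J - I"
        have "i = 3 \<or> i = i0"
        proof (rule ccontr)
          assume "\<not> (i = 3 \<or> i = i0)"
          moreover have "i \<noteq> 4" using i by auto
          ultimately show False using i by (auto simp: I_def)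
        qed
        hence "(\<Sum>d\<in>{1,2,3}. of_int (weight i0 d) * real d ^ i) = 0" using weight_sums(1,2)[of i0] by metis
        thus "2 * (\<Sum>d\<in>{1,2,3}. of_int (weight i0 d) * real d ^ i) * rho N i * zeta (real i) = 0" by (simp only: mult_zero_right mult_zero_left)
      qed
    qed (auto simp: I_def)
    finally show ?thesis by simp
  qed
  have int: "real q * real (den N) * \<Lambda> N \<in> \<int>" if N: "N \<ge> 1" for N
  proof -
    have "real q * real (den N) * \<Lambda> N = (\<Sum>i\<in>I. of_int (2 * (\<Sum>d\<in>{1,2,3}. weight i0 d * int d ^ i)) * (real (den N) * rho N i) * (real q * zeta (real i)))
        - (\<Sum>d\<in>{1,2,3}. of_int (weight i0 d) * real q * (real (den N) * rat_part N d))"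
      unfolding form right_diff_distrib sum_distrib_left by (simp only: mult_ac)
    also have "\<dots> \<in> \<int>"
    proof (intro Ints_diff Ints_sum)
      fix i assume "i \<in> I"
      hence "real q * zeta (real i) \<in> \<int>" using q by blast
      thus "of_int (2 * (\<Sum>d\<in>{1,2,3}. weight i0 d * int d ^ i)) * (real (den N) * rho N i) * (real q * zeta (real i)) \<in> \<int>"
        by (rule Ints_mult[OF Ints_mult[OF Ints_of_int den_rho_integer[OF N]]])
    next
      fix d :: nat assume d: "d \<in> {1, 2, 3}"
      show "of_int (weight i0 d) * real q * (real (den N) * rat_part N d) \<in> \<int>"
        by (rule Ints_mult[OF Ints_mult[OF Ints_of_int Ints_of_nat] den_rat_part_integer[OF N d]])
    qed
    finally show ?thesis .
  qed
  \<comment> \<open>The limit of \<open>\<Lambda> N / R_sum N 1\<close>: the weights applied to the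
    ratios 1, 2, 3, doubled.\<close>
  define w :: real where "w = 2 * (6 * (3 ^ i0 - 4 * 2 ^ i0 + 5))"
  have w: "w > 0" using weight_pos[OF i0] by (simp add: w_def)
  have "(\<lambda>N. \<Sum>d\<in>{1,2,3}. of_int (weight i0 d) * (2 * (R_sum N d / R_sum N 1))) \<longlonglongrightarrow> (\<Sum>d\<in>{1,2,3}. of_int (weight i0 d) * (2 * real d))"
    by (intro tendsto_sum tendsto_mult tendsto_const R_sum_ratio_limit)
  also have "(\<Sum>d\<in>{1,2,3}. of_int (weight i0 d) * (2 * real d)) = w"
  proof -
    have "(\<Sum>d\<in>{1,2,3}. of_int (weight i0 d) * (2 * real d)) = 2 * (\<Sum>d\<in>{1,2,3}. real_of_int (weight i0 d) * real d)"
      by (simp only: sum_distrib_left mult_ac)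
    thus ?thesis unfolding weight_sums(3) w_def .
  qed
  also have "(\<lambda>N. \<Sum>d\<in>{1,2,3}. of_int (weight i0 d) * (2 * (R_sum N d / R_sum N 1))) = (\<lambda>N. \<Lambda> N / R_sum N 1)"
    by (simp only: \<Lambda>_def sum_divide_distrib times_divide_eq_right)
  finally have ratio: "(\<lambda>N. \<Lambda> N / R_sum N 1) \<longlonglongrightarrow> w" .
  have "(\<lambda>N. real q * (real (den N) * R_sum N 1) * (\<Lambda> N / R_sum N 1)) \<longlonglongrightarrow> real q * 0 * w"
    by (intro tendsto_mult tendsto_const den_R_sum_limit ratio)
  hence "eventually (\<lambda>N. real q * (real (den N) * R_sum N 1) * (\<Lambda> N / R_sum N 1) < 1) sequentially"
    by (rule order_tendstoD) simp
  moreover have "eventually (\<lambda>N. \<Lambda> N / R_sum N 1 > 0) sequentially" by (rule order_tendstoD(1)[OF ratio w])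
  ultimately have "eventually (\<lambda>N. False) sequentially"
    using R_sum_pos eventually_ge_at_top[of 1]
  proof eventually_elim
    case (elim N)
    have pos: "R_sum N 1 > 0" using elim(3) .
    define x where "x = real q * real (den N) * \<Lambda> N"
    have eq: "real q * (real (den N) * R_sum N 1) * (\<Lambda> N / R_sum N 1) = x" using pos by (simp add: x_def)
    have "\<Lambda> N > 0" using elim(2) pos by (simp add: zero_less_divide_iff)
    hence "x > 0" using q den_pos[of N] by (simp add: x_def)
    moreover have "x < 1" using elim(1) unfolding eq .
    moreover obtain z where "x = of_int z" using int[OF elim(4)] unfolding x_def by (elim Ints_cases)
    ultimately show False by simp
  qed
  thus False by simp
qed

theorem theorem1p2:
  "card {k \<in> {5..35::nat}. odd k \<and> zeta (real k) \<notin> \<rat>} \<ge> 2"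
proof -
  let ?A = "{k \<in> {5..35::nat}. odd k \<and> zeta (real k) \<notin> \<rat>}"
  \<comment> \<open>Eliminating \<open>zeta 5\<close> yields one irrational value, at
    \<open>a\<close>; eliminating that one yields another.\<close>
  obtain a where a: "a \<in> ?A" using not_at_most_one_irrational[of 5] by blast
  then obtain b where b: "b \<in> ?A" "b \<noteq> a" using not_at_most_one_irrational[of a] by auto
  have "card {a, b} \<le> card ?A" using a b by (intro card_mono) auto
  thus ?thesis using b by simp
qed

end
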